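(* Let $X$ be a smooth projective curve over $\mathbb{C}$ of genus $g\ge 2$, $L$ a line bundle of odd degree on $X$, $M$ the moduli space of rank 2 stable vector bundles on $X$ with determinant isomorphic to $L$, and $E$ the normalized Poincaré bundle on $X\times M$. Let $p_{13},p_{23}:X\times X\times M\to X\times M$ be the projections, let $\Delta\subset X\times X$ be the diagonal, and let $\widetilde F$ be the vector bundle on $X\times X\times M$ defined by the exact sequence $$ 0 \to \widetilde{F} \to p_{13}^*E \otimes p_{23}^*E \to {\textstyle\bigwedge^2} E|_{\Delta \times M} \to 0. $$ Then $\widetilde F$ descends to a vector bundle $F$ on $X_2\times M$: there is a vector bundle $F$ on $X_2 \times M$ such that $(q\times \mathrm{id}_M)^*F\cong\widetilde F$ as $S_2$-equivariant bundles, where $q: X\times X\to X_2$ is the quotient map to the second symmetric product.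
   Context: We work over $\mathbb{C}$. $\theta$ is the ample generator of $\mathrm{Pic}(M)$, and $E$ is a Poincaré (universal) bundle on $X\times M$ normalized so that $\det(E_x)\cong\theta$ for all $x\in X$, where $E_x=E|_{\{x\}\times M}$. The surjection in the exact sequence is the restriction of $p_{13}^*E\otimes p_{23}^*E$ to $\Delta\times M\cong X\times M$ (where it becomes $E\otimes E$) followed by the natural quotient $E\otimes E\to\bigwedge^2E$. The group $S_2$ acts on $X\times X\times M$ by swapping the first two factors; the action lifts to $p_{13}^*E\otimes p_{23}^*E$ by permuting the tensor factors and preserves $\widetilde F$. *)

theory Defs
  imports "HOL-Analysis.Analysis" "HOL-Library.Function_Algebras"
begin

section \<open>Varieties over the complex numbers\<close>

text \<open>
  Varieties are taken in the sense of Serre: a topological space together with a sheaf of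
  complex-valued functions that is locally isomorphic to a Zariski-closed subset of some
  affine space. \<open>reg S U\<close> is the ring of regular functions on the open set \<open>U\<close>; functions in it
  are total, and only their values on \<open>U\<close> matter.
\<close>

record 'a space =
  zariski :: "'a topology"
  reg :: "'a set \<Rightarrow> ('a \<Rightarrow> complex) set"

abbreviation points :: "('a, 'z) space_scheme \<Rightarrow> 'a set" where
  "points S \<equiv> topspace (zariski S)"

definition function_sheaf :: "'a space \<Rightarrow> bool" where
  "function_sheaf S \<longleftrightarrow>
     (\<forall>U f g. openin (zariski S) U \<and> f \<in> reg S U \<and> (\<forall>x\<in>U. g x = f x) \<longrightarrow> g \<in> reg S U) \<and>
     (\<forall>U V f. openin (zariski S) U \<and> openin (zariski S) V \<and> V \<subseteq> U \<and> f \<in> reg S U \<longrightarrow> f \<in> reg S V) \<and>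
     (\<forall>U f. openin (zariski S) U \<and>
        (\<forall>x\<in>U. \<exists>V. openin (zariski S) V \<and> x \<in> V \<and> V \<subseteq> U \<and> f \<in> reg S V) \<longrightarrow> f \<in> reg S U)"

definition morphism :: "'a space \<Rightarrow> 'b space \<Rightarrow> ('a \<Rightarrow> 'b) \<Rightarrow> bool" where
  "morphism S T \<phi> \<longleftrightarrow> continuous_map (zariski S) (zariski T) \<phi> \<and>
     (\<forall>V f. openin (zariski T) V \<and> f \<in> reg T V \<longrightarrow> f \<circ> \<phi> \<in> reg S (points S \<inter> \<phi> -` V))"

definition isomorphic_spaces :: "'a space \<Rightarrow> 'b space \<Rightarrow> bool" where
  "isomorphic_spaces S T \<longleftrightarrow> (\<exists>\<phi> \<psi>. morphism S T \<phi> \<and> morphism T S \<psi> \<and>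
     (\<forall>x\<in>points S. \<psi> (\<phi> x) = x) \<and> (\<forall>y\<in>points T. \<phi> (\<psi> y) = y))"

definition induced_space :: "'a space \<Rightarrow> 'a set \<Rightarrow> 'a space" where
  "induced_space S A =
     \<lparr>zariski = subtopology (zariski S) A,
      reg = (\<lambda>W. {f. \<forall>x\<in>W. \<exists>U g. openin (zariski S) U \<and> x \<in> U \<and> g \<in> reg S U \<and>
                                  (\<forall>y\<in>U \<inter> W. f y = g y)})\<rparr>"

definition quotient_space :: "'a space \<Rightarrow> ('a \<Rightarrow> 'b) \<Rightarrow> 'b space" where
  "quotient_space S \<pi> =
     \<lparr>zariski = topology (\<lambda>V. V \<subseteq> \<pi> ` points S \<and> openin (zariski S) (points S \<inter> \<pi> -` V)),
      reg = (\<lambda>V. {f. f \<circ> \<pi> \<in> reg S (points S \<inter> \<pi> -` V)})\<rparr>"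

lemma openin_quotient_space:
  "openin (zariski (quotient_space S \<pi>)) V \<longleftrightarrow>
     V \<subseteq> \<pi> ` points S \<and> openin (zariski S) (points S \<inter> \<pi> -` V)"
proof -
  have "istopology (\<lambda>V. V \<subseteq> \<pi> ` points S \<and> openin (zariski S) (points S \<inter> \<pi> -` V))"
    unfolding istopology_def
  proof (intro conjI allI impI)
    fix A B
    assume "A \<subseteq> \<pi> ` points S \<and> openin (zariski S) (points S \<inter> \<pi> -` A)"
      and "B \<subseteq> \<pi> ` points S \<and> openin (zariski S) (points S \<inter> \<pi> -` B)"
    moreover have "points S \<inter> \<pi> -` (A \<inter> B) = (points S \<inter> \<pi> -` A) \<inter> (points S \<inter> \<pi> -` B)"
      by auto
    ultimately show "A \<inter> B \<subseteq> \<pi> ` points S"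
      and "openin (zariski S) (points S \<inter> \<pi> -` (A \<inter> B))"
      by auto
  next
    fix K
    assume *: "\<forall>V\<in>K. V \<subseteq> \<pi> ` points S \<and> openin (zariski S) (points S \<inter> \<pi> -` V)"
    then show "\<Union>K \<subseteq> \<pi> ` points S"
      by blast
    have "points S \<inter> \<pi> -` \<Union>K = (\<Union>V\<in>K. points S \<inter> \<pi> -` V)"
      by auto
    then show "openin (zariski S) (points S \<inter> \<pi> -` \<Union>K)"
      using * by (simp only:) (blast intro: openin_Union)
  qed
  then show ?thesis
    by (simp add: quotient_space_def)
qed

subsection \<open>Affine and projective space\<close>

inductive_set polys :: "nat \<Rightarrow> ((nat \<Rightarrow> complex) \<Rightarrow> complex) set" for n where
  const: "(\<lambda>_. c) \<in> polys n"
| coord: "k < n \<Longrightarrow> (\<lambda>v. v k) \<in> polys n"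
| add: "p \<in> polys n \<Longrightarrow> q \<in> polys n \<Longrightarrow> (\<lambda>v. p v + q v) \<in> polys n"
| mult: "p \<in> polys n \<Longrightarrow> q \<in> polys n \<Longrightarrow> (\<lambda>v. p v * q v) \<in> polys n"

definition Aspace :: "nat \<Rightarrow> (nat \<Rightarrow> complex) space" where
  "Aspace n =
     \<lparr>zariski = topology_generated_by {{v. (\<forall>k\<ge>n. v k = 0) \<and> p v \<noteq> 0} | p. p \<in> polys n},
      reg = (\<lambda>U. {f. \<forall>x\<in>U. \<exists>p\<in>polys n. \<exists>q\<in>polys n. q x \<noteq> 0 \<and>
                              (\<forall>y\<in>U. q y \<noteq> 0 \<longrightarrow> f y = p y / q y)})\<rparr>"

definition Pspace :: "nat \<Rightarrow> (nat \<Rightarrow> complex) set space" where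
  "Pspace n = quotient_space
     (induced_space (Aspace (Suc n)) (points (Aspace (Suc n)) - {\<lambda>_. 0}))
     (\<lambda>v. {\<lambda>k. c * v k | c. True})"

definition affine_variety :: "'a space \<Rightarrow> bool" where
  "affine_variety S \<longleftrightarrow> function_sheaf S \<and>
     (\<exists>n Z. closedin (zariski (Aspace n)) Z \<and> isomorphic_spaces S (induced_space (Aspace n) Z))"

definition projective_variety :: "'a space \<Rightarrow> bool" where
  "projective_variety S \<longleftrightarrow> function_sheaf S \<and>
     (\<exists>n Z. closedin (zariski (Pspace n)) Z \<and> isomorphic_spaces S (induced_space (Pspace n) Z))"

subsection \<open>Products and varieties\<close>

definition tensor_functions ::
  "'a space \<Rightarrow> 'b space \<Rightarrow> 'a set \<Rightarrow> 'b set \<Rightarrow> ('a \<times> 'b \<Rightarrow> complex) set" where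
  "tensor_functions S T U V =
     {\<lambda>(x, y). \<Sum>k<n. f k x * g k y | (n::nat) f g. \<forall>k<n. f k \<in> reg S U \<and> g k \<in> reg T V}"

text \<open>
  On a product of affine open sets \<open>U \<times> V\<close> the coordinate ring is the tensor product of the
  coordinate rings of \<open>U\<close> and \<open>V\<close>; the topology is the Zariski topology of the product, not the
  product topology.
\<close>

definition prod_space :: "'a space \<Rightarrow> 'b space \<Rightarrow> ('a \<times> 'b) space" where
  "prod_space S T =
     \<lparr>zariski = topology_generated_by
        {{z \<in> U \<times> V. h z \<noteq> 0} | U V h. openin (zariski S) U \<and> openin (zariski T) V \<and>
                                        h \<in> tensor_functions S T U V},
      reg = (\<lambda>W. {f. \<forall>z\<in>W. \<exists>U V. \<exists>p\<in>tensor_functions S T U V. \<exists>q\<in>tensor_functions S T U V.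
                openin (zariski S) U \<and> openin (zariski T) V \<and> z \<in> U \<times> V \<and> q z \<noteq> 0 \<and>
                (\<forall>w\<in>W \<inter> (U \<times> V). q w \<noteq> 0 \<longrightarrow> f w = p w / q w)})\<rparr>"

definition variety :: "'a space \<Rightarrow> bool" where
  "variety S \<longleftrightarrow> function_sheaf S \<and>
     (\<exists>\<U>. finite \<U> \<and> \<Union>\<U> = points S \<and>
        (\<forall>U\<in>\<U>. openin (zariski S) U \<and> affine_variety (induced_space S U))) \<and>
     closedin (zariski (prod_space S S)) {(x, x) | x. x \<in> points S}"

subsection \<open>Dimension, smoothness, curves and genus\<close>

definition irreducible_closed :: "'a space \<Rightarrow> 'a set \<Rightarrow> bool" where
  "irreducible_closed S A \<longleftrightarrow> closedin (zariski S) A \<and> A \<noteq> {} \<and>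
     (\<forall>B C. closedin (zariski S) B \<and> closedin (zariski S) C \<and> A \<subseteq> B \<union> C \<longrightarrow> A \<subseteq> B \<or> A \<subseteq> C)"

definition irreducible_chain :: "'a space \<Rightarrow> nat \<Rightarrow> bool" where
  "irreducible_chain S n \<longleftrightarrow>
     (\<exists>C::nat \<Rightarrow> 'a set. (\<forall>k\<le>n. irreducible_closed S (C k)) \<and> (\<forall>k<n. C k \<subset> C (Suc k)))"

definition has_dimension :: "'a space \<Rightarrow> nat \<Rightarrow> bool" where
  "has_dimension S n \<longleftrightarrow> irreducible_chain S n \<and> \<not> irreducible_chain S (Suc n)"

definition regular_at :: "'a space \<Rightarrow> 'a \<Rightarrow> ('a \<Rightarrow> complex) \<Rightarrow> bool" where
  "regular_at S x f \<longleftrightarrow> (\<exists>U. openin (zariski S) U \<and> x \<in> U \<and> f \<in> reg S U)"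

definition same_germ :: "'a space \<Rightarrow> 'a \<Rightarrow> ('a \<Rightarrow> complex) \<Rightarrow> ('a \<Rightarrow> complex) \<Rightarrow> bool" where
  "same_germ S x f g \<longleftrightarrow> (\<exists>U. openin (zariski S) U \<and> x \<in> U \<and> (\<forall>y\<in>U. f y = g y))"

text \<open>
  The Zariski tangent space, as the space of derivations of the local ring at \<open>x\<close> with values
  in the residue field. The value 0 on functions that are not regular at \<open>x\<close> is a normalization.
\<close>

definition tangent_space :: "'a space \<Rightarrow> 'a \<Rightarrow> (('a \<Rightarrow> complex) \<Rightarrow> complex) set" where
  "tangent_space S x = {D.
     (\<forall>f. \<not> regular_at S x f \<longrightarrow> D f = 0) \<and>
     (\<forall>f g. regular_at S x f \<and> regular_at S x g \<and> same_germ S x f g \<longrightarrow> D f = D g) \<and>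
     (\<forall>c. D (\<lambda>_. c) = 0) \<and>
     (\<forall>f g. regular_at S x f \<and> regular_at S x g \<longrightarrow>
        D (\<lambda>y. f y + g y) = D f + D g \<and> D (\<lambda>y. f y * g y) = f x * D g + g x * D f)}"

definition smooth_projective_curve :: "'a space \<Rightarrow> bool" where
  "smooth_projective_curve X \<longleftrightarrow> variety X \<and> projective_variety X \<and>
     irreducible_closed X (points X) \<and> has_dimension X 1 \<and>
     (\<forall>x\<in>points X. vector_space.dim (\<lambda>c D f. c * D f) (tangent_space X x) = 1)"

text \<open>
  Global sections of the sheaf of differentials on a smooth variety. That sheaf is locally
  free, so a section is determined by its values on tangent vectors; locally it is a sum of
  terms \<open>f dg\<close>.
\<close>

definition regular_one_forms :: "'a space \<Rightarrow> ('a \<Rightarrow> (('a \<Rightarrow> complex) \<Rightarrow> complex) \<Rightarrow> complex) set" where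
  "regular_one_forms X = {\<omega>.
     (\<forall>x D. \<not> (x \<in> points X \<and> D \<in> tangent_space X x) \<longrightarrow> \<omega> x D = 0) \<and>
     (\<forall>x\<in>points X. \<exists>U (n::nat) f g. openin (zariski X) U \<and> x \<in> U \<and>
        (\<forall>k<n. f k \<in> reg X U \<and> g k \<in> reg X U) \<and>
        (\<forall>y\<in>U. \<forall>D\<in>tangent_space X y. \<omega> y D = (\<Sum>k<n. f k y * D (g k))))}"

definition genus :: "'a space \<Rightarrow> nat" where
  "genus X = vector_space.dim (\<lambda>c \<omega> x D. c * \<omega> x D) (regular_one_forms X)"

section \<open>Vector bundles\<close>

text \<open>
  Vector bundles are given by transition functions. A section over \<open>W\<close> is a family of vector-valued
  regular functions \<open>s i\<close> on \<open>W \<inter> chart i\<close>, extended by 0, with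
  \<open>s i = transition i j *v s j\<close>. The rank is the cardinality of the index type \<open>'n\<close>.
  Charts may be empty and varieties are quasi-compact, so every vector bundle has a
  presentation with charts indexed by the natural numbers.
\<close>

record ('a, 'i, 'n::finite) vbundle =
  chart :: "'i \<Rightarrow> 'a set"
  transition :: "'i \<Rightarrow> 'i \<Rightarrow> 'a \<Rightarrow> complex^'n^'n"

definition vector_bundle :: "'a space \<Rightarrow> ('a, 'i, 'n::finite) vbundle \<Rightarrow> bool" where
  "vector_bundle S E \<longleftrightarrow>
     (\<forall>i. openin (zariski S) (chart E i)) \<and> (\<Union>i. chart E i) = points S \<and>
     (\<forall>i j a b. (\<lambda>x. transition E i j x $ a $ b) \<in> reg S (chart E i \<inter> chart E j)) \<and>
     (\<forall>i. \<forall>x\<in>chart E i. transition E i i x = mat 1) \<and>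
     (\<forall>i j k. \<forall>x\<in>chart E i \<inter> chart E j \<inter> chart E k.
        transition E i j x ** transition E j k x = transition E i k x)"

definition sections ::
  "'a space \<Rightarrow> ('a, 'i, 'n::finite) vbundle \<Rightarrow> 'a set \<Rightarrow> ('i \<Rightarrow> 'a \<Rightarrow> complex^'n) set" where
  "sections S E W = {s.
     (\<forall>i x. x \<notin> W \<inter> chart E i \<longrightarrow> s i x = 0) \<and>
     (\<forall>i a. (\<lambda>x. s i x $ a) \<in> reg S (W \<inter> chart E i)) \<and>
     (\<forall>i j. \<forall>x\<in>W \<inter> chart E i \<inter> chart E j. s i x = transition E i j x *v s j x)}"

definition bundle_hom ::
  "'a space \<Rightarrow> ('a, 'i, 'n::finite) vbundle \<Rightarrow> ('a, 'j, 'm::finite) vbundle \<Rightarrow>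
     ('j \<Rightarrow> 'i \<Rightarrow> 'a \<Rightarrow> complex^'n^'m) \<Rightarrow> bool" where
  "bundle_hom S E E' h \<longleftrightarrow>
     (\<forall>j i a b. (\<lambda>x. h j i x $ a $ b) \<in> reg S (chart E' j \<inter> chart E i)) \<and>
     (\<forall>j j' i i'. \<forall>x\<in>chart E' j \<inter> chart E' j' \<inter> chart E i \<inter> chart E i'.
        transition E' j' j x ** h j i x ** transition E i i' x = h j' i' x)"

definition isomorphic_bundles ::
  "'a space \<Rightarrow> ('a, 'i, 'n::finite) vbundle \<Rightarrow> ('a, 'j, 'm::finite) vbundle \<Rightarrow> bool" where
  "isomorphic_bundles S E E' \<longleftrightarrow> (\<exists>h. bundle_hom S E E' h \<and>
     (\<forall>j i. \<forall>x\<in>chart E' j \<inter> chart E i. invertible (h j i x)))"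

definition pullback_bundle ::
  "'a set \<Rightarrow> ('a \<Rightarrow> 'b) \<Rightarrow> ('b, 'i, 'n::finite) vbundle \<Rightarrow> ('a, 'i, 'n) vbundle" where
  "pullback_bundle A \<phi> E =
     \<lparr>chart = (\<lambda>i. A \<inter> \<phi> -` chart E i), transition = (\<lambda>i j x. transition E i j (\<phi> x))\<rparr>"

definition tensor_matrix ::
  "complex^'n::finite^'n \<Rightarrow> complex^'m::finite^'m \<Rightarrow> complex^('n \<times> 'm)^('n \<times> 'm)" where
  "tensor_matrix A B = (\<chi> a b. A $ fst a $ fst b * B $ snd a $ snd b)"

definition tensor_bundle ::
  "('a, 'i, 'n::finite) vbundle \<Rightarrow> ('a, 'j, 'm::finite) vbundle \<Rightarrow> ('a, 'i \<times> 'j, 'n \<times> 'm) vbundle" where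
  "tensor_bundle E E' =
     \<lparr>chart = (\<lambda>(i, j). chart E i \<inter> chart E' j),
      transition = (\<lambda>(i, j) (i', j') x. tensor_matrix (transition E i i' x) (transition E' j j' x))\<rparr>"

definition det_bundle :: "('a, 'i, 'n::finite) vbundle \<Rightarrow> ('a, 'i, 1) vbundle" where
  "det_bundle E = \<lparr>chart = chart E, transition = (\<lambda>i j x. mat (det (transition E i j x)))\<rparr>"

definition line_power :: "('a, 'i, 1) vbundle \<Rightarrow> int \<Rightarrow> ('a, 'i, 1) vbundle" where
  "line_power L k =
     \<lparr>chart = chart L, transition = (\<lambda>i j x. mat ((transition L i j x $ 1 $ 1) powi k))\<rparr>"

definition ample :: "'a space \<Rightarrow> ('a, 'i, 1) vbundle \<Rightarrow> bool" where
  "ample S L \<longleftrightarrow> (\<forall>x\<in>points S. \<exists>n::nat. n \<ge> 1 \<and>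
     (\<exists>s\<in>sections S (line_power L (int n)) (points S).
        (\<exists>i. s i x \<noteq> 0) \<and> affine_variety (induced_space S {y \<in> points S. \<exists>i. s i y \<noteq> 0})))"

definition generates_Pic :: "'a space \<Rightarrow> ('a, nat, 1) vbundle \<Rightarrow> bool" where
  "generates_Pic S L \<longleftrightarrow> (\<forall>N :: ('a, nat, 1) vbundle. vector_bundle S N \<longrightarrow>
     (\<exists>k. isomorphic_bundles S N (line_power L k)))"

subsection \<open>Degree and stability on a smooth projective curve\<close>

definition uniformizer :: "'a space \<Rightarrow> 'a \<Rightarrow> ('a \<Rightarrow> complex) \<Rightarrow> bool" where
  "uniformizer X x t \<longleftrightarrow> regular_at X x t \<and> t x = 0 \<and>
     (\<forall>f. regular_at X x f \<and> f x = 0 \<longrightarrow>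
        (\<exists>a. regular_at X x a \<and> same_germ X x f (\<lambda>y. a y * t y)))"

text \<open>
  The order at \<open>x\<close> of a nonzero rational section \<open>s\<close>, regular on the nonempty open set \<open>W\<close>;
  \<open>x\<close> need not belong to \<open>W\<close>.
\<close>

definition order_at ::
  "'a space \<Rightarrow> ('a, 'i, 1) vbundle \<Rightarrow> 'a set \<Rightarrow> ('i \<Rightarrow> 'a \<Rightarrow> complex^1) \<Rightarrow> 'a \<Rightarrow> int" where
  "order_at X L W s x = (THE k. \<exists>i V t u. openin (zariski X) V \<and> x \<in> V \<and> V \<subseteq> chart L i \<and>
     uniformizer X x t \<and> t \<in> reg X V \<and> u \<in> reg X V \<and> (\<forall>y\<in>V. u y \<noteq> 0) \<and>
     (\<forall>y\<in>V \<inter> W - {x}. s i y $ 1 = u y * t y powi k))"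

definition line_degree :: "'a space \<Rightarrow> ('a, 'i, 1) vbundle \<Rightarrow> int" where
  "line_degree X L = (THE d. \<exists>W s. openin (zariski X) W \<and> s \<in> sections X L W \<and>
     (\<exists>i. \<exists>x\<in>W. s i x \<noteq> 0) \<and>
     d = (\<Sum>x | x \<in> points X \<and> order_at X L W s x \<noteq> 0. order_at X L W s x))"

text \<open>Slope stability for rank 2, where the proper nonzero subbundles are the line subbundles.\<close>

definition stable_bundle :: "'a space \<Rightarrow> ('a, 'i, 2) vbundle \<Rightarrow> bool" where
  "stable_bundle X V \<longleftrightarrow> (\<forall>(N :: ('a, nat, 1) vbundle) h.
     vector_bundle X N \<and> bundle_hom X N V h \<and>
     (\<forall>j i. \<forall>x\<in>chart V j \<inter> chart N i. inj ((*v) (h j i x))) \<longrightarrow>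
     2 * line_degree X N < line_degree X (det_bundle V))"

subsection \<open>The moduli space and the universal bundle\<close>

definition stable_family ::
  "'x space \<Rightarrow> ('x, nat, 1) vbundle \<Rightarrow> 't space \<Rightarrow> ('x \<times> 't, 'i, 2) vbundle \<Rightarrow> bool" where
  "stable_family X L T E \<longleftrightarrow> vector_bundle (prod_space X T) E \<and>
     (\<forall>t\<in>points T. let V = pullback_bundle (points X) (\<lambda>x. (x, t)) E in
        stable_bundle X V \<and> isomorphic_bundles X (det_bundle V) L)"

definition equivalent_families ::
  "'x space \<Rightarrow> 't space \<Rightarrow> ('x \<times> 't, nat, 2) vbundle \<Rightarrow> ('x \<times> 't, nat, 2) vbundle \<Rightarrow> bool" where
  "equivalent_families X T E E' \<longleftrightarrow>
     (\<exists>N :: ('t, nat, 1) vbundle. vector_bundle T N \<and>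
        isomorphic_bundles (prod_space X T) E
          (tensor_bundle E' (pullback_bundle (points (prod_space X T)) snd N)))"

text \<open>
  \<open>M\<close> is the moduli space of stable rank 2 bundles with determinant \<open>L\<close>, and \<open>E\<close> is a
  Poincare (universal) vbundle on \<open>X \<times> M\<close>: every family, parametrized by a variety \<open>T\<close>, is the
  pullback of \<open>E\<close> along a unique morphism from \<open>T\<close> to \<open>M\<close>, up to a line bundle on \<open>T\<close>. A variety has
  at most continuum many points, so letting \<open>T\<close> range over the varieties with points in the type
  \<open>complex\<close> is no restriction.
\<close>

definition moduli_space_with_universal_bundle ::
  "'x space \<Rightarrow> ('x, nat, 1) vbundle \<Rightarrow> 'm space \<Rightarrow> ('x \<times> 'm, nat, 2) vbundle \<Rightarrow> bool" where
  "moduli_space_with_universal_bundle X L M E \<longleftrightarrow>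
     variety M \<and> stable_family X L M E \<and>
     (\<forall>(T :: complex space) (E' :: ('x \<times> complex, nat, 2) vbundle).
        variety T \<and> stable_family X L T E' \<longrightarrow>
        (let classifies = (\<lambda>\<phi>. morphism T M \<phi> \<and>
               equivalent_families X T E'
                 (pullback_bundle (points (prod_space X T)) (map_prod id \<phi>) E))
         in (\<exists>\<phi>. classifies \<phi> \<and> (\<forall>\<psi>. classifies \<psi> \<longrightarrow> (\<forall>t\<in>points T. \<psi> t = \<phi> t)))))"

section \<open>The kernel sheaf and descent\<close>

definition symq :: "'x \<times> 'x \<Rightarrow> 'x set" where
  "symq = (\<lambda>(x, y). {x, y})"

definition sym2 :: "'x space \<Rightarrow> 'x set space" where
  "sym2 X = quotient_space (prod_space X X) symq"

abbreviation XXM :: "'x space \<Rightarrow> 'm space \<Rightarrow> (('x \<times> 'x) \<times> 'm) space" where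
  "XXM X M \<equiv> prod_space (prod_space X X) M"

definition p13 :: "('x \<times> 'x) \<times> 'm \<Rightarrow> 'x \<times> 'm" where
  "p13 = (\<lambda>((x, y), m). (x, m))"

definition p23 :: "('x \<times> 'x) \<times> 'm \<Rightarrow> 'x \<times> 'm" where
  "p23 = (\<lambda>((x, y), m). (y, m))"

definition diag :: "'x \<times> 'm \<Rightarrow> ('x \<times> 'x) \<times> 'm" where
  "diag = (\<lambda>(x, m). ((x, x), m))"

definition swap12 :: "('x \<times> 'x) \<times> 'm \<Rightarrow> ('x \<times> 'x) \<times> 'm" where
  "swap12 = (\<lambda>((x, y), m). ((y, x), m))"

definition boxtimes ::
  "'x space \<Rightarrow> 'm space \<Rightarrow> ('x \<times> 'm, 'i, 2) vbundle \<Rightarrow> (('x \<times> 'x) \<times> 'm, 'i \<times> 'i, 2 \<times> 2) vbundle" where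
  "boxtimes X M E = tensor_bundle (pullback_bundle (points (XXM X M)) p13 E)
                                  (pullback_bundle (points (XXM X M)) p23 E)"

lemma pullback_diag_boxtimes:
  fixes E :: "('x \<times> 'm, 'i, 2) vbundle"
  assumes "vector_bundle (prod_space X M) E"
    and "diag ` points (prod_space X M) \<subseteq> points (XXM X M)"
  shows "pullback_bundle (points (prod_space X M)) diag (boxtimes X M E) = tensor_bundle E E"
proof -
  have "chart E i \<subseteq> points (prod_space X M)" for i
    using assms(1) by (simp add: vector_bundle_def openin_subset)
  then have "points (prod_space X M) \<inter> diag -` (points (XXM X M) \<inter> p13 -` chart E i \<inter>
      (points (XXM X M) \<inter> p23 -` chart E j)) = chart E i \<inter> chart E j" for i j
    using assms(2) by (force simp: diag_def p13_def p23_def)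
  moreover have "p13 (diag z) = z" "p23 (diag z) = z" for z :: "'x \<times> 'm"
    by (auto simp: diag_def p13_def p23_def split: prod.splits)
  ultimately show ?thesis
    by (simp add: boxtimes_def pullback_bundle_def tensor_bundle_def fun_eq_iff)
qed

definition restrict_to_diag ::
  "('i \<Rightarrow> ('x \<times> 'x) \<times> 'm \<Rightarrow> complex^'n) \<Rightarrow> 'i \<Rightarrow> 'x \<times> 'm \<Rightarrow> complex^'n::finite" where
  "restrict_to_diag s = (\<lambda>i z. s i (diag z))"

text \<open>
  The exterior square of a rank 2 bundle \<open>E\<close> is \<open>det_bundle E\<close>, in the local frames
  \<open>e\<^sub>1 \<and> e\<^sub>2\<close>, and the natural quotient map sends \<open>e\<^sub>a \<otimes> e\<^sub>b\<close> to \<open>e\<^sub>a \<and> e\<^sub>b\<close>. On the chart \<open>k\<close> of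
  \<open>det_bundle E\<close> it is computed from the chart \<open>(k, k)\<close> of \<open>tensor_bundle E E\<close>.
\<close>

definition wedge :: "complex^(2 \<times> 2) \<Rightarrow> complex^1" where
  "wedge v = (\<chi> _. v $ (1, 2) - v $ (2, 1))"

definition to_ext_square ::
  "('i \<times> 'i \<Rightarrow> 'a \<Rightarrow> complex^(2 \<times> 2)) \<Rightarrow> 'i \<Rightarrow> 'a \<Rightarrow> complex^1" where
  "to_ext_square t = (\<lambda>k z. wedge (t (k, k) z))"

lemma wedge_tensor_matrix:
  "wedge (tensor_matrix A A *v v) = mat (det A) *v wedge v"
  by (simp add: wedge_def tensor_matrix_def matrix_vector_mult_def mat_def det_2 vec_eq_iff sum_2
      UNIV_Times_UNIV[symmetric] sum.cartesian_product' algebra_simps del: UNIV_Times_UNIV)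

definition tildeF ::
  "'x space \<Rightarrow> 'm space \<Rightarrow> ('x \<times> 'm, 'i, 2) vbundle \<Rightarrow> (('x \<times> 'x) \<times> 'm) set \<Rightarrow>
     ('i \<times> 'i \<Rightarrow> ('x \<times> 'x) \<times> 'm \<Rightarrow> complex^(2 \<times> 2)) set" where
  "tildeF X M E W = {s \<in> sections (XXM X M) (boxtimes X M E) W.
     to_ext_square (restrict_to_diag s) = (\<lambda>k z. 0)}"

text \<open>
  Isomorphisms between two subsheaves of modules of sheaves of sections of vector bundles:
  \<open>\<F>\<close> and \<open>\<G>\<close> assign to an open set the module of sections over it.
\<close>

definition module_iso ::
  "'a space \<Rightarrow> ('a set \<Rightarrow> ('i \<Rightarrow> 'a \<Rightarrow> complex^'n::finite) set) \<Rightarrow>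
     ('a set \<Rightarrow> ('j \<Rightarrow> 'a \<Rightarrow> complex^'m::finite) set) \<Rightarrow>
     ('a set \<Rightarrow> ('i \<Rightarrow> 'a \<Rightarrow> complex^'n) \<Rightarrow> ('j \<Rightarrow> 'a \<Rightarrow> complex^'m)) \<Rightarrow> bool" where
  "module_iso S \<F> \<G> \<Phi> \<longleftrightarrow> (\<forall>W. openin (zariski S) W \<longrightarrow>
     bij_betw (\<Phi> W) (\<F> W) (\<G> W) \<and>
     (\<forall>s\<in>\<F> W. \<forall>s'\<in>\<F> W. \<Phi> W (\<lambda>i x. s i x + s' i x) = (\<lambda>j x. \<Phi> W s j x + \<Phi> W s' j x)) \<and>
     (\<forall>s\<in>\<F> W. \<forall>f\<in>reg S W. \<Phi> W (\<lambda>i x. f x *s s i x) = (\<lambda>j x. f x *s \<Phi> W s j x)) \<and>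
     (\<forall>s\<in>\<F> W. \<forall>V. openin (zariski S) V \<and> V \<subseteq> W \<longrightarrow>
        \<Phi> V (\<lambda>i x. if x \<in> V then s i x else 0) = (\<lambda>j x. if x \<in> V then \<Phi> W s j x else 0)))"

text \<open>
  The involution of \<open>S\<^sub>2\<close> acts on sections of a pullback along \<open>q \<times> id\<close> through \<open>q \<circ> swap = q\<close>,
  and on sections of \<open>boxtimes X M E\<close> by also permuting the tensor factors (which exchanges the
  charts \<open>(i, j)\<close> and \<open>(j, i)\<close>). Both map sections over \<open>W\<close> to sections over \<open>swap12 ` W\<close>.
\<close>

definition act_pullback ::
  "('i \<Rightarrow> ('x \<times> 'x) \<times> 'm \<Rightarrow> complex^'n) \<Rightarrow> 'i \<Rightarrow> ('x \<times> 'x) \<times> 'm \<Rightarrow> complex^'n::finite" where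
  "act_pullback s = (\<lambda>i z. s i (swap12 z))"

definition act_boxtimes ::
  "('i \<times> 'i \<Rightarrow> ('x \<times> 'x) \<times> 'm \<Rightarrow> complex^(2 \<times> 2)) \<Rightarrow>
     'i \<times> 'i \<Rightarrow> ('x \<times> 'x) \<times> 'm \<Rightarrow> complex^(2 \<times> 2)" where
  "act_boxtimes s = (\<lambda>(i, j) z. \<chi> c. s (j, i) (swap12 z) $ prod.swap c)"

end

theory Submission
  imports Defs "HOL-Computational_Algebra.Fundamental_Theorem_Algebra"
begin

text \<open>
  Every orbit of the involution on \<open>X \<times> X \<times> M\<close> has an invariant neighbourhood of the form
  \<open>p\<^sub>1\<^sub>3\<^sup>-\<^sup>1 N \<inter> p\<^sub>2\<^sub>3\<^sup>-\<^sup>1 N\<close>, where \<open>N\<close> is open in \<open>X \<times> M\<close> and \<open>E\<close> has a frame \<open>e\<^sub>1, e\<^sub>2\<close> on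
  \<open>N\<close>: two points of a projective curve lie in a common affine open set, and a vector bundle is
  trivial near two points of an affine variety. After shrinking, the ideal of the diagonal is
  generated by \<open>t = u(x) - u(y)\<close> with \<open>u\<close> a coordinate function on \<open>X\<close>, because \<open>X\<close> is a smooth
  curve. There the kernel has the invariant frame \<open>e\<^sub>1 \<otimes> e\<^sub>1\<close>, \<open>e\<^sub>2 \<otimes> e\<^sub>2\<close>, \<open>e\<^sub>1 \<otimes> e\<^sub>2 + e\<^sub>2 \<otimes> e\<^sub>1\<close>,
  \<open>t (e\<^sub>1 \<otimes> e\<^sub>2 - e\<^sub>2 \<otimes> e\<^sub>1)\<close>. The transition matrices between such frames are invariant, since they
  are determined off the diagonal, which is dense. An invariant regular function descends to
  \<open>X\<^sub>2 \<times> M\<close>, as it is locally a fraction with invariant numerator and denominator; so these matrices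
  define \<open>F\<close>, and finitely many of the neighbourhoods suffice because \<open>X \<times> X \<times> M\<close> is quasi-compact.
\<close>

section \<open>The weak Nullstellensatz\<close>

text \<open>Descent along the quotient by \<open>swap12\<close> can fail only over the fixed locus,
  the diagonal, where the involution acts on the fibres and has to act trivially. On E \<otimes> E
  it is -1 on the antisymmetric line. Passing to the kernel multiplies that line by the ideal of the
  diagonal; a generator t that is odd under the swap contributes a second -1, and the signs cancel.
  This is why t is taken as a difference of two values of one function. The price is that the frame,
  as a matrix over E \<otimes> E, is singular on the diagonal. Coordinates exist there because
  functions vanishing on the diagonal are divisible by t, and they are unique because the complement
  of the diagonal is dense; these two facts replace inverting the matrix. Regular functions are by
  definition only local fractions, whereas clearing denominators near two points at once and
  extracting finite covers are global questions on an affine set. The Nullstellensatz is the bridge;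
  over the complex numbers it follows from a cardinality argument.\<close>

lemma polys_uminus: "p \<in> polys n \<Longrightarrow> (\<lambda>v. - p v) \<in> polys n"
  using polys.mult[OF polys.const[of "-1"]] by fastforce

lemma polys_diff: "p \<in> polys n \<Longrightarrow> q \<in> polys n \<Longrightarrow> (\<lambda>v. p v - q v) \<in> polys n"
  using polys.add[OF _ polys_uminus] by fastforce

lemma polys_prod: "(\<And>i. i \<in> A \<Longrightarrow> f i \<in> polys n) \<Longrightarrow> (\<lambda>v. \<Prod>i\<in>A. f i v) \<in> polys n"
  by (induction A rule: infinite_finite_induct) (auto intro: polys.intros)

lemma polys_power: "p \<in> polys n \<Longrightarrow> (\<lambda>v. p v ^ k) \<in> polys n"
  by (induction k) (auto intro: polys.intros)

lemma polys_poly: "k < n \<Longrightarrow> (\<lambda>v. poly P (v k)) \<in> polys n"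
  by (induction P) (auto intro!: polys.const polys.add[OF polys.const] polys.mult[OF polys.coord])

lemma polys_cong: "p \<in> polys n \<Longrightarrow> (\<And>k. k < n \<Longrightarrow> v k = w k) \<Longrightarrow> p v = p w"
  by (induction rule: polys.induct) auto

lemma polys_subst:
  "p \<in> polys n \<Longrightarrow> (\<And>k. k < n \<Longrightarrow> (\<lambda>v. f v k) \<in> polys m) \<Longrightarrow> (\<lambda>v. p (f v)) \<in> polys m"
  by (induction rule: polys.induct) (auto intro: polys.intros)

definition poly_ideal :: "nat \<Rightarrow> ((nat \<Rightarrow> complex) \<Rightarrow> complex) set \<Rightarrow> bool" where
  "poly_ideal n I \<longleftrightarrow> I \<subseteq> polys n \<and> (\<lambda>_. 0) \<in> I \<and> (\<forall>p\<in>I. \<forall>q\<in>I. (\<lambda>v. p v + q v) \<in> I) \<and>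
     (\<forall>r\<in>polys n. \<forall>p\<in>I. (\<lambda>v. r v * p v) \<in> I)"

lemma poly_ideal_polys: "poly_ideal n I \<Longrightarrow> p \<in> I \<Longrightarrow> p \<in> polys n"
  by (auto simp: poly_ideal_def)

lemma poly_ideal_zero: "poly_ideal n I \<Longrightarrow> (\<lambda>_. 0) \<in> I"
  by (simp add: poly_ideal_def)

lemma poly_ideal_add: "poly_ideal n I \<Longrightarrow> p \<in> I \<Longrightarrow> q \<in> I \<Longrightarrow> (\<lambda>v. p v + q v) \<in> I"
  by (simp add: poly_ideal_def)

lemma poly_ideal_mult: "poly_ideal n I \<Longrightarrow> r \<in> polys n \<Longrightarrow> p \<in> I \<Longrightarrow> (\<lambda>v. r v * p v) \<in> I"
  by (simp add: poly_ideal_def)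

lemma poly_idealI:
  assumes "\<And>p. p \<in> I \<Longrightarrow> p \<in> polys n" "(\<lambda>_. 0) \<in> I"
    "\<And>p q. p \<in> I \<Longrightarrow> q \<in> I \<Longrightarrow> (\<lambda>v. p v + q v) \<in> I"
    "\<And>r p. r \<in> polys n \<Longrightarrow> p \<in> I \<Longrightarrow> (\<lambda>v. r v * p v) \<in> I"
  shows "poly_ideal n I"
  unfolding poly_ideal_def using assms by auto

section \<open>Maximal ideals of the ring of polynomial functions\<close>

definition maximal_ideal :: "nat \<Rightarrow> ((nat \<Rightarrow> complex) \<Rightarrow> complex) set \<Rightarrow> bool" where
  "maximal_ideal n m \<longleftrightarrow> poly_ideal n m \<and> (\<lambda>_. 1) \<notin> m \<and>
     (\<forall>J. poly_ideal n J \<and> (\<lambda>_. 1) \<notin> J \<and> m \<subseteq> J \<longrightarrow> J = m)"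

text \<open>Zorn's lemma applies because properness is the single condition that 1 is absent, and
  this passes to the union of a chain.\<close>

lemma maximal_ideal_exists:
  assumes I: "poly_ideal n I" and I1: "(\<lambda>_. 1) \<notin> I"
  shows "\<exists>m. maximal_ideal n m \<and> I \<subseteq> m"
proof -
  let ?A = "{J. poly_ideal n J \<and> (\<lambda>_. 1) \<notin> J \<and> I \<subseteq> J}"
  have "\<exists>M\<in>?A. \<forall>X\<in>?A. M \<subseteq> X \<longrightarrow> X = M"
  proof (rule subset_Zorn_nonempty)
    show "?A \<noteq> {}" using assms by blast
    fix \<C> assume ne: "\<C> \<noteq> {}" and ch: "subset.chain ?A \<C>"
    have sub: "\<C> \<subseteq> ?A" and lin: "\<And>J K. J \<in> \<C> \<Longrightarrow> K \<in> \<C> \<Longrightarrow> J \<subseteq> K \<or> K \<subseteq> J"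
      using ch by (auto simp: subset.chain_def)
    have "poly_ideal n (\<Union>\<C>)"
    proof (rule poly_idealI)
      fix p q assume pq: "p \<in> \<Union>\<C>" "q \<in> \<Union>\<C>"
      obtain J K where JK: "p \<in> J" "J \<in> \<C>" "q \<in> K" "K \<in> \<C>" using pq by blast
      then obtain L where L: "L \<in> \<C>" "p \<in> L" "q \<in> L" using lin[of J K] by blast
      then have "(\<lambda>v. p v + q v) \<in> L" using sub by (intro poly_ideal_add[of n]) auto
      then show "(\<lambda>v. p v + q v) \<in> \<Union>\<C>" using L by blast
    next
      obtain L where "L \<in> \<C>" using ne by blast
      then show "(\<lambda>_. 0) \<in> \<Union>\<C>" using sub poly_ideal_zero[of n L] by blast
    next
      fix r p assume r: "r \<in> polys n" and "p \<in> \<Union>\<C>"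
      then obtain L where L: "L \<in> \<C>" "p \<in> L" by blast
      then have "(\<lambda>v. r v * p v) \<in> L" using sub r by (intro poly_ideal_mult[of n]) auto
      then show "(\<lambda>v. r v * p v) \<in> \<Union>\<C>" using L by blast
    qed (use sub poly_ideal_polys in blast)
    then show "\<Union>\<C> \<in> ?A" using ne sub by blast
  qed
  then obtain m where m: "m \<in> ?A" "\<forall>X\<in>?A. m \<subseteq> X \<longrightarrow> X = m" by blast
  then have "maximal_ideal n m"
    unfolding maximal_ideal_def by blast
  then show ?thesis using m by blast
qed

lemma poly_ideal_minus:
  assumes "poly_ideal n I" "p \<in> I" "q \<in> I" shows "(\<lambda>v. p v - q v) \<in> I"
proof -
  have "(\<lambda>v. p v + (-1) * q v) \<in> I"
    by (intro poly_ideal_add[OF assms(1)] poly_ideal_mult[OF assms(1)] assms polys.const)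
  then show ?thesis by simp
qed

lemma poly_ideal_sum:
  assumes "poly_ideal n I" "\<And>i. i \<in> A \<Longrightarrow> f i \<in> I" shows "(\<lambda>v. \<Sum>i\<in>A. f i v) \<in> I"
  using assms(2)
proof (induction A rule: infinite_finite_induct)
  case (insert x F)
  then have "(\<lambda>v. f x v + (\<Sum>i\<in>F. f i v)) \<in> I"
    by (intro poly_ideal_add[OF assms(1)]) auto
  then show ?case using insert by simp
qed (use assms(1) in \<open>auto simp: poly_ideal_def\<close>)

text \<open>The ideal generated by \<open>m\<close> and \<open>p\<close> is strictly larger than
  \<open>m\<close>, so it contains 1, and \<open>r\<close> is the cofactor of \<open>p\<close> in
  such a representation of 1. In other words the quotient by \<open>m\<close> is a field.\<close>

lemma maximal_ideal_inverse:
  assumes m: "maximal_ideal n m" and p: "p \<in> polys n" "p \<notin> m"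
  shows "\<exists>r\<in>polys n. (\<lambda>v. r v * p v - 1) \<in> m"
proof -
  have id: "poly_ideal n m" using m by (simp add: maximal_ideal_def)
  define J where "J = {\<lambda>v. a v + r v * p v | a r. a \<in> m \<and> r \<in> polys n}"
  have JI: "(\<lambda>v. a v + r v * p v) \<in> J" if "a \<in> m" "r \<in> polys n" for a r
    unfolding J_def using that by blast
  have mJ: "m \<subseteq> J"
  proof
    fix a assume "a \<in> m"
    from JI[OF this polys.const[of 0 n]] show "a \<in> J" by simp
  qed
  have J: "poly_ideal n J"
  proof (rule poly_idealI)
    fix f assume "f \<in> J"
    then show "f \<in> polys n"
      using poly_ideal_polys[OF id] p unfolding J_def by (auto intro: polys.intros)
  next
    show "(\<lambda>_. 0) \<in> J" using mJ poly_ideal_zero[OF id] by blast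
  next
    fix f g assume fg: "f \<in> J" "g \<in> J"
    from fg obtain a r b s where e: "f = (\<lambda>v. a v + r v * p v)" "g = (\<lambda>v. b v + s v * p v)"
      and h: "a \<in> m" "b \<in> m" "r \<in> polys n" "s \<in> polys n" unfolding J_def by blast
    from JI[OF poly_ideal_add[OF id h(1,2)] polys.add[OF h(3,4)]]
    show "(\<lambda>v. f v + g v) \<in> J" unfolding e by (simp add: algebra_simps)
  next
    fix f g assume fg: "f \<in> polys n" "g \<in> J"
    from fg obtain b s where e: "g = (\<lambda>v. b v + s v * p v)"
      and h: "b \<in> m" "s \<in> polys n" unfolding J_def by blast
    from JI[OF poly_ideal_mult[OF id fg(1) h(1)] polys.mult[OF fg(1) h(2)]]
    show "(\<lambda>v. f v * g v) \<in> J" unfolding e by (simp add: algebra_simps)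
  qed
  from JI[OF poly_ideal_zero[OF id] polys.const[of 1 n]] have "p \<in> J" by simp
  then have "J \<noteq> m" using p by blast
  then have "(\<lambda>_. 1) \<in> J" using m J mJ unfolding maximal_ideal_def by blast
  then obtain a r where ar: "(\<lambda>_. 1) = (\<lambda>v. a v + r v * p v)" "a \<in> m" "r \<in> polys n"
    unfolding J_def by blast
  have "(\<lambda>v. (\<lambda>_. 0) v - a v) \<in> m" by (rule poly_ideal_minus[OF id poly_ideal_zero[OF id] ar(2)])
  moreover have "(\<lambda>v. (\<lambda>_. 0) v - a v) = (\<lambda>v. r v * p v - 1)"
  proof
    fix v
    have "1 = a v + r v * p v" using ar(1) by (rule fun_cong)
    then show "(\<lambda>_. 0) v - a v = r v * p v - 1" by (simp add: algebra_simps)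
  qed
  ultimately show ?thesis using ar(3) by auto
qed

text \<open>If \<open>r\<close> inverts \<open>p\<close> modulo \<open>m\<close>, then q = r (p q) -
  q (r p - 1) is a combination of elements of \<open>m\<close>.\<close>

lemma maximal_ideal_prime:
  assumes m: "maximal_ideal n m" and p: "p \<in> polys n" "q \<in> polys n" "(\<lambda>v. p v * q v) \<in> m"
  shows "p \<in> m \<or> q \<in> m"
proof (rule ccontr)
  assume "\<not> (p \<in> m \<or> q \<in> m)"
  then have pm: "p \<notin> m" and qm: "q \<notin> m" by auto
  have id: "poly_ideal n m" using m by (simp add: maximal_ideal_def)
  obtain r where r: "r \<in> polys n" "(\<lambda>v. r v * p v - 1) \<in> m"
    using maximal_ideal_inverse[OF m p(1) pm] by blast
  have 1: "(\<lambda>v. r v * (p v * q v)) \<in> m" "(\<lambda>v. q v * (r v * p v - 1)) \<in> m"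
    by (auto intro: poly_ideal_mult[OF id] r p)
  have "(\<lambda>v. r v * (p v * q v) - q v * (r v * p v - 1)) \<in> m"
    using poly_ideal_minus[OF id 1] .
  moreover have "(\<lambda>v. r v * (p v * q v) - q v * (r v * p v - 1)) = q"
    by (auto simp: algebra_simps)
  ultimately show False using qm by simp
qed

text \<open>\<open>P\<close> splits into linear factors over the complex numbers, and primeness
  passes membership on to one of them; a nonzero constant cannot be the one that lies in
  \<open>m\<close>.\<close>

lemma maximal_ideal_linear_factor:
  assumes m: "maximal_ideal n m" and k: "k < n" and P: "P \<noteq> 0" "(\<lambda>v. poly P (v k)) \<in> m"
  shows "\<exists>c. (\<lambda>v. v k - c) \<in> m"
  using P
proof (induction "degree P" arbitrary: P rule: less_induct)
  case less
  have id: "poly_ideal n m" and 1: "(\<lambda>_. 1) \<notin> m" using m by (simp_all add: maximal_ideal_def)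
  show ?case
  \<comment> \<open>The case distinction is the negated hypothesis of
    \<open>fundamental_theorem_of_algebra_alt\<close>; it singles out the nonzero constants.\<close>
  proof (cases "\<exists>a l. a \<noteq> 0 \<and> l = 0 \<and> P = pCons a l")
    case True
    then obtain a where a: "a \<noteq> 0" "P = [:a:]" by blast
    have "(\<lambda>v. (\<lambda>_. inverse a) v * poly P (v k)) \<in> m"
      by (rule poly_ideal_mult[OF id polys.const less.prems(2)])
    then have False using a 1 by simp
    then show ?thesis ..
  next
    case False
    then obtain z where "poly P z = 0" using fundamental_theorem_of_algebra_alt by blast
    then obtain Q where Q: "P = [:-z, 1:] * Q" by (metis dvdE poly_eq_0_iff_dvd)
    then have Q0: "Q \<noteq> 0" and deg: "degree Q < degree P"
      using less.prems(1) by (auto simp: degree_mult_eq simp del: mult_pCons_left)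
    have "(\<lambda>v. (v k - z) * poly Q (v k)) \<in> m"
      using less.prems(2) unfolding Q by (simp add: algebra_simps)
    then have "(\<lambda>v. v k - z) \<in> m \<or> (\<lambda>v. poly Q (v k)) \<in> m"
      by (rule maximal_ideal_prime[OF m polys_diff[OF polys.coord[OF k] polys.const] polys_poly[OF k]])
    then show ?thesis using less.hyps[OF deg Q0] by blast
  qed
qed

section \<open>The space of polynomials has countable dimension\<close>

interpretation fun_vs: vector_space "\<lambda>(c::complex) (f::'b \<Rightarrow> complex) x. c * f x"
  by unfold_locales (auto simp: fun_eq_iff algebra_simps)

lemma sum_fun_apply: "(\<Sum>i\<in>A. F i) x = (\<Sum>i\<in>A. F i x)"
  for F :: "'i \<Rightarrow> 'b \<Rightarrow> complex"
  by (induction A rule: infinite_finite_induct) auto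

text \<open>A monomial is encoded by a list of indices with repetitions. The encoding is redundant,
  but multiplication becomes concatenation and there are visibly countably many lists.\<close>

definition monomial :: "nat list \<Rightarrow> (nat \<Rightarrow> complex) \<Rightarrow> complex" where
  "monomial xs v = (\<Prod>k\<leftarrow>xs. v k)"

lemma span_monomial_mult:
  assumes "p \<in> fun_vs.span (range monomial)" "q \<in> fun_vs.span (range monomial)"
  shows "(\<lambda>v. p v * q v) \<in> fun_vs.span (range monomial)"
  using assms(1)
proof (induction rule: fun_vs.span_induct_alt)
  case base
  have "(\<lambda>v. (0::((nat \<Rightarrow> complex) \<Rightarrow> complex)) v * q v) = 0" by auto
  then show ?case using fun_vs.span_zero by metis
next
  case (step c x y)
  then obtain xs where xs: "x = monomial xs" by blast
  have "(\<lambda>v. x v * q v) \<in> fun_vs.span (range monomial)"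
    using assms(2)
  proof (induction rule: fun_vs.span_induct_alt)
    case base
    have "(\<lambda>v. x v * (0::((nat \<Rightarrow> complex) \<Rightarrow> complex)) v) = 0" by auto
    then show ?case using fun_vs.span_zero by metis
  next
    case (step d z w)
    then obtain ys where ys: "z = monomial ys" by blast
    have "(\<lambda>v. d * monomial (xs @ ys) v) + (\<lambda>v. x v * w v) \<in> fun_vs.span (range monomial)"
      by (intro fun_vs.span_add fun_vs.span_scale fun_vs.span_base step) auto
    moreover have "(\<lambda>v. d * monomial (xs @ ys) v) + (\<lambda>v. x v * w v)
        = (\<lambda>v. x v * ((\<lambda>u. d * z u) + w) v)"
      by (auto simp: fun_eq_iff xs ys monomial_def algebra_simps)
    ultimately show ?case by simp
  qed
  then have "(\<lambda>v. c * (\<lambda>v. x v * q v) v) + (\<lambda>v. y v * q v) \<in> fun_vs.span (range monomial)"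
    using step by (intro fun_vs.span_add fun_vs.span_scale) auto
  moreover have "(\<lambda>v. c * (\<lambda>v. x v * q v) v) + (\<lambda>v. y v * q v) = (\<lambda>v. ((\<lambda>u. c * x u) + y) v * q v)"
    by (auto simp: fun_eq_iff algebra_simps)
  ultimately show ?case by simp
qed

lemma polys_span_monomial: "p \<in> polys n \<Longrightarrow> p \<in> fun_vs.span (range monomial)"
proof (induction rule: polys.induct)
  case (const c)
  have "(\<lambda>v. c * monomial [] v) \<in> fun_vs.span (range monomial)"
    by (intro fun_vs.span_scale fun_vs.span_base) auto
  moreover have "(\<lambda>v. c * monomial [] v) = (\<lambda>_. c)" by (simp add: monomial_def)
  ultimately show ?case by simp
next
  case (coord k)
  have "(\<lambda>v. v k) = monomial [k]" by (auto simp: monomial_def)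
  then show ?case by (metis fun_vs.span_base rangeI)
next
  case (add p q)
  then show ?case using fun_vs.span_add[of p "range monomial" q] by (simp add: plus_fun_def)
next
  case (mult p q)
  then show ?case by (rule_tac span_monomial_mult)
qed

lemma span_countable_finite:
  assumes "countable B" "B \<noteq> {}" "p \<in> fun_vs.span B"
  shows "\<exists>d. p \<in> fun_vs.span (from_nat_into B ` {..<d::nat})"
proof -
  obtain t r where t: "finite t" "t \<subseteq> B" "p = (\<Sum>a\<in>t. (\<lambda>x. r a * a x))"
    using assms(3) unfolding fun_vs.span_explicit by blast
  have "\<forall>a\<in>t. \<exists>i. from_nat_into B i = a" using t(2) assms(1)
    by (metis from_nat_into_surj subsetD)
  then obtain i where i: "\<forall>a\<in>t. from_nat_into B (i a) = a" by metis
  define d where "d = Suc (Max (insert 0 (i ` t)))"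
  have "i a < d" if "a \<in> t" for a using that t(1) by (simp add: d_def le_imp_less_Suc)
  then have "t \<subseteq> from_nat_into B ` {..<d}" using i by (metis imageI lessThan_iff subsetI)
  then have "p \<in> fun_vs.span (from_nat_into B ` {..<d})"
    unfolding t(3) by (intro fun_vs.span_sum fun_vs.span_scale fun_vs.span_base) auto
  then show ?thesis ..
qed

text \<open>\<open>S\<close> is the union over \<open>d\<close> of its intersections with the span
  of the first \<open>d\<close> monomials. An independent set inside a finitely generated space is
  finite.\<close>

lemma polys_independent_countable:
  assumes "fun_vs.independent S" "S \<subseteq> polys n"
  shows "countable S"
proof -
  let ?B = "range monomial"
  let ?V = "\<lambda>d::nat. fun_vs.span (from_nat_into ?B ` {..<d})"
  have "countable (S \<inter> ?V d)" for d
  proof -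
    have "fun_vs.independent (S \<inter> ?V d)" using assms(1) fun_vs.independent_mono by blast
    then have "finite (S \<inter> ?V d)"
      using fun_vs.independent_span_bound[of "from_nat_into ?B ` {..<d}" "S \<inter> ?V d"] by simp
    then show ?thesis by (rule countable_finite)
  qed
  moreover have "S \<subseteq> (\<Union>d. S \<inter> ?V d)"
  proof
    fix p assume p: "p \<in> S"
    then have "p \<in> fun_vs.span ?B" using assms(2) polys_span_monomial by blast
    then obtain d where "p \<in> ?V d" using span_countable_finite[of ?B p] by auto
    then show "p \<in> (\<Union>d. S \<inter> ?V d)" using p by blast
  qed
  ultimately show ?thesis by (meson countable_UN countable_subset countableI_type)
qed

text \<open>Dependence is a notion for sets; injectivity of \<open>r\<close> allows linear relations
  to be indexed by the parameter of the family instead.\<close>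

lemma fun_vs_independent_range:
  fixes r :: "'c \<Rightarrow> 'b \<Rightarrow> complex"
  assumes "inj r"
    and "\<And>S a c. finite S \<Longrightarrow> c \<in> S \<Longrightarrow> (\<And>v. (\<Sum>c\<in>S. a c * r c v) = 0) \<Longrightarrow> a c = 0"
  shows "fun_vs.independent (range r)"
proof
  assume "fun_vs.dependent (range r)"
  then obtain T u f where T: "finite T" "T \<subseteq> range r" "f \<in> T" "u f \<noteq> 0"
    and z: "(\<Sum>f\<in>T. (\<lambda>x. u f * f x)) = 0"
    unfolding fun_vs.dependent_explicit by blast
  define S where "S = r -` T"
  have TS: "T = r ` S" using T(2) unfolding S_def by auto
  have S: "finite S" unfolding S_def using T(1) \<open>inj r\<close> by (rule finite_vimageI)
  obtain c where c: "f = r c" "c \<in> S" using T(3) TS by blast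
  have "(\<Sum>c\<in>S. u (r c) * r c v) = 0" for v
  proof -
    have "(\<Sum>f\<in>T. (\<lambda>x. u f * f x)) v = 0" using z by simp
    then have "(\<Sum>f\<in>T. u f * f v) = 0" by (simp add: sum_fun_apply)
    then show ?thesis unfolding TS by (simp add: sum.reindex inj_on_subset[OF \<open>inj r\<close>])
  qed
  then have "u (r c) = 0" by (rule assms(2)[OF S c(2), where a = "\<lambda>c. u (r c)"])
  then show False using T(4) c(1) by simp
qed

text \<open>
  If no \<open>v\<^sub>k - c\<close> lies in the maximal ideal, the inverses of these elements are uncountably many
  linearly independent polynomials, while the space of polynomials has countable dimension.
\<close>

lemma maximal_ideal_coordinate:
  assumes m: "maximal_ideal n m" and k: "k < n"
  shows "\<exists>c. (\<lambda>v. v k - c) \<in> m"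
proof (rule ccontr)
  assume no: "\<nexists>c. (\<lambda>v. v k - c) \<in> m"
  have id: "poly_ideal n m" and 1: "(\<lambda>_. 1) \<notin> m" using m by (simp_all add: maximal_ideal_def)
  have mult: "(\<lambda>v. r v * p v) \<in> m" if "r \<in> polys n" "p \<in> m" for r p
    by (rule poly_ideal_mult[OF id that])
  have lin: "(\<lambda>v. v k - c) \<in> polys n" for c by (intro polys_diff polys.intros k)
  have "\<forall>c. \<exists>r. r \<in> polys n \<and> (\<lambda>v. r v * (v k - c) - 1) \<in> m"
    using maximal_ideal_inverse[OF m lin] no by blast
  from choice[OF this] obtain r
    where r: "\<And>c. r c \<in> polys n" "\<And>c. (\<lambda>v. r c v * (v k - c) - 1) \<in> m" by auto
  have indep: "a c0 = 0" if S: "finite S" "c0 \<in> S" and z: "\<And>v. (\<Sum>c\<in>S. a c * r c v) = 0" for a S c0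
  proof (rule ccontr)
    assume a0: "a c0 \<noteq> 0"
    \<comment> \<open>\<open>Q\<close> is the numerator of the sum of the fractions a c / (x - c)
      over their common denominator. At \<open>c0\<close> every term but one vanishes, so
      \<open>Q\<close> is not 0.\<close>
    define Q where "Q = (\<Sum>c\<in>S. smult (a c) (\<Prod>c'\<in>S - {c}. [:-c', 1:]))"
    have Qv: "poly Q x = (\<Sum>c\<in>S. a c * (\<Prod>c'\<in>S - {c}. (x - c')))" for x
      unfolding Q_def by (simp add: poly_sum poly_prod)
    have "poly Q c0 = a c0 * (\<Prod>c'\<in>S - {c0}. (c0 - c')) +
        (\<Sum>c\<in>S - {c0}. a c * (\<Prod>c'\<in>S - {c}. (c0 - c')))"
      unfolding Qv using S by (simp add: sum.remove)
    also have "(\<Sum>c\<in>S - {c0}. a c * (\<Prod>c'\<in>S - {c}. (c0 - c'))) = 0"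
    proof (rule sum.neutral, rule)
      fix c assume "c \<in> S - {c0}"
      then have "(\<Prod>c'\<in>S - {c}. (c0 - c')) = 0"
        using S by (intro prod_zero) auto
      then show "a c * (\<Prod>c'\<in>S - {c}. (c0 - c')) = 0" by simp
    qed
    finally have "poly Q c0 \<noteq> 0" using a0 S by (simp add: prod_zero_iff)
    then have "Q \<noteq> 0" by auto
    \<comment> \<open>Modulo \<open>m\<close> each \<open>r c\<close> is the inverse of v k - c.
      Hence Q (v k) is congruent to the product of all factors v k - c' times the vanishing sum of
      the a c r c, and so lies in \<open>m\<close>.\<close>
    have "(\<lambda>v. \<Sum>c\<in>S. (a c * (\<Prod>c'\<in>S - {c}. (v k - c'))) * (r c v * (v k - c) - 1)) \<in> m"
    proof (rule poly_ideal_sum[OF id])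
      fix c
      show "(\<lambda>v. (a c * (\<Prod>c'\<in>S - {c}. (v k - c'))) * (r c v * (v k - c) - 1)) \<in> m"
        by (rule mult[OF _ r(2)]) (intro polys.mult polys.const polys_prod lin)
    qed
    moreover have "(\<Sum>c\<in>S. (a c * (\<Prod>c'\<in>S - {c}. (v k - c'))) * (r c v * (v k - c) - 1)) = - poly Q (v k)"
      for v
    proof -
      have "(\<Sum>c\<in>S. (a c * (\<Prod>c'\<in>S - {c}. (v k - c'))) * (r c v * (v k - c) - 1))
          = (\<Sum>c\<in>S. (\<Prod>c'\<in>S. (v k - c')) * (a c * r c v) - a c * (\<Prod>c'\<in>S - {c}. (v k - c')))"
      proof (rule sum.cong[OF refl])
        fix c assume "c \<in> S"
        then have "(\<Prod>c'\<in>S. (v k - c')) = (v k - c) * (\<Prod>c'\<in>S - {c}. (v k - c'))"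
          using S by (simp add: prod.remove)
        then show "(a c * (\<Prod>c'\<in>S - {c}. (v k - c'))) * (r c v * (v k - c) - 1)
            = (\<Prod>c'\<in>S. (v k - c')) * (a c * r c v) - a c * (\<Prod>c'\<in>S - {c}. (v k - c'))"
          by (simp only:) (simp add: algebra_simps)
      qed
      also have "\<dots> = (\<Prod>c'\<in>S. (v k - c')) * (\<Sum>c\<in>S. a c * r c v) - poly Q (v k)"
        by (simp add: Qv sum_subtractf sum_distrib_left)
      finally show ?thesis using z by simp
    qed
    ultimately have "(\<lambda>v. - poly Q (v k)) \<in> m" by simp
    from mult[OF polys.const[of "-1"] this] have "(\<lambda>v. poly Q (v k)) \<in> m" by simp
    then show False using maximal_ideal_linear_factor[OF m k \<open>Q \<noteq> 0\<close>] no by blast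
  qed
  have "inj r"
  proof (rule injI, rule ccontr)
    fix c d assume e: "r c = r d" and ne: "c \<noteq> d"
    \<comment> \<open>If r c = r d, the coefficients 1 and -1 on \<open>c\<close> and
      \<open>d\<close> give a nontrivial relation, which \<open>indep\<close> excludes.\<close>
    have "(1::complex) = 0"
      using indep[of "{c, d}" c "\<lambda>x. if x = c then 1 else -1"] e ne by simp
    then show False by simp
  qed
  have "fun_vs.independent (range r)"
    by (rule fun_vs_independent_range[OF \<open>inj r\<close>]) (rule indep)
  moreover have "range r \<subseteq> polys n" using r(1) by (rule image_subsetI)
  ultimately have "countable (range r)" by (rule polys_independent_countable)
  then have "countable (UNIV :: complex set)"
    using \<open>inj r\<close> countable_image_inj_on by blast
  then show False using uncountable_UNIV_complex by blast
qed

text \<open>A maximal ideal above \<open>I\<close> contains v k - c k for all k < n, hence p - p(c)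
  for every polynomial p. If p in \<open>I\<close> had p(c) nonzero, this constant would lie in the
  ideal as well. The point is continued by 0 from index \<open>n\<close> on, as the points of
  \<open>Aspace n\<close> are.\<close>

theorem weak_nullstellensatz:
  assumes I: "poly_ideal n I" and I1: "(\<lambda>_. 1) \<notin> I"
  shows "\<exists>c. (\<forall>k\<ge>n. c k = 0) \<and> (\<forall>p\<in>I. p c = 0)"
proof -
  obtain m where m: "maximal_ideal n m" and Im: "I \<subseteq> m"
    using maximal_ideal_exists[OF assms] by blast
  have id: "poly_ideal n m" and 1: "(\<lambda>_. 1) \<notin> m" using m by (simp_all add: maximal_ideal_def)
  have "\<forall>k. \<exists>c. k < n \<longrightarrow> (\<lambda>v. v k - c) \<in> m" using maximal_ideal_coordinate[OF m] by blast
  then obtain c' where c': "\<And>k. k < n \<Longrightarrow> (\<lambda>v. v k - c' k) \<in> m" by metis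
  define c where "c k = (if k < n then c' k else 0)" for k
  have ev: "(\<lambda>v. p v - p c) \<in> m" if "p \<in> polys n" for p
    using that
  proof (induction rule: polys.induct)
    case (const a) then show ?case using id by (simp add: poly_ideal_def)
  next
    case (coord k) then show ?case using c' by (simp add: c_def)
  next
    case (add p q)
    then have "(\<lambda>v. (p v - p c) + (q v - q c)) \<in> m" by (intro poly_ideal_add[OF id])
    then show ?case by (simp add: algebra_simps)
  next
    case (mult p q)
    then have "(\<lambda>v. q v * (p v - p c) + (\<lambda>_. p c) v * (q v - q c)) \<in> m"
      by (intro poly_ideal_add[OF id] poly_ideal_mult[OF id] polys.const)
    then show ?case by (simp add: algebra_simps)
  qed
  have "p c = 0" if "p \<in> I" for p
  proof (rule ccontr)
    assume pc: "p c \<noteq> 0"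
    have pm: "p \<in> m" "p \<in> polys n" using that Im poly_ideal_polys[OF id] by blast+
    have "(\<lambda>v. p v - (p v - p c)) \<in> m" by (rule poly_ideal_minus[OF id pm(1) ev[OF pm(2)]])
    then have "(\<lambda>v. (\<lambda>_. inverse (p c)) v * (p v - (p v - p c))) \<in> m"
      by (intro poly_ideal_mult[OF id] polys.const)
    then show False using 1 pc by simp
  qed
  then show ?thesis by (intro exI[of _ c]) (simp add: c_def)
qed

section \<open>Regular functions and affine charts\<close>

text \<open>These are the properties of varieties that pass to products and to quotients. The later
  arguments rest on them so that \<open>sym2 X\<close> and its product with \<open>M\<close> can be
  treated without first being made into varieties.\<close>

definition regular_space :: "'a space \<Rightarrow> bool" where
  "regular_space S \<longleftrightarrow> function_sheaf S \<and>
     (\<forall>U. openin (zariski S) U \<longrightarrow> (\<forall>c. (\<lambda>_. c) \<in> reg S U) \<and>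
        (\<forall>f\<in>reg S U. \<forall>g\<in>reg S U. (\<lambda>x. f x + g x) \<in> reg S U \<and> (\<lambda>x. f x * g x) \<in> reg S U) \<and>
        (\<forall>f\<in>reg S U. openin (zariski S) {x \<in> U. f x \<noteq> 0} \<and>
           (\<lambda>x. inverse (f x)) \<in> reg S {x \<in> U. f x \<noteq> 0}))"

lemma regular_space_sheaf: "regular_space S \<Longrightarrow> function_sheaf S"
  by (simp add: regular_space_def)

lemma sheaf_cong:
  assumes "function_sheaf S" "openin (zariski S) U" "f \<in> reg S U" "\<And>x. x \<in> U \<Longrightarrow> g x = f x"
  shows "g \<in> reg S U"
  using assms(1)[unfolded function_sheaf_def, THEN conjunct1, rule_format, of U f g] assms(2-) by simp

lemma sheaf_mono:
  assumes "function_sheaf S" "openin (zariski S) U" "openin (zariski S) V" "V \<subseteq> U" "f \<in> reg S U"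
  shows "f \<in> reg S V"
  using assms(1)[unfolded function_sheaf_def, THEN conjunct2, THEN conjunct1, rule_format, of U V f]
    assms(2-) by simp

lemma sheaf_local:
  assumes "function_sheaf S" "openin (zariski S) U"
    "\<And>x. x \<in> U \<Longrightarrow> \<exists>V. openin (zariski S) V \<and> x \<in> V \<and> V \<subseteq> U \<and> f \<in> reg S V"
  shows "f \<in> reg S U"
  using assms(1)[unfolded function_sheaf_def, THEN conjunct2, THEN conjunct2, rule_format, of U f]
    assms(2-) by simp

lemmas reg_cong = sheaf_cong[OF regular_space_sheaf]
lemmas reg_mono = sheaf_mono[OF regular_space_sheaf]
lemmas reg_local = sheaf_local[OF regular_space_sheaf]

lemma reg_const: "regular_space S \<Longrightarrow> openin (zariski S) U \<Longrightarrow> (\<lambda>_. c) \<in> reg S U"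
  and reg_add: "regular_space S \<Longrightarrow> openin (zariski S) U \<Longrightarrow> f \<in> reg S U \<Longrightarrow> g \<in> reg S U \<Longrightarrow>
    (\<lambda>x. f x + g x) \<in> reg S U"
  and reg_mult: "regular_space S \<Longrightarrow> openin (zariski S) U \<Longrightarrow> f \<in> reg S U \<Longrightarrow> g \<in> reg S U \<Longrightarrow>
    (\<lambda>x. f x * g x) \<in> reg S U"
  and reg_open: "regular_space S \<Longrightarrow> openin (zariski S) U \<Longrightarrow> f \<in> reg S U \<Longrightarrow>
    openin (zariski S) {x \<in> U. f x \<noteq> 0}"
  and reg_inverse': "regular_space S \<Longrightarrow> openin (zariski S) U \<Longrightarrow> f \<in> reg S U \<Longrightarrow>
    (\<lambda>x. inverse (f x)) \<in> reg S {x \<in> U. f x \<noteq> 0}"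
  by (simp_all add: regular_space_def)

lemma reg_uminus:
  assumes "regular_space S" "openin (zariski S) U" "f \<in> reg S U"
  shows "(\<lambda>x. - f x) \<in> reg S U"
  using reg_mult[OF assms(1,2) reg_const[OF assms(1,2), of "-1"] assms(3)] by simp

lemma reg_diff:
  assumes "regular_space S" "openin (zariski S) U" "f \<in> reg S U" "g \<in> reg S U"
  shows "(\<lambda>x. f x - g x) \<in> reg S U"
  using reg_add[OF assms(1-3) reg_uminus[OF assms(1,2,4)]] by simp

lemma reg_inverse:
  assumes "regular_space S" "openin (zariski S) U" "f \<in> reg S U" "\<And>x. x \<in> U \<Longrightarrow> f x \<noteq> 0"
  shows "(\<lambda>x. inverse (f x)) \<in> reg S U"
proof -
  have "{x \<in> U. f x \<noteq> 0} = U" using assms(4) by auto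
  then show ?thesis using reg_inverse'[OF assms(1-3)] by simp
qed

lemma reg_divide:
  assumes "regular_space S" "openin (zariski S) U" "f \<in> reg S U" "g \<in> reg S U"
    "\<And>x. x \<in> U \<Longrightarrow> g x \<noteq> 0"
  shows "(\<lambda>x. f x / g x) \<in> reg S U"
  using reg_mult[OF assms(1-3) reg_inverse[OF assms(1,2,4,5)]] by (simp add: divide_inverse)

lemma reg_sum:
  assumes "regular_space S" "openin (zariski S) U" "\<And>i. i \<in> A \<Longrightarrow> f i \<in> reg S U"
  shows "(\<lambda>x. \<Sum>i\<in>A. f i x) \<in> reg S U"
  using assms(3)
  by (induction A rule: infinite_finite_induct) (auto intro!: reg_const reg_add assms(1,2))

lemma reg_prod:
  assumes "regular_space S" "openin (zariski S) U" "\<And>i. i \<in> A \<Longrightarrow> f i \<in> reg S U"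
  shows "(\<lambda>x. \<Prod>i\<in>A. f i x) \<in> reg S U"
  using assms(3)
  by (induction A rule: infinite_finite_induct) (auto intro!: reg_const reg_mult assms(1,2))

lemma reg_polys:
  assumes "regular_space S" "openin (zariski S) U" "p \<in> polys n" "\<And>k. k < n \<Longrightarrow> (\<lambda>x. f x k) \<in> reg S U"
  shows "(\<lambda>x. p (f x)) \<in> reg S U"
  using assms(3)
  by (induction rule: polys.induct) (auto intro!: reg_const reg_mult reg_add assms(1,2,4))

lemma regular_spaceI:
  assumes "function_sheaf S" "\<And>U c. openin (zariski S) U \<Longrightarrow> (\<lambda>_. c) \<in> reg S U"
    "\<And>U f g. openin (zariski S) U \<Longrightarrow> f \<in> reg S U \<Longrightarrow> g \<in> reg S U \<Longrightarrow> (\<lambda>x. f x + g x) \<in> reg S U"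
    "\<And>U f g. openin (zariski S) U \<Longrightarrow> f \<in> reg S U \<Longrightarrow> g \<in> reg S U \<Longrightarrow> (\<lambda>x. f x * g x) \<in> reg S U"
    "\<And>U f. openin (zariski S) U \<Longrightarrow> f \<in> reg S U \<Longrightarrow> openin (zariski S) {x \<in> U. f x \<noteq> 0}"
    "\<And>U f. openin (zariski S) U \<Longrightarrow> f \<in> reg S U \<Longrightarrow> (\<lambda>x. inverse (f x)) \<in> reg S {x \<in> U. f x \<noteq> 0}"
  shows "regular_space S"
  unfolding regular_space_def using assms by auto

lemma openin_generated_basis:
  assumes "openin (topology_generated_by \<B>) O'" "x \<in> O'"
    and int: "\<And>A C. A \<in> \<B> \<Longrightarrow> C \<in> \<B> \<Longrightarrow> x \<in> A \<Longrightarrow> x \<in> C \<Longrightarrow> \<exists>D\<in>\<B>. x \<in> D \<and> D \<subseteq> A \<inter> C"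
  shows "\<exists>D\<in>\<B>. x \<in> D \<and> D \<subseteq> O'"
proof -
  have "generate_topology_on \<B> O'" using assms(1) by (simp add: openin_topology_generated_by_iff)
  then show ?thesis
    using assms(2)
  proof (induction rule: generate_topology_on.induct)
    case (Int a b)
    then obtain A C where "A \<in> \<B>" "C \<in> \<B>" "x \<in> A" "x \<in> C" "A \<subseteq> a" "C \<subseteq> b" by blast
    with int[of A C] show ?case by blast
  next
    case (UN K)
    then obtain k where k: "k \<in> K" "x \<in> k" by blast
    then obtain D where D: "D \<in> \<B>" "x \<in> D" "D \<subseteq> k" using UN.IH[OF k] by blast
    have "D \<subseteq> \<Union>K" using k(1) D(3) by blast
    then show ?case using D by blast
  qed auto
qed

subsection \<open>Affine space\<close>

lemma openin_Aspace_basic: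
  "p \<in> polys n \<Longrightarrow> openin (zariski (Aspace n)) {v. (\<forall>k\<ge>n. v k = 0) \<and> p v \<noteq> 0}"
  unfolding Aspace_def by (auto intro!: topology_generated_by_Basis)

lemma points_Aspace: "points (Aspace n) = {v. \<forall>k\<ge>n. v k = 0}"
proof -
  have "\<Union>{{v. (\<forall>k\<ge>n. v k = 0) \<and> p v \<noteq> 0} | p. p \<in> polys n} = {v. \<forall>k\<ge>n. v k = 0}"
      (is "\<Union>?B = ?P")
  proof
    have "{v. (\<forall>k\<ge>n. v k = 0) \<and> (\<lambda>_. 1::complex) v \<noteq> 0} \<in> ?B"
      by (intro CollectI exI[of _ "\<lambda>_. 1"] conjI refl polys.const)
    then show "?P \<subseteq> \<Union>?B" by auto
  qed auto
  then show ?thesis by (simp add: Aspace_def)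
qed

lemma Aspace_basis:
  assumes "openin (zariski (Aspace n)) O'" "v \<in> O'"
  shows "\<exists>p\<in>polys n. p v \<noteq> 0 \<and> (\<forall>w. (\<forall>k\<ge>n. w k = 0) \<and> p w \<noteq> 0 \<longrightarrow> w \<in> O')"
proof -
  let ?B = "{{v. (\<forall>k\<ge>n. v k = 0) \<and> p v \<noteq> 0} | p. p \<in> polys n}"
  have "\<exists>D\<in>?B. v \<in> D \<and> D \<subseteq> O'"
  proof (rule openin_generated_basis)
    show "openin (topology_generated_by ?B) O'" using assms(1) by (simp add: Aspace_def)
    fix A C assume "A \<in> ?B" "C \<in> ?B" and v: "v \<in> A" "v \<in> C"
    then obtain p q where pq: "p \<in> polys n" "q \<in> polys n"
      "A = {v. (\<forall>k\<ge>n. v k = 0) \<and> p v \<noteq> 0}" "C = {v. (\<forall>k\<ge>n. v k = 0) \<and> q v \<noteq> 0}" by blast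
    have "{v. (\<forall>k\<ge>n. v k = 0) \<and> (\<lambda>v. p v * q v) v \<noteq> 0} \<in> ?B"
      by (intro CollectI exI[of _ "\<lambda>v. p v * q v"] conjI refl polys.mult pq)
    then show "\<exists>D\<in>?B. v \<in> D \<and> D \<subseteq> A \<inter> C"
      by (rule bexI[rotated]) (use v pq in auto)
  qed (fact assms(2))
  then show ?thesis by blast
qed

lemma reg_Aspace: "f \<in> reg (Aspace n) U \<longleftrightarrow> (\<forall>x\<in>U. \<exists>p\<in>polys n. \<exists>q\<in>polys n. q x \<noteq> 0 \<and>
    (\<forall>y\<in>U. q y \<noteq> 0 \<longrightarrow> f y = p y / q y))"
  by (simp add: Aspace_def)

lemma reg_AspaceE:
  assumes "f \<in> reg (Aspace n) U" "x \<in> U"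
  obtains p q where "p \<in> polys n" "q \<in> polys n" "q x \<noteq> 0" "\<forall>y\<in>U. q y \<noteq> 0 \<longrightarrow> f y = p y / q y"
  using bspec[OF assms(1)[unfolded reg_Aspace] assms(2)] by (elim bexE conjE) auto

lemma function_sheaf_Aspace: "function_sheaf (Aspace n)"
  unfolding function_sheaf_def
proof (intro conjI allI impI)
  fix U f g assume "openin (zariski (Aspace n)) U \<and> f \<in> reg (Aspace n) U \<and> (\<forall>x\<in>U. g x = f x)"
  then show "g \<in> reg (Aspace n) U" by (simp add: reg_Aspace)
next
  fix U V f
  assume *: "openin (zariski (Aspace n)) U \<and> openin (zariski (Aspace n)) V \<and> V \<subseteq> U \<and> f \<in> reg (Aspace n) U"
  show "f \<in> reg (Aspace n) V" unfolding reg_Aspace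
  proof
    fix x assume "x \<in> V"
    then have "x \<in> U" using * by auto
    moreover have "f \<in> reg (Aspace n) U" using * by simp
    ultimately obtain p q where "p \<in> polys n" "q \<in> polys n" "q x \<noteq> 0"
      "\<forall>y\<in>U. q y \<noteq> 0 \<longrightarrow> f y = p y / q y"
      by (rule_tac reg_AspaceE)
    then show "\<exists>p\<in>polys n. \<exists>q\<in>polys n. q x \<noteq> 0 \<and> (\<forall>y\<in>V. q y \<noteq> 0 \<longrightarrow> f y = p y / q y)"
      by (intro bexI[of _ p] bexI[of _ q]) (use * in auto)
  qed
next
  fix U f
  assume *: "openin (zariski (Aspace n)) U \<and> (\<forall>x\<in>U. \<exists>V. openin (zariski (Aspace n)) V \<and> x \<in> V \<and>
      V \<subseteq> U \<and> f \<in> reg (Aspace n) V)"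
  have supp: "\<forall>k\<ge>n. y k = 0" if "y \<in> U" for y
    using openin_subset[of "zariski (Aspace n)" U] * that points_Aspace[of n] by auto
  show "f \<in> reg (Aspace n) U"
    unfolding reg_Aspace
  proof
    fix x assume x: "x \<in> U"
    then obtain V where V: "openin (zariski (Aspace n)) V" "x \<in> V" "V \<subseteq> U" "f \<in> reg (Aspace n) V"
      using * by blast
    from reg_AspaceE[OF V(4,2)] obtain p q where pq: "p \<in> polys n" "q \<in> polys n" "q x \<noteq> 0"
      "\<forall>y\<in>V. q y \<noteq> 0 \<longrightarrow> f y = p y / q y" .
    \<comment> \<open>The fraction is known on \<open>V\<close> only, but must hold wherever its
      denominator is nonzero on \<open>U\<close>. Multiplying numerator and denominator by
      \<open>r\<close>, which vanishes outside \<open>V\<close>, achieves this. The same device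
      recurs for charts and for products.\<close>
    obtain r where r: "r \<in> polys n" "r x \<noteq> 0" "\<forall>w. (\<forall>k\<ge>n. w k = 0) \<and> r w \<noteq> 0 \<longrightarrow> w \<in> V"
      using Aspace_basis[OF V(1,2)] by blast
    show "\<exists>p\<in>polys n. \<exists>q\<in>polys n. q x \<noteq> 0 \<and> (\<forall>y\<in>U. q y \<noteq> 0 \<longrightarrow> f y = p y / q y)"
      using pq r supp
      by (intro bexI[of _ "\<lambda>v. p v * r v"] bexI[of _ "\<lambda>v. q v * r v"] polys.mult) auto
  qed
qed

subsection \<open>Induced and quotient spaces\<close>

lemma openin_induced:
  "openin (zariski (induced_space S A)) W \<longleftrightarrow> (\<exists>T. openin (zariski S) T \<and> W = T \<inter> A)"
  by (simp add: induced_space_def openin_subtopology)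

lemma points_induced: "points (induced_space S A) = points S \<inter> A"
  by (simp add: induced_space_def)

lemma reg_inducedI:
  assumes "openin (zariski S) U" "W \<subseteq> U" "f \<in> reg S U"
  shows "f \<in> reg (induced_space S A) W"
  unfolding induced_space_def using assms by auto

lemma reg_inducedD:
  assumes "f \<in> reg (induced_space S A) W" "x \<in> W"
  shows "\<exists>U g. openin (zariski S) U \<and> x \<in> U \<and> g \<in> reg S U \<and> (\<forall>y\<in>U \<inter> W. f y = g y)"
  using assms unfolding induced_space_def by auto

lemma reg_induced_open:
  assumes "function_sheaf S" "openin (zariski S) W" "f \<in> reg (induced_space S A) W"
  shows "f \<in> reg S W"
proof (rule sheaf_local[OF assms(1,2)])
  fix x assume "x \<in> W"
  from reg_inducedD[OF assms(3) this] obtain U g where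
    U: "openin (zariski S) U" "x \<in> U" "g \<in> reg S U" "\<forall>y\<in>U \<inter> W. f y = g y" by blast
  have o: "openin (zariski S) (U \<inter> W)" using U(1) assms(2) by blast
  have "f \<in> reg S (U \<inter> W)"
    by (rule sheaf_cong[OF assms(1) o sheaf_mono[OF assms(1) U(1) o _ U(3)]]) (use U(4) in auto)
  then show "\<exists>V. openin (zariski S) V \<and> x \<in> V \<and> V \<subseteq> W \<and> f \<in> reg S V"
    using o U(2) \<open>x \<in> W\<close> by blast
qed

lemma points_quotient: "points (quotient_space S \<pi>) = \<pi> ` points S"
proof
  show "points (quotient_space S \<pi>) \<subseteq> \<pi> ` points S"
    using openin_topspace[of "zariski (quotient_space S \<pi>)"] unfolding openin_quotient_space by blast
  have "openin (zariski (quotient_space S \<pi>)) (\<pi> ` points S)"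
    unfolding openin_quotient_space
  proof
    have "points S \<inter> \<pi> -` \<pi> ` points S = points S" by blast
    then show "openin (zariski S) (points S \<inter> \<pi> -` \<pi> ` points S)" by simp
  qed simp
  then show "\<pi> ` points S \<subseteq> points (quotient_space S \<pi>)" by (rule openin_subset)
qed

lemma reg_quotient: "reg (quotient_space S \<pi>) V = {f. f \<circ> \<pi> \<in> reg S (points S \<inter> \<pi> -` V)}"
  by (simp add: quotient_space_def)

lemma morphism_openin:
  assumes "morphism S T \<phi>" "openin (zariski T) V"
  shows "openin (zariski S) (points S \<inter> \<phi> -` V)"
proof -
  have "openin (zariski S) {x \<in> points S. \<phi> x \<in> V}"
    using assms unfolding morphism_def continuous_map_def by blast
  moreover have "{x \<in> points S. \<phi> x \<in> V} = points S \<inter> \<phi> -` V" by auto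
  ultimately show ?thesis by simp
qed

lemma morphism_reg:
  "morphism S T \<phi> \<Longrightarrow> openin (zariski T) V \<Longrightarrow> f \<in> reg T V \<Longrightarrow> f \<circ> \<phi> \<in> reg S (points S \<inter> \<phi> -` V)"
  unfolding morphism_def by blast

lemma morphism_points: "morphism S T \<phi> \<Longrightarrow> x \<in> points S \<Longrightarrow> \<phi> x \<in> points T"
  unfolding morphism_def continuous_map_def by blast

lemma regular_space_quotient:
  assumes S: "regular_space S"
  shows "regular_space (quotient_space S \<pi>)"
proof -
  let ?Q = "quotient_space S \<pi>" and ?p = "\<lambda>V. points S \<inter> \<pi> -` V"
  have op: "openin (zariski S) (?p V)" if "openin (zariski ?Q) V" for V
    using that unfolding openin_quotient_space by blast
  have sub: "V \<subseteq> \<pi> ` points S" if "openin (zariski ?Q) V" for V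
    using that unfolding openin_quotient_space by blast
  show ?thesis
  proof (rule regular_spaceI)
    show "function_sheaf ?Q"
      unfolding function_sheaf_def
    proof (intro conjI allI impI)
      fix U f g assume *: "openin (zariski ?Q) U \<and> f \<in> reg ?Q U \<and> (\<forall>x\<in>U. g x = f x)"
      then show "g \<in> reg ?Q U"
        using reg_cong[OF S op, of U "f \<circ> \<pi>" "g \<circ> \<pi>"] by (simp add: reg_quotient)
    next
      fix U V f assume *: "openin (zariski ?Q) U \<and> openin (zariski ?Q) V \<and> V \<subseteq> U \<and> f \<in> reg ?Q U"
      then show "f \<in> reg ?Q V"
        using reg_mono[OF S op op, of U V "f \<circ> \<pi>"] by (auto simp: reg_quotient)
    next
      fix U f assume *: "openin (zariski ?Q) U \<and> (\<forall>x\<in>U. \<exists>V. openin (zariski ?Q) V \<and> x \<in> V \<and> V \<subseteq> U \<and> f \<in> reg ?Q V)"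
      have "f \<circ> \<pi> \<in> reg S (?p U)"
      proof (rule reg_local[OF S op])
        fix x assume x: "x \<in> ?p U"
        then obtain V where V: "openin (zariski ?Q) V" "\<pi> x \<in> V" "V \<subseteq> U" "f \<in> reg ?Q V" using * by blast
        then show "\<exists>V. openin (zariski S) V \<and> x \<in> V \<and> V \<subseteq> ?p U \<and> f \<circ> \<pi> \<in> reg S V"
          using x by (intro exI[of _ "?p V"]) (auto simp: reg_quotient op)
      qed (use * in auto)
      then show "f \<in> reg ?Q U" by (simp add: reg_quotient)
    qed
  next
    fix U c assume "openin (zariski ?Q) U"
    then show "(\<lambda>_. c) \<in> reg ?Q U"
      using reg_const[OF S op, of U c] by (simp add: reg_quotient comp_def)
  next
    fix U f g assume "openin (zariski ?Q) U" "f \<in> reg ?Q U" "g \<in> reg ?Q U"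
    then show "(\<lambda>x. f x + g x) \<in> reg ?Q U" "(\<lambda>x. f x * g x) \<in> reg ?Q U"
      using reg_add[OF S op, of U "f \<circ> \<pi>" "g \<circ> \<pi>"] reg_mult[OF S op, of U "f \<circ> \<pi>" "g \<circ> \<pi>"]
      by (simp_all add: reg_quotient comp_def)
  next
    fix U f assume U: "openin (zariski ?Q) U" "f \<in> reg ?Q U"
    have e: "?p {x \<in> U. f x \<noteq> 0} = {x \<in> ?p U. (f \<circ> \<pi>) x \<noteq> 0}" by auto
    show "openin (zariski ?Q) {x \<in> U. f x \<noteq> 0}"
      unfolding openin_quotient_space e
      using reg_open[OF S op, of U "f \<circ> \<pi>"] sub U by (auto simp: reg_quotient)
    show "(\<lambda>x. inverse (f x)) \<in> reg ?Q {x \<in> U. f x \<noteq> 0}"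
      unfolding reg_quotient e mem_Collect_eq
      using reg_inverse'[OF S op, of U "f \<circ> \<pi>"] U by (simp add: reg_quotient comp_def)
  qed
qed

subsection \<open>Affine charts\<close>

text \<open>
  The fifth clause says that \<open>\<zeta>\<close> maps \<open>U\<close> onto a Zariski-closed set; the sixth, with \<open>f = 0\<close>,
  also says that the sets \<open>q \<noteq> 0\<close> form a basis of the topology of \<open>U\<close>.
\<close>

definition affine_chart :: "'a space \<Rightarrow> 'a set \<Rightarrow> nat \<Rightarrow> ('a \<Rightarrow> nat \<Rightarrow> complex) \<Rightarrow> bool" where
  "affine_chart S U n \<zeta> \<longleftrightarrow> openin (zariski S) U \<and> inj_on \<zeta> U \<and> (\<forall>x\<in>U. \<forall>k\<ge>n. \<zeta> x k = 0) \<and>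
     (\<forall>p\<in>polys n. \<forall>q\<in>polys n. openin (zariski S) {x \<in> U. q (\<zeta> x) \<noteq> 0} \<and>
        (\<lambda>x. p (\<zeta> x) / q (\<zeta> x)) \<in> reg S {x \<in> U. q (\<zeta> x) \<noteq> 0}) \<and>
     (\<forall>c. (\<forall>k\<ge>n. c k = 0) \<and> (\<forall>p\<in>polys n. (\<forall>x\<in>U. p (\<zeta> x) = 0) \<longrightarrow> p c = 0) \<longrightarrow> c \<in> \<zeta> ` U) \<and>
     (\<forall>W f w. openin (zariski S) W \<and> f \<in> reg S W \<and> w \<in> W \<and> w \<in> U \<longrightarrow>
        (\<exists>p\<in>polys n. \<exists>q\<in>polys n. q (\<zeta> w) \<noteq> 0 \<and>
           (\<forall>x\<in>U. q (\<zeta> x) \<noteq> 0 \<longrightarrow> x \<in> W \<and> f x = p (\<zeta> x) / q (\<zeta> x))))"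

lemma affine_chartI:
  assumes "openin (zariski S) U" "inj_on \<zeta> U" "\<And>x k. x \<in> U \<Longrightarrow> k \<ge> n \<Longrightarrow> \<zeta> x k = 0"
    "\<And>q. q \<in> polys n \<Longrightarrow> openin (zariski S) {x \<in> U. q (\<zeta> x) \<noteq> 0}"
    "\<And>p q. p \<in> polys n \<Longrightarrow> q \<in> polys n \<Longrightarrow> (\<lambda>x. p (\<zeta> x) / q (\<zeta> x)) \<in> reg S {x \<in> U. q (\<zeta> x) \<noteq> 0}"
    "\<And>c. (\<And>k. k \<ge> n \<Longrightarrow> c k = 0) \<Longrightarrow> (\<And>p. p \<in> polys n \<Longrightarrow> (\<And>x. x \<in> U \<Longrightarrow> p (\<zeta> x) = 0) \<Longrightarrow> p c = 0) \<Longrightarrow> c \<in> \<zeta> ` U"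
    "\<And>W f w. openin (zariski S) W \<Longrightarrow> f \<in> reg S W \<Longrightarrow> w \<in> W \<Longrightarrow> w \<in> U \<Longrightarrow>
        (\<exists>p\<in>polys n. \<exists>q\<in>polys n. q (\<zeta> w) \<noteq> 0 \<and>
           (\<forall>x\<in>U. q (\<zeta> x) \<noteq> 0 \<longrightarrow> x \<in> W \<and> f x = p (\<zeta> x) / q (\<zeta> x)))"
  shows "affine_chart S U n \<zeta>"
  unfolding affine_chart_def
  by (intro conjI ballI allI impI) (use assms in auto)

lemma affine_chart_open: "affine_chart S U n \<zeta> \<Longrightarrow> openin (zariski S) U"
  and affine_chart_inj: "affine_chart S U n \<zeta> \<Longrightarrow> inj_on \<zeta> U"
  and affine_chart_supp: "affine_chart S U n \<zeta> \<Longrightarrow> x \<in> U \<Longrightarrow> k \<ge> n \<Longrightarrow> \<zeta> x k = 0"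
  and affine_chart_reg_quotient: "affine_chart S U n \<zeta> \<Longrightarrow> p \<in> polys n \<Longrightarrow> q \<in> polys n \<Longrightarrow>
    (\<lambda>x. p (\<zeta> x) / q (\<zeta> x)) \<in> reg S {x \<in> U. q (\<zeta> x) \<noteq> 0}"
  by (simp_all add: affine_chart_def)

lemma affine_chart_open_basic:
  assumes "affine_chart S U n \<zeta>" "q \<in> polys n"
  shows "openin (zariski S) {x \<in> U. q (\<zeta> x) \<noteq> 0}"
  using assms(1)[unfolded affine_chart_def, THEN conjunct2, THEN conjunct2, THEN conjunct2,
      THEN conjunct1, rule_format, OF polys.const[of 1] assms(2)] by simp

lemma affine_chart_closed:
  assumes "affine_chart S U n \<zeta>" "\<And>k. k \<ge> n \<Longrightarrow> c k = 0"
    "\<And>p. p \<in> polys n \<Longrightarrow> (\<And>x. x \<in> U \<Longrightarrow> p (\<zeta> x) = 0) \<Longrightarrow> p c = 0"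
  shows "c \<in> \<zeta> ` U"
  using assms(1)[unfolded affine_chart_def, THEN conjunct2, THEN conjunct2, THEN conjunct2,
      THEN conjunct2, THEN conjunct1, THEN spec, of c] assms(2,3) by simp

lemma affine_chart_fraction:
  assumes "affine_chart S U n \<zeta>" "openin (zariski S) W" "f \<in> reg S W" "w \<in> W" "w \<in> U"
  obtains p q where "p \<in> polys n" "q \<in> polys n" "q (\<zeta> w) \<noteq> 0"
    "\<forall>x\<in>U. q (\<zeta> x) \<noteq> 0 \<longrightarrow> x \<in> W \<and> f x = p (\<zeta> x) / q (\<zeta> x)"
  using assms(1)[unfolded affine_chart_def, THEN conjunct2, THEN conjunct2, THEN conjunct2,
      THEN conjunct2, THEN conjunct2, THEN spec, of W, THEN spec, of f, THEN spec, of w] assms(2-)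
  by (elim impE bexE conjE) auto

lemma affine_chart_polys:
  assumes "affine_chart S U n \<zeta>" "p \<in> polys n"
  shows "(\<lambda>x. p (\<zeta> x)) \<in> reg S U"
  using affine_chart_reg_quotient[OF assms polys.const[of 1]] by simp

lemma affine_chart_coord:
  assumes "affine_chart S U n \<zeta>" "k < n"
  shows "(\<lambda>x. \<zeta> x k) \<in> reg S U"
  using affine_chart_polys[OF assms(1) polys.coord[OF assms(2)]] by simp

lemma affine_chart_separates:
  assumes "affine_chart S U n \<zeta>" "x \<in> U" "y \<in> U" "x \<noteq> y"
  shows "\<exists>k<n. \<zeta> x k \<noteq> \<zeta> y k"
proof (rule ccontr)
  assume "\<not> ?thesis"
  then have "\<zeta> x = \<zeta> y"
    using affine_chart_supp[OF assms(1)] assms(2,3) by (metis ext not_le_imp_less)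
  then show False using affine_chart_inj[OF assms(1)] assms by (auto dest: inj_onD)
qed

text \<open>Near each point a regular function is a fraction of polynomials in the coordinates of a
  chart, and conversely (\<open>L\<close>) a function that is such a fraction near each point is
  regular by gluing. The closure properties thus reduce to the arithmetic of fractions.\<close>

lemma charted_regular_space:
  assumes S: "function_sheaf S"
    and ch: "\<And>x. x \<in> points S \<Longrightarrow> \<exists>U n \<zeta>. affine_chart S U n \<zeta> \<and> x \<in> U"
  shows "regular_space S"
proof -
  have L: "f \<in> reg S W" if W: "openin (zariski S) W"
    and f: "\<And>w U n \<zeta>. w \<in> W \<Longrightarrow> affine_chart S U n \<zeta> \<Longrightarrow> w \<in> U \<Longrightarrow> \<exists>p\<in>polys n. \<exists>q\<in>polys n. q (\<zeta> w) \<noteq> 0 \<and>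
        (\<forall>x\<in>U. x \<in> W \<and> q (\<zeta> x) \<noteq> 0 \<longrightarrow> f x = p (\<zeta> x) / q (\<zeta> x))" for f W
  proof (rule sheaf_local[OF S W])
    fix w assume w: "w \<in> W"
    then have "w \<in> points S" using openin_subset[OF W] by auto
    from ch[OF this] obtain U n \<zeta> where c: "affine_chart S U n \<zeta>" "w \<in> U" by auto
    from f[OF w c] obtain p q where pq: "p \<in> polys n" "q \<in> polys n" "q (\<zeta> w) \<noteq> 0"
      and e: "\<forall>x\<in>U. x \<in> W \<and> q (\<zeta> x) \<noteq> 0 \<longrightarrow> f x = p (\<zeta> x) / q (\<zeta> x)" by auto
    let ?V = "{x \<in> U. q (\<zeta> x) \<noteq> 0}"
    note o = affine_chart_open_basic[OF c(1) pq(2)]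
    have o2: "openin (zariski S) (?V \<inter> W)" using o W by (rule openin_Int)
    have "(\<lambda>x. p (\<zeta> x) / q (\<zeta> x)) \<in> reg S (?V \<inter> W)"
      by (rule sheaf_mono[OF S o o2 _ affine_chart_reg_quotient[OF c(1) pq(1,2)]]) auto
    then have "f \<in> reg S (?V \<inter> W)" by (rule sheaf_cong[OF S o2]) (use e in auto)
    then show "\<exists>V. openin (zariski S) V \<and> w \<in> V \<and> V \<subseteq> W \<and> f \<in> reg S V"
      using o2 pq w c by (intro exI[of _ "?V \<inter> W"]) auto
  qed
  show ?thesis
  proof (rule regular_spaceI[OF S])
    fix W c assume W: "openin (zariski S) W"
    show "(\<lambda>_. c) \<in> reg S W"
    proof (rule L[OF W])
      fix w U n and \<zeta> :: "'a \<Rightarrow> nat \<Rightarrow> complex"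
      show "\<exists>p\<in>polys n. \<exists>q\<in>polys n. q (\<zeta> w) \<noteq> 0 \<and>
        (\<forall>x\<in>U. x \<in> W \<and> q (\<zeta> x) \<noteq> 0 \<longrightarrow> c = p (\<zeta> x) / q (\<zeta> x))"
        by (intro bexI[of _ "\<lambda>_. c"] bexI[of _ "\<lambda>_. 1"] polys.const) auto
    qed
  next
    fix W f g assume W: "openin (zariski S) W" and f: "f \<in> reg S W" and g: "g \<in> reg S W"
    show "(\<lambda>x. f x + g x) \<in> reg S W"
    proof (rule L[OF W])
      fix w U n \<zeta> assume w: "w \<in> W" and c: "affine_chart S U n \<zeta>" "w \<in> U"
      from affine_chart_fraction[OF c(1) W f w c(2)] obtain p q where
        pq: "p \<in> polys n" "q \<in> polys n" "q (\<zeta> w) \<noteq> 0"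
        "\<forall>x\<in>U. q (\<zeta> x) \<noteq> 0 \<longrightarrow> x \<in> W \<and> f x = p (\<zeta> x) / q (\<zeta> x)" .
      from affine_chart_fraction[OF c(1) W g w c(2)] obtain p' q' where
        pq': "p' \<in> polys n" "q' \<in> polys n" "q' (\<zeta> w) \<noteq> 0"
        "\<forall>x\<in>U. q' (\<zeta> x) \<noteq> 0 \<longrightarrow> x \<in> W \<and> g x = p' (\<zeta> x) / q' (\<zeta> x)" .
      show "\<exists>p\<in>polys n. \<exists>q\<in>polys n. q (\<zeta> w) \<noteq> 0 \<and>
          (\<forall>x\<in>U. x \<in> W \<and> q (\<zeta> x) \<noteq> 0 \<longrightarrow> f x + g x = p (\<zeta> x) / q (\<zeta> x))"
        using pq pq'
        by (intro bexI[of _ "\<lambda>v. p v * q' v + p' v * q v"]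
            bexI[of _ "\<lambda>v. q v * q' v"] polys.mult polys.add) (auto simp: add_frac_eq)
    qed
    show "(\<lambda>x. f x * g x) \<in> reg S W"
    proof (rule L[OF W])
      fix w U n \<zeta> assume w: "w \<in> W" and c: "affine_chart S U n \<zeta>" "w \<in> U"
      from affine_chart_fraction[OF c(1) W f w c(2)] obtain p q where
        pq: "p \<in> polys n" "q \<in> polys n" "q (\<zeta> w) \<noteq> 0"
        "\<forall>x\<in>U. q (\<zeta> x) \<noteq> 0 \<longrightarrow> x \<in> W \<and> f x = p (\<zeta> x) / q (\<zeta> x)" .
      from affine_chart_fraction[OF c(1) W g w c(2)] obtain p' q' where
        pq': "p' \<in> polys n" "q' \<in> polys n" "q' (\<zeta> w) \<noteq> 0"
        "\<forall>x\<in>U. q' (\<zeta> x) \<noteq> 0 \<longrightarrow> x \<in> W \<and> g x = p' (\<zeta> x) / q' (\<zeta> x)" .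
      show "\<exists>p\<in>polys n. \<exists>q\<in>polys n. q (\<zeta> w) \<noteq> 0 \<and>
          (\<forall>x\<in>U. x \<in> W \<and> q (\<zeta> x) \<noteq> 0 \<longrightarrow> f x * g x = p (\<zeta> x) / q (\<zeta> x))"
        using pq pq'
        by (intro bexI[of _ "\<lambda>v. p v * p' v"] bexI[of _ "\<lambda>v. q v * q' v"] polys.mult) auto
    qed
  next
    fix W f assume W: "openin (zariski S) W" and f: "f \<in> reg S W"
    show o: "openin (zariski S) {x \<in> W. f x \<noteq> 0}"
    proof (subst openin_subopen, rule)
      fix w assume w: "w \<in> {x \<in> W. f x \<noteq> 0}"
      then have "w \<in> points S" using openin_subset[OF W] by auto
      from ch[OF this] obtain U n \<zeta> where c: "affine_chart S U n \<zeta>" "w \<in> U" by auto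
      have wW: "w \<in> W" using w by simp
      from affine_chart_fraction[OF c(1) W f wW c(2)] obtain p q where
        pq: "p \<in> polys n" "q \<in> polys n" "q (\<zeta> w) \<noteq> 0"
        "\<forall>x\<in>U. q (\<zeta> x) \<noteq> 0 \<longrightarrow> x \<in> W \<and> f x = p (\<zeta> x) / q (\<zeta> x)" .
      have "openin (zariski S) {x \<in> U. (\<lambda>v. p v * q v) (\<zeta> x) \<noteq> 0}"
        by (rule affine_chart_open_basic[OF c(1) polys.mult[OF pq(1,2)]])
      then show "\<exists>T. openin (zariski S) T \<and> w \<in> T \<and> T \<subseteq> {x \<in> W. f x \<noteq> 0}"
        using w c pq by (intro exI[of _ "{x \<in> U. (\<lambda>v. p v * q v) (\<zeta> x) \<noteq> 0}"]) auto
    qed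
    show "(\<lambda>x. inverse (f x)) \<in> reg S {x \<in> W. f x \<noteq> 0}"
    proof (rule L[OF o])
      fix w U n \<zeta> assume w: "w \<in> {x \<in> W. f x \<noteq> 0}" and c: "affine_chart S U n \<zeta>" "w \<in> U"
      have wW: "w \<in> W" using w by simp
      from affine_chart_fraction[OF c(1) W f wW c(2)] obtain p q where
        pq: "p \<in> polys n" "q \<in> polys n" "q (\<zeta> w) \<noteq> 0"
        "\<forall>x\<in>U. q (\<zeta> x) \<noteq> 0 \<longrightarrow> x \<in> W \<and> f x = p (\<zeta> x) / q (\<zeta> x)" .
      \<comment> \<open>The inverse of p / q is written as q^2 / (p q): a nonzero denominator then
        also keeps \<open>q\<close> nonzero, where the fraction for \<open>f\<close> is
        valid.\<close>
      show "\<exists>p\<in>polys n. \<exists>q\<in>polys n. q (\<zeta> w) \<noteq> 0 \<and>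
          (\<forall>x\<in>U. x \<in> {x \<in> W. f x \<noteq> 0} \<and> q (\<zeta> x) \<noteq> 0 \<longrightarrow> inverse (f x) = p (\<zeta> x) / q (\<zeta> x))"
        using pq w c
        by (intro bexI[of _ "\<lambda>v. q v * q v"] bexI[of _ "\<lambda>v. p v * q v"] polys.mult)
          (auto simp: field_simps)
    qed
  qed
qed

subsection \<open>Coordinate rings\<close>

lemma polys_mono: "p \<in> polys n \<Longrightarrow> n \<le> m \<Longrightarrow> p \<in> polys m"
proof (induction rule: polys.induct)
  case (coord k)
  then show ?case by (intro polys.coord) simp
qed (auto intro: polys.const polys.add polys.mult)

text \<open>The variable with index \<open>n\<close> stands for 1/h, and a power of \<open>h\<close>
  clears it. For sums and for products the exponents are added, so that no degree has to be
  tracked.\<close>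

lemma polys_clear_denominators:
  assumes "p \<in> polys (Suc n)" and h: "h \<in> polys n"
  shows "\<exists>N. \<exists>P\<in>polys n. \<forall>v. h v \<noteq> 0 \<longrightarrow> p (v(n := inverse (h v))) * h v ^ N = P v"
  using assms(1)
proof (induction rule: polys.induct)
  case (const c)
  show ?case by (intro exI[of _ 0] bexI[of _ "\<lambda>_. c"] polys.const) simp
next
  case (coord k)
  show ?case
  proof (cases "k = n")
    case True
    show ?thesis by (intro exI[of _ 1] bexI[of _ "\<lambda>_. 1"] polys.const) (simp add: True)
  next
    case False
    show ?thesis
      by (intro exI[of _ 0] bexI[of _ "\<lambda>v. v k"] polys.coord) (use False coord in auto)
  qed
next
  case (add p q)
  then obtain N P M Q where P: "P \<in> polys n" "Q \<in> polys n"
    "\<forall>v. h v \<noteq> 0 \<longrightarrow> p (v(n := inverse (h v))) * h v ^ N = P v"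
    "\<forall>v. h v \<noteq> 0 \<longrightarrow> q (v(n := inverse (h v))) * h v ^ M = Q v" by (auto simp del: fun_upd_apply)
  show ?case
  proof (intro exI[of _ "N + M"] bexI[of _ "\<lambda>v. P v * h v ^ M + Q v * h v ^ N"] allI impI)
    fix v assume "h v \<noteq> 0"
    then show "(p (v(n := inverse (h v))) + q (v(n := inverse (h v)))) * h v ^ (N + M)
        = P v * h v ^ M + Q v * h v ^ N"
      using P(3,4)[rule_format, of v, symmetric] by (simp add: power_add algebra_simps)
  qed (intro polys.add polys.mult polys_power P h)
next
  case (mult p q)
  then obtain N P M Q where P: "P \<in> polys n" "Q \<in> polys n"
    "\<forall>v. h v \<noteq> 0 \<longrightarrow> p (v(n := inverse (h v))) * h v ^ N = P v"
    "\<forall>v. h v \<noteq> 0 \<longrightarrow> q (v(n := inverse (h v))) * h v ^ M = Q v" by (auto simp del: fun_upd_apply)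
  show ?case
  proof (intro exI[of _ "N + M"] bexI[of _ "\<lambda>v. P v * Q v"] allI impI)
    fix v assume "h v \<noteq> 0"
    then show "(p (v(n := inverse (h v))) * q (v(n := inverse (h v)))) * h v ^ (N + M) = P v * Q v"
      using P(3,4)[rule_format, of v, symmetric] by (simp add: power_add algebra_simps)
  qed (intro polys.mult P)
qed

text \<open>
  The polynomials \<open>p\<close> in the coordinates and \<open>1/h\<close> for which \<open>p f\<close> is again such a polynomial
  form an ideal without zeros on the basic open set of \<open>h\<close>.
\<close>

theorem reg_basic_open:
  assumes S: "regular_space S" and c: "affine_chart S U n \<zeta>" and h: "h \<in> polys n"
    and f: "f \<in> reg S {x \<in> U. h (\<zeta> x) \<noteq> 0}"
  shows "\<exists>N. \<exists>p\<in>polys n. \<forall>x\<in>U. h (\<zeta> x) \<noteq> 0 \<longrightarrow> f x * h (\<zeta> x) ^ N = p (\<zeta> x)"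
proof -
  \<comment> \<open>Rabinowitsch's trick: x \<mapsto> (\<zeta> x, 1/h) embeds the basic open set of
    \<open>h\<close> as a closed set in one dimension more, where the Nullstellensatz
    applies.\<close>
  define w where "w x = (\<zeta> x)(n := inverse (h (\<zeta> x)))" for x
  let ?D = "{x \<in> U. h (\<zeta> x) \<noteq> 0}"
  note oD = affine_chart_open_basic[OF c h]
  define I where "I = {p \<in> polys (Suc n). \<exists>p'\<in>polys (Suc n). \<forall>x\<in>?D. p (w x) * f x = p' (w x)}"
  have pw: "p (w x) = p (\<zeta> x)" if "p \<in> polys n" for p x
    using that by (rule polys_cong) (simp add: w_def)
  have id: "poly_ideal (Suc n) I"
  proof (rule poly_idealI)
    fix p assume "p \<in> I" then show "p \<in> polys (Suc n)" by (simp add: I_def)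
  next
    show "(\<lambda>_. 0) \<in> I"
      unfolding I_def by (intro CollectI conjI bexI[of _ "\<lambda>_. 0"] polys.const) simp
  next
    fix p q assume "p \<in> I" "q \<in> I"
    then obtain p' q' where *: "p \<in> polys (Suc n)" "p' \<in> polys (Suc n)" "q \<in> polys (Suc n)" "q' \<in> polys (Suc n)"
      "\<forall>x\<in>?D. p (w x) * f x = p' (w x)" "\<forall>x\<in>?D. q (w x) * f x = q' (w x)" unfolding I_def by auto
    then show "(\<lambda>v. p v + q v) \<in> I"
      unfolding I_def
      by (intro CollectI conjI bexI[of _ "\<lambda>v. p' v + q' v"] polys.add) (simp_all add: distrib_right)
  next
    fix r p assume "r \<in> polys (Suc n)" "p \<in> I"
    then obtain p' where *: "r \<in> polys (Suc n)" "p \<in> polys (Suc n)" "p' \<in> polys (Suc n)"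
      "\<forall>x\<in>?D. p (w x) * f x = p' (w x)" unfolding I_def by auto
    then show "(\<lambda>v. r v * p v) \<in> I"
      unfolding I_def
      by (intro CollectI conjI bexI[of _ "\<lambda>v. r v * p' v"] polys.mult) (simp_all add: mult.assoc)
  qed
  have rel: "p \<in> I" if "p \<in> polys (Suc n)" "\<And>x. x \<in> ?D \<Longrightarrow> p (w x) = 0" for p
    unfolding I_def using that by (intro CollectI conjI bexI[of _ "\<lambda>_. 0"] polys.const) auto
  have "(\<lambda>_. 1) \<in> I"
  proof (rule ccontr)
    assume "(\<lambda>_. 1) \<notin> I"
    from weak_nullstellensatz[OF id this] obtain c'
      where z: "\<And>p. p \<in> I \<Longrightarrow> p c' = 0" by auto
    define c0 where "c0 k = (if k < n then c' k else 0)" for k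
    have pc: "p c' = p c0" if "p \<in> polys n" for p
      using that by (rule polys_cong) (simp add: c0_def)
    have "c0 \<in> \<zeta> ` U"
    proof (rule affine_chart_closed[OF c])
      fix p assume p: "p \<in> polys n" and "\<And>x. x \<in> U \<Longrightarrow> p (\<zeta> x) = 0"
      then have "p \<in> I" by (intro rel polys_mono[OF p]) (auto simp: pw)
      from z[OF this] show "p c0 = 0" using pc[OF p] by simp
    qed (simp add: c0_def)
    then obtain x0 where x0: "x0 \<in> U" "c0 = \<zeta> x0" by auto
    \<comment> \<open>This relation holds on the graph of 1/h and forces \<open>h\<close> to be
      nonzero at the common zero.\<close>
    have "(\<lambda>v. v n * h v - 1) \<in> I"
      by (intro rel polys_diff polys.mult polys.coord polys_mono[OF h] polys.const)
        (simp_all add: pw[OF h], simp add: w_def)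
    then have "c' n * h c' - 1 = 0" by (rule z)
    then have hx0: "h (\<zeta> x0) \<noteq> 0" using pc[OF h] x0 by auto
    then have x0D: "x0 \<in> ?D" using x0 by simp
    obtain p q where pq: "p \<in> polys n" "q \<in> polys n" "q (\<zeta> x0) \<noteq> 0"
      "\<forall>x\<in>U. q (\<zeta> x) \<noteq> 0 \<longrightarrow> x \<in> ?D \<and> f x = p (\<zeta> x) / q (\<zeta> x)"
      by (rule affine_chart_fraction[OF c oD f x0D x0(1)])
    \<comment> \<open>The square is essential: where \<open>q\<close> vanishes nothing is known
      about \<open>p\<close>, so q f = p may fail there, whereas both sides of q q f = q p are
      0.\<close>
    have "(\<lambda>v. q v * q v) \<in> I"
      unfolding I_def
    proof (intro CollectI conjI bexI[of _ "\<lambda>v. q v * p v"] ballI)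
      fix x assume x: "x \<in> ?D"
      show "q (w x) * q (w x) * f x = q (w x) * p (w x)"
        using pq(4) x by (cases "q (\<zeta> x) = 0") (auto simp: pw[OF pq(1)] pw[OF pq(2)])
    qed (intro polys.mult polys_mono[OF pq(1)] polys_mono[OF pq(2)], simp_all)+
    then have "q c' * q c' = 0" by (rule z)
    then show False using pc[OF pq(2)] pq(3) x0 by simp
  qed
  then obtain p' where p': "p' \<in> polys (Suc n)" "\<forall>x\<in>?D. f x = p' (w x)" unfolding I_def by auto
  from polys_clear_denominators[OF p'(1) h] obtain N P where
    P: "P \<in> polys n" "\<forall>v. h v \<noteq> 0 \<longrightarrow> p' (v(n := inverse (h v))) * h v ^ N = P v" by auto
  show ?thesis
    by (intro exI[of _ N] bexI[of _ P] P) (use p'(2) P(2) in \<open>auto simp: w_def\<close>)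
qed

text \<open>The polynomials whose nonvanishing locus in \<open>U\<close> has a finite subcover form
  an ideal. If it were proper, its common zero would be a point of \<open>U\<close>; that point lies
  in some member \<open>V\<close> of the cover, hence in a basic open set
  \<open>q \<noteq> 0\<close> inside \<open>V\<close>, so \<open>q\<close> would belong to the ideal
  without vanishing at the point.\<close>

theorem affine_chart_compact:
  assumes S: "regular_space S" and c: "affine_chart S U n \<zeta>"
    and C: "\<And>C. C \<in> \<C> \<Longrightarrow> openin (zariski S) C" and U: "U \<subseteq> \<Union>\<C>"
  shows "\<exists>\<D>. finite \<D> \<and> \<D> \<subseteq> \<C> \<and> U \<subseteq> \<Union>\<D>"
proof -
  define I where "I = {p \<in> polys n. \<exists>\<D>. finite \<D> \<and> \<D> \<subseteq> \<C> \<and> (\<forall>x\<in>U. p (\<zeta> x) \<noteq> 0 \<longrightarrow> x \<in> \<Union>\<D>)}"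
  have id: "poly_ideal n I"
  proof (rule poly_idealI)
    fix p assume "p \<in> I" then show "p \<in> polys n" by (simp add: I_def)
  next
    show "(\<lambda>_. 0) \<in> I"
      unfolding I_def by (intro CollectI conjI exI[of _ "{}"] polys.const) auto
  next
    fix p q assume "p \<in> I" "q \<in> I"
    then obtain A B where *: "p \<in> polys n" "q \<in> polys n" "finite A" "finite B" "A \<subseteq> \<C>" "B \<subseteq> \<C>"
      "\<forall>x\<in>U. p (\<zeta> x) \<noteq> 0 \<longrightarrow> x \<in> \<Union>A" "\<forall>x\<in>U. q (\<zeta> x) \<noteq> 0 \<longrightarrow> x \<in> \<Union>B" unfolding I_def by auto
    then have "x \<in> \<Union>(A \<union> B)" if "x \<in> U" "p (\<zeta> x) + q (\<zeta> x) \<noteq> 0" for x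
      using that by (cases "p (\<zeta> x) = 0") auto
    with * show "(\<lambda>v. p v + q v) \<in> I"
      unfolding I_def by (intro CollectI conjI exI[of _ "A \<union> B"] polys.add) auto
  next
    fix r p assume "r \<in> polys n" "p \<in> I"
    then obtain A where *: "r \<in> polys n" "p \<in> polys n" "finite A" "A \<subseteq> \<C>"
      "\<forall>x\<in>U. p (\<zeta> x) \<noteq> 0 \<longrightarrow> x \<in> \<Union>A" unfolding I_def by auto
    then show "(\<lambda>v. r v * p v) \<in> I"
      unfolding I_def by (intro CollectI conjI exI[of _ A] polys.mult) auto
  qed
  have "(\<lambda>_. 1) \<in> I"
  proof (rule ccontr)
    assume "(\<lambda>_. 1) \<notin> I"
    from weak_nullstellensatz[OF id this] obtain c0
      where supp: "\<And>k. k \<ge> n \<Longrightarrow> c0 k = 0" and z: "\<And>p. p \<in> I \<Longrightarrow> p c0 = 0" by auto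
    have "c0 \<in> \<zeta> ` U"
    proof (rule affine_chart_closed[OF c supp])
      fix p assume p: "p \<in> polys n" and "\<And>x. x \<in> U \<Longrightarrow> p (\<zeta> x) = 0"
      then have "p \<in> I" unfolding I_def by (intro CollectI conjI exI[of _ "{}"]) auto
      then show "p c0 = 0" by (rule z)
    qed
    then obtain x0 where x0: "x0 \<in> U" "c0 = \<zeta> x0" by auto
    then obtain V where V: "x0 \<in> V" "V \<in> \<C>" using U by blast
    obtain p q where pq: "p \<in> polys n" "q \<in> polys n" "q (\<zeta> x0) \<noteq> 0"
      "\<forall>x\<in>U. q (\<zeta> x) \<noteq> 0 \<longrightarrow> x \<in> V \<and> 0 = p (\<zeta> x) / q (\<zeta> x)"
      by (rule affine_chart_fraction[OF c C[OF V(2)] reg_const[OF S C[OF V(2)], of 0] V(1) x0(1)])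
    have "q \<in> I"
      unfolding I_def using pq V by (intro CollectI conjI exI[of _ "{V}"]) auto
    then show False using z pq(3) x0(2) by simp
  qed
  then show ?thesis unfolding I_def by auto
qed

subsection \<open>Existence of affine charts\<close>

text \<open>The coordinates are the components of the isomorphism onto a closed set. Polynomials are
  pulled back along it; a regular function on \<open>S\<close> is carried over by the inverse,
  extends locally to affine space, and is a fraction there. Closedness of the image is restated as
  being cut out by its polynomial relations.\<close>

lemma affine_variety_chart:
  assumes S: "function_sheaf S" and U: "openin (zariski S) U" and a: "affine_variety (induced_space S U)"
  shows "\<exists>n \<zeta>. affine_chart S U n \<zeta>"
proof -
  obtain n Z \<phi> \<psi> where Z: "closedin (zariski (Aspace n)) Z"
    and \<phi>: "morphism (induced_space S U) (induced_space (Aspace n) Z) \<phi>"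
    and \<psi>: "morphism (induced_space (Aspace n) Z) (induced_space S U) \<psi>"
    and inv: "\<forall>x\<in>points (induced_space S U). \<psi> (\<phi> x) = x" "\<forall>y\<in>points (induced_space (Aspace n) Z). \<phi> (\<psi> y) = y"
    using a unfolding affine_variety_def isomorphic_spaces_def by auto
  let ?T = "induced_space S U" and ?I = "induced_space (Aspace n) Z"
  have pT: "points ?T = U" using openin_subset[OF U] by (auto simp: points_induced)
  have pI: "points ?I = Z" using closedin_subset[OF Z] by (auto simp: points_induced)
  have supp: "v k = 0" if "v \<in> Z" "k \<ge> n" for v k
    using closedin_subset[OF Z] that by (auto simp: points_Aspace)
  have phi: "\<phi> x \<in> Z" if "x \<in> U" for x using morphism_points[OF \<phi>] that by (simp add: pT pI)
  have psi: "\<psi> y \<in> U" if "y \<in> Z" for y using morphism_points[OF \<psi>] that by (simp add: pT pI)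
  have basic: "openin (zariski ?I) {v \<in> Z. q v \<noteq> 0}" if "q \<in> polys n" for q
    unfolding openin_induced
    by (intro exI[of _ "{v. (\<forall>k\<ge>n. v k = 0) \<and> q v \<noteq> 0}"] conjI openin_Aspace_basic[OF that])
      (auto simp: supp)
  have pre: "{x \<in> U. q (\<phi> x) \<noteq> 0} = points ?T \<inter> \<phi> -` {v \<in> Z. q v \<noteq> 0}" for q
    using phi by (auto simp: pT)
  have o: "openin (zariski S) {x \<in> U. q (\<phi> x) \<noteq> 0}" if q: "q \<in> polys n" for q
  proof -
    have "openin (zariski ?T) {x \<in> U. q (\<phi> x) \<noteq> 0}"
      unfolding pre by (rule morphism_openin[OF \<phi> basic[OF q]])
    then show ?thesis unfolding openin_induced using U by auto
  qed
  show ?thesis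
  proof (intro exI affine_chartI)
    show "openin (zariski S) U" by fact
    show "inj_on \<phi> U" using inv(1) by (metis inj_onI pT)
    show "\<phi> x k = 0" if "x \<in> U" "n \<le> k" for x k using supp phi that by blast
    show "openin (zariski S) {x \<in> U. q (\<phi> x) \<noteq> 0}" if "q \<in> polys n" for q by (rule o[OF that])
  next
    fix p q assume pq: "p \<in> polys n" "q \<in> polys n"
    have "(\<lambda>v. p v / q v) \<in> reg (Aspace n) {v. (\<forall>k\<ge>n. v k = 0) \<and> q v \<noteq> 0}"
      unfolding reg_Aspace using pq by (intro ballI bexI[of _ p] bexI[of _ q]) auto
    then have "(\<lambda>v. p v / q v) \<in> reg ?I {v \<in> Z. q v \<noteq> 0}"
      by (rule reg_inducedI[OF openin_Aspace_basic[OF pq(2)], rotated]) (auto simp: supp)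
    from morphism_reg[OF \<phi> basic[OF pq(2)] this]
    have "(\<lambda>x. p (\<phi> x) / q (\<phi> x)) \<in> reg ?T {x \<in> U. q (\<phi> x) \<noteq> 0}"
      unfolding pre by (simp add: comp_def)
    then show "(\<lambda>x. p (\<phi> x) / q (\<phi> x)) \<in> reg S {x \<in> U. q (\<phi> x) \<noteq> 0}"
      by (rule reg_induced_open[OF S o[OF pq(2)]])
  next
    fix c assume c: "\<And>k. k \<ge> n \<Longrightarrow> c k = 0" "\<And>p. p \<in> polys n \<Longrightarrow> (\<And>x. x \<in> U \<Longrightarrow> p (\<phi> x) = 0) \<Longrightarrow> p c = 0"
    have "c \<in> Z"
    proof (rule ccontr)
      assume "c \<notin> Z"
      then have "c \<in> points (Aspace n) - Z" using c(1) by (simp add: points_Aspace)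
      moreover have "openin (zariski (Aspace n)) (points (Aspace n) - Z)" using Z by blast
      ultimately obtain p where p: "p \<in> polys n" "p c \<noteq> 0"
        "\<forall>w. (\<forall>k\<ge>n. w k = 0) \<and> p w \<noteq> 0 \<longrightarrow> w \<in> points (Aspace n) - Z"
        using Aspace_basis by blast
      then have "p (\<phi> x) = 0" if "x \<in> U" for x using phi[OF that] supp by blast
      then show False using c(2)[OF p(1)] p(2) by simp
    qed
    then show "c \<in> \<phi> ` U" using inv(2) psi by (metis image_eqI pI)
  next
    fix W f w assume W: "openin (zariski S) W" "f \<in> reg S W" "w \<in> W" "w \<in> U"
    have oW: "openin (zariski ?T) (W \<inter> U)" unfolding openin_induced using W(1) by blast
    have "f \<in> reg ?T (W \<inter> U)" by (rule reg_inducedI[OF W(1) _ W(2)]) simp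
    from morphism_reg[OF \<psi> oW this]
    have f\<psi>: "f \<circ> \<psi> \<in> reg ?I (Z \<inter> \<psi> -` (W \<inter> U))" by (simp add: pI)
    have mem: "\<phi> x \<in> Z \<inter> \<psi> -` (W \<inter> U) \<longleftrightarrow> x \<in> W" if "x \<in> U" for x
      using that phi inv(1) by (simp add: pT)
    from reg_inducedD[OF f\<psi>, of "\<phi> w"] mem[OF W(4)] W(3)
    obtain O1 g where O1: "openin (zariski (Aspace n)) O1" "\<phi> w \<in> O1" "g \<in> reg (Aspace n) O1"
      "\<forall>y\<in>O1 \<inter> (Z \<inter> \<psi> -` (W \<inter> U)). (f \<circ> \<psi>) y = g y" by auto
    obtain p q where pq: "p \<in> polys n" "q \<in> polys n" "q (\<phi> w) \<noteq> 0" "\<forall>y\<in>O1. q y \<noteq> 0 \<longrightarrow> g y = p y / q y"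
      by (rule reg_AspaceE[OF O1(3,2)])
    have "openin (zariski ?I) (Z \<inter> \<psi> -` (W \<inter> U))" using morphism_openin[OF \<psi> oW] by (simp add: pI)
    then obtain O2 where O2: "openin (zariski (Aspace n)) O2" "Z \<inter> \<psi> -` (W \<inter> U) = O2 \<inter> Z"
      unfolding openin_induced by auto
    have "\<phi> w \<in> O1 \<inter> O2" using O2(2) mem[OF W(4)] W(3) O1(2) by auto
    from Aspace_basis[OF openin_Int[OF O1(1) O2(1)] this] obtain r where
      r: "r \<in> polys n" "r (\<phi> w) \<noteq> 0" "\<forall>w. (\<forall>k\<ge>n. w k = 0) \<and> r w \<noteq> 0 \<longrightarrow> w \<in> O1 \<inter> O2" by auto
    show "\<exists>p\<in>polys n. \<exists>q\<in>polys n. q (\<phi> w) \<noteq> 0 \<and> (\<forall>x\<in>U. q (\<phi> x) \<noteq> 0 \<longrightarrow> x \<in> W \<and> f x = p (\<phi> x) / q (\<phi> x))"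
    proof (rule bexI[of _ "\<lambda>v. p v * r v"], rule bexI[of _ "\<lambda>v. q v * r v"], intro conjI ballI impI)
      show "q (\<phi> w) * r (\<phi> w) \<noteq> 0" using pq r by simp
      fix x assume x: "x \<in> U" "q (\<phi> x) * r (\<phi> x) \<noteq> 0"
      then have xO: "\<phi> x \<in> O1 \<inter> O2" using r(3) supp phi by auto
      then show xW: "x \<in> W" using mem[OF x(1)] phi[OF x(1)] O2(2) by blast
      have "f x = (f \<circ> \<psi>) (\<phi> x)" using inv(1) x(1) by (simp add: pT)
      also have "\<dots> = g (\<phi> x)" using O1(4) xO mem[OF x(1)] xW by blast
      also have "\<dots> = p (\<phi> x) / q (\<phi> x)" using pq(4) xO x by auto
      finally show "f x = p (\<phi> x) * r (\<phi> x) / (q (\<phi> x) * r (\<phi> x))" using x by auto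
    qed (intro polys.mult pq(1,2) r(1))+
  qed
qed

lemma variety_regular_space:
  assumes "variety S" shows "regular_space S"
proof (rule charted_regular_space)
  show S: "function_sheaf S" using assms by (simp add: variety_def)
  fix x assume "x \<in> points S"
  then obtain U where "openin (zariski S) U" "affine_variety (induced_space S U)" "x \<in> U"
    using assms unfolding variety_def by blast
  then show "\<exists>U n \<zeta>. affine_chart S U n \<zeta> \<and> x \<in> U" using affine_variety_chart[OF S] by blast
qed

lemma variety_finite_charts:
  assumes "variety S"
  shows "\<exists>\<U>. finite \<U> \<and> \<Union>\<U> = points S \<and> (\<forall>U\<in>\<U>. \<exists>n \<zeta>. affine_chart S U n \<zeta>)"
proof -
  have S: "function_sheaf S" using assms by (simp add: variety_def)
  show ?thesis using assms affine_variety_chart[OF S] unfolding variety_def by metis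
qed

lemma affine_chart_Aspace: "affine_chart (Aspace n) (points (Aspace n)) n id"
proof (rule affine_chartI)
  show "openin (zariski (Aspace n)) (points (Aspace n))" by simp
  show "openin (zariski (Aspace n)) {x \<in> points (Aspace n). q (id x) \<noteq> 0}" if "q \<in> polys n" for q
    using openin_Aspace_basic[OF that] by (simp add: points_Aspace)
  show "(\<lambda>x. p (id x) / q (id x)) \<in> reg (Aspace n) {x \<in> points (Aspace n). q (id x) \<noteq> 0}"
    if "p \<in> polys n" "q \<in> polys n" for p q
    unfolding reg_Aspace using that by (intro ballI bexI[of _ p] bexI[of _ q]) auto
  fix W f w assume W: "openin (zariski (Aspace n)) W" "f \<in> reg (Aspace n) W" "w \<in> W"
  obtain p q where pq: "p \<in> polys n" "q \<in> polys n" "q w \<noteq> 0" "\<forall>y\<in>W. q y \<noteq> 0 \<longrightarrow> f y = p y / q y"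
    by (rule reg_AspaceE[OF W(2,3)])
  from Aspace_basis[OF W(1,3)] obtain r where
    r: "r \<in> polys n" "r w \<noteq> 0" "\<forall>w. (\<forall>k\<ge>n. w k = 0) \<and> r w \<noteq> 0 \<longrightarrow> w \<in> W" by auto
  show "\<exists>p\<in>polys n. \<exists>q\<in>polys n. q (id w) \<noteq> 0 \<and>
      (\<forall>x\<in>points (Aspace n). q (id x) \<noteq> 0 \<longrightarrow> x \<in> W \<and> f x = p (id x) / q (id x))"
    using pq r by (intro bexI[of _ "\<lambda>v. p v * r v"] bexI[of _ "\<lambda>v. q v * r v"] polys.mult)
      (auto simp: points_Aspace)
qed (auto simp: points_Aspace)

lemma regular_space_Aspace: "regular_space (Aspace n)"
  by (rule charted_regular_space[OF function_sheaf_Aspace]) (use affine_chart_Aspace in blast)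

text \<open>
  Two points of a projective variety lie outside a common hyperplane \<open>l = 0\<close>; the coordinates
  are those of the representative with \<open>l = 1\<close>.
\<close>

lemma projective_chart_two_points:
  assumes S: "function_sheaf S" and a: "projective_variety S" and xy: "x1 \<in> points S" "x2 \<in> points S"
  shows "\<exists>U n \<zeta>. affine_chart S U n \<zeta> \<and> x1 \<in> U \<and> x2 \<in> U"
proof -
  obtain n Z \<phi> \<psi> where Z: "closedin (zariski (Pspace n)) Z"
    and \<phi>: "morphism S (induced_space (Pspace n) Z) \<phi>"
    and \<psi>: "morphism (induced_space (Pspace n) Z) S \<psi>"
    and inv: "\<forall>x\<in>points S. \<psi> (\<phi> x) = x" "\<forall>y\<in>points (induced_space (Pspace n) Z). \<phi> (\<psi> y) = y"
    using a unfolding projective_variety_def isomorphic_spaces_def by auto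
  let ?I = "induced_space (Pspace n) Z"
  let ?A = "Aspace (Suc n)"
  let ?V = "points ?A - {\<lambda>_. 0}"
  let ?A' = "induced_space ?A ?V"
  define \<pi> :: "(nat \<Rightarrow> complex) \<Rightarrow> (nat \<Rightarrow> complex) set" where "\<pi> v = {\<lambda>k. c * v k | c. True}" for v
  have \<pi>I: "(\<lambda>k. c * v k) \<in> \<pi> v" for c v
    unfolding \<pi>_def by (intro CollectI exI[of _ c] conjI refl TrueI)
  have P: "Pspace n = quotient_space ?A' \<pi>" by (simp add: Pspace_def \<pi>_def[abs_def])
  have rA: "regular_space ?A" by (rule regular_space_Aspace)
  have pA': "points ?A' = ?V" by (auto simp: points_induced)
  have pP: "points (Pspace n) = \<pi> ` ?V" by (simp add: P points_quotient pA')
  have pI: "points ?I = Z" using closedin_subset[OF Z] by (auto simp: points_induced)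
  have phi: "\<phi> x \<in> Z" if "x \<in> points S" for x using morphism_points[OF \<phi>] that by (simp add: pI)
  have psi: "\<psi> y \<in> points S" if "y \<in> Z" for y using morphism_points[OF \<psi>] that by (simp add: pI)
  have openA': "openin (zariski ?A') (T \<inter> ?V)" if "openin (zariski ?A) T" for T
    unfolding openin_induced using that by blast
  obtain v1 where v1: "v1 \<in> ?V" "\<phi> x1 = \<pi> v1" using phi[OF xy(1)] closedin_subset[OF Z] pP by blast
  obtain v2 where v2: "v2 \<in> ?V" "\<phi> x2 = \<pi> v2" using phi[OF xy(2)] closedin_subset[OF Z] pP by blast
  obtain i where i: "i < Suc n" "v1 i \<noteq> 0"
  proof -
    obtain i where "v1 i \<noteq> 0" using v1(1) by auto
    moreover have "i < Suc n" using calculation v1(1) by (auto simp: points_Aspace intro: ccontr)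
    ultimately show ?thesis using that by blast
  qed
  obtain j where j: "j < Suc n" "v2 j \<noteq> 0"
  proof -
    obtain j where "v2 j \<noteq> 0" using v2(1) by auto
    moreover have "j < Suc n" using calculation v2(1) by (auto simp: points_Aspace intro: ccontr)
    ultimately show ?thesis using that by blast
  qed
  \<comment> \<open>One of the linear forms v j, v i and v i + v j is nonzero on both
    representatives, since v1 i and v2 j are nonzero.\<close>
  obtain a b :: complex where ab: "a * v1 i + b * v1 j \<noteq> 0" "a * v2 i + b * v2 j \<noteq> 0"
  proof (cases "v1 j = 0")
    case False
    then show ?thesis using j that[of 0 1] by simp
  next
    case True
    show ?thesis
    proof (cases "v2 i = 0")
      case False then show ?thesis using i that[of 1 0] by simp
    next
      case v20: True
      then show ?thesis using True i j that[of 1 1] by simp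
    qed
  qed
  define l where "l v = a * v i + b * v j" for v :: "nat \<Rightarrow> complex"
  have l: "l \<in> polys (Suc n)"
    unfolding l_def[abs_def] by (intro polys.add polys.mult polys.const polys.coord i j)
  have lc: "l (\<lambda>k. c * v k) = c * l v" for c v by (simp add: l_def algebra_simps)
  have ldiv: "l (\<lambda>k. v k / l v) = 1" if "l v \<noteq> 0" for v
    using lc[of "inverse (l v)" v] that by (simp add: field_simps)
  define \<sigma> where "\<sigma> Q = (SOME v. v \<in> Q \<and> l v = 1)" for Q :: "(nat \<Rightarrow> complex) set"
  have \<sigma>\<pi>: "\<sigma> (\<pi> v) = (\<lambda>k. v k / l v)" if "l v \<noteq> 0" for v
    unfolding \<sigma>_def
  proof (rule some_equality)
    have "(\<lambda>k. v k / l v) = (\<lambda>k. inverse (l v) * v k)" by (simp add: field_simps)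
    then have "(\<lambda>k. v k / l v) \<in> \<pi> v" using \<pi>I[of "inverse (l v)" v] by simp
    then show "(\<lambda>k. v k / l v) \<in> \<pi> v \<and> l (\<lambda>k. v k / l v) = 1"
      using ldiv[OF that] by blast
    fix w assume "w \<in> \<pi> v \<and> l w = 1"
    then obtain c where c: "w = (\<lambda>k. c * v k)" "l w = 1" by (auto simp: \<pi>_def)
    then have "c * l v = 1" by (simp add: lc)
    then show "w = (\<lambda>k. v k / l v)" using that by (auto simp: c(1) field_simps)
  qed
  have \<pi>scale: "\<pi> (\<lambda>k. c * v k) = \<pi> v" if "c \<noteq> 0" for c v
  proof (intro set_eqI iffI)
    fix w assume "w \<in> \<pi> (\<lambda>k. c * v k)"
    then obtain d where d: "w = (\<lambda>k. d * (c * v k))" by (auto simp: \<pi>_def)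
    show "w \<in> \<pi> v" using \<pi>I[of "d * c" v] unfolding d by (simp only: mult.assoc)
  next
    fix w assume "w \<in> \<pi> v"
    then obtain d where d: "w = (\<lambda>k. d * v k)" by (auto simp: \<pi>_def)
    show "w \<in> \<pi> (\<lambda>k. c * v k)" using \<pi>I[of "d / c" "\<lambda>k. c * v k"] that unfolding d by simp
  qed
  have \<pi>\<sigma>: "\<pi> (\<lambda>k. v k / l v) = \<pi> v" if "l v \<noteq> 0" for v
    using \<pi>scale[of "inverse (l v)" v] that by (simp add: field_simps)
  have linv: "l v \<noteq> 0" if "\<pi> v = \<pi> w" "l w \<noteq> 0" for v w
  proof -
    have "w \<in> \<pi> w" using \<pi>I[of 1 w] by simp
    then have "w \<in> \<pi> v" using that(1) by simp
    then obtain c where "w = (\<lambda>k. c * v k)" unfolding \<pi>_def by auto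
    then show ?thesis using that(2) by (auto simp: lc)
  qed
  define D where "D = \<pi> ` {v \<in> ?V. l v \<noteq> 0}"
  have inD: "\<pi> v \<in> D \<longleftrightarrow> l v \<noteq> 0" if "v \<in> ?V" for v
  proof
    assume "\<pi> v \<in> D"
    then obtain w where "\<pi> v = \<pi> w" "l w \<noteq> 0" unfolding D_def by auto
    then show "l v \<noteq> 0" by (rule linv)
  qed (use that in \<open>auto simp: D_def\<close>)
  have l0: "l (\<lambda>_. 0) = 0" by (simp add: l_def)
  note oL0 = openin_Aspace_basic[OF l]
  let ?L = "{v. (\<forall>k\<ge>Suc n. v k = 0) \<and> l v \<noteq> 0}"
  \<comment> \<open>Because \<open>l\<close> vanishes at the origin, its basic open set in affine
    space already avoids the origin. Regularity can therefore be checked in \<open>?A\<close>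
    itself.\<close>
  have LV: "v \<in> ?L \<longleftrightarrow> v \<in> ?V \<and> l v \<noteq> 0" for v using l0 by (auto simp: points_Aspace)
  have regc: "(\<lambda>v. p (\<lambda>k. v k / l v)) \<in> reg ?A ?L" if "p \<in> polys (Suc n)" for p
  proof (rule reg_polys[OF rA oL0 that])
    fix k assume "k < Suc n"
    then show "(\<lambda>x. x k / l x) \<in> reg ?A ?L"
      unfolding reg_Aspace using l by (intro ballI bexI[of _ "\<lambda>v. v k"] bexI[of _ l] polys.coord) auto
  qed
  define B where "B q = {Q \<in> D. q (\<sigma> Q) \<noteq> 0}" for q :: "(nat \<Rightarrow> complex) \<Rightarrow> complex"
  have Bpre: "points ?A' \<inter> \<pi> -` B q = {v \<in> ?L. q (\<lambda>k. v k / l v) \<noteq> 0}" for q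
  proof (rule set_eqI)
    fix v
    have "v \<in> points ?A' \<inter> \<pi> -` B q \<longleftrightarrow> v \<in> ?V \<and> l v \<noteq> 0 \<and> q (\<sigma> (\<pi> v)) \<noteq> 0"
      unfolding B_def pA' using inD[of v] by blast
    also have "\<dots> \<longleftrightarrow> (v \<in> ?V \<and> l v \<noteq> 0) \<and> q (\<lambda>k. v k / l v) \<noteq> 0"
      by (auto simp only: \<sigma>\<pi>)
    also have "\<dots> \<longleftrightarrow> v \<in> ?L \<and> q (\<lambda>k. v k / l v) \<noteq> 0"
      by (simp only: LV)
    finally show "v \<in> points ?A' \<inter> \<pi> -` B q \<longleftrightarrow> v \<in> {v \<in> ?L. q (\<lambda>k. v k / l v) \<noteq> 0}" by blast
  qed
  have oB': "openin (zariski ?A) {v \<in> ?L. q (\<lambda>k. v k / l v) \<noteq> 0}" if "q \<in> polys (Suc n)" for q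
    by (rule reg_open[OF rA oL0 regc[OF that]])
  have oB: "openin (zariski (Pspace n)) (B q)" if "q \<in> polys (Suc n)" for q
  proof -
    have "B q \<subseteq> \<pi> ` points ?A'" unfolding B_def D_def pA' by blast
    moreover have "{v \<in> ?L. q (\<lambda>k. v k / l v) \<noteq> 0} = {v \<in> ?L. q (\<lambda>k. v k / l v) \<noteq> 0} \<inter> ?V"
      using LV by blast
    then have "openin (zariski ?A') {v \<in> ?L. q (\<lambda>k. v k / l v) \<noteq> 0}"
      using openA'[OF oB'[OF that]] by simp
    ultimately show ?thesis unfolding P openin_quotient_space Bpre by blast
  qed
  have regB: "(\<lambda>Q. p (\<sigma> Q) / q (\<sigma> Q)) \<in> reg (Pspace n) (B q)" if pq: "p \<in> polys (Suc n)" "q \<in> polys (Suc n)" for p q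
  proof -
    let ?W = "{v \<in> ?L. q (\<lambda>k. v k / l v) \<noteq> 0}"
    have sub: "?W \<subseteq> ?L" by blast
    have "(\<lambda>v. p (\<lambda>k. v k / l v) / q (\<lambda>k. v k / l v)) \<in> reg ?A ?W"
      by (rule reg_divide[OF rA oB'[OF pq(2)] reg_mono[OF rA oL0 oB'[OF pq(2)] sub regc[OF pq(1)]]
            reg_mono[OF rA oL0 oB'[OF pq(2)] sub regc[OF pq(2)]]]) auto
    then have "((\<lambda>Q. p (\<sigma> Q) / q (\<sigma> Q)) \<circ> \<pi>) \<in> reg ?A ?W"
      by (rule reg_cong[OF rA oB'[OF pq(2)]]) (simp add: \<sigma>\<pi>)
    then have "((\<lambda>Q. p (\<sigma> Q) / q (\<sigma> Q)) \<circ> \<pi>) \<in> reg ?A' ?W"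
      by (rule reg_inducedI[OF oB'[OF pq(2)] order_refl])
    then show ?thesis unfolding P reg_quotient Bpre by simp
  qed
  define U where "U = {x \<in> points S. \<phi> x \<in> D}"
  define \<zeta> where "\<zeta> x = \<sigma> (\<phi> x)" for x
  have repr: "\<exists>v\<in>?V. l v \<noteq> 0 \<and> \<phi> x = \<pi> v" if "x \<in> U" for x
    using that unfolding U_def D_def by blast
  have \<zeta>1: "l (\<zeta> x) = 1" and \<zeta>2: "\<pi> (\<zeta> x) = \<phi> x" and \<zeta>3: "\<zeta> x \<in> ?V" if x: "x \<in> U" for x
  proof -
    obtain v where v: "v \<in> ?V" "l v \<noteq> 0" "\<phi> x = \<pi> v" using repr[OF x] by blast
    show "l (\<zeta> x) = 1" "\<pi> (\<zeta> x) = \<phi> x" using v by (simp_all add: \<zeta>_def \<sigma>\<pi> ldiv \<pi>\<sigma>)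
    then show "\<zeta> x \<in> ?V" using v l0 by (auto simp: \<zeta>_def \<sigma>\<pi> points_Aspace)
  qed
  have pre: "{x \<in> U. q (\<zeta> x) \<noteq> 0} = points S \<inter> \<phi> -` (B q \<inter> Z)" for q
    unfolding U_def B_def \<zeta>_def using phi by auto
  have oBZ: "openin (zariski ?I) (B q \<inter> Z)" if "q \<in> polys (Suc n)" for q
    unfolding openin_induced using oB[OF that] by blast
  have oU: "openin (zariski S) {x \<in> U. q (\<zeta> x) \<noteq> 0}" if "q \<in> polys (Suc n)" for q
    unfolding pre by (rule morphism_openin[OF \<phi> oBZ[OF that]])
  have "affine_chart S U (Suc n) \<zeta>"
  proof (rule affine_chartI)
    show "openin (zariski S) U" using oU[OF polys.const[of 1]] by simp
    show "inj_on \<zeta> U"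
    proof (rule inj_onI)
      fix x y assume "x \<in> U" "y \<in> U" "\<zeta> x = \<zeta> y"
      then have "\<phi> x = \<phi> y" using \<zeta>2 by metis
      then show "x = y" using inv(1) \<open>x \<in> U\<close> \<open>y \<in> U\<close> unfolding U_def by (metis (lifting) mem_Collect_eq)
    qed
    show "\<zeta> x k = 0" if "x \<in> U" "Suc n \<le> k" for x k using \<zeta>3[OF that(1)] that(2) by (simp add: points_Aspace)
    show "openin (zariski S) {x \<in> U. q (\<zeta> x) \<noteq> 0}" if "q \<in> polys (Suc n)" for q by (rule oU[OF that])
  next
    fix p q assume pq: "p \<in> polys (Suc n)" "q \<in> polys (Suc n)"
    have "(\<lambda>Q. p (\<sigma> Q) / q (\<sigma> Q)) \<in> reg ?I (B q \<inter> Z)"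
      by (rule reg_inducedI[OF oB[OF pq(2)] _ regB[OF pq]]) blast
    from morphism_reg[OF \<phi> oBZ[OF pq(2)] this]
    show "(\<lambda>x. p (\<zeta> x) / q (\<zeta> x)) \<in> reg S {x \<in> U. q (\<zeta> x) \<noteq> 0}"
      unfolding pre by (simp add: comp_def \<zeta>_def)
  next
    fix c assume c: "\<And>k. k \<ge> Suc n \<Longrightarrow> c k = 0"
      "\<And>p. p \<in> polys (Suc n) \<Longrightarrow> (\<And>x. x \<in> U \<Longrightarrow> p (\<zeta> x) = 0) \<Longrightarrow> p c = 0"
    \<comment> \<open>The relation l = 1 holds on the whole chart, so it puts \<open>c\<close> on
      the same affine hyperplane and makes it a normalized representative.\<close>
    have "l c - 1 = 0" by (rule c(2)[OF polys_diff[OF l polys.const]]) (simp add: \<zeta>1)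
    then have lc1: "l c = 1" by simp
    then have cV: "c \<in> ?V" using c(1) l0 by (auto simp: points_Aspace)
    have "\<pi> c \<in> Z"
    proof (rule ccontr)
      assume "\<pi> c \<notin> Z"
      have "openin (zariski (Pspace n)) (points (Pspace n) - Z)" using Z by blast
      then have "openin (zariski ?A') (points ?A' \<inter> \<pi> -` (points (Pspace n) - Z))"
        unfolding P openin_quotient_space by blast
      then obtain T where T: "openin (zariski ?A) T"
        "points ?A' \<inter> \<pi> -` (points (Pspace n) - Z) = T \<inter> ?V" unfolding openin_induced by blast
      have "c \<in> T" using T(2) cV \<open>\<pi> c \<notin> Z\<close> pA' pP by blast
      from Aspace_basis[OF T(1) this] obtain p where p: "p \<in> polys (Suc n)" "p c \<noteq> 0"
        "\<forall>w. (\<forall>k\<ge>Suc n. w k = 0) \<and> p w \<noteq> 0 \<longrightarrow> w \<in> T" by auto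
      have "p (\<zeta> x) = 0" if x: "x \<in> U" for x
      proof (rule ccontr)
        assume "p (\<zeta> x) \<noteq> 0"
        then have "\<zeta> x \<in> T \<inter> ?V" using p(3) \<zeta>3[OF x] by (auto simp: points_Aspace)
        then have "\<pi> (\<zeta> x) \<notin> Z" unfolding T(2)[symmetric] by blast
        then show False using \<zeta>2[OF x] phi x by (simp add: U_def)
      qed
      then show False using c(2)[OF p(1)] p(2) by simp
    qed
    moreover from this have "\<phi> (\<psi> (\<pi> c)) = \<pi> c" using inv(2) pI by simp
    ultimately have "\<psi> (\<pi> c) \<in> U" "\<zeta> (\<psi> (\<pi> c)) = c"
      unfolding U_def \<zeta>_def using psi inD[OF cV] lc1 by (auto simp: \<sigma>\<pi>)
    then show "c \<in> \<zeta> ` U" by force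
  next
    fix W f w assume W: "openin (zariski S) W" "f \<in> reg S W" "w \<in> W" "w \<in> U"
    have Wp: "x \<in> points S" if "x \<in> W" for x using that openin_subset[OF W(1)] by blast
    have f\<psi>: "f \<circ> \<psi> \<in> reg ?I (Z \<inter> \<psi> -` W)" using morphism_reg[OF \<psi> W(1,2)] by (simp add: pI)
    have mem: "\<phi> x \<in> Z \<inter> \<psi> -` W \<longleftrightarrow> x \<in> W" if "x \<in> U" for x
      using that phi inv(1) by (simp add: U_def)
    from reg_inducedD[OF f\<psi>, of "\<phi> w"] mem[OF W(4)] W(3)
    obtain O1 g where O1: "openin (zariski (Pspace n)) O1" "\<phi> w \<in> O1" "g \<in> reg (Pspace n) O1"
      "\<forall>y\<in>O1 \<inter> (Z \<inter> \<psi> -` W). (f \<circ> \<psi>) y = g y" by auto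
    have "openin (zariski ?I) (Z \<inter> \<psi> -` W)" using morphism_openin[OF \<psi> W(1)] by (simp add: pI)
    then obtain O2 where O2: "openin (zariski (Pspace n)) O2" "Z \<inter> \<psi> -` W = O2 \<inter> Z"
      unfolding openin_induced by auto
    let ?O = "points ?A' \<inter> \<pi> -` O1"
    have gO: "g \<circ> \<pi> \<in> reg ?A' ?O" using O1(3) unfolding P reg_quotient by simp
    have w1: "\<zeta> w \<in> ?O" using \<zeta>3[OF W(4)] \<zeta>2[OF W(4)] O1(2) by (simp add: pA')
    from reg_inducedD[OF gO w1] obtain T g' where T: "openin (zariski ?A) T" "\<zeta> w \<in> T" "g' \<in> reg ?A T"
      "\<forall>y\<in>T \<inter> ?O. (g \<circ> \<pi>) y = g' y" by blast
    obtain p q where pq: "p \<in> polys (Suc n)" "q \<in> polys (Suc n)" "q (\<zeta> w) \<noteq> 0" "\<forall>y\<in>T. q y \<noteq> 0 \<longrightarrow> g' y = p y / q y"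
      by (rule reg_AspaceE[OF T(3,2)])
    have "openin (zariski (Pspace n)) (O1 \<inter> O2)" using O1(1) O2(1) by blast
    then have "openin (zariski ?A') (points ?A' \<inter> \<pi> -` (O1 \<inter> O2))"
      unfolding P openin_quotient_space by blast
    then obtain T2 where T2: "openin (zariski ?A) T2" "points ?A' \<inter> \<pi> -` (O1 \<inter> O2) = T2 \<inter> ?V"
      unfolding openin_induced by blast
    have "\<zeta> w \<in> points ?A' \<inter> \<pi> -` (O1 \<inter> O2)" using w1 mem[OF W(4)] W(3) O2(2) \<zeta>2[OF W(4)] by auto
    then have "\<zeta> w \<in> T \<inter> T2" using T2(2) T(2) by blast
    from Aspace_basis[OF openin_Int[OF T(1) T2(1)] this] obtain r where
      r: "r \<in> polys (Suc n)" "r (\<zeta> w) \<noteq> 0" "\<forall>w. (\<forall>k\<ge>Suc n. w k = 0) \<and> r w \<noteq> 0 \<longrightarrow> w \<in> T \<inter> T2" by auto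
    show "\<exists>p\<in>polys (Suc n). \<exists>q\<in>polys (Suc n). q (\<zeta> w) \<noteq> 0 \<and> (\<forall>x\<in>U. q (\<zeta> x) \<noteq> 0 \<longrightarrow> x \<in> W \<and> f x = p (\<zeta> x) / q (\<zeta> x))"
    proof (rule bexI[of _ "\<lambda>v. p v * r v"], rule bexI[of _ "\<lambda>v. q v * r v"], intro conjI ballI impI)
      show "q (\<zeta> w) * r (\<zeta> w) \<noteq> 0" using pq r by simp
      fix x assume x: "x \<in> U" "q (\<zeta> x) * r (\<zeta> x) \<noteq> 0"
      have xT: "\<zeta> x \<in> T" "\<zeta> x \<in> T2 \<inter> ?V" using r(3) x \<zeta>3[OF x(1)] by (auto simp: points_Aspace)
      then have xO: "\<phi> x \<in> O1" "\<phi> x \<in> O2" "\<zeta> x \<in> ?O"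
        unfolding T2(2)[symmetric] using \<zeta>2[OF x(1)] by auto
      then show xW: "x \<in> W" using mem[OF x(1)] phi x(1) O2(2) unfolding U_def by blast
      have "f x = (f \<circ> \<psi>) (\<phi> x)" using inv(1) x(1) by (simp add: U_def)
      also have "\<dots> = g (\<phi> x)" using O1(4) xO mem[OF x(1)] xW by blast
      also have "\<dots> = (g \<circ> \<pi>) (\<zeta> x)" using \<zeta>2[OF x(1)] by simp
      also have "\<dots> = g' (\<zeta> x)" using T(4) xT xO by blast
      also have "\<dots> = p (\<zeta> x) / q (\<zeta> x)" using pq(4) xT x by auto
      finally show "f x = p (\<zeta> x) * r (\<zeta> x) / (q (\<zeta> x) * r (\<zeta> x))" using x by auto
    qed (intro polys.mult pq(1,2) r(1))+
  qed
  moreover have "x1 \<in> U" "x2 \<in> U" unfolding U_def using xy v1 v2 inD ab by (simp_all add: l_def)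
  ultimately show ?thesis by blast
qed

section \<open>Products\<close>

lemma tensor_functionsE:
  assumes "h \<in> tensor_functions S T U V"
  obtains n f g where "h = (\<lambda>(x, y). \<Sum>k<n. f k x * g k y)" "\<forall>k<(n::nat). f k \<in> reg S U \<and> g k \<in> reg T V"
  using assms unfolding tensor_functions_def by auto

lemma tensor_functionsI:
  "\<forall>k<(n::nat). f k \<in> reg S U \<and> g k \<in> reg T V \<Longrightarrow>
    (\<lambda>(x, y). \<Sum>k<n. f k x * g k y) \<in> tensor_functions S T U V"
  unfolding tensor_functions_def by (intro CollectI exI[of _ n] exI[of _ f] exI[of _ g]) simp

lemma tensor_zero: "(\<lambda>_. 0) \<in> tensor_functions S T U V"
  using tensor_functionsI[of 0 undefined S U undefined T V] by (simp add: split_def)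

lemma tensor_pure:
  assumes "f \<in> reg S U" "g \<in> reg T V"
  shows "(\<lambda>z. f (fst z) * g (snd z)) \<in> tensor_functions S T U V"
  using tensor_functionsI[of 1 "\<lambda>_. f" S U "\<lambda>_. g" T V] assms by (simp add: split_def)

lemma tensor_add:
  assumes "h \<in> tensor_functions S T U V" "h' \<in> tensor_functions S T U V"
  shows "(\<lambda>z. h z + h' z) \<in> tensor_functions S T U V"
proof -
  obtain n f g where 1: "h = (\<lambda>(x, y). \<Sum>k<n. f k x * g k y)" "\<forall>k<(n::nat). f k \<in> reg S U \<and> g k \<in> reg T V"
    by (rule tensor_functionsE[OF assms(1)])
  obtain m f' g' where 2: "h' = (\<lambda>(x, y). \<Sum>k<m. f' k x * g' k y)" "\<forall>k<(m::nat). f' k \<in> reg S U \<and> g' k \<in> reg T V"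
    by (rule tensor_functionsE[OF assms(2)])
  have split: "(\<Sum>k<n + m. F k) = (\<Sum>k<n. F k) + (\<Sum>k<m. F (n + k))" for F :: "nat \<Rightarrow> complex"
    by (induction m) auto
  have "(\<lambda>(x, y). \<Sum>k<n + m. (if k < n then f k else f' (k - n)) x * (if k < n then g k else g' (k - n)) y)
      \<in> tensor_functions S T U V"
    by (rule tensor_functionsI) (use 1 2 in auto)
  moreover have "(\<lambda>(x, y). \<Sum>k<n + m. (if k < n then f k else f' (k - n)) x * (if k < n then g k else g' (k - n)) y)
      = (\<lambda>z. h z + h' z)"
    unfolding split 1(1) 2(1) by (auto simp: fun_eq_iff)
  ultimately show ?thesis by simp
qed

text \<open>Splits off one pure tensor at a time, so that statements additive in \<open>h\<close>
  have to be checked only for products f \<otimes> g.\<close>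

lemma tensor_induct [consumes 1, case_names zero add]:
  assumes "h \<in> tensor_functions S T U V" "P (\<lambda>_. 0)"
    and "\<And>f g h. f \<in> reg S U \<Longrightarrow> g \<in> reg T V \<Longrightarrow> h \<in> tensor_functions S T U V \<Longrightarrow> P h \<Longrightarrow>
      P (\<lambda>z. f (fst z) * g (snd z) + h z)"
  shows "P h"
proof -
  obtain n f g where h: "h = (\<lambda>(x, y). \<Sum>k<n. f k x * g k y)" and fg: "\<forall>k<(n::nat). f k \<in> reg S U \<and> g k \<in> reg T V"
    by (rule tensor_functionsE[OF assms(1)])
  have "m \<le> n \<Longrightarrow> P (\<lambda>(x, y). \<Sum>k<m. f k x * g k y)" for m
  proof (induction m)
    case 0 then show ?case using assms(2) by (simp add: split_def)
  next
    case (Suc m)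
    have "(\<lambda>(x, y). \<Sum>k<m. f k x * g k y) \<in> tensor_functions S T U V"
      by (rule tensor_functionsI) (use fg Suc.prems in auto)
    then have "P (\<lambda>z. f m (fst z) * g m (snd z) + (\<lambda>(x, y). \<Sum>k<m. f k x * g k y) z)"
      using Suc fg by (intro assms(3)) auto
    then show ?case by (simp add: split_def add.commute)
  qed
  then show ?thesis unfolding h by simp
qed

lemma tensor_const:
  assumes "regular_space S" "regular_space T" "openin (zariski S) U" "openin (zariski T) V"
  shows "(\<lambda>_. c) \<in> tensor_functions S T U V"
  using tensor_pure[OF reg_const[OF assms(1,3), of c] reg_const[OF assms(2,4), of 1]] by simp

lemma tensor_mult:
  assumes S: "regular_space S" "openin (zariski S) U" and T: "regular_space T" "openin (zariski T) V"
    and h: "h \<in> tensor_functions S T U V" "h' \<in> tensor_functions S T U V"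
  shows "(\<lambda>z. h z * h' z) \<in> tensor_functions S T U V"
  using h(1)
proof (induction rule: tensor_induct)
  case zero
  show ?case using tensor_zero by simp
next
  case (add f g h)
  have "(\<lambda>z. (f (fst z) * g (snd z)) * h' z) \<in> tensor_functions S T U V"
    using h(2)
  proof (induction rule: tensor_induct)
    case zero
    show ?case using tensor_zero by simp
  next
    case add': (add f' g' h')
    have "(\<lambda>z. (\<lambda>x. f x * f' x) (fst z) * (\<lambda>y. g y * g' y) (snd z) + (f (fst z) * g (snd z)) * h' z)
        \<in> tensor_functions S T U V"
      by (intro tensor_add tensor_pure reg_mult S T add(1,2) add')
    then show ?case by (simp add: algebra_simps)
  qed
  then have "(\<lambda>z. (f (fst z) * g (snd z)) * h' z + h z * h' z) \<in> tensor_functions S T U V"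
    by (intro tensor_add add)
  then show ?case by (simp add: algebra_simps)
qed

lemma tensor_mono:
  assumes S: "regular_space S" "openin (zariski S) U" "openin (zariski S) U'" "U' \<subseteq> U"
    and T: "regular_space T" "openin (zariski T) V" "openin (zariski T) V'" "V' \<subseteq> V"
    and h: "h \<in> tensor_functions S T U V"
  shows "h \<in> tensor_functions S T U' V'"
proof -
  obtain n f g where h: "h = (\<lambda>(x, y). \<Sum>k<n. f k x * g k y)" and fg: "\<forall>k<(n::nat). f k \<in> reg S U \<and> g k \<in> reg T V"
    by (rule tensor_functionsE[OF assms(9)])
  show ?thesis unfolding h
    by (rule tensor_functionsI) (use fg in \<open>auto intro: reg_mono[OF S] reg_mono[OF T]\<close>)
qed

lemma openin_prod_basic:
  assumes "openin (zariski S) U" "openin (zariski T) V" "h \<in> tensor_functions S T U V"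
  shows "openin (zariski (prod_space S T)) {z \<in> U \<times> V. h z \<noteq> 0}"
proof -
  have "{z \<in> U \<times> V. h z \<noteq> 0} \<in> {{z \<in> U \<times> V. h z \<noteq> 0} | U V h. openin (zariski S) U \<and> openin (zariski T) V \<and>
                                        h \<in> tensor_functions S T U V}"
    using assms by (intro CollectI exI[of _ U] exI[of _ V] exI[of _ h]) simp
  then show ?thesis unfolding prod_space_def by (simp add: topology_generated_by_Basis)
qed

lemma openin_prod_basis:
  assumes S: "regular_space S" and T: "regular_space T"
    and O': "openin (zariski (prod_space S T)) O'" "z \<in> O'"
  obtains U V h where "openin (zariski S) U" "openin (zariski T) V" "h \<in> tensor_functions S T U V"
    "z \<in> U \<times> V" "h z \<noteq> 0" "\<forall>w\<in>U \<times> V. h w \<noteq> 0 \<longrightarrow> w \<in> O'"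
proof -
  let ?B = "{{z \<in> U \<times> V. h z \<noteq> 0} | U V h. openin (zariski S) U \<and> openin (zariski T) V \<and>
                                        h \<in> tensor_functions S T U V}"
  have "\<exists>D\<in>?B. z \<in> D \<and> D \<subseteq> O'"
  proof (rule openin_generated_basis)
    show "openin (topology_generated_by ?B) O'" using O'(1) by (simp add: prod_space_def)
    fix A C assume A: "A \<in> ?B" and C: "C \<in> ?B" and z: "z \<in> A" "z \<in> C"
    from A obtain U V h where 1: "openin (zariski S) U" "openin (zariski T) V"
      "h \<in> tensor_functions S T U V" "A = {z \<in> U \<times> V. h z \<noteq> 0}" by (elim CollectE exE conjE)
    from C obtain U' V' h' where 2: "openin (zariski S) U'" "openin (zariski T) V'"
      "h' \<in> tensor_functions S T U' V'" "C = {z \<in> U' \<times> V'. h' z \<noteq> 0}" by (elim CollectE exE conjE)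
    note o = openin_Int[OF 1(1) 2(1)] openin_Int[OF 1(2) 2(2)]
    have "(\<lambda>z. h z * h' z) \<in> tensor_functions S T (U \<inter> U') (V \<inter> V')"
      by (rule tensor_mult[OF S o(1) T o(2) tensor_mono[OF S 1(1) o(1) _ T 1(2) o(2) _ 1(3)]
            tensor_mono[OF S 2(1) o(1) _ T 2(2) o(2) _ 2(3)]]) auto
    then have "{z \<in> (U \<inter> U') \<times> (V \<inter> V'). h z * h' z \<noteq> 0} \<in> ?B"
      using o by (intro CollectI exI[of _ "U \<inter> U'"] exI[of _ "V \<inter> V'"] exI[of _ "\<lambda>z. h z * h' z"]) simp
    then show "\<exists>D\<in>?B. z \<in> D \<and> D \<subseteq> A \<inter> C"
      by (rule bexI[rotated]) (use z 1(4) 2(4) in auto)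
  qed (fact O'(2))
  then obtain D where D: "D \<in> ?B" "z \<in> D" "D \<subseteq> O'" by (elim bexE conjE)
  from D(1) obtain U V h where 1: "openin (zariski S) U" "openin (zariski T) V"
      "h \<in> tensor_functions S T U V" "D = {z \<in> U \<times> V. h z \<noteq> 0}" by (elim CollectE exE conjE)
  show ?thesis by (rule that[OF 1(1-3)]) (use 1(4) D in auto)
qed

lemma openin_prod_Times:
  assumes "regular_space S" "regular_space T" "openin (zariski S) U" "openin (zariski T) V"
  shows "openin (zariski (prod_space S T)) (U \<times> V)"
  using openin_prod_basic[OF assms(3,4) tensor_const[OF assms, of 1]] by simp

lemma points_prod:
  assumes S: "regular_space S" and T: "regular_space T"
  shows "points (prod_space S T) = points S \<times> points T"
proof
  show "points (prod_space S T) \<subseteq> points S \<times> points T"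
  proof
    fix z assume "z \<in> points (prod_space S T)"
    from openin_prod_basis[OF S T openin_topspace this] obtain U V h
      where "openin (zariski S) U" "openin (zariski T) V" "h \<in> tensor_functions S T U V"
        "z \<in> U \<times> V" "h z \<noteq> 0" "\<forall>w\<in>U \<times> V. h w \<noteq> 0 \<longrightarrow> w \<in> points (prod_space S T)" .
    then show "z \<in> points S \<times> points T"
      using openin_subset[of "zariski S" U] openin_subset[of "zariski T" V] by auto
  qed
  show "points S \<times> points T \<subseteq> points (prod_space S T)"
    by (intro openin_subset openin_prod_Times assms openin_topspace)
qed

lemma reg_prod_space:
  "f \<in> reg (prod_space S T) W \<longleftrightarrow> (\<forall>z\<in>W. \<exists>U V. \<exists>p\<in>tensor_functions S T U V. \<exists>q\<in>tensor_functions S T U V.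
                openin (zariski S) U \<and> openin (zariski T) V \<and> z \<in> U \<times> V \<and> q z \<noteq> 0 \<and>
                (\<forall>w\<in>W \<inter> (U \<times> V). q w \<noteq> 0 \<longrightarrow> f w = p w / q w))"
  by (simp add: prod_space_def)

lemma reg_prodE:
  assumes "f \<in> reg (prod_space S T) W" "z \<in> W"
  obtains U V p q where "openin (zariski S) U" "openin (zariski T) V" "z \<in> U \<times> V"
    "p \<in> tensor_functions S T U V" "q \<in> tensor_functions S T U V" "q z \<noteq> 0"
    "\<forall>w\<in>W \<inter> (U \<times> V). q w \<noteq> 0 \<longrightarrow> f w = p w / q w"
  using bspec[OF assms(1)[unfolded reg_prod_space] assms(2)] by (elim exE bexE conjE)

lemma reg_prodI:
  assumes "\<And>z. z \<in> W \<Longrightarrow> \<exists>U V p q. openin (zariski S) U \<and> openin (zariski T) V \<and> z \<in> U \<times> V \<and>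
    p \<in> tensor_functions S T U V \<and> q \<in> tensor_functions S T U V \<and> q z \<noteq> 0 \<and>
    (\<forall>w\<in>W \<inter> (U \<times> V). q w \<noteq> 0 \<longrightarrow> f w = p w / q w)"
  shows "f \<in> reg (prod_space S T) W"
  unfolding reg_prod_space
proof
  fix z assume "z \<in> W"
  from assms[OF this] obtain U V p q where "openin (zariski S) U" "openin (zariski T) V" "z \<in> U \<times> V"
    "p \<in> tensor_functions S T U V" "q \<in> tensor_functions S T U V" "q z \<noteq> 0"
    "\<forall>w\<in>W \<inter> (U \<times> V). q w \<noteq> 0 \<longrightarrow> f w = p w / q w" by (elim exE conjE)
  then show "\<exists>U V. \<exists>p\<in>tensor_functions S T U V. \<exists>q\<in>tensor_functions S T U V.
                openin (zariski S) U \<and> openin (zariski T) V \<and> z \<in> U \<times> V \<and> q z \<noteq> 0 \<and>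
                (\<forall>w\<in>W \<inter> (U \<times> V). q w \<noteq> 0 \<longrightarrow> f w = p w / q w)"
    by (intro exI[of _ U] exI[of _ V] bexI[of _ p] bexI[of _ q]) simp_all
qed

lemma reg_prod_pair:
  assumes S: "regular_space S" and T: "regular_space T"
    and f: "f \<in> reg (prod_space S T) W" and g: "g \<in> reg (prod_space S T) W'" and z: "z \<in> W" "z \<in> W'"
  obtains U V p q p' q' where "openin (zariski S) U" "openin (zariski T) V" "z \<in> U \<times> V"
    "p \<in> tensor_functions S T U V" "q \<in> tensor_functions S T U V"
    "p' \<in> tensor_functions S T U V" "q' \<in> tensor_functions S T U V" "q z \<noteq> 0" "q' z \<noteq> 0"
    "\<forall>w\<in>W \<inter> (U \<times> V). q w \<noteq> 0 \<longrightarrow> f w = p w / q w" "\<forall>w\<in>W' \<inter> (U \<times> V). q' w \<noteq> 0 \<longrightarrow> g w = p' w / q' w"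
proof -
  obtain U V p q where 1: "openin (zariski S) U" "openin (zariski T) V" "z \<in> U \<times> V"
    "p \<in> tensor_functions S T U V" "q \<in> tensor_functions S T U V" "q z \<noteq> 0"
    "\<forall>w\<in>W \<inter> (U \<times> V). q w \<noteq> 0 \<longrightarrow> f w = p w / q w" by (rule reg_prodE[OF f z(1)])
  obtain U' V' p' q' where 2: "openin (zariski S) U'" "openin (zariski T) V'" "z \<in> U' \<times> V'"
    "p' \<in> tensor_functions S T U' V'" "q' \<in> tensor_functions S T U' V'" "q' z \<noteq> 0"
    "\<forall>w\<in>W' \<inter> (U' \<times> V'). q' w \<noteq> 0 \<longrightarrow> g w = p' w / q' w" by (rule reg_prodE[OF g z(2)])
  note o = openin_Int[OF 1(1) 2(1)] openin_Int[OF 1(2) 2(2)]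
  note m1 = tensor_mono[OF S 1(1) o(1) Int_lower1 T 1(2) o(2) Int_lower1]
  note m2 = tensor_mono[OF S 2(1) o(1) Int_lower2 T 2(2) o(2) Int_lower2]
  show ?thesis
    by (rule that[OF o _ m1[OF 1(4)] m1[OF 1(5)] m2[OF 2(4)] m2[OF 2(5)] 1(6) 2(6)])
      (use 1(3,7) 2(3,7) in auto)
qed

theorem regular_space_prod:
  assumes S: "regular_space S" and T: "regular_space T"
  shows "regular_space (prod_space S T)"
proof (rule regular_spaceI)
  let ?P = "prod_space S T"
  show "function_sheaf ?P"
    unfolding function_sheaf_def
  proof (intro conjI allI impI)
    fix U f g assume *: "openin (zariski ?P) U \<and> f \<in> reg ?P U \<and> (\<forall>x\<in>U. g x = f x)"
    then show "g \<in> reg ?P U" by (simp add: reg_prod_space)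
  next
    fix W W' f assume *: "openin (zariski ?P) W \<and> openin (zariski ?P) W' \<and> W' \<subseteq> W \<and> f \<in> reg ?P W"
    show "f \<in> reg ?P W'"
    proof (rule reg_prodI)
      fix z assume "z \<in> W'"
      then have z: "z \<in> W" and f: "f \<in> reg ?P W" using * by auto
      obtain U V p q where 1: "openin (zariski S) U" "openin (zariski T) V" "z \<in> U \<times> V"
        "p \<in> tensor_functions S T U V" "q \<in> tensor_functions S T U V" "q z \<noteq> 0"
        "\<forall>w\<in>W \<inter> (U \<times> V). q w \<noteq> 0 \<longrightarrow> f w = p w / q w" by (rule reg_prodE[OF f z])
      then show "\<exists>U V p q. openin (zariski S) U \<and> openin (zariski T) V \<and> z \<in> U \<times> V \<and>
          p \<in> tensor_functions S T U V \<and> q \<in> tensor_functions S T U V \<and> q z \<noteq> 0 \<and>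
          (\<forall>w\<in>W' \<inter> (U \<times> V). q w \<noteq> 0 \<longrightarrow> f w = p w / q w)"
        using * by (intro exI[of _ U] exI[of _ V] exI[of _ p] exI[of _ q]) auto
    qed
  next
    fix W f assume *: "openin (zariski ?P) W \<and> (\<forall>x\<in>W. \<exists>V. openin (zariski ?P) V \<and> x \<in> V \<and> V \<subseteq> W \<and> f \<in> reg ?P V)"
    show "f \<in> reg ?P W"
    proof (rule reg_prodI)
      fix z assume z: "z \<in> W"
      obtain W' where W': "openin (zariski ?P) W'" "z \<in> W'" "W' \<subseteq> W" "f \<in> reg ?P W'" using * z by blast
      obtain U V p q where 1: "openin (zariski S) U" "openin (zariski T) V" "z \<in> U \<times> V"
        "p \<in> tensor_functions S T U V" "q \<in> tensor_functions S T U V" "q z \<noteq> 0"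
        "\<forall>w\<in>W' \<inter> (U \<times> V). q w \<noteq> 0 \<longrightarrow> f w = p w / q w" by (rule reg_prodE[OF W'(4,2)])
      \<comment> \<open>As in affine space, multiplying by \<open>h\<close>, which vanishes on its
        box outside \<open>W'\<close>, turns a fraction valid on \<open>W'\<close> into one valid on
        \<open>W\<close>.\<close>
      obtain U' V' h where 2: "openin (zariski S) U'" "openin (zariski T) V'"
        "h \<in> tensor_functions S T U' V'" "z \<in> U' \<times> V'" "h z \<noteq> 0" "\<forall>w\<in>U' \<times> V'. h w \<noteq> 0 \<longrightarrow> w \<in> W'"
        by (rule openin_prod_basis[OF S T W'(1,2)])
      note o = openin_Int[OF 1(1) 2(1)] openin_Int[OF 1(2) 2(2)]
      note m1 = tensor_mono[OF S 1(1) o(1) Int_lower1 T 1(2) o(2) Int_lower1]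
      note m2 = tensor_mono[OF S 2(1) o(1) Int_lower2 T 2(2) o(2) Int_lower2]
      show "\<exists>U V p q. openin (zariski S) U \<and> openin (zariski T) V \<and> z \<in> U \<times> V \<and>
          p \<in> tensor_functions S T U V \<and> q \<in> tensor_functions S T U V \<and> q z \<noteq> 0 \<and>
          (\<forall>w\<in>W \<inter> (U \<times> V). q w \<noteq> 0 \<longrightarrow> f w = p w / q w)"
      proof (intro exI conjI)
        show "(\<lambda>z. p z * h z) \<in> tensor_functions S T (U \<inter> U') (V \<inter> V')"
          "(\<lambda>z. q z * h z) \<in> tensor_functions S T (U \<inter> U') (V \<inter> V')"
          by (intro tensor_mult S T o m1 m2 1 2)+
        show "openin (zariski S) (U \<inter> U')" "openin (zariski T) (V \<inter> V')" by (fact o)+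
      qed (use 1 2 in auto)
    qed
  qed
next
  fix W c assume W: "openin (zariski (prod_space S T)) W"
  show "(\<lambda>_. c) \<in> reg (prod_space S T) W"
  proof (rule reg_prodI)
    fix z assume "z \<in> W"
    then have z: "z \<in> points S \<times> points T"
      using openin_subset[OF W] points_prod[OF S T] by blast
    show "\<exists>U V p q. openin (zariski S) U \<and> openin (zariski T) V \<and> z \<in> U \<times> V \<and>
          p \<in> tensor_functions S T U V \<and> q \<in> tensor_functions S T U V \<and> q z \<noteq> 0 \<and>
          (\<forall>w\<in>W \<inter> (U \<times> V). q w \<noteq> 0 \<longrightarrow> c = p w / q w)"
    proof (intro exI conjI)
      show "(\<lambda>_. c) \<in> tensor_functions S T (points S) (points T)"
        "(\<lambda>_. 1) \<in> tensor_functions S T (points S) (points T)"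
        by (rule tensor_const[OF S T openin_topspace openin_topspace])+
    qed (use z in auto)
  qed
next
  fix W f g assume W: "openin (zariski (prod_space S T)) W" and fg: "f \<in> reg (prod_space S T) W" "g \<in> reg (prod_space S T) W"
  show "(\<lambda>x. f x + g x) \<in> reg (prod_space S T) W"
  proof (rule reg_prodI)
    fix z assume z: "z \<in> W"
    obtain U V p q p' q' where 1: "openin (zariski S) U" "openin (zariski T) V" "z \<in> U \<times> V"
    "p \<in> tensor_functions S T U V" "q \<in> tensor_functions S T U V"
    "p' \<in> tensor_functions S T U V" "q' \<in> tensor_functions S T U V" "q z \<noteq> 0" "q' z \<noteq> 0"
    "\<forall>w\<in>W \<inter> (U \<times> V). q w \<noteq> 0 \<longrightarrow> f w = p w / q w" "\<forall>w\<in>W \<inter> (U \<times> V). q' w \<noteq> 0 \<longrightarrow> g w = p' w / q' w"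
      by (rule reg_prod_pair[OF S T fg z z])
    show "\<exists>U V p q. openin (zariski S) U \<and> openin (zariski T) V \<and> z \<in> U \<times> V \<and>
          p \<in> tensor_functions S T U V \<and> q \<in> tensor_functions S T U V \<and> q z \<noteq> 0 \<and>
          (\<forall>w\<in>W \<inter> (U \<times> V). q w \<noteq> 0 \<longrightarrow> f w + g w = p w / q w)"
    proof (intro exI conjI)
      show "(\<lambda>z. p z * q' z + p' z * q z) \<in> tensor_functions S T U V"
        "(\<lambda>z. q z * q' z) \<in> tensor_functions S T U V"
        by (intro tensor_add tensor_mult S T 1)+
    qed (use 1 in \<open>auto simp: add_frac_eq\<close>)
  qed
  show "(\<lambda>x. f x * g x) \<in> reg (prod_space S T) W"
  proof (rule reg_prodI)
    fix z assume z: "z \<in> W"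
    obtain U V p q p' q' where 1: "openin (zariski S) U" "openin (zariski T) V" "z \<in> U \<times> V"
    "p \<in> tensor_functions S T U V" "q \<in> tensor_functions S T U V"
    "p' \<in> tensor_functions S T U V" "q' \<in> tensor_functions S T U V" "q z \<noteq> 0" "q' z \<noteq> 0"
    "\<forall>w\<in>W \<inter> (U \<times> V). q w \<noteq> 0 \<longrightarrow> f w = p w / q w" "\<forall>w\<in>W \<inter> (U \<times> V). q' w \<noteq> 0 \<longrightarrow> g w = p' w / q' w"
      by (rule reg_prod_pair[OF S T fg z z])
    show "\<exists>U V p q. openin (zariski S) U \<and> openin (zariski T) V \<and> z \<in> U \<times> V \<and>
          p \<in> tensor_functions S T U V \<and> q \<in> tensor_functions S T U V \<and> q z \<noteq> 0 \<and>
          (\<forall>w\<in>W \<inter> (U \<times> V). q w \<noteq> 0 \<longrightarrow> f w * g w = p w / q w)"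
    proof (intro exI conjI)
      show "(\<lambda>z. p z * p' z) \<in> tensor_functions S T U V"
        "(\<lambda>z. q z * q' z) \<in> tensor_functions S T U V"
        by (intro tensor_mult S T 1)+
    qed (use 1 in auto)
  qed
next
  fix W f assume W: "openin (zariski (prod_space S T)) W" and f: "f \<in> reg (prod_space S T) W"
  show o: "openin (zariski (prod_space S T)) {x \<in> W. f x \<noteq> 0}"
  proof (subst openin_subopen, rule)
    fix z assume z: "z \<in> {x \<in> W. f x \<noteq> 0}"
    then have zW: "z \<in> W" by simp
    obtain U V p q where 1: "openin (zariski S) U" "openin (zariski T) V" "z \<in> U \<times> V"
        "p \<in> tensor_functions S T U V" "q \<in> tensor_functions S T U V" "q z \<noteq> 0"
        "\<forall>w\<in>W \<inter> (U \<times> V). q w \<noteq> 0 \<longrightarrow> f w = p w / q w" by (rule reg_prodE[OF f zW])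
    have "openin (zariski (prod_space S T)) ({w \<in> U \<times> V. p w * q w \<noteq> 0} \<inter> W)"
      by (intro openin_Int openin_prod_basic tensor_mult S T 1 W)
    then show "\<exists>T'. openin (zariski (prod_space S T)) T' \<and> z \<in> T' \<and> T' \<subseteq> {x \<in> W. f x \<noteq> 0}"
      using z 1 by (intro exI[of _ "{w \<in> U \<times> V. p w * q w \<noteq> 0} \<inter> W"]) auto
  qed
  show "(\<lambda>x. inverse (f x)) \<in> reg (prod_space S T) {x \<in> W. f x \<noteq> 0}"
  proof (rule reg_prodI)
    fix z assume z: "z \<in> {x \<in> W. f x \<noteq> 0}"
    then have zW: "z \<in> W" by simp
    obtain U V p q where 1: "openin (zariski S) U" "openin (zariski T) V" "z \<in> U \<times> V"
        "p \<in> tensor_functions S T U V" "q \<in> tensor_functions S T U V" "q z \<noteq> 0"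
        "\<forall>w\<in>W \<inter> (U \<times> V). q w \<noteq> 0 \<longrightarrow> f w = p w / q w" by (rule reg_prodE[OF f zW])
    show "\<exists>U V p q. openin (zariski S) U \<and> openin (zariski T) V \<and> z \<in> U \<times> V \<and>
          p \<in> tensor_functions S T U V \<and> q \<in> tensor_functions S T U V \<and> q z \<noteq> 0 \<and>
          (\<forall>w\<in>{x \<in> W. f x \<noteq> 0} \<inter> (U \<times> V). q w \<noteq> 0 \<longrightarrow> inverse (f w) = p w / q w)"
    proof (intro exI conjI)
      show "(\<lambda>z. q z * q z) \<in> tensor_functions S T U V"
        "(\<lambda>z. p z * q z) \<in> tensor_functions S T U V"
        by (intro tensor_mult S T 1)+
    qed (use 1 z in auto)
  qed
qed

lemma reg_tensor:
  assumes S: "regular_space S" and T: "regular_space T"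
    and o: "openin (zariski S) U" "openin (zariski T) V" and h: "h \<in> tensor_functions S T U V"
  shows "h \<in> reg (prod_space S T) (U \<times> V)"
  by (rule reg_prodI, intro exI conjI, (rule o)+, assumption, rule h, rule tensor_const[OF S T o, of 1])
    simp_all

subsection \<open>Morphisms\<close>

lemma morphismI:
  assumes "\<And>x. x \<in> points S \<Longrightarrow> \<phi> x \<in> points T"
    "\<And>V. openin (zariski T) V \<Longrightarrow> openin (zariski S) (points S \<inter> \<phi> -` V)"
    "\<And>V f. openin (zariski T) V \<Longrightarrow> f \<in> reg T V \<Longrightarrow> (\<lambda>x. f (\<phi> x)) \<in> reg S (points S \<inter> \<phi> -` V)"
  shows "morphism S T \<phi>"
proof -
  have "points S \<inter> \<phi> -` V = {x \<in> points S. \<phi> x \<in> V}" for V by auto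
  then show ?thesis
    unfolding morphism_def continuous_map_def using assms by (auto simp: comp_def)
qed

lemma morphism_reg':
  assumes "morphism S T \<phi>" "regular_space S" "openin (zariski T) V" "f \<in> reg T V"
    "openin (zariski S) W" "W \<subseteq> \<phi> -` V"
  shows "(\<lambda>x. f (\<phi> x)) \<in> reg S W"
proof -
  have "W \<subseteq> points S \<inter> \<phi> -` V" using assms(5,6) openin_subset by blast
  then show ?thesis
    using reg_mono[OF assms(2) morphism_openin[OF assms(1,3)] assms(5) _ morphism_reg[OF assms(1,3,4)]]
    by (simp add: comp_def)
qed

lemma morphism_id: "morphism S S (\<lambda>x. x)"
proof (rule morphismI)
  have "points S \<inter> (\<lambda>x. x) -` V = V" if "openin (zariski S) V" for V
    using openin_subset[OF that] by auto
  then show "openin (zariski S) (points S \<inter> (\<lambda>x. x) -` V)" if "openin (zariski S) V" for V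
    using that by simp
  show "(\<lambda>x. f x) \<in> reg S (points S \<inter> (\<lambda>x. x) -` V)" if "openin (zariski S) V" "f \<in> reg S V" for V f
    using that \<open>\<And>V. openin (zariski S) V \<Longrightarrow> points S \<inter> (\<lambda>x. x) -` V = V\<close> by simp
qed

lemma morphism_comp:
  assumes "morphism S T \<phi>" "morphism T R \<psi>"
  shows "morphism S R (\<lambda>x. \<psi> (\<phi> x))"
proof (rule morphismI)
  have e: "points S \<inter> (\<lambda>x. \<psi> (\<phi> x)) -` V = points S \<inter> \<phi> -` (points T \<inter> \<psi> -` V)" for V
    using morphism_points[OF assms(1)] by auto
  show "\<psi> (\<phi> x) \<in> points R" if "x \<in> points S" for x
    using that morphism_points assms by metis
  show "openin (zariski S) (points S \<inter> (\<lambda>x. \<psi> (\<phi> x)) -` V)" if "openin (zariski R) V" for V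
    unfolding e by (intro morphism_openin[OF assms(1)] morphism_openin[OF assms(2)] that)
  show "(\<lambda>x. f (\<psi> (\<phi> x))) \<in> reg S (points S \<inter> (\<lambda>x. \<psi> (\<phi> x)) -` V)"
    if "openin (zariski R) V" "f \<in> reg R V" for V f
    unfolding e
    using morphism_reg[OF assms(1) morphism_openin[OF assms(2) that(1)] morphism_reg[OF assms(2) that]]
    by (simp add: comp_def)
qed

lemma morphism_fst:
  assumes "regular_space S" "regular_space T"
  shows "morphism (prod_space S T) S fst"
proof (rule morphismI)
  have e: "points (prod_space S T) \<inter> fst -` U = U \<times> points T" if "openin (zariski S) U" for U
    using openin_subset[OF that] by (auto simp: points_prod[OF assms])
  show "fst z \<in> points S" if "z \<in> points (prod_space S T)" for z
    using that by (auto simp: points_prod[OF assms])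
  show "openin (zariski (prod_space S T)) (points (prod_space S T) \<inter> fst -` U)" if "openin (zariski S) U" for U
    unfolding e[OF that] by (rule openin_prod_Times[OF assms that openin_topspace])
  show "(\<lambda>z. f (fst z)) \<in> reg (prod_space S T) (points (prod_space S T) \<inter> fst -` U)"
    if "openin (zariski S) U" "f \<in> reg S U" for U f
    unfolding e[OF that(1)]
    using reg_tensor[OF assms that(1) openin_topspace tensor_pure[OF that(2) reg_const[OF assms(2) openin_topspace, of 1]]]
    by simp
qed

lemma morphism_snd:
  assumes "regular_space S" "regular_space T"
  shows "morphism (prod_space S T) T snd"
proof (rule morphismI)
  have e: "points (prod_space S T) \<inter> snd -` U = points S \<times> U" if "openin (zariski T) U" for U
    using openin_subset[OF that] by (auto simp: points_prod[OF assms])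
  show "snd z \<in> points T" if "z \<in> points (prod_space S T)" for z
    using that by (auto simp: points_prod[OF assms])
  show "openin (zariski (prod_space S T)) (points (prod_space S T) \<inter> snd -` U)" if "openin (zariski T) U" for U
    unfolding e[OF that] by (rule openin_prod_Times[OF assms openin_topspace that])
  show "(\<lambda>z. f (snd z)) \<in> reg (prod_space S T) (points (prod_space S T) \<inter> snd -` U)"
    if "openin (zariski T) U" "f \<in> reg T U" for U f
    unfolding e[OF that(1)]
    using reg_tensor[OF assms openin_topspace that(1) tensor_pure[OF reg_const[OF assms(1) openin_topspace, of 1] that(2)]]
    by simp
qed

text \<open>The topology and the regular functions of a product are both defined through tensor
  functions. Their pullbacks are sums of products of pulled back functions, hence regular
  (\<open>tens\<close>).\<close>

lemma morphism_pair:
  assumes R: "regular_space R" and S: "regular_space S" and T: "regular_space T"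
    and \<phi>: "morphism R S \<phi>" and \<psi>: "morphism R T \<psi>"
  shows "morphism R (prod_space S T) (\<lambda>x. (\<phi> x, \<psi> x))"
proof -
  let ?c = "\<lambda>x. (\<phi> x, \<psi> x)"
  let ?N = "\<lambda>U V. (points R \<inter> \<phi> -` U) \<inter> (points R \<inter> \<psi> -` V)"
  have oN: "openin (zariski R) (?N U V)" if "openin (zariski S) U" "openin (zariski T) V" for U V
    by (intro openin_Int morphism_openin[OF \<phi>] morphism_openin[OF \<psi>] that)
  have tens: "(\<lambda>x. h (?c x)) \<in> reg R (?N U V)"
    if UV: "openin (zariski S) U" "openin (zariski T) V" and h: "h \<in> tensor_functions S T U V" for U V h
    using h
  proof (induction rule: tensor_induct)
    case zero show ?case by (rule reg_const[OF R oN[OF UV]])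
  next
    case (add f g h)
    have "(\<lambda>x. f (\<phi> x) * g (\<psi> x) + h (?c x)) \<in> reg R (?N U V)"
      by (intro reg_add[OF R oN[OF UV]] reg_mult[OF R oN[OF UV]] add(4)
          morphism_reg'[OF \<phi> R UV(1) add(1) oN[OF UV]] morphism_reg'[OF \<psi> R UV(2) add(2) oN[OF UV]]) auto
    then show ?case by simp
  qed
  have cP: "?c x \<in> points (prod_space S T)" if "x \<in> points R" for x
    using morphism_points[OF \<phi> that] morphism_points[OF \<psi> that] by (simp add: points_prod[OF S T])
  have op: "openin (zariski R) (points R \<inter> ?c -` W)" if W: "openin (zariski (prod_space S T)) W" for W
  proof (subst openin_subopen, rule)
    fix x assume x: "x \<in> points R \<inter> ?c -` W"
    then have "?c x \<in> W" by simp
    from openin_prod_basis[OF S T W this] obtain U V h where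
      1: "openin (zariski S) U" "openin (zariski T) V" "h \<in> tensor_functions S T U V"
      "?c x \<in> U \<times> V" "h (?c x) \<noteq> 0" "\<forall>w\<in>U \<times> V. h w \<noteq> 0 \<longrightarrow> w \<in> W" .
    have "openin (zariski R) {x \<in> ?N U V. h (?c x) \<noteq> 0}"
      by (rule reg_open[OF R oN[OF 1(1,2)] tens[OF 1(1,2,3)]])
    then show "\<exists>T. openin (zariski R) T \<and> x \<in> T \<and> T \<subseteq> points R \<inter> ?c -` W"
      by (rule_tac exI[of _ "{x \<in> ?N U V. h (?c x) \<noteq> 0}"]) (use 1 x in auto)
  qed
  show ?thesis
  proof (rule morphismI)
    show "?c x \<in> points (prod_space S T)" if "x \<in> points R" for x by (rule cP[OF that])
    show "openin (zariski R) (points R \<inter> ?c -` W)" if "openin (zariski (prod_space S T)) W" for W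
      by (rule op[OF that])
    fix W f assume W: "openin (zariski (prod_space S T)) W" and f: "f \<in> reg (prod_space S T) W"
    show "(\<lambda>x. f (?c x)) \<in> reg R (points R \<inter> ?c -` W)"
    proof (rule reg_local[OF R op[OF W]])
      fix x assume x: "x \<in> points R \<inter> ?c -` W"
      then have cx: "?c x \<in> W" by simp
      obtain U V p q where 1: "openin (zariski S) U" "openin (zariski T) V" "?c x \<in> U \<times> V"
        "p \<in> tensor_functions S T U V" "q \<in> tensor_functions S T U V" "q (?c x) \<noteq> 0"
        "\<forall>w\<in>W \<inter> (U \<times> V). q w \<noteq> 0 \<longrightarrow> f w = p w / q w" by (rule reg_prodE[OF f cx])
      let ?D = "{x \<in> ?N U V. q (?c x) \<noteq> 0}" and ?W = "points R \<inter> ?c -` W"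
      note oD = reg_open[OF R oN[OF 1(1,2)] tens[OF 1(1,2,5)]]
      note oDW = openin_Int[OF oD op[OF W]]
      have sub: "?D \<inter> ?W \<subseteq> ?N U V" by auto
      note r = reg_mono[OF R oN[OF 1(1,2)] oDW sub tens[OF 1(1,2)]]
      have "(\<lambda>x. p (?c x) / q (?c x)) \<in> reg R (?D \<inter> ?W)"
        by (rule reg_divide[OF R oDW r[OF 1(4)] r[OF 1(5)]]) auto
      then have "(\<lambda>x. f (?c x)) \<in> reg R (?D \<inter> ?W)"
        by (rule reg_cong[OF R oDW]) (use 1(7) in auto)
      then show "\<exists>V. openin (zariski R) V \<and> x \<in> V \<and> V \<subseteq> ?W \<and> (\<lambda>x. f (?c x)) \<in> reg R V"
        using oDW x 1 by (intro exI[of _ "?D \<inter> ?W"]) auto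
    qed
  qed
qed

subsection \<open>Products of affine charts\<close>

definition join_coords :: "nat \<Rightarrow> ('a \<Rightarrow> nat \<Rightarrow> complex) \<Rightarrow> ('b \<Rightarrow> nat \<Rightarrow> complex) \<Rightarrow> 'a \<times> 'b \<Rightarrow> nat \<Rightarrow> complex" where
  "join_coords n \<zeta> \<eta> z k = (if k < n then \<zeta> (fst z) k else \<eta> (snd z) (k - n))"

text \<open>A point satisfying all polynomial relations of the product satisfies in particular those
  that involve one block of coordinates, so each block comes from a point of \<open>U\<close> or
  \<open>V\<close>. For fractions, the tensor functions defining the structure of the product live
  on arbitrary smaller boxes; \<open>LF\<close> rewrites them in the coordinates of the
  chart.\<close>

lemma affine_chart_prod:
  assumes S: "regular_space S" and T: "regular_space T"
    and c: "affine_chart S U n \<zeta>" and d: "affine_chart T V m \<eta>"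
  shows "affine_chart (prod_space S T) (U \<times> V) (n + m) (join_coords n \<zeta> \<eta>)"
proof -
  let ?P = "prod_space S T" and ?\<xi> = "join_coords n \<zeta> \<eta>"
  have P: "regular_space ?P" by (rule regular_space_prod[OF S T])
  note oU = affine_chart_open[OF c] and oV = affine_chart_open[OF d]
  have oK: "openin (zariski ?P) (U \<times> V)" by (rule openin_prod_Times[OF S T oU oV])
  have coord: "(\<lambda>z. ?\<xi> z k) \<in> reg ?P (U \<times> V)" if "k < n + m" for k
  proof (cases "k < n")
    case True
    have "U \<times> V \<subseteq> fst -` U" by auto
    from morphism_reg'[OF morphism_fst[OF S T] P oU affine_chart_coord[OF c True] oK this] True
    show ?thesis by (simp add: join_coords_def)
  next
    case False
    then have "k - n < m" using that by simp
    moreover have "U \<times> V \<subseteq> snd -` V" by auto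
    ultimately show ?thesis
      using morphism_reg'[OF morphism_snd[OF S T] P oV affine_chart_coord[OF d] oK] False
      by (simp add: join_coords_def)
  qed
  have pol: "(\<lambda>z. p (?\<xi> z)) \<in> reg ?P (U \<times> V)" if "p \<in> polys (n + m)" for p
    by (rule reg_polys[OF P oK that coord])
  have oq: "openin (zariski ?P) {z \<in> U \<times> V. q (?\<xi> z) \<noteq> 0}" if "q \<in> polys (n + m)" for q
    by (rule reg_open[OF P oK pol[OF that]])
  have p1: "p (?\<xi> z) = p (\<zeta> (fst z))" if "p \<in> polys n" for p z
    using that by (rule polys_cong) (simp add: join_coords_def)
  have p2: "(\<lambda>v. p (\<lambda>k. v (k + n))) \<in> polys (n + m)" if "p \<in> polys m" for p
    by (rule polys_subst[OF that]) (auto intro!: polys.coord)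
  have p2': "p (\<lambda>k. ?\<xi> z (k + n)) = p (\<eta> (snd z))" for p :: "(nat \<Rightarrow> complex) \<Rightarrow> complex" and z
    by (simp add: join_coords_def)
  have LF: "\<exists>p\<in>polys (n + m). \<exists>q\<in>polys (n + m). q (?\<xi> w) \<noteq> 0 \<and>
      (\<forall>x\<in>U \<times> V. q (?\<xi> x) \<noteq> 0 \<longrightarrow> x \<in> U' \<times> V' \<and> h x = p (?\<xi> x) / q (?\<xi> x))"
    if o: "openin (zariski S) U'" "openin (zariski T) V'" and w: "w \<in> U' \<times> V'" "w \<in> U \<times> V"
      and h: "h \<in> tensor_functions S T U' V'" for U' V' h w
    using h
  proof (induction rule: tensor_induct)
    \<comment> \<open>Even the zero function needs a suitable denominator, since its nonvanishing
      has to confine the point to the box U' \<times> V'. Fractions for the zero functions on the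
      two factors provide it.\<close>
    case zero
    obtain p q where pq: "p \<in> polys n" "q \<in> polys n" "q (\<zeta> (fst w)) \<noteq> 0"
      "\<forall>x\<in>U. q (\<zeta> x) \<noteq> 0 \<longrightarrow> x \<in> U' \<and> 0 = p (\<zeta> x) / q (\<zeta> x)"
      by (rule affine_chart_fraction[OF c o(1) reg_const[OF S o(1), of 0], of "fst w"]) (use w in auto)
    obtain p' q' where pq': "p' \<in> polys m" "q' \<in> polys m" "q' (\<eta> (snd w)) \<noteq> 0"
      "\<forall>x\<in>V. q' (\<eta> x) \<noteq> 0 \<longrightarrow> x \<in> V' \<and> 0 = p' (\<eta> x) / q' (\<eta> x)"
      by (rule affine_chart_fraction[OF d o(2) reg_const[OF T o(2), of 0], of "snd w"]) (use w in auto)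
    show ?case
      by (rule bexI[of _ "\<lambda>_. 0"], rule bexI[of _ "\<lambda>v. q v * q' (\<lambda>k. v (k + n))"])
        (use pq(3,4) pq'(3,4) in \<open>auto simp: p1[OF pq(2)] p2' intro!: polys.const polys.mult
          p2[OF pq'(2)] polys_mono[OF pq(2)]\<close>)
  next
    case (add f g h)
    obtain P Q where PQ: "P \<in> polys (n + m)" "Q \<in> polys (n + m)" "Q (?\<xi> w) \<noteq> 0"
      "\<forall>x\<in>U \<times> V. Q (?\<xi> x) \<noteq> 0 \<longrightarrow> x \<in> U' \<times> V' \<and> h x = P (?\<xi> x) / Q (?\<xi> x)"
      using add(4) by (elim bexE conjE)
    obtain p q where pq: "p \<in> polys n" "q \<in> polys n" "q (\<zeta> (fst w)) \<noteq> 0"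
      "\<forall>x\<in>U. q (\<zeta> x) \<noteq> 0 \<longrightarrow> x \<in> U' \<and> f x = p (\<zeta> x) / q (\<zeta> x)"
      by (rule affine_chart_fraction[OF c o(1) add(1), of "fst w"]) (use w in auto)
    obtain p' q' where pq': "p' \<in> polys m" "q' \<in> polys m" "q' (\<eta> (snd w)) \<noteq> 0"
      "\<forall>x\<in>V. q' (\<eta> x) \<noteq> 0 \<longrightarrow> x \<in> V' \<and> g x = p' (\<eta> x) / q' (\<eta> x)"
      by (rule affine_chart_fraction[OF d o(2) add(2), of "snd w"]) (use w in auto)
    let ?pp = "\<lambda>v. p v * p' (\<lambda>k. v (k + n))" and ?qq = "\<lambda>v. q v * q' (\<lambda>k. v (k + n))"
    have po: "?pp \<in> polys (n + m)" "?qq \<in> polys (n + m)"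
      by (intro polys.mult p2[OF pq'(1)] p2[OF pq'(2)] polys_mono[OF pq(2)] polys_mono[OF pq(1)] le_add1)+
    show ?case
    proof (rule bexI[of _ "\<lambda>v. ?pp v * Q v + P v * ?qq v"], rule bexI[of _ "\<lambda>v. ?qq v * Q v"], intro conjI ballI impI)
      show "?qq (?\<xi> w) * Q (?\<xi> w) \<noteq> 0" using pq(3) pq'(3) PQ(3) by (simp add: p1[OF pq(2)] p2')
      fix x assume x: "x \<in> U \<times> V" "?qq (?\<xi> x) * Q (?\<xi> x) \<noteq> 0"
      show "x \<in> U' \<times> V'" using x PQ(4) by auto
      have "q (\<zeta> (fst x)) \<noteq> 0" "q' (\<eta> (snd x)) \<noteq> 0" "Q (?\<xi> x) \<noteq> 0" using x(2) by (auto simp: p1[OF pq(2)] p2')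
      moreover from this have "f (fst x) = p (\<zeta> (fst x)) / q (\<zeta> (fst x))" "g (snd x) = p' (\<eta> (snd x)) / q' (\<eta> (snd x))"
        "h x = P (?\<xi> x) / Q (?\<xi> x)"
        using pq(4) pq'(4) bspec[OF PQ(4) x(1)] x(1) by (auto simp: mem_Times_iff)
      ultimately show "f (fst x) * g (snd x) + h x = (?pp (?\<xi> x) * Q (?\<xi> x) + P (?\<xi> x) * ?qq (?\<xi> x)) / (?qq (?\<xi> x) * Q (?\<xi> x))"
        by (simp add: p1[OF pq(2)] p1[OF pq(1)] p2' add_frac_eq)
    qed (intro polys.add polys.mult po PQ)+
  qed
  show ?thesis
  proof (rule affine_chartI)
    show "openin (zariski ?P) (U \<times> V)" by (fact oK)
    show "inj_on ?\<xi> (U \<times> V)"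
    proof (rule inj_onI)
      fix z w assume zw: "z \<in> U \<times> V" "w \<in> U \<times> V" "?\<xi> z = ?\<xi> w"
      have e: "?\<xi> z k = ?\<xi> w k" for k using zw(3) by simp
      have "fst z = fst w"
      proof (rule ccontr)
        assume "fst z \<noteq> fst w"
        then obtain k where "k < n" "\<zeta> (fst z) k \<noteq> \<zeta> (fst w) k"
          using affine_chart_separates[OF c, of "fst z" "fst w"] zw by auto
        then show False using e[of k] by (simp add: join_coords_def)
      qed
      moreover have "snd z = snd w"
      proof (rule ccontr)
        assume "snd z \<noteq> snd w"
        then obtain k where "k < m" "\<eta> (snd z) k \<noteq> \<eta> (snd w) k"
          using affine_chart_separates[OF d, of "snd z" "snd w"] zw by auto
        then show False using e[of "k + n"] by (simp add: join_coords_def)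
      qed
      ultimately show "z = w" by (rule prod_eqI)
    qed
    show "?\<xi> z k = 0" if "z \<in> U \<times> V" "n + m \<le> k" for z k
      using that affine_chart_supp[OF d, of "snd z" "k - n"] by (auto simp: join_coords_def)
    show "openin (zariski ?P) {x \<in> U \<times> V. q (?\<xi> x) \<noteq> 0}" if "q \<in> polys (n + m)" for q
      by (rule oq[OF that])
    show "(\<lambda>x. p (?\<xi> x) / q (?\<xi> x)) \<in> reg ?P {x \<in> U \<times> V. q (?\<xi> x) \<noteq> 0}"
      if pq: "p \<in> polys (n + m)" "q \<in> polys (n + m)" for p q
      by (rule reg_divide[OF P oq[OF pq(2)] reg_mono[OF P oK oq[OF pq(2)] _ pol[OF pq(1)]]
            reg_mono[OF P oK oq[OF pq(2)] _ pol[OF pq(2)]]]) auto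
  next
    fix e assume supp: "\<And>k. n + m \<le> k \<Longrightarrow> e k = 0"
      and rel: "\<And>p. p \<in> polys (n + m) \<Longrightarrow> (\<And>x. x \<in> U \<times> V \<Longrightarrow> p (?\<xi> x) = 0) \<Longrightarrow> p e = 0"
    define e1 where "e1 k = (if k < n then e k else 0)" for k
    have "e1 \<in> \<zeta> ` U"
    proof (rule affine_chart_closed[OF c])
      fix p assume p: "p \<in> polys n" "\<And>x. x \<in> U \<Longrightarrow> p (\<zeta> x) = 0"
      have "p e = 0" by (rule rel[OF polys_mono[OF p(1)]]) (auto simp: p1[OF p(1)] p(2))
      moreover have "p e = p e1" using p(1) by (rule polys_cong) (simp add: e1_def)
      ultimately show "p e1 = 0" by simp
    qed (simp add: e1_def)
    moreover have "(\<lambda>k. e (k + n)) \<in> \<eta> ` V"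
    proof (rule affine_chart_closed[OF d])
      fix p assume p: "p \<in> polys m" "\<And>x. x \<in> V \<Longrightarrow> p (\<eta> x) = 0"
      show "p (\<lambda>k. e (k + n)) = 0" by (rule rel[OF p2[OF p(1)]]) (auto simp: p2' p(2))
    qed (simp add: supp)
    ultimately obtain x y where xy: "x \<in> U" "y \<in> V" "e1 = \<zeta> x" "(\<lambda>k. e (k + n)) = \<eta> y" by auto
    have "e = ?\<xi> (x, y)"
    proof
      fix k
      show "e k = ?\<xi> (x, y) k"
        using fun_cong[OF xy(3), of k] fun_cong[OF xy(4), of "k - n"] by (auto simp: join_coords_def e1_def split: if_splits)
    qed
    then show "e \<in> ?\<xi> ` (U \<times> V)" using xy by blast
  next
    fix W f w assume W: "openin (zariski ?P) W" "f \<in> reg ?P W" "w \<in> W" "w \<in> U \<times> V"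
    obtain U1 V1 p q where 1: "openin (zariski S) U1" "openin (zariski T) V1" "w \<in> U1 \<times> V1"
        "p \<in> tensor_functions S T U1 V1" "q \<in> tensor_functions S T U1 V1" "q w \<noteq> 0"
        "\<forall>w\<in>W \<inter> (U1 \<times> V1). q w \<noteq> 0 \<longrightarrow> f w = p w / q w" by (rule reg_prodE[OF W(2,3)])
    obtain U2 V2 h where 2: "openin (zariski S) U2" "openin (zariski T) V2"
        "h \<in> tensor_functions S T U2 V2" "w \<in> U2 \<times> V2" "h w \<noteq> 0" "\<forall>w\<in>U2 \<times> V2. h w \<noteq> 0 \<longrightarrow> w \<in> W"
        by (rule openin_prod_basis[OF S T W(1,3)])
    from LF[OF 1(1,2,3) W(4) 1(4)] obtain pp pq where a: "pp \<in> polys (n + m)" "pq \<in> polys (n + m)" "pq (?\<xi> w) \<noteq> 0"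
      "\<forall>x\<in>U \<times> V. pq (?\<xi> x) \<noteq> 0 \<longrightarrow> x \<in> U1 \<times> V1 \<and> p x = pp (?\<xi> x) / pq (?\<xi> x)" by (elim bexE conjE)
    from LF[OF 1(1,2,3) W(4) 1(5)] obtain qp qq where b: "qp \<in> polys (n + m)" "qq \<in> polys (n + m)" "qq (?\<xi> w) \<noteq> 0"
      "\<forall>x\<in>U \<times> V. qq (?\<xi> x) \<noteq> 0 \<longrightarrow> x \<in> U1 \<times> V1 \<and> q x = qp (?\<xi> x) / qq (?\<xi> x)" by (elim bexE conjE)
    from LF[OF 2(1,2,4) W(4) 2(3)] obtain hp hq where e: "hp \<in> polys (n + m)" "hq \<in> polys (n + m)" "hq (?\<xi> w) \<noteq> 0"
      "\<forall>x\<in>U \<times> V. hq (?\<xi> x) \<noteq> 0 \<longrightarrow> x \<in> U2 \<times> V2 \<and> h x = hp (?\<xi> x) / hq (?\<xi> x)" by (elim bexE conjE)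
    \<comment> \<open>The factor \<open>?r\<close> is nonzero only where the fractions for
      \<open>q\<close> and \<open>h\<close> are valid and \<open>h\<close> is nonzero, which keeps
      the point inside \<open>W\<close>.\<close>
    let ?r = "\<lambda>v. qq v * hp v * hq v"
    show "\<exists>p\<in>polys (n + m). \<exists>q\<in>polys (n + m). q (?\<xi> w) \<noteq> 0 \<and>
      (\<forall>x\<in>U \<times> V. q (?\<xi> x) \<noteq> 0 \<longrightarrow> x \<in> W \<and> f x = p (?\<xi> x) / q (?\<xi> x))"
    proof (rule bexI[of _ "\<lambda>v. pp v * qq v * ?r v"], rule bexI[of _ "\<lambda>v. pq v * qp v * ?r v"], intro conjI ballI impI)
      have "qp (?\<xi> w) \<noteq> 0" "hp (?\<xi> w) \<noteq> 0"
        using b(3,4) W(4) 1(6) e(3,4) 2(5) by auto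
      then show "pq (?\<xi> w) * qp (?\<xi> w) * ?r (?\<xi> w) \<noteq> 0" using a(3) b(3) e(3) by simp
      fix x assume x: "x \<in> U \<times> V" "pq (?\<xi> x) * qp (?\<xi> x) * ?r (?\<xi> x) \<noteq> 0"
      then have nz: "pq (?\<xi> x) \<noteq> 0" "qp (?\<xi> x) \<noteq> 0" "qq (?\<xi> x) \<noteq> 0" "hp (?\<xi> x) \<noteq> 0" "hq (?\<xi> x) \<noteq> 0" by auto
      have h: "x \<in> U2 \<times> V2" "h x = hp (?\<xi> x) / hq (?\<xi> x)" using e(4) x(1) nz(5) by blast+
      have pqx: "x \<in> U1 \<times> V1" "p x = pp (?\<xi> x) / pq (?\<xi> x)" "q x = qp (?\<xi> x) / qq (?\<xi> x)"
        using a(4) b(4) x(1) nz by blast+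
      show xW: "x \<in> W" using 2(6) h nz by auto
      have "f x = p x / q x" using 1(7) xW pqx nz by auto
      then show "f x = pp (?\<xi> x) * qq (?\<xi> x) * ?r (?\<xi> x) / (pq (?\<xi> x) * qp (?\<xi> x) * ?r (?\<xi> x))"
        using nz by (simp add: pqx(2,3))
    qed (intro polys.mult a b e)+
  qed
qed

section \<open>Descent of functions to the symmetric product\<close>

text \<open>The involution moves only the two \<open>X\<close> factors. Charts of \<open>X\<close>
  therefore have to contain two given points at once, which yields invariant affine neighbourhoods
  \<open>(U \<times> U) \<times> V\<close>; for \<open>M\<close> one point suffices.\<close>

locale charted_pair =
  fixes X :: "'x space" and M :: "'m space"
  assumes X: "regular_space X" and M: "regular_space M"
    and charts_X: "x \<in> points X \<Longrightarrow> y \<in> points X \<Longrightarrow> \<exists>U n \<zeta>. affine_chart X U n \<zeta> \<and> x \<in> U \<and> y \<in> U"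
    and charts_M: "m \<in> points M \<Longrightarrow> \<exists>V n \<eta>. affine_chart M V n \<eta> \<and> m \<in> V"
begin

abbreviation "XX \<equiv> prod_space X X"
abbreviation "Y \<equiv> XXM X M"
abbreviation "quot \<equiv> map_prod symq id :: ('x \<times> 'x) \<times> 'm \<Rightarrow> 'x set \<times> 'm"

lemma XX: "regular_space XX" and Y: "regular_space Y" and XM: "regular_space (prod_space X M)"
  by (intro regular_space_prod X M)+

lemma sym2: "regular_space (sym2 X)"
  unfolding sym2_def by (rule regular_space_quotient[OF XX])

lemma points_XX: "points XX = points X \<times> points X"
  by (rule points_prod[OF X X])

lemma points_Y: "points Y = (points X \<times> points X) \<times> points M"
  by (simp add: points_prod[OF XX M] points_XX)

lemma points_S2M: "points (prod_space (sym2 X) M) = quot ` points Y"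
proof -
  have "points (sym2 X) = symq ` (points X \<times> points X)"
    by (simp add: sym2_def points_quotient points_XX)
  then show ?thesis by (simp add: points_prod[OF sym2 M] points_Y map_prod_surj_on[OF refl])
qed

lemma swap12_swap12 [simp]: "swap12 (swap12 z) = z"
  by (simp add: swap12_def split: prod.splits)

lemma quot_swap12 [simp]: "quot (swap12 z) = quot z"
  by (auto simp: swap12_def symq_def split: prod.splits)

lemma quot_eq_iff: "quot z = quot w \<longleftrightarrow> z = w \<or> z = swap12 w"
proof -
  obtain a b m c d l where "z = ((a, b), m)" "w = ((c, d), l)" by (metis surj_pair)
  then show ?thesis by (auto simp: swap12_def symq_def doubleton_eq_iff)
qed

lemma swap12_simp [simp]: "swap12 ((x, y), m) = ((y, x), m)"
  by (simp add: swap12_def)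

lemma morphism_p13: "morphism Y (prod_space X M) p13"
proof -
  have "morphism Y (prod_space X M) (\<lambda>z. (fst (fst z), snd z))"
    by (intro morphism_pair[OF Y X M] morphism_comp[OF morphism_fst[OF XX M] morphism_fst[OF X X]]
        morphism_snd[OF XX M])
  then show ?thesis by (simp add: p13_def split_def)
qed

lemma morphism_p23: "morphism Y (prod_space X M) p23"
proof -
  have "morphism Y (prod_space X M) (\<lambda>z. (snd (fst z), snd z))"
    by (intro morphism_pair[OF Y X M] morphism_comp[OF morphism_fst[OF XX M] morphism_snd[OF X X]]
        morphism_snd[OF XX M])
  then show ?thesis by (simp add: p23_def split_def)
qed

lemma morphism_swap: "morphism XX XX prod.swap"
proof -
  have "morphism XX XX (\<lambda>z. (snd z, fst z))"
    by (intro morphism_pair[OF XX X X] morphism_fst[OF X X] morphism_snd[OF X X])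
  moreover have "(\<lambda>z. (snd z, fst z)) = (prod.swap :: 'x \<times> 'x \<Rightarrow> 'x \<times> 'x)" by auto
  ultimately show ?thesis by simp
qed

lemma morphism_swap12: "morphism Y Y swap12"
proof -
  have "morphism Y Y (\<lambda>z. (prod.swap (fst z), snd z))"
    by (intro morphism_pair[OF Y XX M] morphism_comp[OF morphism_fst[OF XX M] morphism_swap]
        morphism_snd[OF XX M])
  then show ?thesis by (simp add: swap12_def split_def prod.swap_def)
qed

text \<open>The sum of \<open>f\<close> and its mirror image is constant on the fibres of
  \<open>symq\<close>, and regularity on a quotient is by definition regularity of the
  pullback.\<close>

lemma symmetrize_function:
  assumes U: "openin (zariski X) U" and f: "f \<in> reg XX (U \<times> U)"
  shows "\<exists>F\<in>reg (sym2 X) (symq ` (U \<times> U)). \<forall>w\<in>U \<times> U. F (symq w) = f w + f (prod.swap w)"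
proof -
  note oUU = openin_prod_Times[OF X X U U]
  define g where "g w = f w + f (prod.swap w)" for w
  define F where "F s = g (SOME w. w \<in> U \<times> U \<and> symq w = s)" for s
  have Fg: "F (symq w) = g w" if w: "w \<in> U \<times> U" for w
  proof -
    define v where "v = (SOME v. v \<in> U \<times> U \<and> symq v = symq w)"
    have "v \<in> U \<times> U \<and> symq v = symq w"
      unfolding v_def by (rule someI[of _ w]) (use w in simp)
    then have "v = w \<or> v = prod.swap w"
      by (auto simp: symq_def doubleton_eq_iff split: prod.splits)
    then show ?thesis unfolding F_def v_def[symmetric] by (auto simp: g_def)
  qed
  have "(\<lambda>w. f (prod.swap w)) \<in> reg XX (U \<times> U)"
    by (rule morphism_reg'[OF morphism_swap XX oUU f oUU]) auto
  then have "g \<in> reg XX (U \<times> U)"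
    unfolding g_def[abs_def] by (rule reg_add[OF XX oUU f])
  then have "F \<circ> symq \<in> reg XX (U \<times> U)"
    by (rule reg_cong[OF XX oUU]) (simp add: Fg)
  moreover have "points XX \<inter> symq -` symq ` (U \<times> U) = U \<times> U"
    using openin_subset[OF oUU] by (auto simp: symq_def doubleton_eq_iff)
  ultimately have "F \<in> reg (sym2 X) (symq ` (U \<times> U))"
    by (simp add: sym2_def reg_quotient)
  moreover have "\<forall>w\<in>U \<times> U. F (symq w) = f w + f (prod.swap w)" using Fg by (simp add: g_def)
  ultimately show ?thesis by (intro bexI[of _ F])
qed

lemma openin_sym2:
  assumes U: "openin (zariski X) U"
  shows "openin (zariski (sym2 X)) (symq ` (U \<times> U))"
proof -
  note oUU = openin_prod_Times[OF X X U U]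
  have "points XX \<inter> symq -` symq ` (U \<times> U) = U \<times> U"
    using openin_subset[OF oUU] by (auto simp: symq_def doubleton_eq_iff)
  then show ?thesis
    using oUU openin_subset[OF oUU] by (auto simp: sym2_def openin_quotient_space)
qed

text \<open>The swap leaves the factor from \<open>M\<close> alone, so a pure tensor is symmetrized
  by symmetrizing its first component. Symmetrization is additive, which gives all tensor
  functions.\<close>

lemma symmetrize_tensor:
  assumes U: "openin (zariski X) U" and V: "openin (zariski M) V"
    and h: "h \<in> tensor_functions XX M (U \<times> U) V"
  shows "\<exists>T\<in>tensor_functions (sym2 X) M (symq ` (U \<times> U)) V.
    \<forall>z\<in>(U \<times> U) \<times> V. T (quot z) = h z + h (swap12 z)"
  using h
proof (induction rule: tensor_induct)
  case zero
  show ?case by (rule bexI[of _ "\<lambda>_. 0"]) (simp_all add: tensor_zero)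
next
  case (add f g h)
  from add(4) obtain T where T: "T \<in> tensor_functions (sym2 X) M (symq ` (U \<times> U)) V"
    "\<forall>z\<in>(U \<times> U) \<times> V. T (quot z) = h z + h (swap12 z)" by (elim bexE)
  from symmetrize_function[OF U add(1)] obtain F where F: "F \<in> reg (sym2 X) (symq ` (U \<times> U))"
    "\<forall>w\<in>U \<times> U. F (symq w) = f w + f (prod.swap w)" by (elim bexE)
  show ?case
  proof (rule bexI[of _ "\<lambda>w. F (fst w) * g (snd w) + T w"])
    show "(\<lambda>w. F (fst w) * g (snd w) + T w) \<in> tensor_functions (sym2 X) M (symq ` (U \<times> U)) V"
      by (intro tensor_add tensor_pure F T add)
    show "\<forall>z\<in>(U \<times> U) \<times> V. F (fst (quot z)) * g (snd (quot z)) + T (quot z)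
        = f (fst z) * g (snd z) + h z + (f (fst (swap12 z)) * g (snd (swap12 z)) + h (swap12 z))"
      using F(2) T(2) by (auto simp: algebra_simps)
  qed
qed

lemma chart_polys_tensor:
  assumes c: "affine_chart XX W n \<xi>" and d: "affine_chart M V m \<eta>" and p: "p \<in> polys (n + m)"
  shows "(\<lambda>z. p (join_coords n \<xi> \<eta> z)) \<in> tensor_functions XX M W V"
proof -
  note oW = affine_chart_open[OF c] and oV = affine_chart_open[OF d]
  show ?thesis
    using p
  proof (induction rule: polys.induct)
    case (const c)
    show ?case by (rule tensor_const[OF XX M oW oV])
  next
    case (coord k)
    show ?case
    proof (cases "k < n")
      case True
      then show ?thesis
        using tensor_pure[OF affine_chart_coord[OF c True] reg_const[OF M oV, of 1]]
        by (simp add: join_coords_def)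
    next
      case False
      then have "k - n < m" using coord by simp
      from tensor_pure[OF reg_const[OF XX oW, of 1] affine_chart_coord[OF d this]] False
      show ?thesis by (simp add: join_coords_def)
    qed
  next
    case (add p q)
    then show ?case by (intro tensor_add)
  next
    case (mult p q)
    then show ?case by (intro tensor_mult XX M oW oV)
  qed
qed

text \<open>
  If \<open>f = p/q\<close> near \<open>z0\<close> and \<open>r\<close> vanishes at \<open>swap12 z0\<close> but not at \<open>z0\<close>, then the
  symmetrizations of \<open>p q r\<close> and \<open>q\<^sup>2 r\<close> represent \<open>f\<close> as an invariant fraction.
\<close>

lemma invariant_fraction:
  assumes W: "openin (zariski Y) W" and sym: "\<And>z. z \<in> W \<Longrightarrow> swap12 z \<in> W"
    and f: "f \<in> reg Y W" "\<And>z. z \<in> W \<Longrightarrow> f (swap12 z) = f z" and z0: "z0 \<in> W"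
  obtains U V P Q where "openin (zariski X) U" "openin (zariski M) V" "z0 \<in> (U \<times> U) \<times> V"
    "P \<in> tensor_functions (sym2 X) M (symq ` (U \<times> U)) V" "Q \<in> tensor_functions (sym2 X) M (symq ` (U \<times> U)) V"
    "Q (quot z0) \<noteq> 0" "\<forall>z\<in>(U \<times> U) \<times> V. Q (quot z) \<noteq> 0 \<longrightarrow> z \<in> W \<and> f z = P (quot z) / Q (quot z)"
proof -
  have "z0 \<in> (points X \<times> points X) \<times> points M" using openin_subset[OF W] z0 points_Y by blast
  then obtain x y m where z0e: "z0 = ((x, y), m)" "x \<in> points X" "y \<in> points X" "m \<in> points M" by auto
  obtain U n \<zeta> where c: "affine_chart X U n \<zeta>" and xU: "x \<in> U" "y \<in> U" using charts_X[OF z0e(2,3)] by auto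
  obtain V k \<eta> where d: "affine_chart M V k \<eta>" and mV: "m \<in> V" using charts_M[OF z0e(4)] by auto
  note cc = affine_chart_prod[OF X X c c]
  define \<xi> where "\<xi> = join_coords (n + n) (join_coords n \<zeta> \<zeta>) \<eta>"
  let ?K = "(U \<times> U) \<times> V"
  note ccd = affine_chart_prod[OF XX M cc d, folded \<xi>_def]
  note oU = affine_chart_open[OF c] and oV = affine_chart_open[OF d]
  have zK: "z0 \<in> ?K" using z0e xU mV by simp
  have sK: "swap12 z \<in> ?K" if "z \<in> ?K" for z using that by auto
  obtain p q where pq: "p \<in> polys (n + n + k)" "q \<in> polys (n + n + k)" "q (\<xi> z0) \<noteq> 0"
    "\<forall>z\<in>?K. q (\<xi> z) \<noteq> 0 \<longrightarrow> z \<in> W \<and> f z = p (\<xi> z) / q (\<xi> z)"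
    by (rule affine_chart_fraction[OF ccd W f(1) z0 zK])
  obtain r where r: "r \<in> polys (n + n + k)" "r (\<xi> z0) \<noteq> 0" "swap12 z0 \<noteq> z0 \<Longrightarrow> r (\<xi> (swap12 z0)) = 0"
  proof (cases "swap12 z0 = z0")
    case True
    then show ?thesis using that[of "\<lambda>_. 1"] polys.const[of 1] by simp
  next
    case False
    obtain l where l: "l < n + n + k" "\<xi> (swap12 z0) l \<noteq> \<xi> z0 l"
      using affine_chart_separates[OF ccd sK[OF zK] zK False] by auto
    then show ?thesis
      using that[OF polys_diff[OF polys.coord[OF l(1)] polys.const[of "\<xi> (swap12 z0) l"]]] by simp
  qed
  define a where "a v = p v * q v * r v" for v
  define b where "b v = q v * q v * r v" for v
  have ab: "a \<in> polys (n + n + k)" "b \<in> polys (n + n + k)"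
    unfolding a_def[abs_def] b_def[abs_def] by (intro polys.mult pq r)+
  note tens = symmetrize_tensor[OF oU oV chart_polys_tensor[OF cc d], folded \<xi>_def]
  from tens[OF ab(1)] obtain P where P: "P \<in> tensor_functions (sym2 X) M (symq ` (U \<times> U)) V"
    "\<forall>z\<in>?K. P (quot z) = a (\<xi> z) + a (\<xi> (swap12 z))" by (elim bexE)
  from tens[OF ab(2)] obtain Q where Q: "Q \<in> tensor_functions (sym2 X) M (symq ` (U \<times> U)) V"
    "\<forall>z\<in>?K. Q (quot z) = b (\<xi> z) + b (\<xi> (swap12 z))" by (elim bexE)
  \<comment> \<open>Both \<open>a\<close> and \<open>b\<close> carry a factor \<open>q\<close>, so
    the identity survives where \<open>q\<close> vanishes and the fraction for \<open>f\<close> is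
    meaningless. This allows it to be added to its mirror image.\<close>
  have fb: "f z * b (\<xi> z) = a (\<xi> z)" if "z \<in> ?K" for z
  proof (cases "q (\<xi> z) = 0")
    case False
    then have "f z = p (\<xi> z) / q (\<xi> z)" using bspec[OF pq(4) that] by simp
    then show ?thesis using False by (simp add: a_def b_def)
  qed (simp add: a_def b_def)
  show ?thesis
  proof (rule that[OF oU oV zK P(1) Q(1)])
    have Qz: "Q (quot z0) = b (\<xi> z0) + b (\<xi> (swap12 z0))" by (rule bspec[OF Q(2) zK])
    have b0: "b (\<xi> z0) \<noteq> 0" using pq(3) r(2) by (simp add: b_def)
    show "Q (quot z0) \<noteq> 0"
    proof (cases "swap12 z0 = z0")
      case True
      then show ?thesis using Qz b0 by (simp only:) simp
    next
      case False
      then have "b (\<xi> (swap12 z0)) = 0" using r(3) by (simp add: b_def)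
      then show ?thesis using Qz b0 by (simp only:) simp
    qed
    show "\<forall>z\<in>?K. Q (quot z) \<noteq> 0 \<longrightarrow> z \<in> W \<and> f z = P (quot z) / Q (quot z)"
    proof (intro ballI impI conjI)
      fix z assume z: "z \<in> ?K" and Q0: "Q (quot z) \<noteq> 0"
      have "Q (quot z) = b (\<xi> z) + b (\<xi> (swap12 z))" using Q(2) z by blast
      then have "b (\<xi> z) \<noteq> 0 \<or> b (\<xi> (swap12 z)) \<noteq> 0" using Q0 by auto
      then have "q (\<xi> z) \<noteq> 0 \<or> q (\<xi> (swap12 z)) \<noteq> 0" by (auto simp: b_def)
      then have "z \<in> W \<or> swap12 z \<in> W" using bspec[OF pq(4) z] bspec[OF pq(4) sK[OF z]] by metis
      then show zW: "z \<in> W" using sym[of "swap12 z"] by auto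
      have "f z * b (\<xi> (swap12 z)) = a (\<xi> (swap12 z))" using fb[OF sK[OF z]] f(2)[OF zW] by simp
      then have "f z * Q (quot z) = P (quot z)"
        using fb[OF z] bspec[OF P(2) z] bspec[OF Q(2) z] by (simp add: distrib_left)
      then show "f z = P (quot z) / Q (quot z)" using Q0 by (simp add: field_simps)
    qed
  qed
qed

text \<open>The topology of \<open>prod_space (sym2 X) M\<close> is generated by tensor functions of
  the two factors, not as a quotient of \<open>Y\<close>. Around each point a function
  \<open>Q\<close> on the quotient is needed whose nonvanishing locus stays inside
  \<open>W'\<close>; \<open>invariant_fraction\<close>, applied to the zero function, supplies
  it.\<close>

lemma openin_S2M:
  assumes W': "W' \<subseteq> points (prod_space (sym2 X) M)"
    and W: "openin (zariski Y) (points Y \<inter> quot -` W')"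
  shows "openin (zariski (prod_space (sym2 X) M)) W'"
proof (subst openin_subopen, rule)
  fix w assume w: "w \<in> W'"
  then have "w \<in> quot ` points Y" using W' points_S2M by (metis subsetD)
  then obtain z0 where z0: "z0 \<in> points Y" "w = quot z0" by (elim imageE) simp
  let ?W = "points Y \<inter> quot -` W'"
  have sym: "swap12 z \<in> ?W" if "z \<in> ?W" for z
    using that morphism_points[OF morphism_swap12] by simp
  have zW: "z0 \<in> ?W" using w z0 by simp
  obtain U V P Q where 1: "openin (zariski X) U" "openin (zariski M) V" "z0 \<in> (U \<times> U) \<times> V"
    "P \<in> tensor_functions (sym2 X) M (symq ` (U \<times> U)) V" "Q \<in> tensor_functions (sym2 X) M (symq ` (U \<times> U)) V"
    "Q (quot z0) \<noteq> 0" "\<forall>z\<in>(U \<times> U) \<times> V. Q (quot z) \<noteq> 0 \<longrightarrow> z \<in> ?W \<and> 0 = P (quot z) / Q (quot z)"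
    by (rule invariant_fraction[OF W sym reg_const[OF Y W, of 0] refl zW])
  let ?O = "{v \<in> symq ` (U \<times> U) \<times> V. Q v \<noteq> 0}"
  have "openin (zariski (prod_space (sym2 X) M)) ?O"
    by (rule openin_prod_basic[OF openin_sym2[OF 1(1)] 1(2,5)])
  moreover have "w \<in> ?O" using 1(3,6) z0(2) by auto
  moreover have "?O \<subseteq> W'"
  proof
    fix v assume v: "v \<in> ?O"
    then obtain z where "z \<in> (U \<times> U) \<times> V" "v = quot z" by force
    then show "v \<in> W'" using bspec[OF 1(7), of z] v by simp
  qed
  ultimately show "\<exists>T. openin (zariski (prod_space (sym2 X) M)) T \<and> w \<in> T \<and> T \<subseteq> W'" by blast
qed

text \<open>The fraction from \<open>invariant_fraction\<close> has numerator and denominator on the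
  quotient, which is the local form that regular functions on a product must have. This lets
  invariant transition matrices descend.\<close>

lemma reg_S2M:
  assumes W': "W' \<subseteq> points (prod_space (sym2 X) M)"
    and W: "openin (zariski Y) (points Y \<inter> quot -` W')"
    and f: "(\<lambda>z. f (quot z)) \<in> reg Y (points Y \<inter> quot -` W')"
  shows "f \<in> reg (prod_space (sym2 X) M) W'"
proof (rule reg_prodI)
  fix w assume w: "w \<in> W'"
  then have "w \<in> quot ` points Y" using W' points_S2M by (metis subsetD)
  then obtain z0 where z0: "z0 \<in> points Y" "w = quot z0" by (elim imageE) simp
  let ?W = "points Y \<inter> quot -` W'"
  have sym: "swap12 z \<in> ?W" if "z \<in> ?W" for z
    using that morphism_points[OF morphism_swap12] by simp
  have zW: "z0 \<in> ?W" using w z0 by simp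
  have inv: "f (quot (swap12 z)) = f (quot z)" for z by simp
  obtain U V P Q where 1: "openin (zariski X) U" "openin (zariski M) V" "z0 \<in> (U \<times> U) \<times> V"
    "P \<in> tensor_functions (sym2 X) M (symq ` (U \<times> U)) V" "Q \<in> tensor_functions (sym2 X) M (symq ` (U \<times> U)) V"
    "Q (quot z0) \<noteq> 0" "\<forall>z\<in>(U \<times> U) \<times> V. Q (quot z) \<noteq> 0 \<longrightarrow> z \<in> ?W \<and> f (quot z) = P (quot z) / Q (quot z)"
    by (rule invariant_fraction[OF W sym f inv zW])
  show "\<exists>U V p q. openin (zariski (sym2 X)) U \<and> openin (zariski M) V \<and> w \<in> U \<times> V \<and>
    p \<in> tensor_functions (sym2 X) M U V \<and> q \<in> tensor_functions (sym2 X) M U V \<and> q w \<noteq> 0 \<and>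
    (\<forall>v\<in>W' \<inter> (U \<times> V). q v \<noteq> 0 \<longrightarrow> f v = p v / q v)"
  proof (intro exI conjI ballI impI)
    show "openin (zariski (sym2 X)) (symq ` (U \<times> U))" by (rule openin_sym2[OF 1(1)])
    show "w \<in> symq ` (U \<times> U) \<times> V" using 1(3) z0(2) by auto
    show "Q w \<noteq> 0" using 1(6) z0(2) by simp
    fix v assume v: "v \<in> W' \<inter> (symq ` (U \<times> U) \<times> V)" "Q v \<noteq> 0"
    then obtain z where "z \<in> (U \<times> U) \<times> V" "v = quot z" by force
    then show "f v = P v / Q v" using bspec[OF 1(7), of z] v(2) by simp
  qed (fact 1)+
qed

end

section \<open>Local equations of the diagonal of a smooth curve\<close>

lemma eventually_zariski:
  assumes "w \<in> points S"
  shows "(\<forall>\<^sub>F v in nhdsin (zariski S) w. P v) \<longleftrightarrow> (\<exists>U. openin (zariski S) U \<and> w \<in> U \<and> (\<forall>v\<in>U. P v))"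
  using assms by (simp add: eventually_nhdsin)

lemma regular_at_points: "regular_at S x f \<Longrightarrow> x \<in> points S"
  unfolding regular_at_def using openin_subset by blast

lemma regular_atI: "openin (zariski S) U \<Longrightarrow> x \<in> U \<Longrightarrow> f \<in> reg S U \<Longrightarrow> regular_at S x f"
  unfolding regular_at_def by blast

lemma regular_at_const: "regular_space S \<Longrightarrow> x \<in> points S \<Longrightarrow> regular_at S x (\<lambda>_. c)"
  by (rule regular_atI[OF openin_topspace]) (auto intro: reg_const)

lemma regular_at_pair:
  assumes S: "regular_space S" and f: "regular_at S x f" and g: "regular_at S x g"
  obtains U where "openin (zariski S) U" "x \<in> U" "f \<in> reg S U" "g \<in> reg S U"
proof -
  obtain U where U: "openin (zariski S) U" "x \<in> U" "f \<in> reg S U" using f unfolding regular_at_def by auto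
  obtain V where V: "openin (zariski S) V" "x \<in> V" "g \<in> reg S V" using g unfolding regular_at_def by auto
  note o = openin_Int[OF U(1) V(1)]
  show ?thesis
    by (rule that[OF o _ reg_mono[OF S U(1) o Int_lower1 U(3)] reg_mono[OF S V(1) o Int_lower2 V(3)]])
      (use U V in auto)
qed

lemma regular_at_add:
  assumes S: "regular_space S" and f: "regular_at S x f" and g: "regular_at S x g"
  shows "regular_at S x (\<lambda>y. f y + g y)"
proof -
  obtain U where "openin (zariski S) U" "x \<in> U" "f \<in> reg S U" "g \<in> reg S U"
    by (rule regular_at_pair[OF assms])
  then show ?thesis by (intro regular_atI[of S U]) (auto intro: reg_add[OF S])
qed

lemma regular_at_mult:
  assumes S: "regular_space S" and f: "regular_at S x f" and g: "regular_at S x g"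
  shows "regular_at S x (\<lambda>y. f y * g y)"
proof -
  obtain U where "openin (zariski S) U" "x \<in> U" "f \<in> reg S U" "g \<in> reg S U"
    by (rule regular_at_pair[OF assms])
  then show ?thesis by (intro regular_atI[of S U]) (auto intro: reg_mult[OF S])
qed

lemma regular_at_diff:
  assumes S: "regular_space S" and f: "regular_at S x f" and g: "regular_at S x g"
  shows "regular_at S x (\<lambda>y. f y - g y)"
proof -
  obtain U where "openin (zariski S) U" "x \<in> U" "f \<in> reg S U" "g \<in> reg S U"
    by (rule regular_at_pair[OF assms])
  then show ?thesis by (intro regular_atI[of S U]) (auto intro: reg_diff[OF S])
qed

lemma regular_at_sum:
  assumes "regular_space S" "x \<in> points S" "\<And>i. i \<in> A \<Longrightarrow> regular_at S x (f i)"
  shows "regular_at S x (\<lambda>y. \<Sum>i\<in>A. f i y)"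
  using assms(3)
  by (induction A rule: infinite_finite_induct)
    (auto intro: regular_at_const regular_at_add assms(1,2))

lemma regular_at_inverse:
  assumes S: "regular_space S" and f: "regular_at S x f" and nz: "f x \<noteq> 0"
  shows "regular_at S x (\<lambda>y. inverse (f y))"
proof -
  obtain U where U: "openin (zariski S) U" "x \<in> U" "f \<in> reg S U" using f unfolding regular_at_def by auto
  show ?thesis
    by (rule regular_atI[OF reg_open[OF S U(1,3)] _ reg_inverse'[OF S U(1,3)]]) (use U(2) nz in auto)
qed

lemma eventually_nonzero:
  assumes S: "regular_space S" and f: "regular_at S x f" and nz: "f x \<noteq> 0"
  shows "\<forall>\<^sub>F y in nhdsin (zariski S) x. f y \<noteq> 0"
proof -
  obtain U where U: "openin (zariski S) U" "x \<in> U" "f \<in> reg S U" using f unfolding regular_at_def by auto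
  show ?thesis
    unfolding eventually_zariski[OF regular_at_points[OF f]]
    by (intro exI[of _ "{y \<in> U. f y \<noteq> 0}"] conjI reg_open[OF S U(1,3)]) (use U(2) nz in auto)
qed

lemma regular_at_comp:
  assumes "morphism R S \<phi>" "w \<in> points R" "regular_at S (\<phi> w) f"
  shows "regular_at R w (\<lambda>v. f (\<phi> v))"
proof -
  obtain U where U: "openin (zariski S) U" "\<phi> w \<in> U" "f \<in> reg S U" using assms(3) unfolding regular_at_def by auto
  show ?thesis
    by (rule regular_atI[OF morphism_openin[OF assms(1) U(1)]])
      (use morphism_reg[OF assms(1) U(1,3)] U(2) assms(2) in \<open>auto simp: comp_def\<close>)
qed

lemma eventually_comp:
  assumes "morphism R S \<phi>" "w \<in> points R" "\<forall>\<^sub>F v in nhdsin (zariski S) (\<phi> w). P v"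
  shows "\<forall>\<^sub>F v in nhdsin (zariski R) w. P (\<phi> v)"
proof -
  obtain U where U: "openin (zariski S) U" "\<phi> w \<in> U" "\<forall>v\<in>U. P v"
    using assms(3) unfolding eventually_zariski[OF morphism_points[OF assms(1,2)]] by auto
  show ?thesis
    unfolding eventually_zariski[OF assms(2)]
    by (rule exI[of _ "points R \<inter> \<phi> -` U"]) (use U assms(2) morphism_openin[OF assms(1) U(1)] in auto)
qed

text \<open>Identities of germs are treated as \<open>eventually\<close> statements, so that several
  of them combine without naming the neighbourhoods.\<close>

lemma same_germ_eventually:
  assumes "x \<in> points S"
  shows "same_germ S x f g \<longleftrightarrow> (\<forall>\<^sub>F y in nhdsin (zariski S) x. f y = g y)"
  unfolding eventually_zariski[OF assms] same_germ_def ..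

text \<open>A basis of \<open>W\<close> stays independent when \<open>f\<close> is added; the
  functional is prescribed on the enlarged set and extended. This covers infinite-dimensional spaces
  such as spaces of germs, and serves to construct tangent vectors.\<close>

lemma fun_vs_functional:
  fixes f :: "'b \<Rightarrow> complex"
  assumes W: "fun_vs.subspace W" and f: "f \<notin> W"
  obtains l :: "('b \<Rightarrow> complex) \<Rightarrow> complex" where "\<And>a b. l (\<lambda>x. a x + b x) = l a + l b"
    "\<And>c a. l (\<lambda>x. c * a x) = c * l a" "l f = 1" "\<And>w. w \<in> W \<Longrightarrow> l w = 0"
proof -
  interpret p: vector_space_pair "\<lambda>(c::complex) (f::'b \<Rightarrow> complex) x. c * f x" "(*) :: complex \<Rightarrow> complex \<Rightarrow> complex"
    by (intro vector_space_pair.intro fun_vs.vector_space_axioms vector_space.intro)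
      (simp_all add: algebra_simps)
  obtain B where B: "B \<subseteq> W" "fun_vs.independent B" "W \<subseteq> fun_vs.span B" "card B = fun_vs.dim W"
    by (rule fun_vs.basis_exists)
  have "fun_vs.span B \<subseteq> W" by (rule fun_vs.span_minimal[OF B(1) W])
  then have fB: "f \<notin> fun_vs.span B" using f by blast
  then have "fun_vs.independent (insert f B)" by (rule fun_vs.independent_insertI[OF _ B(2)])
  from p.linear_independent_extend[OF this, of "\<lambda>b. if b = f then 1 else 0"] obtain l where
    l: "Vector_Spaces.linear (\<lambda>(c::complex) (f::'b \<Rightarrow> complex) x. c * f x) (*) l"
    and v: "\<forall>b\<in>insert f B. l b = (if b = f then 1 else 0)" by auto
  have "f \<notin> B" using fB fun_vs.span_base by metis
  then have "l b = 0" if "b \<in> B" for b using v that by auto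
  then have z: "l w = 0" if "w \<in> W" for w
    using p.linear_eq_0_on_span[OF l] B(3) that by (metis subsetD)
  show ?thesis
  proof (rule that)
    show "l (\<lambda>x. a x + b x) = l a + l b" for a b
      using Vector_Spaces.linear.axioms(3)[OF l] p.linear_add[OF l, of a b] by (simp add: plus_fun_def)
    show "l (\<lambda>x. c * a x) = c * l a" for c a by (rule p.linear_scale[OF l])
    show "l f = 1" using v by simp
    show "\<And>w. w \<in> W \<Longrightarrow> l w = 0" by (rule z)
  qed
qed

section \<open>Tangent vectors and the square of the maximal ideal\<close>

lemma tangent_space_const: "D \<in> tangent_space S x \<Longrightarrow> D (\<lambda>_. c) = 0"
  and tangent_space_add: "D \<in> tangent_space S x \<Longrightarrow> regular_at S x f \<Longrightarrow> regular_at S x g \<Longrightarrow>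
    D (\<lambda>y. f y + g y) = D f + D g"
  and tangent_space_mult: "D \<in> tangent_space S x \<Longrightarrow> regular_at S x f \<Longrightarrow> regular_at S x g \<Longrightarrow>
    D (\<lambda>y. f y * g y) = f x * D g + g x * D f"
  and tangent_space_germ: "D \<in> tangent_space S x \<Longrightarrow> regular_at S x f \<Longrightarrow> regular_at S x g \<Longrightarrow>
    same_germ S x f g \<Longrightarrow> D f = D g"
  and tangent_space_nonregular: "D \<in> tangent_space S x \<Longrightarrow> \<not> regular_at S x f \<Longrightarrow> D f = 0"
  unfolding tangent_space_def by simp_all

text \<open>The functions whose germ lies in C + m^2, where m is the maximal ideal of the local ring
  at \<open>x\<close>. The constants are included because a derivation kills them too.\<close>

definition square_germs :: "'a space \<Rightarrow> 'a \<Rightarrow> ('a \<Rightarrow> complex) set" where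
  "square_germs S x = {f. \<exists>c (N::nat) a b. (\<forall>j<N. regular_at S x (a j) \<and> regular_at S x (b j) \<and>
      a j x = 0 \<and> b j x = 0) \<and> (\<forall>\<^sub>F y in nhdsin (zariski S) x. f y = c + (\<Sum>j<N. a j y * b j y))}"

lemma square_germsI:
  assumes "\<forall>j<(N::nat). regular_at S x (a j) \<and> regular_at S x (b j) \<and> a j x = 0 \<and> b j x = 0"
    "\<forall>\<^sub>F y in nhdsin (zariski S) x. f y = c + (\<Sum>j<N. a j y * b j y)"
  shows "f \<in> square_germs S x"
  unfolding square_germs_def using assms
  by (intro CollectI exI[of _ c] exI[of _ N] exI[of _ a] exI[of _ b]) simp

lemma square_germsE:
  assumes "f \<in> square_germs S x"
  obtains c N a b where "\<forall>j<(N::nat). regular_at S x (a j) \<and> regular_at S x (b j) \<and> a j x = 0 \<and> b j x = 0"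
    "\<forall>\<^sub>F y in nhdsin (zariski S) x. f y = c + (\<Sum>j<N. a j y * b j y)"
  using assms unfolding square_germs_def by (elim CollectE exE conjE)

lemma subspace_square_germs:
  assumes S: "regular_space S" and x: "x \<in> points S"
  shows "fun_vs.subspace (square_germs S x)"
  unfolding fun_vs.subspace_def
proof (intro conjI ballI allI)
  show "0 \<in> square_germs S x"
    by (rule square_germsI[of 0 _ _ "\<lambda>_ _. 0" "\<lambda>_ _. 0" _ 0]) auto
next
  fix f g assume f: "f \<in> square_germs S x" and g: "g \<in> square_germs S x"
  obtain c N a b where 1: "\<forall>j<(N::nat). regular_at S x (a j) \<and> regular_at S x (b j) \<and> a j x = 0 \<and> b j x = 0"
    "\<forall>\<^sub>F y in nhdsin (zariski S) x. f y = c + (\<Sum>j<N. a j y * b j y)" by (rule square_germsE[OF f])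
  obtain c' N' a' b' where 2: "\<forall>j<(N'::nat). regular_at S x (a' j) \<and> regular_at S x (b' j) \<and> a' j x = 0 \<and> b' j x = 0"
    "\<forall>\<^sub>F y in nhdsin (zariski S) x. g y = c' + (\<Sum>j<N'. a' j y * b' j y)" by (rule square_germsE[OF g])
  have split: "(\<Sum>k<N + m. F k) = (\<Sum>k<N. F k) + (\<Sum>k<m. F (N + k))" for F :: "nat \<Rightarrow> complex" and m
    by (induction m) auto
  show "f + g \<in> square_germs S x"
  proof (rule square_germsI[of "N + N'" _ _ "\<lambda>j. if j < N then a j else a' (j - N)"
        "\<lambda>j. if j < N then b j else b' (j - N)" _ "c + c'"])
    show "\<forall>\<^sub>F y in nhdsin (zariski S) x. (f + g) y = c + c' + (\<Sum>j<N + N'. (if j < N then a j else a' (j - N)) y *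
        (if j < N then b j else b' (j - N)) y)"
      using 1(2) 2(2) unfolding split by eventually_elim simp
  qed (use 1(1) 2(1) in auto)
next
  fix k f assume f: "f \<in> square_germs S x"
  obtain c N a b where 1: "\<forall>j<(N::nat). regular_at S x (a j) \<and> regular_at S x (b j) \<and> a j x = 0 \<and> b j x = 0"
    "\<forall>\<^sub>F y in nhdsin (zariski S) x. f y = c + (\<Sum>j<N. a j y * b j y)" by (rule square_germsE[OF f])
  show "(\<lambda>y. k * f y) \<in> square_germs S x"
  proof (rule square_germsI[of N _ _ "\<lambda>j y. k * a j y" b _ "k * c"])
    show "\<forall>\<^sub>F y in nhdsin (zariski S) x. k * f y = k * c + (\<Sum>j<N. k * a j y * b j y)"
      using 1(2) by eventually_elim (simp add: algebra_simps sum_distrib_left)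
  qed (use 1(1) in \<open>auto intro!: regular_at_mult regular_at_const S x\<close>)
qed

text \<open>A functional that kills C + m^2 is a derivation: g h - g(x) h - h(x) g differs from (g -
  g(x)) (h - h(x)) by a constant, which gives the Leibniz rule. Such a functional can be chosen with
  value 1 at a germ outside this space.\<close>

lemma tangent_vector_exists:
  assumes S: "regular_space S" and f: "regular_at S x f" "f \<notin> square_germs S x"
  shows "\<exists>D\<in>tangent_space S x. D f \<noteq> 0"
proof -
  note x = regular_at_points[OF f(1)]
  obtain l :: "('a \<Rightarrow> complex) \<Rightarrow> complex" where l: "\<And>a b. l (\<lambda>x. a x + b x) = l a + l b"
    "\<And>c a. l (\<lambda>x. c * a x) = c * l a" "l f = 1" "\<And>w. w \<in> square_germs S x \<Longrightarrow> l w = 0"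
    by (rule fun_vs_functional[OF subspace_square_germs[OF S x] f(2)]) (rule that)
  have const: "l (\<lambda>_. c) = 0" for c
    by (rule l(4), rule square_germsI[of 0 _ _ "\<lambda>_ _. 0" "\<lambda>_ _. 0" _ c]) auto
  define D where "D g = (if regular_at S x g then l g else 0)" for g
  have "D \<in> tangent_space S x"
    unfolding tangent_space_def
  proof (intro CollectI conjI allI impI)
    fix g assume "\<not> regular_at S x g" then show "D g = 0" by (simp add: D_def)
  next
    fix g h assume *: "regular_at S x g \<and> regular_at S x h \<and> same_germ S x g h"
    then have "\<forall>\<^sub>F y in nhdsin (zariski S) x. g y = h y" using same_germ_eventually[OF x] by blast
    then have "\<forall>\<^sub>F y in nhdsin (zariski S) x. g y + (-1) * h y = 0 + (\<Sum>j<(0::nat). 0 * 0)"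
      by eventually_elim simp
    then have "(\<lambda>y. g y + (-1) * h y) \<in> square_germs S x"
      by (rule square_germsI[of 0 _ _ "\<lambda>_ _. 0" "\<lambda>_ _. 0", rotated]) auto
    then have "l (\<lambda>y. g y + (-1) * h y) = 0" by (rule l(4))
    then have "l g + (-1) * l h = 0" by (simp only: l(1) l(2))
    then show "D g = D h" using * by (simp add: D_def)
  next
    fix c show "D (\<lambda>_. c) = 0" by (simp add: D_def const)
  next
    fix g h assume *: "regular_at S x g \<and> regular_at S x h"
    then have gh: "regular_at S x g" "regular_at S x h" by auto
    show "D (\<lambda>y. g y + h y) = D g + D h"
      using gh regular_at_add[OF S gh] by (simp add: D_def l(1))
    have "(\<lambda>y. g y * h y + ((- g x) * h y + (- h x) * g y)) \<in> square_germs S x"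
    proof (rule square_germsI[of 1 _ _ "\<lambda>_ y. g y - g x" "\<lambda>_ y. h y - h x" _ "- g x * h x"])
      show "\<forall>\<^sub>F y in nhdsin (zariski S) x. g y * h y + ((- g x) * h y + (- h x) * g y) =
          - g x * h x + (\<Sum>j<(1::nat). (g y - g x) * (h y - h x))"
        by (simp add: algebra_simps)
    qed (auto intro!: regular_at_diff[OF S] regular_at_const[OF S x] gh)
    then have "l (\<lambda>y. g y * h y + ((- g x) * h y + (- h x) * g y)) = 0" by (rule l(4))
    then have "l (\<lambda>y. g y * h y) + ((- g x) * l h + (- h x) * l g) = 0" by (simp only: l(1) l(2))
    then show "D (\<lambda>y. g y * h y) = g x * D h + h x * D g"
      using gh regular_at_mult[OF S gh] by (simp add: D_def algebra_simps eq_neg_iff_add_eq_0)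
  qed
  moreover have "D f \<noteq> 0" using f(1) l(3) by (simp add: D_def)
  ultimately show ?thesis by (intro bexI[of _ D])
qed

text \<open>Let D0 span the tangent line. It cannot kill all coordinates, for then it would kill
  polynomials and hence fractions. With \<open>k0\<close> a coordinate it does not kill and
  \<open>e k\<close> the ratio of its values, every tangent vector kills \<zeta> k - e k \<zeta> k0;
  by \<open>tangent_vector_exists\<close> this function then lies in C + m^2.\<close>

lemma tangent_line_expansion:
  assumes S: "regular_space S" and c: "affine_chart S U n \<zeta>" and x: "x \<in> U"
    and dim: "vector_space.dim (\<lambda>c D f. c * D f) (tangent_space S x) = 1"
  obtains k0 e where "k0 < n"
    "\<And>k. k < n \<Longrightarrow> (\<lambda>y. \<zeta> y k - e k * \<zeta> y k0) \<in> square_germs S x"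
proof -
  note oU = affine_chart_open[OF c]
  have xp: "x \<in> points S" using openin_subset[OF oU] x by blast
  obtain B where B: "B \<subseteq> tangent_space S x" "fun_vs.independent B" "tangent_space S x \<subseteq> fun_vs.span B"
    "card B = fun_vs.dim (tangent_space S x)" by (rule fun_vs.basis_exists)
  \<comment> \<open>The hypothesis \<open>dim\<close> uses the same scaling of functions as the
    interpretation \<open>fun_vs\<close>, so it speaks about \<open>fun_vs.dim\<close>.\<close>
  then have "card B = 1" using dim by simp
  then obtain D0 where D0: "B = {D0}" by (rule card_1_singletonE)
  then have DT: "D0 \<in> tangent_space S x" using B(1) by simp
  have Dnz: "D0 \<noteq> 0" using B(2) D0 by auto
  have span: "\<exists>k. D = (\<lambda>f. k * D0 f)" if "D \<in> tangent_space S x" for D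
  proof -
    have "D \<in> fun_vs.span {D0}" by (rule subsetD[OF B(3)[unfolded D0] that])
    then have "D \<in> range (\<lambda>k f. k * D0 f)" by (simp only: fun_vs.span_singleton)
    then show ?thesis by (rule imageE) (rule exI)
  qed
  have reg: "regular_at S x (\<lambda>y. p (\<zeta> y))" if "p \<in> polys n" for p
    by (rule regular_atI[OF oU x affine_chart_polys[OF c that]])
  have regc: "regular_at S x (\<lambda>y. \<zeta> y k)" if "k < n" for k
    by (rule regular_atI[OF oU x affine_chart_coord[OF c that]])
  have "\<exists>k0<n. D0 (\<lambda>y. \<zeta> y k0) \<noteq> 0"
  proof (rule ccontr)
    assume "\<not> ?thesis"
    then have z: "D0 (\<lambda>y. \<zeta> y k) = 0" if "k < n" for k using that by simp
    have Dp: "D0 (\<lambda>y. p (\<zeta> y)) = 0" if "p \<in> polys n" for p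
      using that
    proof (induction rule: polys.induct)
      case (add p q)
      then show ?case using tangent_space_add[OF DT reg[OF add(1)] reg[OF add(2)]] by simp
    next
      case (mult p q)
      then show ?case using tangent_space_mult[OF DT reg[OF mult(1)] reg[OF mult(2)]] by simp
    qed (simp_all add: tangent_space_const[OF DT] z)
    have "D0 f = 0" for f
    proof (cases "regular_at S x f")
      case True
      then obtain W where W: "openin (zariski S) W" "x \<in> W" "f \<in> reg S W" unfolding regular_at_def by auto
      obtain p q where pq: "p \<in> polys n" "q \<in> polys n" "q (\<zeta> x) \<noteq> 0"
        "\<forall>y\<in>U. q (\<zeta> y) \<noteq> 0 \<longrightarrow> y \<in> W \<and> f y = p (\<zeta> y) / q (\<zeta> y)"
        by (rule affine_chart_fraction[OF c W(1,3,2) x])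
      have "same_germ S x (\<lambda>y. f y * q (\<zeta> y)) (\<lambda>y. p (\<zeta> y))"
        unfolding same_germ_def
        by (rule exI[of _ "{y \<in> U. q (\<zeta> y) \<noteq> 0}"]) (use pq x affine_chart_open_basic[OF c pq(2)] in auto)
      then have "D0 (\<lambda>y. f y * q (\<zeta> y)) = 0"
        using tangent_space_germ[OF DT regular_at_mult[OF S True reg[OF pq(2)]] reg[OF pq(1)]] Dp[OF pq(1)] by simp
      then show ?thesis
        using tangent_space_mult[OF DT True reg[OF pq(2)]] Dp[OF pq(2)] pq(3) by simp
    qed (rule tangent_space_nonregular[OF DT])
    then have "D0 = 0" by (simp add: fun_eq_iff)
    then show False using Dnz by simp
  qed
  then obtain k0 where k0: "k0 < n" "D0 (\<lambda>y. \<zeta> y k0) \<noteq> 0" by blast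
  define e where "e k = D0 (\<lambda>y. \<zeta> y k) / D0 (\<lambda>y. \<zeta> y k0)" for k
  show ?thesis
  proof (rule that[OF k0(1)])
    fix k assume k: "k < n"
    let ?f = "\<lambda>y. \<zeta> y k - e k * \<zeta> y k0"
    have r: "regular_at S x (\<lambda>y. - e k * \<zeta> y k0)"
      by (rule regular_at_mult[OF S regular_at_const[OF S xp] regc[OF k0(1)]])
    have "D0 (\<lambda>y. \<zeta> y k + (- e k * \<zeta> y k0)) = D0 (\<lambda>y. \<zeta> y k) + D0 (\<lambda>y. - e k * \<zeta> y k0)"
      by (rule tangent_space_add[OF DT regc[OF k] r])
    also have "D0 (\<lambda>y. - e k * \<zeta> y k0) = - e k * D0 (\<lambda>y. \<zeta> y k0)"
      using tangent_space_mult[OF DT regular_at_const[OF S xp, of "- e k"] regc[OF k0(1)]]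
      by (simp add: tangent_space_const[OF DT])
    finally have D0f: "D0 ?f = 0" using k0(2) by (simp add: e_def)
    show "?f \<in> square_germs S x"
    proof (rule ccontr)
      assume "?f \<notin> square_germs S x"
      moreover have "regular_at S x ?f" using regular_at_add[OF S regc[OF k] r] by simp
      ultimately obtain D where D: "D \<in> tangent_space S x" "D ?f \<noteq> 0"
        using tangent_vector_exists[OF S] by blast
      then show False using span[OF D(1)] D0f by auto
    qed
  qed
qed

text \<open>Nakayama's lemma for a finitely generated module of germs, by elimination.\<close>

lemma germ_elimination:
  fixes n :: nat
  assumes P: "regular_space P" and w: "w \<in> points P"
    and "\<And>k. k < n \<Longrightarrow> regular_at P w (c k)"
    and "\<And>k l. k < n \<Longrightarrow> l < n \<Longrightarrow> regular_at P w (B k l) \<and> B k l w = 0"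
    and "\<And>k. k < n \<Longrightarrow> \<forall>\<^sub>F y in nhdsin (zariski P) w. v k y = c k y * t y + (\<Sum>l<n. B k l y * v l y)"
  shows "\<exists>d. \<forall>k<n. regular_at P w (d k) \<and> (\<forall>\<^sub>F y in nhdsin (zariski P) w. v k y = d k y * t y)"
  using assms(3-)
proof (induction n arbitrary: c B)
  case 0
  then show ?case by simp
next
  case (Suc n)
  \<comment> \<open>Since \<open>B n n\<close> vanishes at \<open>w\<close>, 1 - B n n is a unit
    there. The last relation can thus be solved for \<open>v n\<close> and substituted into the
    others.\<close>
  define u where "u y = inverse (1 - B n n y)" for y
  have r1: "regular_at P w (\<lambda>y. 1 - B n n y)"
    by (rule regular_at_diff[OF P regular_at_const[OF P w]]) (use Suc.prems(2) in blast)
  have nz: "1 - B n n w \<noteq> 0" using Suc.prems(2)[of n n] by simp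
  have u: "regular_at P w u" unfolding u_def[abs_def] by (rule regular_at_inverse[OF P r1 nz])
  have vn: "\<forall>\<^sub>F y in nhdsin (zariski P) w. v n y = u y * c n y * t y + (\<Sum>l<n. u y * B n l y * v l y)"
    using Suc.prems(3)[OF lessI] eventually_nonzero[OF P r1 nz]
  proof eventually_elim
    case (elim y)
    have "(1 - B n n y) * v n y = c n y * t y + (\<Sum>l<n. B n l y * v l y)"
      using elim(1) by (simp add: algebra_simps)
    then have "v n y = u y * (c n y * t y + (\<Sum>l<n. B n l y * v l y))"
      using elim(2) by (simp add: u_def field_simps)
    then show ?case by (simp add: distrib_left sum_distrib_left mult.assoc)
  qed
  define c' where "c' k y = c k y + B k n y * (u y * c n y)" for k y
  define B' where "B' k l y = B k l y + B k n y * (u y * B n l y)" for k l y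
  have "\<exists>d. \<forall>k<n. regular_at P w (d k) \<and> (\<forall>\<^sub>F y in nhdsin (zariski P) w. v k y = d k y * t y)"
  proof (rule Suc.IH[of c' B'])
    show "regular_at P w (c' k)" if "k < n" for k
      unfolding c'_def[abs_def] using that Suc.prems(1,2)
      by (intro regular_at_add[OF P] regular_at_mult[OF P] u) auto
    show "regular_at P w (B' k l) \<and> B' k l w = 0" if "k < n" "l < n" for k l
      unfolding B'_def[abs_def] using that Suc.prems(2)
      by (intro conjI regular_at_add[OF P] regular_at_mult[OF P] u) auto
    show "\<forall>\<^sub>F y in nhdsin (zariski P) w. v k y = c' k y * t y + (\<Sum>l<n. B' k l y * v l y)" if "k < n" for k
      using Suc.prems(3)[of k, OF less_SucI[OF that]] vn
    proof eventually_elim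
      case (elim y)
      have "v k y = c k y * t y + (\<Sum>l<n. B k l y * v l y) + B k n y * v n y"
        using elim(1) by (simp add: algebra_simps)
      also have "B k n y * v n y = B k n y * (u y * c n y * t y) + (\<Sum>l<n. B k n y * (u y * B n l y * v l y))"
        unfolding elim(2) by (simp add: distrib_left sum_distrib_left)
      finally show ?case
        by (simp add: c'_def B'_def distrib_right sum.distrib mult.assoc)
    qed
  qed
  then obtain d where d: "\<forall>k<n. regular_at P w (d k) \<and> (\<forall>\<^sub>F y in nhdsin (zariski P) w. v k y = d k y * t y)" ..
  define dn where "dn y = u y * c n y + (\<Sum>l<n. u y * B n l y * d l y)" for y
  have "regular_at P w dn"
    unfolding dn_def[abs_def] using Suc.prems(1,2) d
    by (intro regular_at_add[OF P] regular_at_mult[OF P] regular_at_sum[OF P w] u) auto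
  moreover have "\<forall>\<^sub>F y in nhdsin (zariski P) w. \<forall>k\<in>{..<n}. v k y = d k y * t y"
    using d by (intro eventually_ball_finite) auto
  then have "\<forall>\<^sub>F y in nhdsin (zariski P) w. v n y = dn y * t y"
    using vn
  proof eventually_elim
    case (elim y)
    have "(\<Sum>l<n. u y * B n l y * v l y) = (\<Sum>l<n. u y * B n l y * d l y * t y)"
      by (rule sum.cong[OF refl]) (use elim(1) in simp)
    then show ?case using elim(2) by (simp add: dn_def distrib_right sum_distrib_right)
  qed
  ultimately show ?case
    using d by (intro exI[of _ "\<lambda>k. if k = n then dn else d k"]) (auto simp: less_Suc_eq)
qed

text \<open>The increment of a polynomial lies in the ideal generated by the increments of the
  coordinates. For products, p q - p' q' = q (p - p') + p' (q - q').\<close>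

lemma polys_difference:
  assumes P: "regular_space P" and o: "openin (zariski P) W" and p: "p \<in> polys n"
    and a: "\<And>k. k < n \<Longrightarrow> (\<lambda>y. a y k) \<in> reg P W" and b: "\<And>k. k < n \<Longrightarrow> (\<lambda>y. b y k) \<in> reg P W"
  shows "\<exists>\<beta>. (\<forall>l<n. \<beta> l \<in> reg P W) \<and> (\<forall>y\<in>W. p (a y) - p (b y) = (\<Sum>l<n. \<beta> l y * (a y l - b y l)))"
  using p
proof (induction rule: polys.induct)
  case (const c)
  show ?case by (rule exI[of _ "\<lambda>_ _. 0"]) (auto intro: reg_const[OF P o])
next
  case (coord k)
  show ?case
  proof (rule exI[of _ "\<lambda>l _. if l = k then 1 else 0"], intro conjI allI impI ballI)
    fix y
    have "(\<Sum>l<n. (if l = k then 1 else 0) * (a y l - b y l)) = (\<Sum>l<n. if l = k then a y l - b y l else 0)"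
      by (rule sum.cong) auto
    then show "a y k - b y k = (\<Sum>l<n. (if l = k then 1 else 0) * (a y l - b y l))"
      using coord by simp
  qed (auto intro: reg_const[OF P o])
next
  case (add p q)
  then obtain \<beta> \<gamma> where h: "\<forall>l<n. \<beta> l \<in> reg P W" "\<forall>y\<in>W. p (a y) - p (b y) = (\<Sum>l<n. \<beta> l y * (a y l - b y l))"
    "\<forall>l<n. \<gamma> l \<in> reg P W" "\<forall>y\<in>W. q (a y) - q (b y) = (\<Sum>l<n. \<gamma> l y * (a y l - b y l))" by auto
  show ?case
  proof (rule exI[of _ "\<lambda>l y. \<beta> l y + \<gamma> l y"], intro conjI allI impI ballI)
    fix y assume "y \<in> W"
    then have "p (a y) - p (b y) + (q (a y) - q (b y)) = (\<Sum>l<n. (\<beta> l y + \<gamma> l y) * (a y l - b y l))"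
      using h(2,4) by (simp add: distrib_right sum.distrib)
    then show "p (a y) + q (a y) - (p (b y) + q (b y)) = (\<Sum>l<n. (\<beta> l y + \<gamma> l y) * (a y l - b y l))"
      by (simp add: algebra_simps)
  qed (use h in \<open>auto intro: reg_add[OF P o]\<close>)
next
  case (mult p q)
  then obtain \<beta> \<gamma> where h: "\<forall>l<n. \<beta> l \<in> reg P W" "\<forall>y\<in>W. p (a y) - p (b y) = (\<Sum>l<n. \<beta> l y * (a y l - b y l))"
    "\<forall>l<n. \<gamma> l \<in> reg P W" "\<forall>y\<in>W. q (a y) - q (b y) = (\<Sum>l<n. \<gamma> l y * (a y l - b y l))" by auto
  have rq: "(\<lambda>y. q (a y)) \<in> reg P W" by (rule reg_polys[OF P o mult(2) a])
  have rp: "(\<lambda>y. p (b y)) \<in> reg P W" by (rule reg_polys[OF P o mult(1) b])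
  show ?case
  proof (rule exI[of _ "\<lambda>l y. q (a y) * \<beta> l y + p (b y) * \<gamma> l y"], intro conjI allI impI ballI)
    fix y assume "y \<in> W"
    then have "q (a y) * (p (a y) - p (b y)) + p (b y) * (q (a y) - q (b y))
        = (\<Sum>l<n. (q (a y) * \<beta> l y + p (b y) * \<gamma> l y) * (a y l - b y l))"
      using h(2,4) by (simp add: distrib_right sum.distrib sum_distrib_left mult.assoc)
    then show "p (a y) * q (a y) - p (b y) * q (b y) = (\<Sum>l<n. (q (a y) * \<beta> l y + p (b y) * \<gamma> l y) * (a y l - b y l))"
      by (simp add: algebra_simps)
  qed (use h in \<open>auto intro!: reg_add[OF P o] reg_mult[OF P o] rq rp\<close>)
qed

text \<open>Extends \<open>polys_difference\<close> to fractions: for b = p/q the numerator of the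
  increment is (p - p') q' - p' (q - q'), where primes denote values at the second point, and the
  denominator q q' is a unit near (x, x).\<close>

lemma germ_difference:
  assumes X: "regular_space X" and c: "affine_chart X U n \<zeta>" and x: "x \<in> U" and b: "regular_at X x b"
  shows "\<exists>\<beta>. (\<forall>l<n. regular_at (prod_space X X) (x, x) (\<beta> l)) \<and>
    (\<forall>\<^sub>F w in nhdsin (zariski (prod_space X X)) (x, x).
      b (fst w) - b (snd w) = (\<Sum>l<n. \<beta> l w * (\<zeta> (fst w) l - \<zeta> (snd w) l)))"
proof -
  let ?P = "prod_space X X"
  have P: "regular_space ?P" by (rule regular_space_prod[OF X X])
  note oU = affine_chart_open[OF c]
  note oK = openin_prod_Times[OF X X oU oU]
  have xK: "(x, x) \<in> U \<times> U" using x by simp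
  have xp: "(x, x) \<in> points ?P" using openin_subset[OF oK] xK by blast
  obtain W where W: "openin (zariski X) W" "x \<in> W" "b \<in> reg X W" using b unfolding regular_at_def by auto
  obtain p q where pq: "p \<in> polys n" "q \<in> polys n" "q (\<zeta> x) \<noteq> 0"
    "\<forall>y\<in>U. q (\<zeta> y) \<noteq> 0 \<longrightarrow> y \<in> W \<and> b y = p (\<zeta> y) / q (\<zeta> y)"
    by (rule affine_chart_fraction[OF c W(1,3,2) x])
  have r1: "(\<lambda>w. \<zeta> (fst w) k) \<in> reg ?P (U \<times> U)" if "k < n" for k
    by (rule morphism_reg'[OF morphism_fst[OF X X] P oU affine_chart_coord[OF c that] oK]) auto
  have r2: "(\<lambda>w. \<zeta> (snd w) k) \<in> reg ?P (U \<times> U)" if "k < n" for k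
    by (rule morphism_reg'[OF morphism_snd[OF X X] P oU affine_chart_coord[OF c that] oK]) auto
  have pd: "\<exists>\<beta>. (\<forall>l<n. \<beta> l \<in> reg ?P (U \<times> U)) \<and> (\<forall>w\<in>U \<times> U.
      p (\<zeta> (fst w)) - p (\<zeta> (snd w)) = (\<Sum>l<n. \<beta> l w * (\<zeta> (fst w) l - \<zeta> (snd w) l)))"
    if "p \<in> polys n" for p
    by (rule polys_difference[OF P oK that]) (erule r1, erule r2)
  obtain \<beta> where \<beta>: "\<forall>l<n. \<beta> l \<in> reg ?P (U \<times> U)" and \<beta>2: "\<forall>w\<in>U \<times> U.
      p (\<zeta> (fst w)) - p (\<zeta> (snd w)) = (\<Sum>l<n. \<beta> l w * (\<zeta> (fst w) l - \<zeta> (snd w) l))"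
    using pd[OF pq(1)] by (elim exE conjE)
  obtain \<gamma> where \<gamma>: "\<forall>l<n. \<gamma> l \<in> reg ?P (U \<times> U)" and \<gamma>2: "\<forall>w\<in>U \<times> U.
      q (\<zeta> (fst w)) - q (\<zeta> (snd w)) = (\<Sum>l<n. \<gamma> l w * (\<zeta> (fst w) l - \<zeta> (snd w) l))"
    using pd[OF pq(2)] by (elim exE conjE)
  have rp: "(\<lambda>w. p (\<zeta> (snd w))) \<in> reg ?P (U \<times> U)" by (rule reg_polys[OF P oK pq(1) r2])
  have rq: "(\<lambda>w. q (\<zeta> (snd w))) \<in> reg ?P (U \<times> U)" by (rule reg_polys[OF P oK pq(2) r2])
  have rq1: "(\<lambda>w. q (\<zeta> (fst w))) \<in> reg ?P (U \<times> U)" by (rule reg_polys[OF P oK pq(2) r1])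
  define Q where "Q w = q (\<zeta> (fst w)) * q (\<zeta> (snd w))" for w
  have rQ: "Q \<in> reg ?P (U \<times> U)" unfolding Q_def[abs_def] by (rule reg_mult[OF P oK rq1 rq])
  note at = regular_atI[OF oK xK]
  have Qx: "Q (x, x) \<noteq> 0" using pq(3) by (simp add: Q_def)
  define \<delta> where "\<delta> l w = (\<beta> l w * q (\<zeta> (snd w)) - p (\<zeta> (snd w)) * \<gamma> l w) * inverse (Q w)" for l w
  show ?thesis
  proof (intro exI[of _ \<delta>] conjI allI impI)
    fix l assume l: "l < n"
    show "regular_at ?P (x, x) (\<delta> l)"
      unfolding \<delta>_def[abs_def]
      by (intro regular_at_mult[OF P] regular_at_inverse[OF P at[OF rQ] Qx]
          at[OF reg_diff[OF P oK reg_mult[OF P oK \<beta>[rule_format, OF l] rq] reg_mult[OF P oK rp \<gamma>[rule_format, OF l]]]])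
  next
    have "\<forall>\<^sub>F w in nhdsin (zariski ?P) (x, x). w \<in> U \<times> U"
      unfolding eventually_zariski[OF xp] using oK xK by blast
    moreover have "\<forall>\<^sub>F w in nhdsin (zariski ?P) (x, x). Q w \<noteq> 0"
      by (rule eventually_nonzero[OF P at[OF rQ] Qx])
    ultimately show "\<forall>\<^sub>F w in nhdsin (zariski ?P) (x, x).
      b (fst w) - b (snd w) = (\<Sum>l<n. \<delta> l w * (\<zeta> (fst w) l - \<zeta> (snd w) l))"
    proof eventually_elim
      case (elim w)
      have q12: "q (\<zeta> (fst w)) \<noteq> 0" "q (\<zeta> (snd w)) \<noteq> 0" using elim(2) by (auto simp: Q_def)
      have b12: "b (fst w) = p (\<zeta> (fst w)) / q (\<zeta> (fst w))" "b (snd w) = p (\<zeta> (snd w)) / q (\<zeta> (snd w))"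
        using pq(4) elim(1) q12 by auto
      have "(b (fst w) - b (snd w)) * Q w = (p (\<zeta> (fst w)) - p (\<zeta> (snd w))) * q (\<zeta> (snd w))
          - p (\<zeta> (snd w)) * (q (\<zeta> (fst w)) - q (\<zeta> (snd w)))"
        using q12 by (simp add: b12 Q_def field_simps)
      also have "\<dots> = (\<Sum>l<n. (\<beta> l w * q (\<zeta> (snd w)) - p (\<zeta> (snd w)) * \<gamma> l w) * (\<zeta> (fst w) l - \<zeta> (snd w) l))"
        unfolding bspec[OF \<beta>2 elim(1)] bspec[OF \<gamma>2 elim(1)] sum_distrib_left sum_distrib_right sum_subtractf[symmetric]
        by (rule sum.cong) (auto simp: algebra_simps)
      finally have e: "(b (fst w) - b (snd w)) * Q w = \<dots>" .
      have "b (fst w) - b (snd w) = (b (fst w) - b (snd w)) * Q w * inverse (Q w)" using elim(2) by simp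
      also have "\<dots> = (\<Sum>l<n. \<delta> l w * (\<zeta> (fst w) l - \<zeta> (snd w) l))"
        unfolding e \<delta>_def sum_distrib_right by (rule sum.cong) (auto simp: algebra_simps)
      finally show ?case .
    qed
  qed
qed

text \<open>Nakayama's lemma for the ideal of the diagonal, which is generated by the increments of
  the coordinates. By \<open>tangent_line_expansion\<close> the increment of \<zeta> k is
  \<open>e k\<close> times that of \<zeta> k0 up to increments of products of functions vanishing at
  \<open>x\<close>, that is, modulo the maximal ideal at (x, x) times the ideal itself.\<close>

lemma diagonal_germ_generator:
  assumes X: "regular_space X" and c: "affine_chart X U n \<zeta>" and x: "x \<in> U"
    and dim: "vector_space.dim (\<lambda>c D f. c * D f) (tangent_space X x) = 1"
  shows "\<exists>k0<n. \<exists>d. \<forall>k<n. regular_at (prod_space X X) (x, x) (d k) \<and>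
    (\<forall>\<^sub>F w in nhdsin (zariski (prod_space X X)) (x, x).
      \<zeta> (fst w) k - \<zeta> (snd w) k = d k w * (\<zeta> (fst w) k0 - \<zeta> (snd w) k0))"
proof -
  let ?P = "prod_space X X" and ?F = "nhdsin (zariski (prod_space X X)) (x, x)"
  have P: "regular_space ?P" by (rule regular_space_prod[OF X X])
  have xX: "x \<in> points X" using openin_subset[OF affine_chart_open[OF c]] x by blast
  then have xp: "(x, x) \<in> points ?P" by (simp add: points_prod[OF X X])
  note fst = morphism_fst[OF X X] and snd = morphism_snd[OF X X]
  obtain k0 e where k0: "k0 < n" and e: "\<And>k. k < n \<Longrightarrow> (\<lambda>y. \<zeta> y k - e k * \<zeta> y k0) \<in> square_germs X x"
    by (rule tangent_line_expansion[OF X c x dim]) (rule that)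
  define \<delta> where "\<delta> k w = \<zeta> (fst w) k - \<zeta> (snd w) k" for k and w :: "'a \<times> 'a"
  have "\<exists>B. k < n \<longrightarrow> (\<forall>l<n. regular_at ?P (x, x) (B l) \<and> B l (x, x) = 0) \<and>
    (\<forall>\<^sub>F w in ?F. \<delta> k w = e k * \<delta> k0 w + (\<Sum>l<n. B l w * \<delta> l w))" for k
  proof (cases "k < n")
    case True
    obtain C N a b where ab: "\<forall>j<(N::nat). regular_at X x (a j) \<and> regular_at X x (b j) \<and> a j x = 0 \<and> b j x = 0"
      and ev: "\<forall>\<^sub>F y in nhdsin (zariski X) x. \<zeta> y k - e k * \<zeta> y k0 = C + (\<Sum>j<N. a j y * b j y)"
      by (rule square_germsE[OF e[OF True]])
    have "\<forall>j. \<exists>\<beta>. j < N \<longrightarrow> (\<forall>l<n. regular_at ?P (x, x) (\<beta> l)) \<and>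
        (\<forall>\<^sub>F w in ?F. a j (fst w) - a j (snd w) = (\<Sum>l<n. \<beta> l w * \<delta> l w))"
      using germ_difference[OF X c x] ab unfolding \<delta>_def by blast
    from choice[OF this] obtain \<alpha> where \<alpha>: "\<And>j. j < N \<Longrightarrow> (\<forall>l<n. regular_at ?P (x, x) (\<alpha> j l)) \<and>
        (\<forall>\<^sub>F w in ?F. a j (fst w) - a j (snd w) = (\<Sum>l<n. \<alpha> j l w * \<delta> l w))" by auto
    have "\<forall>j. \<exists>\<beta>. j < N \<longrightarrow> (\<forall>l<n. regular_at ?P (x, x) (\<beta> l)) \<and>
        (\<forall>\<^sub>F w in ?F. b j (fst w) - b j (snd w) = (\<Sum>l<n. \<beta> l w * \<delta> l w))"
      using germ_difference[OF X c x] ab unfolding \<delta>_def by blast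
    from choice[OF this] obtain \<beta> where \<beta>: "\<And>j. j < N \<Longrightarrow> (\<forall>l<n. regular_at ?P (x, x) (\<beta> j l)) \<and>
        (\<forall>\<^sub>F w in ?F. b j (fst w) - b j (snd w) = (\<Sum>l<n. \<beta> j l w * \<delta> l w))" by auto
    \<comment> \<open>From a b - a' b' = a (b - b') + b' (a - a'): the coefficients contain the
      factors \<open>a j\<close> and \<open>b j\<close>, which vanish at \<open>x\<close>.\<close>
    define B where "B l w = (\<Sum>j<N. a j (fst w) * \<beta> j l w + b j (snd w) * \<alpha> j l w)" for l w
    have "regular_at ?P (x, x) (B l) \<and> B l (x, x) = 0" if l: "l < n" for l
    proof
      show "regular_at ?P (x, x) (B l)"
        unfolding B_def[abs_def] using ab \<alpha> \<beta> l
        by (intro regular_at_sum[OF P xp] regular_at_add[OF P] regular_at_mult[OF P]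
            regular_at_comp[OF fst xp] regular_at_comp[OF snd xp]) auto
      show "B l (x, x) = 0" using ab by (simp add: B_def)
    qed
    moreover have "\<forall>\<^sub>F w in ?F. \<delta> k w = e k * \<delta> k0 w + (\<Sum>l<n. B l w * \<delta> l w)"
    proof -
      have e1: "\<forall>\<^sub>F w in ?F. \<zeta> (fst w) k - e k * \<zeta> (fst w) k0 = C + (\<Sum>j<N. a j (fst w) * b j (fst w))"
        using eventually_comp[OF fst xp, of "\<lambda>y. \<zeta> y k - e k * \<zeta> y k0 = C + (\<Sum>j<N. a j y * b j y)"] ev by simp
      have e2: "\<forall>\<^sub>F w in ?F. \<zeta> (snd w) k - e k * \<zeta> (snd w) k0 = C + (\<Sum>j<N. a j (snd w) * b j (snd w))"
        using eventually_comp[OF snd xp, of "\<lambda>y. \<zeta> y k - e k * \<zeta> y k0 = C + (\<Sum>j<N. a j y * b j y)"] ev by simp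
      have e3: "\<forall>\<^sub>F w in ?F. \<forall>j\<in>{..<N}. a j (fst w) - a j (snd w) = (\<Sum>l<n. \<alpha> j l w * \<delta> l w)"
        using \<alpha> by (intro eventually_ball_finite) auto
      have e4: "\<forall>\<^sub>F w in ?F. \<forall>j\<in>{..<N}. b j (fst w) - b j (snd w) = (\<Sum>l<n. \<beta> j l w * \<delta> l w)"
        using \<beta> by (intro eventually_ball_finite) auto
      show ?thesis
        using e1 e2 e3 e4
      proof eventually_elim
        case (elim w)
        have "\<delta> k w - e k * \<delta> k0 w = (\<Sum>j<N. a j (fst w) * b j (fst w)) - (\<Sum>j<N. a j (snd w) * b j (snd w))"
          using elim(1,2) by (simp add: \<delta>_def algebra_simps)
        also have "\<dots> = (\<Sum>j<N. a j (fst w) * (b j (fst w) - b j (snd w)) + b j (snd w) * (a j (fst w) - a j (snd w)))"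
          unfolding sum_subtractf[symmetric] by (rule sum.cong) (auto simp: algebra_simps)
        also have "\<dots> = (\<Sum>j<N. \<Sum>l<n. (a j (fst w) * \<beta> j l w + b j (snd w) * \<alpha> j l w) * \<delta> l w)"
        proof (rule sum.cong[OF refl])
          fix j assume "j \<in> {..<N}"
          then show "a j (fst w) * (b j (fst w) - b j (snd w)) + b j (snd w) * (a j (fst w) - a j (snd w))
              = (\<Sum>l<n. (a j (fst w) * \<beta> j l w + b j (snd w) * \<alpha> j l w) * \<delta> l w)"
            using elim(3,4) by (simp add: sum_distrib_left distrib_right sum.distrib mult.assoc)
        qed
        also have "\<dots> = (\<Sum>l<n. B l w * \<delta> l w)"
          unfolding B_def by (subst sum.swap) (simp add: sum_distrib_right)
        finally show ?case by (simp add: algebra_simps)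
      qed
    qed
    ultimately show ?thesis by blast
  qed simp
  then have "\<forall>k. \<exists>B. k < n \<longrightarrow> (\<forall>l<n. regular_at ?P (x, x) (B l) \<and> B l (x, x) = 0) \<and>
    (\<forall>\<^sub>F w in ?F. \<delta> k w = e k * \<delta> k0 w + (\<Sum>l<n. B l w * \<delta> l w))" by blast
  from choice[OF this] obtain B where B: "\<And>k. k < n \<Longrightarrow> (\<forall>l<n. regular_at ?P (x, x) (B k l) \<and> B k l (x, x) = 0) \<and>
    (\<forall>\<^sub>F w in ?F. \<delta> k w = e k * \<delta> k0 w + (\<Sum>l<n. B k l w * \<delta> l w))" by auto
  have "\<exists>d. \<forall>k<n. regular_at ?P (x, x) (d k) \<and> (\<forall>\<^sub>F w in ?F. \<delta> k w = d k w * \<delta> k0 w)"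
    by (rule germ_elimination[OF P xp, where c = "\<lambda>k _. e k" and B = B])
      (use B in \<open>auto intro: regular_at_const[OF P xp]\<close>)
  then show ?thesis using k0 unfolding \<delta>_def by blast
qed

text \<open>For distinct points some coordinate separates them, and its increment is invertible near
  (x, y), so it divides all the others. For equal points the finitely many identities of germs are
  spread out over one neighbourhood.\<close>

lemma diagonal_equation:
  assumes X: "regular_space X" and c: "affine_chart X U n \<zeta>" and xy: "x \<in> U" "y \<in> U"
    and dim: "vector_space.dim (\<lambda>c D f. c * D f) (tangent_space X x) = 1"
  obtains k0 W d where "k0 < n" "openin (zariski (prod_space X X)) W" "(x, y) \<in> W" "W \<subseteq> U \<times> U"
    "\<forall>w\<in>W. prod.swap w \<in> W" "\<forall>k<n. d k \<in> reg (prod_space X X) W"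
    "\<forall>k<n. \<forall>w\<in>W. \<zeta> (fst w) k - \<zeta> (snd w) k = d k w * (\<zeta> (fst w) k0 - \<zeta> (snd w) k0)"
proof -
  let ?P = "prod_space X X"
  have P: "regular_space ?P" by (rule regular_space_prod[OF X X])
  note oU = affine_chart_open[OF c]
  note oK = openin_prod_Times[OF X X oU oU]
  show ?thesis
  proof (cases "x = y")
    case False
    then obtain k0 where k0: "k0 < n" "\<zeta> x k0 \<noteq> \<zeta> y k0" using affine_chart_separates[OF c xy] by auto
    define \<delta> where "\<delta> k w = \<zeta> (fst w) k - \<zeta> (snd w) k" for k and w :: "'a \<times> 'a"
    have r: "\<delta> k \<in> reg ?P (U \<times> U)" if "k < n" for k
      unfolding \<delta>_def[abs_def]
      by (intro reg_diff[OF P oK] morphism_reg'[OF morphism_fst[OF X X] P oU affine_chart_coord[OF c that] oK]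
          morphism_reg'[OF morphism_snd[OF X X] P oU affine_chart_coord[OF c that] oK]) auto
    let ?W = "{w \<in> U \<times> U. \<delta> k0 w \<noteq> 0}"
    note oW = reg_open[OF P oK r[OF k0(1)]]
    have sub: "?W \<subseteq> U \<times> U" by blast
    have d: "\<forall>k<n. (\<lambda>w. \<delta> k w / \<delta> k0 w) \<in> reg ?P ?W"
    proof (intro allI impI)
      fix k assume "k < n"
      show "(\<lambda>w. \<delta> k w / \<delta> k0 w) \<in> reg ?P ?W"
        by (rule reg_divide[OF P oW reg_mono[OF P oK oW sub r[OF \<open>k < n\<close>]] reg_mono[OF P oK oW sub r[OF k0(1)]]]) simp
    qed
    show ?thesis
      by (rule that[OF k0(1) oW _ sub _ d]) (use xy k0 in \<open>auto simp: \<delta>_def\<close>)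
  next
    case True
    obtain k0 d where k0: "k0 < n" and d: "\<forall>k<n. regular_at ?P (x, x) (d k) \<and>
      (\<forall>\<^sub>F w in nhdsin (zariski ?P) (x, x). \<zeta> (fst w) k - \<zeta> (snd w) k = d k w * (\<zeta> (fst w) k0 - \<zeta> (snd w) k0))"
      using diagonal_germ_generator[OF X c xy(1) dim] by auto
    have xp: "(x, x) \<in> points ?P" using openin_subset[OF oK] xy by auto
    have "\<exists>W. openin (zariski ?P) W \<and> (x, x) \<in> W \<and> W \<subseteq> U \<times> U \<and> (\<forall>k<m. d k \<in> reg ?P W \<and>
        (\<forall>w\<in>W. \<zeta> (fst w) k - \<zeta> (snd w) k = d k w * (\<zeta> (fst w) k0 - \<zeta> (snd w) k0)))" if "m \<le> n" for m
      using that
    proof (induction m)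
      case 0
      show ?case using oK xy by (intro exI[of _ "U \<times> U"]) auto
    next
      case (Suc m)
      then obtain W where W: "openin (zariski ?P) W" "(x, x) \<in> W" "W \<subseteq> U \<times> U" "\<forall>k<m. d k \<in> reg ?P W \<and>
        (\<forall>w\<in>W. \<zeta> (fst w) k - \<zeta> (snd w) k = d k w * (\<zeta> (fst w) k0 - \<zeta> (snd w) k0))" by auto
      have m: "m < n" using Suc.prems by simp
      obtain W1 where W1: "openin (zariski ?P) W1" "(x, x) \<in> W1" "d m \<in> reg ?P W1"
        using d m unfolding regular_at_def by auto
      obtain W2 where W2: "openin (zariski ?P) W2" "(x, x) \<in> W2"
        "\<forall>w\<in>W2. \<zeta> (fst w) m - \<zeta> (snd w) m = d m w * (\<zeta> (fst w) k0 - \<zeta> (snd w) k0)"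
        using d m unfolding eventually_zariski[OF xp] by auto
      let ?W = "W \<inter> W1 \<inter> W2"
      have o: "openin (zariski ?P) ?W" using W(1) W1(1) W2(1) by (intro openin_Int)
      have "d k \<in> reg ?P ?W" if "k < m" for k
        by (rule reg_mono[OF P W(1) o]) (use W(4) that in auto)
      moreover have "d m \<in> reg ?P ?W" by (rule reg_mono[OF P W1(1) o _ W1(3)]) auto
      ultimately show ?case
        using o W W1 W2 by (intro exI[of _ ?W]) (auto simp: less_Suc_eq)
    qed
    from this[OF order_refl] obtain W where W: "openin (zariski ?P) W" "(x, x) \<in> W" "W \<subseteq> U \<times> U"
        "\<forall>k<n. d k \<in> reg ?P W \<and>
        (\<forall>w\<in>W. \<zeta> (fst w) k - \<zeta> (snd w) k = d k w * (\<zeta> (fst w) k0 - \<zeta> (snd w) k0))" by (elim exE conjE)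
    have sw: "morphism ?P ?P prod.swap"
    proof -
      have "morphism ?P ?P (\<lambda>z. (snd z, fst z))"
        by (intro morphism_pair[OF P X X] morphism_fst[OF X X] morphism_snd[OF X X])
      moreover have "(\<lambda>z. (snd z, fst z)) = (prod.swap :: 'a \<times> 'a \<Rightarrow> 'a \<times> 'a)" by auto
      ultimately show ?thesis by simp
    qed
    \<comment> \<open>The neighbourhood obtained from germs has no symmetry; intersecting it with
      its mirror image makes it invariant.\<close>
    let ?W = "W \<inter> (points ?P \<inter> prod.swap -` W)"
    have o: "openin (zariski ?P) ?W" by (intro openin_Int W(1) morphism_openin[OF sw])
    have d': "\<forall>k<n. d k \<in> reg ?P ?W"
    proof (intro allI impI)
      fix k assume "k < n"
      then have "d k \<in> reg ?P W" using W(4) by blast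
      then show "d k \<in> reg ?P ?W" by (rule reg_mono[OF P W(1) o Int_lower1])
    qed
    show ?thesis
    proof (rule that[OF k0 o _ _ _ d'])
      show "(x, y) \<in> ?W" using W(2) True xp by simp
      show "?W \<subseteq> U \<times> U" using W(3) by blast
      show "\<forall>w\<in>?W. prod.swap w \<in> ?W" using openin_subset[OF W(1)] by auto
      show "\<forall>k<n. \<forall>w\<in>?W. \<zeta> (fst w) k - \<zeta> (snd w) k = d k w * (\<zeta> (fst w) k0 - \<zeta> (snd w) k0)"
        using W(4) by blast
    qed
  qed
qed

section \<open>The diagonal in the product of two copies of the curve with \<open>M\<close>\<close>

lemma morphism_const:
  assumes "regular_space S" "c \<in> points T"
  shows "morphism S T (\<lambda>_. c)"
proof (rule morphismI)
  show "openin (zariski S) (points S \<inter> (\<lambda>_. c) -` V)" for V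
    by (cases "c \<in> V") auto
  then show "(\<lambda>x. f c) \<in> reg S (points S \<inter> (\<lambda>_. c) -` V)" for V f
    by (rule reg_const[OF assms(1)])
qed (rule assms(2))

text \<open>The assumption \<open>tangent\<close> provides the local equation of the diagonal, and
  \<open>not_isolated\<close> the density of its complement.\<close>

locale curve_pair = charted_pair X M for X :: "'x space" and M :: "'m space" +
  assumes tangent: "x \<in> points X \<Longrightarrow> vector_space.dim (\<lambda>c D f. c * D f) (tangent_space X x) = 1"
    and not_isolated: "x \<in> points X \<Longrightarrow> \<not> openin (zariski X) {x}"
begin

abbreviation diagonal :: "('x \<times> 'x) \<times> 'm \<Rightarrow> bool" where
  "diagonal z \<equiv> fst (fst z) = snd (fst z)"

text \<open>Pull back along the slice y \<mapsto> ((x, y), m). If \<open>g\<close> were nonzero at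
  the diagonal point over \<open>x\<close>, its nonvanishing locus would pull back to the open set
  {x}, and \<open>x\<close> would be isolated.\<close>

lemma off_diagonal_dense:
  assumes O': "openin (zariski Y) O'" and g: "g \<in> reg Y O'"
    and off: "\<And>z. z \<in> O' \<Longrightarrow> \<not> diagonal z \<Longrightarrow> g z = 0" and z: "z \<in> O'"
  shows "g z = 0"
proof (rule ccontr)
  assume gz: "g z \<noteq> 0"
  then have "diagonal z" using off[OF z] by blast
  then obtain x m where zx: "z = ((x, x), m)" by (metis prod.collapse)
  have "z \<in> points Y" using openin_subset[OF O'] z by blast
  then have xm: "x \<in> points X" "m \<in> points M" by (auto simp: points_Y zx)
  have \<phi>: "morphism X Y (\<lambda>y. ((x, y), m))"
    by (intro morphism_pair[OF X XX M] morphism_pair[OF X X X] morphism_const[OF X] morphism_id xm)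
  have "openin (zariski X) (points X \<inter> (\<lambda>y. ((x, y), m)) -` {z \<in> O'. g z \<noteq> 0})"
    by (rule morphism_openin[OF \<phi> reg_open[OF Y O' g]])
  moreover have "points X \<inter> (\<lambda>y. ((x, y), m)) -` {z \<in> O'. g z \<noteq> 0} = {x}"
  proof
    show "points X \<inter> (\<lambda>y. ((x, y), m)) -` {z \<in> O'. g z \<noteq> 0} \<subseteq> {x}"
    proof
      fix y assume "y \<in> points X \<inter> (\<lambda>y. ((x, y), m)) -` {z \<in> O'. g z \<noteq> 0}"
      then show "y \<in> {x}" using off[of "((x, y), m)"] by auto
    qed
  qed (use xm z gz zx in auto)
  ultimately show False using not_isolated[OF xm(1)] by simp
qed

text \<open>The last clause says that \<open>t\<close> generates the ideal sheaf of the diagonal on \<open>O'\<close>.\<close>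

definition diag_equation :: "(('x \<times> 'x) \<times> 'm) set \<Rightarrow> (('x \<times> 'x) \<times> 'm \<Rightarrow> complex) \<Rightarrow> bool" where
  "diag_equation O' t \<longleftrightarrow> openin (zariski Y) O' \<and> t \<in> reg Y O' \<and>
     (\<forall>z\<in>O'. swap12 z \<in> O' \<and> t (swap12 z) = - t z) \<and> (\<forall>z\<in>O'. t z = 0 \<longleftrightarrow> diagonal z) \<and>
     (\<forall>W f. openin (zariski Y) W \<and> W \<subseteq> O' \<and> f \<in> reg Y W \<and> (\<forall>z\<in>W. diagonal z \<longrightarrow> f z = 0) \<longrightarrow>
        (\<exists>h\<in>reg Y W. \<forall>z\<in>W. f z = h z * t z))"

text \<open>Let \<open>dg\<close> be the retraction ((x, y), m) \<mapsto> ((x, x), m) onto the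
  diagonal. For \<open>f\<close> vanishing on the diagonal, \<open>f\<close> equals its own
  difference with f \<circ> dg, which by \<open>polys_difference\<close> is a combination of
  increments of coordinates; these are multiples of \<open>t\<close> by the choice of
  \<open>k0\<close>. The quotients so obtained are local and have to be glued.\<close>

lemma diag_equation_exists:
  assumes z0: "z0 \<in> points Y"
  shows "\<exists>O' t. diag_equation O' t \<and> z0 \<in> O'"
proof -
  obtain x0 y0 m0 where z0e: "z0 = ((x0, y0), m0)" by (metis prod.collapse)
  have pts: "x0 \<in> points X" "y0 \<in> points X" "m0 \<in> points M" using z0 by (auto simp: points_Y z0e)
  obtain U n \<zeta> where c: "affine_chart X U n \<zeta>" and xU: "x0 \<in> U" "y0 \<in> U" using charts_X[OF pts(1,2)] by auto
  obtain k0 W d where k0: "k0 < n" and W: "openin (zariski XX) W" "(x0, y0) \<in> W" "W \<subseteq> U \<times> U"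
    "\<forall>w\<in>W. prod.swap w \<in> W" and d: "\<forall>k<n. d k \<in> reg XX W"
    "\<forall>k<n. \<forall>w\<in>W. \<zeta> (fst w) k - \<zeta> (snd w) k = d k w * (\<zeta> (fst w) k0 - \<zeta> (snd w) k0)"
    by (rule diagonal_equation[OF X c xU tangent[OF pts(1)]])
  note oU = affine_chart_open[OF c]
  note oK = openin_prod_Times[OF X X oU oU]
  define O' where "O' = W \<times> points M"
  define t where "t z = \<zeta> (fst (fst z)) k0 - \<zeta> (snd (fst z)) k0" for z :: "('x \<times> 'x) \<times> 'm"
  have oO: "openin (zariski Y) O'" unfolding O'_def by (rule openin_prod_Times[OF XX M W(1) openin_topspace])
  have fO: "O' \<subseteq> fst -` (U \<times> U)" using W(3) unfolding O'_def by auto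
  have "(\<lambda>w. \<zeta> (fst w) k0 - \<zeta> (snd w) k0) \<in> reg XX (U \<times> U)"
    by (intro reg_diff[OF XX oK] morphism_reg'[OF morphism_fst[OF X X] XX oU affine_chart_coord[OF c k0] oK]
          morphism_reg'[OF morphism_snd[OF X X] XX oU affine_chart_coord[OF c k0] oK]) auto
  from morphism_reg'[OF morphism_fst[OF XX M] Y oK this oO fO]
  have rt: "t \<in> reg Y O'" unfolding t_def[abs_def] .
  have t0: "t z = 0 \<longleftrightarrow> diagonal z" if "z \<in> O'" for z
  proof
    assume "t z = 0"
    then have "\<zeta> (fst (fst z)) k = \<zeta> (snd (fst z)) k" if "k < n" for k
      using d(2)[rule_format, OF that, of "fst z"] \<open>z \<in> O'\<close> unfolding O'_def t_def
      by (simp add: mem_Times_iff)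
    then show "diagonal z"
      using affine_chart_separates[OF c, of "fst (fst z)" "snd (fst z)"] fO that by fastforce
  qed (simp add: t_def)
  have sw: "swap12 z \<in> O' \<and> t (swap12 z) = - t z" if "z \<in> O'" for z
    using that W(4) by (auto simp: O'_def t_def swap12_def split: prod.splits)
  define dg where "dg z = ((fst (fst z), fst (fst z)), snd z)" for z :: "('x \<times> 'x) \<times> 'm"
  have mdg: "morphism Y Y dg"
    unfolding dg_def[abs_def]
    by (intro morphism_pair[OF Y XX M] morphism_pair[OF Y X X] morphism_snd[OF XX M]
        morphism_comp[OF morphism_fst[OF XX M] morphism_fst[OF X X]])
  have "\<exists>h\<in>reg Y O1. \<forall>z\<in>O1. f z = h z * t z"
    if O1: "openin (zariski Y) O1" "O1 \<subseteq> O'" and f: "f \<in> reg Y O1" "\<forall>z\<in>O1. diagonal z \<longrightarrow> f z = 0" for O1 f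
  proof -
    have loc: "\<exists>N h. openin (zariski Y) N \<and> z \<in> N \<and> N \<subseteq> O1 \<and> h \<in> reg Y N \<and> (\<forall>w\<in>N. f w = h w * t w)"
      if z: "z \<in> O1" for z
    proof (cases "diagonal z")
      case False
      have rt1: "t \<in> reg Y O1" by (rule reg_mono[OF Y oO O1(1,2) rt])
      let ?N = "{w \<in> O1. t w \<noteq> 0}"
      note oN = reg_open[OF Y O1(1) rt1]
      have sub: "?N \<subseteq> O1" by blast
      have "(\<lambda>w. f w / t w) \<in> reg Y ?N"
        by (rule reg_divide[OF Y oN reg_mono[OF Y O1(1) oN sub f(1)] reg_mono[OF Y O1(1) oN sub rt1]]) simp
      then show ?thesis
        using oN z False t0[of z] O1(2) by (intro exI[of _ ?N] exI[of _ "\<lambda>w. f w / t w"]) auto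
    next
      case True
      then obtain x m where zx: "z = ((x, x), m)" by (metis prod.collapse)
      have zO': "z \<in> O'" using z O1(2) by blast
      then have "m \<in> points M" by (simp add: O'_def zx)
      then obtain V k \<eta> where e: "affine_chart M V k \<eta>" and mV: "m \<in> V" using charts_M by blast
      note oV = affine_chart_open[OF e]
      define \<xi> where "\<xi> = join_coords (n + n) (join_coords n \<zeta> \<zeta>) \<eta>"
      let ?K = "(U \<times> U) \<times> V"
      note ch = affine_chart_prod[OF XX M affine_chart_prod[OF X X c c] e, folded \<xi>_def]
      have oKY: "openin (zariski Y) ?K" by (rule affine_chart_open[OF ch])
      have zK: "z \<in> ?K" using zO' fO mV zx by auto
      obtain p q where pq: "p \<in> polys (n + n + k)" "q \<in> polys (n + n + k)" "q (\<xi> z) \<noteq> 0"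
        "\<forall>w\<in>?K. q (\<xi> w) \<noteq> 0 \<longrightarrow> w \<in> O1 \<and> f w = p (\<xi> w) / q (\<xi> w)"
        by (rule affine_chart_fraction[OF ch O1(1) f(1) z zK])
      let ?KO = "?K \<inter> O1"
      have oN0: "openin (zariski Y) ?KO" using oKY O1(1) by (rule openin_Int)
      have dgK: "dg w \<in> ?K" if "w \<in> ?K" for w using that by (auto simp: dg_def)
      have rk: "(\<lambda>w. p (\<xi> w)) \<in> reg Y ?KO" if "p \<in> polys (n + n + k)" for p
        by (rule reg_mono[OF Y oKY oN0 Int_lower1 affine_chart_polys[OF ch that]])
      have rkd: "(\<lambda>w. p (\<xi> (dg w))) \<in> reg Y ?KO" if "p \<in> polys (n + n + k)" for p
        by (rule morphism_reg'[OF mdg Y oKY affine_chart_polys[OF ch that] oN0]) (use dgK in auto)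
      have ra: "(\<lambda>w. \<xi> w l) \<in> reg Y ?KO" if "l < n + n + k" for l
        using rk[OF polys.coord[OF that]] by simp
      have rb: "(\<lambda>w. \<xi> (dg w) l) \<in> reg Y ?KO" if "l < n + n + k" for l
        using rkd[OF polys.coord[OF that]] by simp
      have "\<exists>\<beta>. (\<forall>l<n + n + k. \<beta> l \<in> reg Y ?KO) \<and>
          (\<forall>w\<in>?KO. p (\<xi> w) - p (\<xi> (dg w)) = (\<Sum>l<n + n + k. \<beta> l w * (\<xi> w l - \<xi> (dg w) l)))"
        by (rule polys_difference[OF Y oN0 pq(1)]) (erule ra, erule rb)
      then obtain \<beta> where \<beta>: "\<forall>l<n + n + k. \<beta> l \<in> reg Y ?KO"
          "\<forall>w\<in>?KO. p (\<xi> w) - p (\<xi> (dg w)) = (\<Sum>l<n + n + k. \<beta> l w * (\<xi> w l - \<xi> (dg w) l))" by (elim exE conjE)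
      \<comment> \<open>Only the second block of coordinates changes under \<open>dg\<close>. Its
        increment is the value at the second point minus that at the first, opposite to
        \<open>t\<close>, hence the sign.\<close>
      define \<epsilon> where "\<epsilon> l w = (if n \<le> l \<and> l < n + n then - d (l - n) (fst w) else 0)" for l and w :: "('x \<times> 'x) \<times> 'm"
      have \<epsilon>: "\<xi> w l - \<xi> (dg w) l = \<epsilon> l w * t w" if w: "w \<in> ?KO" for w l
      proof -
        have "fst w \<in> W" using w O1(2) by (auto simp: O'_def)
        then have "\<zeta> (snd (fst w)) (l - n) - \<zeta> (fst (fst w)) (l - n) = - d (l - n) (fst w) * t w" if "l - n < n"
          using d(2) that by (auto simp: t_def algebra_simps)
        then show ?thesis by (auto simp: \<xi>_def \<epsilon>_def join_coords_def dg_def)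
      qed
      have r\<epsilon>: "\<epsilon> l \<in> reg Y ?KO" for l
      proof (cases "n \<le> l \<and> l < n + n")
        case True
        then have "l - n < n" by linarith
        then have "d (l - n) \<in> reg XX W" using d(1) by blast
        then have "(\<lambda>w. d (l - n) (fst w)) \<in> reg Y ?KO"
          by (rule morphism_reg'[OF morphism_fst[OF XX M] Y W(1) _ oN0]) (use O1(2) in \<open>auto simp: O'_def\<close>)
        then have "(\<lambda>w. - d (l - n) (fst w)) \<in> reg Y ?KO" by (rule reg_uminus[OF Y oN0])
        then show ?thesis using True by (simp add: \<epsilon>_def[abs_def])
      next
        case False
        then show ?thesis using reg_const[OF Y oN0, of 0] by (auto simp: \<epsilon>_def[abs_def])
      qed
      define b where "b w = (\<Sum>l<n + n + k. \<beta> l w * \<epsilon> l w)" for w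
      have rb': "b \<in> reg Y ?KO"
        unfolding b_def[abs_def] using \<beta>(1) r\<epsilon> by (intro reg_sum[OF Y oN0] reg_mult[OF Y oN0]) auto
      have pb: "p (\<xi> w) - p (\<xi> (dg w)) = b w * t w" if "w \<in> ?KO" for w
        using \<beta>(2) that by (simp add: \<epsilon>[OF that] b_def sum_distrib_right mult.assoc)
      \<comment> \<open>The fraction for \<open>f\<close> is used both at \<open>w\<close> and at
        \<open>dg w\<close>, so both denominators must be nonzero. At a diagonal point the two
        coincide.\<close>
      define Q where "Q w = q (\<xi> w) * q (\<xi> (dg w))" for w
      have rQ: "Q \<in> reg Y ?KO" unfolding Q_def[abs_def] by (intro reg_mult[OF Y oN0] rk rkd pq)
      let ?N = "{w \<in> ?KO. Q w \<noteq> 0}"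
      note oN = reg_open[OF Y oN0 rQ]
      have sub: "?N \<subseteq> ?KO" by blast
      have "(\<lambda>w. b w / q (\<xi> w)) \<in> reg Y ?N"
        by (rule reg_divide[OF Y oN reg_mono[OF Y oN0 oN sub rb'] reg_mono[OF Y oN0 oN sub rk[OF pq(2)]]])
          (auto simp: Q_def)
      moreover have "f w = b w / q (\<xi> w) * t w" if w: "w \<in> ?N" for w
      proof -
        have wK: "w \<in> ?K" and q: "q (\<xi> w) \<noteq> 0" "q (\<xi> (dg w)) \<noteq> 0" using w by (auto simp: Q_def)
        have "dg w \<in> O1 \<and> f (dg w) = p (\<xi> (dg w)) / q (\<xi> (dg w))" using bspec[OF pq(4) dgK[OF wK]] q(2) by blast
        moreover have "diagonal (dg w)" by (simp add: dg_def)
        ultimately have "p (\<xi> (dg w)) = 0" using f(2) q(2) by auto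
        then have "p (\<xi> w) = b w * t w" using pb[of w] w by simp
        moreover have "f w = p (\<xi> w) / q (\<xi> w)" using bspec[OF pq(4) wK] q(1) by blast
        ultimately show ?thesis by simp
      qed
      moreover have "dg z = z" by (simp add: dg_def zx)
      then have "z \<in> ?N" using zK z pq(3) by (simp add: Q_def)
      ultimately show ?thesis
        using oN by (intro exI[of _ ?N] exI[of _ "\<lambda>w. b w / q (\<xi> w)"]) auto
    qed
    have "\<forall>z. \<exists>Nh. z \<in> O1 \<longrightarrow> openin (zariski Y) (fst Nh) \<and> z \<in> fst Nh \<and> fst Nh \<subseteq> O1 \<and>
        snd Nh \<in> reg Y (fst Nh) \<and> (\<forall>w\<in>fst Nh. f w = snd Nh w * t w)"
      using loc by (metis fst_conv snd_conv)
    from choice[OF this] obtain Nh where "\<And>z. z \<in> O1 \<Longrightarrow> openin (zariski Y) (fst (Nh z)) \<and> z \<in> fst (Nh z) \<and>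
        fst (Nh z) \<subseteq> O1 \<and> snd (Nh z) \<in> reg Y (fst (Nh z)) \<and> (\<forall>w\<in>fst (Nh z). f w = snd (Nh z) w * t w)" by auto
    then obtain N H where NH: "\<And>z. z \<in> O1 \<Longrightarrow> openin (zariski Y) (N z)" "\<And>z. z \<in> O1 \<Longrightarrow> z \<in> N z"
      "\<And>z. z \<in> O1 \<Longrightarrow> N z \<subseteq> O1" "\<And>z. z \<in> O1 \<Longrightarrow> H z \<in> reg Y (N z)"
      "\<And>z w. z \<in> O1 \<Longrightarrow> w \<in> N z \<Longrightarrow> f w = H z w * t w"
      using that[of "\<lambda>z. fst (Nh z)" "\<lambda>z. snd (Nh z)"] by blast
    define h where "h z = H z z" for z
    \<comment> \<open>Off the diagonal any two local quotients agree because \<open>t\<close> is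
      nonzero there; density extends the agreement to the diagonal, so choosing the quotient
      pointwise gives a regular function.\<close>
    have hH: "h w = H z w" if z: "z \<in> O1" and w: "w \<in> N z" for z w
    proof -
      have wO: "w \<in> O1" using NH(3)[OF z] w by blast
      let ?N = "N z \<inter> N w"
      have o: "openin (zariski Y) ?N" using NH(1)[OF z] NH(1)[OF wO] by (rule openin_Int)
      have r: "(\<lambda>v. H z v - H w v) \<in> reg Y ?N"
        by (intro reg_diff[OF Y o] reg_mono[OF Y NH(1)[OF z] o Int_lower1 NH(4)[OF z]]
            reg_mono[OF Y NH(1)[OF wO] o Int_lower2 NH(4)[OF wO]])
      have "H z w - H w w = 0"
      proof (rule off_diagonal_dense[OF o r])
        fix v assume v: "v \<in> ?N" "\<not> diagonal v"
        have "v \<in> O'" using v(1) NH(3)[OF z] O1(2) by blast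
        then have "t v \<noteq> 0" using t0 v(2) by blast
        moreover have "f v = H z v * t v" by (rule NH(5)[OF z]) (use v(1) in blast)
        moreover have "f v = H w v * t v" by (rule NH(5)[OF wO]) (use v(1) in blast)
        ultimately show "H z v - H w v = 0" by simp
      qed (use w NH(2)[OF wO] in blast)
      then show ?thesis by (simp add: h_def)
    qed
    have "h \<in> reg Y O1"
    proof (rule reg_local[OF Y O1(1)])
      fix z assume z: "z \<in> O1"
      have "h \<in> reg Y (N z)" by (rule reg_cong[OF Y NH(1)[OF z] NH(4)[OF z]]) (rule hH[OF z])
      then show "\<exists>V. openin (zariski Y) V \<and> z \<in> V \<and> V \<subseteq> O1 \<and> h \<in> reg Y V"
        using NH(1-3)[OF z] by blast
    qed
    moreover have "\<forall>z\<in>O1. f z = h z * t z" using NH(2,5) by (auto simp: h_def)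
    ultimately show ?thesis by (intro bexI[of _ h])
  qed
  then have "diag_equation O' t"
    unfolding diag_equation_def using oO rt sw t0 by auto
  moreover have "z0 \<in> O'" using W(2) pts z0e by (simp add: O'_def)
  ultimately show ?thesis by blast
qed

lemma diag_equation_mono:
  assumes "diag_equation O' t" "openin (zariski Y) W" "W \<subseteq> O'" "\<And>z. z \<in> W \<Longrightarrow> swap12 z \<in> W"
  shows "diag_equation W t"
proof -
  note D = assms(1)[unfolded diag_equation_def]
  have "openin (zariski Y) O'" "t \<in> reg Y O'" using D by simp_all
  then have "t \<in> reg Y W" by (rule reg_mono[OF Y _ assms(2,3)])
  moreover have "\<forall>z\<in>W. swap12 z \<in> W \<and> t (swap12 z) = - t z" using D assms(3,4) by blast
  moreover have "\<forall>z\<in>W. t z = 0 \<longleftrightarrow> diagonal z" using D assms(3) by blast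
  moreover have "\<exists>h\<in>reg Y V. \<forall>z\<in>V. f z = h z * t z"
    if "openin (zariski Y) V \<and> V \<subseteq> W \<and> f \<in> reg Y V \<and> (\<forall>z\<in>V. diagonal z \<longrightarrow> f z = 0)" for V f
    using D[THEN conjunct2, THEN conjunct2, THEN conjunct2, THEN conjunct2, THEN spec, of V, THEN spec, of f]
      that assms(3) by auto
  ultimately show ?thesis unfolding diag_equation_def using assms(2) by simp
qed

end

section \<open>Frames of vector bundles\<close>

lemma vector_bundle_chart: "vector_bundle S E \<Longrightarrow> openin (zariski S) (chart E i)"
  and vector_bundle_cover: "vector_bundle S E \<Longrightarrow> (\<Union>i. chart E i) = points S"
  and vector_bundle_reg: "vector_bundle S E \<Longrightarrow>
    (\<lambda>x. transition E i j x $ a $ b) \<in> reg S (chart E i \<inter> chart E j)"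
  and vector_bundle_diag: "vector_bundle S E \<Longrightarrow> x \<in> chart E i \<Longrightarrow> transition E i i x = mat 1"
  and vector_bundle_cocycle: "vector_bundle S E \<Longrightarrow> x \<in> chart E i \<Longrightarrow> x \<in> chart E j \<Longrightarrow> x \<in> chart E k \<Longrightarrow>
    transition E i j x ** transition E j k x = transition E i k x"
  by (simp_all add: vector_bundle_def)

lemma vector_bundle_inverse:
  assumes "vector_bundle S E" "x \<in> chart E i" "x \<in> chart E j"
  shows "transition E i j x ** transition E j i x = mat 1"
  using vector_bundle_cocycle[OF assms(1,2,3,2)] vector_bundle_diag[OF assms(1,2)] by simp

lemma vector_bundle_invertible:
  assumes "vector_bundle S E" "x \<in> chart E i" "x \<in> chart E j"
  shows "invertible (transition E i j x)"
  unfolding invertible_def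
  using vector_bundle_inverse[OF assms] vector_bundle_inverse[OF assms(1,3,2)] by blast

section \<open>Matrices of regular functions and frames\<close>

definition reg_matrix :: "'a space \<Rightarrow> 'a set \<Rightarrow> ('a \<Rightarrow> complex^'n^'m) \<Rightarrow> bool" where
  "reg_matrix S W A \<longleftrightarrow> (\<forall>a b. (\<lambda>x. A x $ a $ b) \<in> reg S W)"

lemma reg_matrix_mult:
  fixes A :: "'a \<Rightarrow> complex^'n::finite^'m"
  assumes S: "regular_space S" and W: "openin (zariski S) W" and A: "reg_matrix S W A" and B: "reg_matrix S W B"
  shows "reg_matrix S W (\<lambda>x. A x ** B x)"
  unfolding reg_matrix_def matrix_matrix_mult_def
  using A B by (auto simp: reg_matrix_def intro!: reg_sum[OF S W] reg_mult[OF S W])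

lemma reg_matrix_mono:
  assumes "regular_space S" "openin (zariski S) U" "openin (zariski S) V" "V \<subseteq> U" "reg_matrix S U A"
  shows "reg_matrix S V A"
  using assms(5) reg_mono[OF assms(1-4)] by (simp add: reg_matrix_def)

lemma reg_matrix_cong:
  assumes "regular_space S" "openin (zariski S) U" "reg_matrix S U A" "\<And>x. x \<in> U \<Longrightarrow> B x = A x"
  shows "reg_matrix S U B"
  unfolding reg_matrix_def
proof (intro allI)
  fix a b
  have "(\<lambda>x. A x $ a $ b) \<in> reg S U" using assms(3) by (simp add: reg_matrix_def)
  then show "(\<lambda>x. B x $ a $ b) \<in> reg S U"
    by (rule reg_cong[OF assms(1,2)]) (simp add: assms(4))
qed

lemma reg_matrix_local:
  assumes "regular_space S" "openin (zariski S) U"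
    "\<And>x. x \<in> U \<Longrightarrow> \<exists>V. openin (zariski S) V \<and> x \<in> V \<and> V \<subseteq> U \<and> reg_matrix S V A"
  shows "reg_matrix S U A"
  unfolding reg_matrix_def
proof (intro allI)
  fix a b
  show "(\<lambda>x. A x $ a $ b) \<in> reg S U"
  proof (rule reg_local[OF assms(1,2)])
    fix x assume "x \<in> U"
    then obtain V where "openin (zariski S) V" "x \<in> V" "V \<subseteq> U" "reg_matrix S V A" using assms(3) by blast
    then show "\<exists>V. openin (zariski S) V \<and> x \<in> V \<and> V \<subseteq> U \<and> (\<lambda>x. A x $ a $ b) \<in> reg S V"
      by (intro exI[of _ V]) (simp add: reg_matrix_def)
  qed
qed

lemma reg_det:
  fixes A :: "'a \<Rightarrow> complex^'n::finite^'n"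
  assumes S: "regular_space S" and W: "openin (zariski S) W" and A: "reg_matrix S W A"
  shows "(\<lambda>x. det (A x)) \<in> reg S W"
  unfolding det_def
  using A by (auto simp: reg_matrix_def intro!: reg_sum[OF S W] reg_mult[OF S W] reg_prod[OF S W] reg_const[OF S W])

text \<open>The columns of \<open>A i\<close> are the frame vectors written in the trivialization
  \<open>i\<close>. The frame is thus an isomorphism from the trivial bundle on \<open>N\<close>,
  given chart by chart.\<close>

definition bundle_frame ::
  "'a space \<Rightarrow> ('a, 'i, 'n::finite) vbundle \<Rightarrow> 'a set \<Rightarrow> ('i \<Rightarrow> 'a \<Rightarrow> complex^'n^'n) \<Rightarrow> bool" where
  "bundle_frame S E N A \<longleftrightarrow> openin (zariski S) N \<and> (\<forall>i. reg_matrix S (N \<inter> chart E i) (A i)) \<and>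
     (\<forall>i. \<forall>x\<in>N \<inter> chart E i. invertible (A i x)) \<and>
     (\<forall>i j. \<forall>x\<in>N \<inter> chart E i \<inter> chart E j. A i x = transition E i j x ** A j x)"

lemma bundle_frame_chart:
  assumes "vector_bundle S E"
  shows "bundle_frame S E (chart E i) (\<lambda>k. transition E k i)"
  unfolding bundle_frame_def reg_matrix_def
  using vector_bundle_chart[OF assms] vector_bundle_reg[OF assms] vector_bundle_invertible[OF assms]
    vector_bundle_cocycle[OF assms]
  by (auto simp: Int_commute)

lemma mat_mult_entry: "(mat c ** A) $ a $ b = c * A $ a $ b" for c :: complex
  by (simp add: matrix_matrix_mult_def mat_def if_distrib[of "\<lambda>x. x * _"] cong: if_cong)

lemma mat_mult_entry': "(A ** mat c) $ a $ b = c * A $ a $ b" for c :: complex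
  by (simp add: matrix_matrix_mult_def mat_def if_distrib[of "\<lambda>x. _ * x"] mult.commute cong: if_cong)

lemma mat_commute: "A ** mat c = mat c ** A" for c :: complex
  by (simp add: vec_eq_iff mat_mult_entry mat_mult_entry')

lemma mat_add_mult:
  fixes g g' :: "complex^'n::finite^'n"
  assumes "g ** g' = mat 1"
  shows "g ** (mat a + mat b ** g') = mat a ** g + mat b"
proof -
  have "g ** (mat b ** g') = (mat b ** g) ** g'" by (simp only: matrix_mul_assoc mat_commute)
  also have "\<dots> = mat b" by (simp only: matrix_mul_assoc[symmetric] assms matrix_mul_rid)
  finally show ?thesis by (simp only: matrix_add_ldistrib mat_commute[of g a])
qed

lemma invertible_mat: "c \<noteq> 0 \<Longrightarrow> invertible (mat c :: complex^'n::finite^'n)"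
  unfolding invertible_def
  by (rule exI[of _ "mat (inverse c)"]) (simp add: vec_eq_iff mat_mult_entry, simp add: mat_def)

text \<open>Obtained for all sufficiently large exponents, so that the transition matrices in both
  directions can share one. The sum of the exponents of all entries is a crude common bound.\<close>

lemma transition_clear_denominators:
  fixes E :: "('a, 'i, 'n::finite) vbundle"
  assumes S: "regular_space S" and c: "affine_chart S K n \<xi>" and E: "vector_bundle S E" and h: "h \<in> polys n"
    and D: "{x \<in> K. h (\<xi> x) \<noteq> 0} \<subseteq> chart E i \<inter> chart E j"
  shows "\<exists>N0. \<forall>N\<ge>N0. \<exists>P. (\<forall>a b. P a b \<in> polys n) \<and>
    (\<forall>a b. \<forall>x\<in>K. h (\<xi> x) \<noteq> 0 \<longrightarrow> transition E i j x $ a $ b * h (\<xi> x) ^ N = P a b (\<xi> x))"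
proof -
  let ?g = "\<lambda>a b x. transition E i j x $ a $ b"
  have "\<exists>N. \<exists>p\<in>polys n. \<forall>x\<in>K. h (\<xi> x) \<noteq> 0 \<longrightarrow> ?g a b x * h (\<xi> x) ^ N = p (\<xi> x)" for a b
    by (rule reg_basic_open[OF S c h reg_mono[OF S _ affine_chart_open_basic[OF c h] D vector_bundle_reg[OF E]]])
      (intro openin_Int vector_bundle_chart[OF E])
  then have "\<forall>ab. \<exists>Np. snd Np \<in> polys n \<and>
      (\<forall>x\<in>K. h (\<xi> x) \<noteq> 0 \<longrightarrow> ?g (fst ab) (snd ab) x * h (\<xi> x) ^ fst Np = snd Np (\<xi> x))"
    by (metis fst_conv snd_conv)
  from choice[OF this] obtain Np where "\<forall>ab. snd (Np ab) \<in> polys n \<and>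
      (\<forall>x\<in>K. h (\<xi> x) \<noteq> 0 \<longrightarrow> ?g (fst ab) (snd ab) x * h (\<xi> x) ^ fst (Np ab) = snd (Np ab) (\<xi> x))" ..
  then have Np: "\<And>ab. snd (Np ab) \<in> polys n"
    "\<And>ab x. x \<in> K \<Longrightarrow> h (\<xi> x) \<noteq> 0 \<Longrightarrow> ?g (fst ab) (snd ab) x * h (\<xi> x) ^ fst (Np ab) = snd (Np ab) (\<xi> x)"
    by blast+
  define N0 where "N0 = (\<Sum>ab\<in>UNIV. fst (Np ab))"
  have le: "fst (Np ab) \<le> N0" for ab
    unfolding N0_def by (rule member_le_sum) auto
  show ?thesis
  proof (intro exI[of _ N0] allI impI)
    fix N assume N: "N0 \<le> N"
    show "\<exists>P. (\<forall>a b. P a b \<in> polys n) \<and>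
      (\<forall>a b. \<forall>x\<in>K. h (\<xi> x) \<noteq> 0 \<longrightarrow> ?g a b x * h (\<xi> x) ^ N = P a b (\<xi> x))"
    proof (intro exI[of _ "\<lambda>a b v. snd (Np (a, b)) v * h v ^ (N - fst (Np (a, b)))"] conjI allI ballI impI)
      fix a b x assume x: "x \<in> K" "h (\<xi> x) \<noteq> 0"
      have "h (\<xi> x) ^ N = h (\<xi> x) ^ fst (Np (a, b)) * h (\<xi> x) ^ (N - fst (Np (a, b)))"
        using le[of "(a, b)"] N by (simp add: power_add[symmetric])
      then show "?g a b x * h (\<xi> x) ^ N = snd (Np (a, b)) (\<xi> x) * h (\<xi> x) ^ (N - fst (Np (a, b)))"
        using Np(2)[OF x, of "(a, b)"] by (simp add: mult.assoc[symmetric])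
    qed (intro polys.mult polys_power Np h)
  qed
qed

text \<open>
  If \<open>a\<close> lies in the basic open set of \<open>h1\<close> inside the chart \<open>i\<close>, and \<open>b\<close> in that of \<open>h2\<close>
  inside the chart \<open>j\<close>, then for large \<open>N\<close> the frame \<open>h1\<^sup>N e\<^sup>i + h2\<^sup>N e\<^sup>j\<close> is regular on both sets.
  It is invertible at \<open>a\<close>, where \<open>h2 = 0\<close>, and at \<open>b\<close>, where \<open>h1 = 0\<close>.
\<close>

lemma local_frame_two_points:
  fixes E :: "('a, 'i, 'n::finite) vbundle"
  assumes S: "regular_space S" and c: "affine_chart S K n \<xi>" and E: "vector_bundle S E"
    and ab: "a \<in> K" "b \<in> K"
  shows "\<exists>N A. bundle_frame S E N A \<and> a \<in> N \<and> b \<in> N"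
proof -
  note oK = affine_chart_open[OF c]
  have pts: "a \<in> points S" "b \<in> points S" using openin_subset[OF oK] ab by auto
  obtain i where i: "a \<in> chart E i" using pts(1) vector_bundle_cover[OF E] by blast
  obtain j where j: "b \<in> chart E j" using pts(2) vector_bundle_cover[OF E] by blast
  show ?thesis
  proof (cases "b \<in> chart E i \<or> a \<in> chart E j")
    case True
    then show ?thesis using bundle_frame_chart[OF E] i j by blast
  next
    case False
    then have bi: "b \<notin> chart E i" and aj: "a \<notin> chart E j" by auto
    note oi = vector_bundle_chart[OF E, of i] and oj = vector_bundle_chart[OF E, of j]
    obtain p1 h1 where h1: "h1 \<in> polys n" "h1 (\<xi> a) \<noteq> 0"
      "\<forall>x\<in>K. h1 (\<xi> x) \<noteq> 0 \<longrightarrow> x \<in> chart E i \<and> 0 = p1 (\<xi> x) / h1 (\<xi> x)"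
      by (rule affine_chart_fraction[OF c oi reg_const[OF S oi, of 0] i ab(1)])
    obtain p2 h2 where h2: "h2 \<in> polys n" "h2 (\<xi> b) \<noteq> 0"
      "\<forall>x\<in>K. h2 (\<xi> x) \<noteq> 0 \<longrightarrow> x \<in> chart E j \<and> 0 = p2 (\<xi> x) / h2 (\<xi> x)"
      by (rule affine_chart_fraction[OF c oj reg_const[OF S oj, of 0] j ab(2)])
    have h1b: "h1 (\<xi> b) = 0" and h2a: "h2 (\<xi> a) = 0" using h1(3) h2(3) ab bi aj by auto
    define h where "h v = h1 v * h2 v" for v
    have h: "h \<in> polys n" unfolding h_def[abs_def] by (intro polys.mult h1 h2)
    have D: "{x \<in> K. h (\<xi> x) \<noteq> 0} \<subseteq> chart E i \<inter> chart E j"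
      using h1(3) h2(3) by (auto simp: h_def)
    then have D': "{x \<in> K. h (\<xi> x) \<noteq> 0} \<subseteq> chart E j \<inter> chart E i" by blast
    obtain N1 where N1: "\<forall>N\<ge>N1. \<exists>P. (\<forall>a b. P a b \<in> polys n) \<and>
        (\<forall>a b. \<forall>x\<in>K. h (\<xi> x) \<noteq> 0 \<longrightarrow> transition E i j x $ a $ b * h (\<xi> x) ^ N = P a b (\<xi> x))"
      using transition_clear_denominators[OF S c E h D] ..
    obtain N2 where N2: "\<forall>N\<ge>N2. \<exists>P. (\<forall>a b. P a b \<in> polys n) \<and>
        (\<forall>a b. \<forall>x\<in>K. h (\<xi> x) \<noteq> 0 \<longrightarrow> transition E j i x $ a $ b * h (\<xi> x) ^ N = P a b (\<xi> x))"
      using transition_clear_denominators[OF S c E h D'] ..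
    define N where "N = max N1 N2"
    obtain P where P: "\<forall>a b. P a b \<in> polys n"
        "\<forall>a b. \<forall>x\<in>K. h (\<xi> x) \<noteq> 0 \<longrightarrow> transition E i j x $ a $ b * h (\<xi> x) ^ N = P a b (\<xi> x)"
      using N1[rule_format, of N] by (auto simp: N_def)
    obtain Q where Q: "\<forall>a b. Q a b \<in> polys n"
        "\<forall>a b. \<forall>x\<in>K. h (\<xi> x) \<noteq> 0 \<longrightarrow> transition E j i x $ a $ b * h (\<xi> x) ^ N = Q a b (\<xi> x)"
      using N2[rule_format, of N] by (auto simp: N_def)
    \<comment> \<open>The frame with exponent \<open>Suc N\<close> in the chart \<open>i\<close>: as
      h = h1 h2, the term h2 P / h1^N is h2^(N+1) times the transition matrix. \<open>P\<close> need
      not vanish at \<open>a\<close>, so the extra factor \<open>h2\<close> is what makes this term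
      vanish there.\<close>
    define Si :: "'a \<Rightarrow> complex^'n^'n" where "Si x = (\<chi> u v. h1 (\<xi> x) ^ Suc N * mat 1 $ u $ v +
        h2 (\<xi> x) * P u v (\<xi> x) / h1 (\<xi> x) ^ N)" for x
    define Sj :: "'a \<Rightarrow> complex^'n^'n" where "Sj x = (\<chi> u v. h2 (\<xi> x) ^ Suc N * mat 1 $ u $ v +
        h1 (\<xi> x) * Q u v (\<xi> x) / h2 (\<xi> x) ^ N)" for x
    let ?D1 = "{x \<in> K. h1 (\<xi> x) \<noteq> 0}" and ?D2 = "{x \<in> K. h2 (\<xi> x) \<noteq> 0}"
    note o1 = affine_chart_open_basic[OF c h1(1)] and o2 = affine_chart_open_basic[OF c h2(1)]
    have r1: "(\<lambda>x. p (\<xi> x)) \<in> reg S ?D1" if "p \<in> polys n" for p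
      by (rule reg_mono[OF S oK o1 _ affine_chart_polys[OF c that]]) blast
    have r2: "(\<lambda>x. p (\<xi> x)) \<in> reg S ?D2" if "p \<in> polys n" for p
      by (rule reg_mono[OF S oK o2 _ affine_chart_polys[OF c that]]) blast
    have rSi: "reg_matrix S ?D1 Si"
      unfolding reg_matrix_def Si_def
    proof (intro allI, simp only: vec_lambda_beta)
      fix u v
      show "(\<lambda>x. h1 (\<xi> x) ^ Suc N * mat 1 $ u $ v + h2 (\<xi> x) * P u v (\<xi> x) / h1 (\<xi> x) ^ N) \<in> reg S ?D1"
        by (intro reg_add[OF S o1] reg_mult[OF S o1] reg_divide[OF S o1] reg_const[OF S o1]
            r1 polys_power h1(1) h2(1) P(1)[rule_format]) auto
    qed
    have rSj: "reg_matrix S ?D2 Sj"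
      unfolding reg_matrix_def Sj_def
    proof (intro allI, simp only: vec_lambda_beta)
      fix u v
      show "(\<lambda>x. h2 (\<xi> x) ^ Suc N * mat 1 $ u $ v + h1 (\<xi> x) * Q u v (\<xi> x) / h2 (\<xi> x) ^ N) \<in> reg S ?D2"
        by (intro reg_add[OF S o2] reg_mult[OF S o2] reg_divide[OF S o2] reg_const[OF S o2]
            r2 polys_power h1(1) h2(1) Q(1)[rule_format]) auto
    qed
    have comp: "Si x = transition E i j x ** Sj x" if x: "x \<in> ?D1" "x \<in> ?D2" for x
    proof -
      have hx: "x \<in> K" "h (\<xi> x) \<noteq> 0" using x by (auto simp: h_def)
      then have xij: "x \<in> chart E i" "x \<in> chart E j" using D by auto
      have "Si x = mat (h1 (\<xi> x) ^ Suc N) + mat (h2 (\<xi> x) ^ Suc N) ** transition E i j x"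
      proof -
        have "h2 (\<xi> x) * P u v (\<xi> x) / h1 (\<xi> x) ^ N = h2 (\<xi> x) ^ Suc N * transition E i j x $ u $ v" for u v
          using P(2)[rule_format, OF hx, symmetric, of u v] x by (simp add: h_def power_mult_distrib field_simps)
        then show ?thesis by (simp add: vec_eq_iff Si_def mat_mult_entry) (simp add: mat_def)
      qed
      moreover have "Sj x = mat (h2 (\<xi> x) ^ Suc N) + mat (h1 (\<xi> x) ^ Suc N) ** transition E j i x"
      proof -
        have "h1 (\<xi> x) * Q u v (\<xi> x) / h2 (\<xi> x) ^ N = h1 (\<xi> x) ^ Suc N * transition E j i x $ u $ v" for u v
          using Q(2)[rule_format, OF hx, symmetric, of u v] x by (simp add: h_def power_mult_distrib field_simps)
        then show ?thesis by (simp add: vec_eq_iff Sj_def mat_mult_entry) (simp add: mat_def)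
      qed
      moreover have "transition E i j x ** (mat (h2 (\<xi> x) ^ Suc N) + mat (h1 (\<xi> x) ^ Suc N) ** transition E j i x)
          = mat (h2 (\<xi> x) ^ Suc N) ** transition E i j x + mat (h1 (\<xi> x) ^ Suc N)"
        by (rule mat_add_mult[OF vector_bundle_inverse[OF E xij]])
      ultimately show ?thesis by (simp only: add.commute)
    qed
    have comp': "Sj x = transition E j i x ** Si x" if x: "x \<in> ?D1" "x \<in> ?D2" for x
    proof -
      have "x \<in> chart E i" "x \<in> chart E j" using h1(3) h2(3) x by auto
      then show ?thesis
        unfolding comp[OF x] by (simp add: matrix_mul_assoc vector_bundle_inverse[OF E])
    qed
    \<comment> \<open>Where both \<open>h1\<close> and \<open>h2\<close> are nonzero,
      \<open>Si\<close> and \<open>Sj\<close> differ by an invertible factor. The two determinant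
      conditions then agree, and \<open>A\<close> may be computed from either matrix.\<close>
    define N' where "N' = {x \<in> ?D1. det (Si x) \<noteq> 0} \<union> {x \<in> ?D2. det (Sj x) \<noteq> 0}"
    define A where "A k x = (if x \<in> ?D1 then transition E k i x ** Si x else transition E k j x ** Sj x)" for k x
    have oN1: "openin (zariski S) {x \<in> ?D1. det (Si x) \<noteq> 0}" by (rule reg_open[OF S o1 reg_det[OF S o1 rSi]])
    have oN2: "openin (zariski S) {x \<in> ?D2. det (Sj x) \<noteq> 0}" by (rule reg_open[OF S o2 reg_det[OF S o2 rSj]])
    have oN: "openin (zariski S) N'" unfolding N'_def using oN1 oN2 by (rule openin_Un)
    have chi: "x \<in> chart E i" if "x \<in> ?D1" for x using that h1(3) by blast
    have chj: "x \<in> chart E j" if "x \<in> ?D2" for x using that h2(3) by blast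
    have A1: "A k x = transition E k i x ** Si x" and d1: "det (Si x) \<noteq> 0"
      if x: "x \<in> ?D1" "x \<in> N'" for k x
    proof -
      show "A k x = transition E k i x ** Si x" using x by (simp add: A_def)
      show "det (Si x) \<noteq> 0"
      proof (cases "x \<in> ?D2 \<and> det (Sj x) \<noteq> 0")
        case True
        then have "det (transition E j i x) * det (Si x) \<noteq> 0"
          using comp'[of x] x(1) by (simp add: det_mul)
        then show ?thesis by auto
      qed (use x in \<open>auto simp: N'_def\<close>)
    qed
    have A2: "A k x = transition E k j x ** Sj x" and d2: "det (Sj x) \<noteq> 0"
      if x: "x \<in> ?D2" "x \<in> N'" "x \<in> chart E k" for k x
    proof -
      show "A k x = transition E k j x ** Sj x"
      proof (cases "x \<in> ?D1")
        case True
        show ?thesis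
          unfolding A1[OF True x(2)] comp[OF True x(1)] matrix_mul_assoc
            vector_bundle_cocycle[OF E x(3) chi[OF True] chj[OF x(1)]] ..
      next
        case False
        then show ?thesis by (simp only: A_def if_False)
      qed
      show "det (Sj x) \<noteq> 0"
      proof (cases "x \<in> ?D1")
        case True
        have "det (transition E i j x) * det (Sj x) \<noteq> 0"
          using d1[OF True x(2)] comp[OF True x(1)] by (simp add: det_mul)
        then show ?thesis by auto
      qed (use x in \<open>auto simp: N'_def\<close>)
    qed
    have "bundle_frame S E N' A"
      unfolding bundle_frame_def
    proof (intro conjI allI ballI)
      show "openin (zariski S) N'" by (rule oN)
    next
      fix k
      have ok: "openin (zariski S) (chart E k)" by (rule vector_bundle_chart[OF E])
      have oNk: "openin (zariski S) (N' \<inter> chart E k)" using oN ok by (rule openin_Int)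
      show "reg_matrix S (N' \<inter> chart E k) (A k)"
      proof (rule reg_matrix_local[OF S oNk])
        fix x assume x: "x \<in> N' \<inter> chart E k"
        show "\<exists>V. openin (zariski S) V \<and> x \<in> V \<and> V \<subseteq> N' \<inter> chart E k \<and> reg_matrix S V (A k)"
        proof (cases "x \<in> ?D1")
          case True
          let ?V = "?D1 \<inter> (N' \<inter> chart E k)"
          have oV: "openin (zariski S) ?V" using o1 oNk by (rule openin_Int)
          have sub: "?V \<subseteq> chart E k \<inter> chart E i" using chi by blast
          have "reg_matrix S ?V (\<lambda>x. transition E k i x ** Si x)"
            by (rule reg_matrix_mult[OF S oV reg_matrix_mono[OF S openin_Int[OF ok oi] oV sub]
                  reg_matrix_mono[OF S o1 oV Int_lower1 rSi]])
              (simp add: reg_matrix_def vector_bundle_reg[OF E])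
          then have "reg_matrix S ?V (A k)"
            by (rule reg_matrix_cong[OF S oV]) (use A1 in blast)
          then show ?thesis using oV x True by blast
        next
          case False
          then have xD2: "x \<in> ?D2" using x by (auto simp: N'_def)
          let ?V = "?D2 \<inter> (N' \<inter> chart E k)"
          have oV: "openin (zariski S) ?V" using o2 oNk by (rule openin_Int)
          have sub: "?V \<subseteq> chart E k \<inter> chart E j" using chj by blast
          have "reg_matrix S ?V (\<lambda>x. transition E k j x ** Sj x)"
            by (rule reg_matrix_mult[OF S oV reg_matrix_mono[OF S openin_Int[OF ok oj] oV sub]
                  reg_matrix_mono[OF S o2 oV Int_lower1 rSj]])
              (simp add: reg_matrix_def vector_bundle_reg[OF E])
          then have "reg_matrix S ?V (A k)"
            by (rule reg_matrix_cong[OF S oV]) (use A2 in blast)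
          then show ?thesis using oV x xD2 by blast
        qed
      qed
    next
      fix k x assume x: "x \<in> N' \<inter> chart E k"
      show "invertible (A k x)"
      proof (cases "x \<in> ?D1")
        case True
        then show ?thesis
          using x d1[OF True] vector_bundle_invertible[OF E _ chi[OF True], of k]
          by (simp add: A1[OF True] invertible_det_nz det_mul)
      next
        case False
        then have xD2: "x \<in> ?D2" using x by (auto simp: N'_def)
        then show ?thesis
          using x d2[OF xD2, of k] vector_bundle_invertible[OF E _ chj[OF xD2], of k]
          by (simp add: A2[OF xD2] invertible_det_nz det_mul)
      qed
    next
      fix k l x assume x: "x \<in> N' \<inter> chart E k \<inter> chart E l"
      show "A k x = transition E k l x ** A l x"
      proof (cases "x \<in> ?D1")
        case True
        then show ?thesis
          using x vector_bundle_cocycle[OF E _ _ chi[OF True], of k l]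
          by (simp add: A1[OF True] matrix_mul_assoc)
      next
        case False
        then have xD2: "x \<in> ?D2" using x by (auto simp: N'_def)
        then show ?thesis
          using x vector_bundle_cocycle[OF E _ _ chj[OF xD2], of k l]
          by (simp add: A2[OF xD2] matrix_mul_assoc)
      qed
    qed
    moreover have "a \<in> N'"
    proof -
      have "Si a = mat (h1 (\<xi> a) ^ Suc N)" by (simp add: vec_eq_iff Si_def h2a) (simp add: mat_def)
      then have "det (Si a) \<noteq> 0" using invertible_mat[of "h1 (\<xi> a) ^ Suc N"] h1(2) by (simp add: invertible_det_nz)
      then show ?thesis using ab h1(2) by (simp add: N'_def)
    qed
    moreover have "b \<in> N'"
    proof -
      have "Sj b = mat (h2 (\<xi> b) ^ Suc N)" by (simp add: vec_eq_iff Sj_def h1b) (simp add: mat_def)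
      then have "det (Sj b) \<noteq> 0" using invertible_mat[of "h2 (\<xi> b) ^ Suc N"] h2(2) by (simp add: invertible_det_nz)
      then show ?thesis using ab h2(2) by (simp add: N'_def)
    qed
    ultimately show ?thesis by blast
  qed
qed

section \<open>The descended bundle\<close>

lemma tensor_matrix_mult: "tensor_matrix A B ** tensor_matrix C D = tensor_matrix (A ** C) (B ** D)"
proof -
  have "(\<Sum>k\<in>UNIV. A $ fst a $ fst k * B $ snd a $ snd k * (C $ fst k $ fst b * D $ snd k $ snd b))
    = (\<Sum>k\<in>UNIV. A $ fst a $ k * C $ k $ fst b) * (\<Sum>k\<in>UNIV. B $ snd a $ k * D $ k $ snd b)" for a b
    unfolding sum_product UNIV_Times_UNIV[symmetric] sum.cartesian_product'
    by (intro sum.cong refl) (simp add: mult.assoc mult.left_commute)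
  then show ?thesis
    by (simp add: tensor_matrix_def matrix_matrix_mult_def vec_eq_iff)
qed

lemma tensor_matrix_one: "tensor_matrix (mat 1) (mat 1) = mat 1"
  by (simp add: tensor_matrix_def mat_def vec_eq_iff prod_eq_iff)

lemma tensor_matrix_inverse:
  "A ** A' = mat 1 \<Longrightarrow> B ** B' = mat 1 \<Longrightarrow> tensor_matrix A B ** tensor_matrix A' B' = mat 1"
  by (simp add: tensor_matrix_mult tensor_matrix_one)

definition flip_matrix :: "complex^(2 \<times> 2)^(2 \<times> 2)" where
  "flip_matrix = (\<chi> c d. if d = prod.swap c then 1 else 0)"

lemma flip_matrix_vec: "flip_matrix *v v = (\<chi> c. v $ prod.swap c)"
  by (simp add: flip_matrix_def matrix_vector_mult_def vec_eq_iff if_distrib[of "\<lambda>x. x * _"] cong: if_cong)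

lemma flip_matrix_left: "(flip_matrix ** A) $ c $ d = A $ prod.swap c $ d"
  by (simp add: flip_matrix_def matrix_matrix_mult_def if_distrib[of "\<lambda>x. x * _"] cong: if_cong)

lemma flip_matrix_right: "(A ** flip_matrix) $ c $ d = A $ c $ prod.swap d"
proof -
  have "(d = prod.swap k) = (k = prod.swap d)" for k :: "2 \<times> 2" by auto
  then show ?thesis
    by (simp add: flip_matrix_def matrix_matrix_mult_def if_distrib[of "\<lambda>x. _ * x"] cong: if_cong)
qed

lemma flip_matrix_tensor: "flip_matrix ** tensor_matrix A B = tensor_matrix B A ** flip_matrix"
  by (simp add: vec_eq_iff flip_matrix_left flip_matrix_right)
    (simp add: tensor_matrix_def mult.commute)

text \<open>
  Columns: \<open>e\<^sub>1 \<otimes> e\<^sub>1\<close>, \<open>e\<^sub>2 \<otimes> e\<^sub>2\<close>, \<open>e\<^sub>1 \<otimes> e\<^sub>2 + e\<^sub>2 \<otimes> e\<^sub>1\<close>, \<open>s (e\<^sub>1 \<otimes> e\<^sub>2 - e\<^sub>2 \<otimes> e\<^sub>1)\<close>. For \<open>s\<close> an odd local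
  equation of the diagonal these form an invariant frame of the kernel sheaf.
\<close>

definition kernel_frame :: "complex \<Rightarrow> complex^4^(2 \<times> 2)" where
  "kernel_frame s = (\<chi> c k. if c = (1, 1) then (if k = 1 then 1 else 0)
     else if c = (2, 2) then (if k = 2 then 1 else 0)
     else if c = (1, 2) then (if k = 3 then 1 else if k = 4 then s else 0)
     else (if k = 3 then 1 else if k = 4 then - s else 0))"

lemma all_2_times_2: "(\<forall>c::2 \<times> 2. P c) \<longleftrightarrow> P (1, 1) \<and> P (2, 2) \<and> P (1, 2) \<and> P (2, 1)"
  unfolding split_paired_All forall_2 by auto

lemma kernel_frame_apply:
  "(kernel_frame s *v c) $ (1, 1) = c $ 1" "(kernel_frame s *v c) $ (2, 2) = c $ 2"
  "(kernel_frame s *v c) $ (1, 2) = c $ 3 + s * c $ 4" "(kernel_frame s *v c) $ (2, 1) = c $ 3 - s * c $ 4"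
  by (simp_all add: kernel_frame_def matrix_vector_mult_def sum_4)

text \<open>The flip fixes the three symmetric columns and negates the fourth, which has the same
  effect as changing the sign of \<open>s\<close>. With \<open>s\<close> odd under the swap, the two
  changes cancel.\<close>

lemma kernel_frame_flip: "flip_matrix ** kernel_frame s = kernel_frame (- s)"
  unfolding vec_eq_iff all_2_times_2 flip_matrix_left by (simp add: kernel_frame_def)

lemma kernel_frame_inj:
  assumes "s \<noteq> 0" "kernel_frame s *v c = kernel_frame s *v c'"
  shows "c = c'"
proof -
  have e: "(kernel_frame s *v c) $ d = (kernel_frame s *v c') $ d" for d using assms(2) by simp
  have 1: "c $ 1 = c' $ 1" "c $ 2 = c' $ 2" using e[of "(1, 1)"] e[of "(2, 2)"] by (simp_all add: kernel_frame_apply)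
  have p: "c $ 3 + s * c $ 4 = c' $ 3 + s * c' $ 4" and m: "c $ 3 - s * c $ 4 = c' $ 3 - s * c' $ 4"
    using e[of "(1, 2)"] e[of "(2, 1)"] by (simp_all add: kernel_frame_apply)
  have "2 * c $ 3 = (c $ 3 + s * c $ 4) + (c $ 3 - s * c $ 4)" by simp
  also have "\<dots> = 2 * c' $ 3" unfolding p m by simp
  finally have 3: "c $ 3 = c' $ 3" by simp
  then have "c $ 4 = c' $ 4" using p assms(1) by simp
  with 1 3 show ?thesis by (simp add: vec_eq_iff forall_4)
qed

text \<open>At s = 0 the fourth column disappears, and the remaining columns are symmetric
  tensors.\<close>

lemma kernel_frame_zero_wedge: "wedge (kernel_frame 0 *v c) = 0"
  by (simp add: wedge_def kernel_frame_apply vec_eq_iff)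

lemma matrix_mult_column: "(A ** B) $ a $ b = (A *v (\<chi> k. B $ k $ b)) $ a"
  by (simp add: matrix_matrix_mult_def matrix_vector_mult_def)

text \<open>The adjugate divided by the determinant, written out so that the regularity of the
  inverse can be read off entry by entry.\<close>

definition inv2 :: "complex^2^2 \<Rightarrow> complex^2^2" where
  "inv2 A = (\<chi> a b. (if a = 1 then (if b = 1 then A $ 2 $ 2 else - A $ 1 $ 2)
      else (if b = 1 then - A $ 2 $ 1 else A $ 1 $ 1)) / det A)"

lemma
  assumes "invertible A"
  shows inv2_left: "inv2 A ** A = mat 1" and inv2_right: "A ** inv2 A = mat 1"
proof -
  define d where "d = det A"
  have d: "d \<noteq> 0" "A $ 1 $ 1 * A $ 2 $ 2 = d + A $ 1 $ 2 * A $ 2 $ 1"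
    using assms by (simp_all add: d_def invertible_det_nz det_2)
  have i: "inv2 A $ 1 $ 1 = A $ 2 $ 2 / d" "inv2 A $ 1 $ 2 = - (A $ 1 $ 2 / d)"
    "inv2 A $ 2 $ 1 = - (A $ 2 $ 1 / d)" "inv2 A $ 2 $ 2 = A $ 1 $ 1 / d"
    by (simp_all add: inv2_def d_def)
  have e: "A $ 1 $ 1 * A $ 2 $ 2 / d - A $ 1 $ 2 * A $ 2 $ 1 / d = 1"
    unfolding d(2) using d(1) by (simp add: add_divide_distrib)
  show "inv2 A ** A = mat 1" "A ** inv2 A = mat 1"
    using e by (simp_all add: vec_eq_iff forall_2 matrix_matrix_mult_def sum_2 mat_def i mult.commute)
qed

lemma reg_if:
  "(P \<Longrightarrow> f \<in> reg S W) \<Longrightarrow> (\<not> P \<Longrightarrow> g \<in> reg S W) \<Longrightarrow> (\<lambda>x. if P then f x else g x) \<in> reg S W"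
  by (cases P) simp_all

lemma reg_matrix_inv2:
  assumes S: "regular_space S" and W: "openin (zariski S) W" and A: "reg_matrix S W A"
    and inv: "\<And>x. x \<in> W \<Longrightarrow> invertible (A x)"
  shows "reg_matrix S W (\<lambda>x. inv2 (A x))"
proof -
  have r: "(\<lambda>x. A x $ a $ b) \<in> reg S W" for a b using A by (simp add: reg_matrix_def)
  have d: "det (A x) \<noteq> 0" if "x \<in> W" for x using inv[OF that] by (simp add: invertible_det_nz)
  show ?thesis
    unfolding reg_matrix_def inv2_def
    by (simp only: vec_lambda_beta)
      (intro allI reg_divide[OF S W _ reg_det[OF S W A] d] reg_if reg_uminus[OF S W] r)
qed

section \<open>Regular vector-valued functions\<close>

definition reg_vector :: "'a space \<Rightarrow> 'a set \<Rightarrow> ('a \<Rightarrow> complex^'n) \<Rightarrow> bool" where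
  "reg_vector S W v \<longleftrightarrow> (\<forall>a. (\<lambda>x. v x $ a) \<in> reg S W)"

lemma reg_vector_mult:
  fixes A :: "'a \<Rightarrow> complex^'n::finite^'m"
  assumes S: "regular_space S" and W: "openin (zariski S) W" and A: "reg_matrix S W A" and v: "reg_vector S W v"
  shows "reg_vector S W (\<lambda>x. A x *v v x)"
  unfolding reg_vector_def matrix_vector_mult_def
  using A v by (auto simp: reg_matrix_def reg_vector_def intro!: reg_sum[OF S W] reg_mult[OF S W])

lemma reg_vector_mono:
  assumes "regular_space S" "openin (zariski S) U" "openin (zariski S) V" "V \<subseteq> U" "reg_vector S U A"
  shows "reg_vector S V A"
  using assms(5) reg_mono[OF assms(1-4)] by (simp add: reg_vector_def)

lemma reg_vector_cong:
  assumes "regular_space S" "openin (zariski S) U" "reg_vector S U A" "\<And>x. x \<in> U \<Longrightarrow> B x = A x"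
  shows "reg_vector S U B"
  unfolding reg_vector_def
proof (intro allI)
  fix a
  have "(\<lambda>x. A x $ a) \<in> reg S U" using assms(3) by (simp add: reg_vector_def)
  then show "(\<lambda>x. B x $ a) \<in> reg S U"
    by (rule reg_cong[OF assms(1,2)]) (simp add: assms(4))
qed

lemma reg_vector_local:
  assumes "regular_space S" "openin (zariski S) U"
    "\<And>x. x \<in> U \<Longrightarrow> \<exists>V. openin (zariski S) V \<and> x \<in> V \<and> V \<subseteq> U \<and> reg_vector S V A"
  shows "reg_vector S U A"
  unfolding reg_vector_def
proof (intro allI)
  fix a
  show "(\<lambda>x. A x $ a) \<in> reg S U"
  proof (rule reg_local[OF assms(1,2)])
    fix x assume "x \<in> U"
    then obtain V where "openin (zariski S) V" "x \<in> V" "V \<subseteq> U" "reg_vector S V A" using assms(3) by blast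
    then show "\<exists>V. openin (zariski S) V \<and> x \<in> V \<and> V \<subseteq> U \<and> (\<lambda>x. A x $ a) \<in> reg S V"
      by (intro exI[of _ V]) (simp add: reg_vector_def)
  qed
qed

lemma reg_matrix_tensor:
  assumes S: "regular_space S" and W: "openin (zariski S) W" and A: "reg_matrix S W A" and B: "reg_matrix S W B"
  shows "reg_matrix S W (\<lambda>x. tensor_matrix (A x) (B x))"
  unfolding reg_matrix_def tensor_matrix_def
  using A B by (auto simp: reg_matrix_def intro!: reg_mult[OF S W])

lemma reg_matrix_kernel_frame:
  assumes S: "regular_space S" and W: "openin (zariski S) W" and t: "t \<in> reg S W"
  shows "reg_matrix S W (\<lambda>x. kernel_frame (t x))"
  unfolding reg_matrix_def kernel_frame_def
  by (simp only: vec_lambda_beta) (intro allI reg_if reg_const[OF S W] reg_uminus[OF S W] t)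

lemma reg_matrix_comp:
  assumes "morphism S T \<phi>" "regular_space S" "openin (zariski T) V" "reg_matrix T V A"
    "openin (zariski S) W" "W \<subseteq> \<phi> -` V"
  shows "reg_matrix S W (\<lambda>x. A (\<phi> x))"
  unfolding reg_matrix_def
proof (intro allI)
  fix a b
  have "(\<lambda>x. A x $ a $ b) \<in> reg T V" using assms(4) by (simp add: reg_matrix_def)
  then show "(\<lambda>x. A (\<phi> x) $ a $ b) \<in> reg S W" by (rule morphism_reg'[OF assms(1-3) _ assms(5,6)])
qed

section \<open>Coordinates with respect to the kernel frame\<close>

context curve_pair
begin

lemma diag_equation_open: "diag_equation O' s \<Longrightarrow> openin (zariski Y) O'"
  and diag_equation_reg: "diag_equation O' s \<Longrightarrow> s \<in> reg Y O'"
  and diag_equation_swap: "diag_equation O' s \<Longrightarrow> z \<in> O' \<Longrightarrow> swap12 z \<in> O'"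
  and diag_equation_odd: "diag_equation O' s \<Longrightarrow> z \<in> O' \<Longrightarrow> s (swap12 z) = - s z"
  and diag_equation_zero: "diag_equation O' s \<Longrightarrow> z \<in> O' \<Longrightarrow> s z = 0 \<longleftrightarrow> diagonal z"
  unfolding diag_equation_def by simp_all

lemma diag_equation_divide:
  assumes "diag_equation O' s" "openin (zariski Y) W" "W \<subseteq> O'" "f \<in> reg Y W"
    "\<And>z. z \<in> W \<Longrightarrow> diagonal z \<Longrightarrow> f z = 0"
  shows "\<exists>h\<in>reg Y W. \<forall>z\<in>W. f z = h z * s z"
  using assms(1)[unfolded diag_equation_def, THEN conjunct2, THEN conjunct2, THEN conjunct2, THEN conjunct2,
      THEN spec, of W, THEN spec, of f] assms(2-) by auto

text \<open>The symmetric part of \<open>w\<close> gives three coordinates at once. Half of its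
  antisymmetric part vanishes on the diagonal by \<open>diag\<close>, so it is divisible by
  \<open>s\<close>, and the quotient is the fourth coordinate.\<close>

lemma kernel_frame_solve:
  assumes D: "diag_equation O' s" and W: "openin (zariski Y) W" "W \<subseteq> O'" and w: "reg_vector Y W w"
    and diag: "\<And>z. z \<in> W \<Longrightarrow> diagonal z \<Longrightarrow> wedge (w z) = 0"
  shows "\<exists>c. reg_vector Y W c \<and> (\<forall>z\<in>W. kernel_frame (s z) *v c z = w z)"
proof -
  have r: "(\<lambda>z. w z $ a) \<in> reg Y W" for a
    using w unfolding reg_vector_def by (rule spec)
  let ?f = "\<lambda>z. (w z $ (1, 2) - w z $ (2, 1)) / 2"
  have rf: "?f \<in> reg Y W"
    by (rule reg_divide[OF Y W(1) reg_diff[OF Y W(1) r r] reg_const[OF Y W(1)]]) simp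
  have "\<exists>h\<in>reg Y W. \<forall>z\<in>W. ?f z = h z * s z"
  proof (rule diag_equation_divide[OF D W rf])
    fix z assume "z \<in> W" "diagonal z"
    from diag[OF this] show "?f z = 0" by (simp add: wedge_def vec_eq_iff)
  qed
  then obtain h where h: "h \<in> reg Y W" "\<forall>z\<in>W. ?f z = h z * s z" by (elim bexE)
  let ?g = "\<lambda>z. (w z $ (1, 2) + w z $ (2, 1)) / 2"
  have g: "?g \<in> reg Y W"
    by (rule reg_divide[OF Y W(1) reg_add[OF Y W(1) r r] reg_const[OF Y W(1)]]) simp
  define c :: "('x \<times> 'x) \<times> 'm \<Rightarrow> complex^4" where
    "c z = (\<chi> k. if k = 1 then w z $ (1, 1) else if k = 2 then w z $ (2, 2) else if k = 3 then ?g z else h z)" for z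
  have "reg_vector Y W c"
    unfolding reg_vector_def c_def by (simp only: vec_lambda_beta) (intro allI reg_if r g h(1))
  moreover have "kernel_frame (s z) *v c z = w z" if "z \<in> W" for z
  proof -
    have "?f z = h z * s z" using h(2) that by blast
    then show ?thesis
      unfolding vec_eq_iff all_2_times_2 kernel_frame_apply by (simp add: c_def field_simps)
  qed
  ultimately show ?thesis by blast
qed

text \<open>\<open>kernel_frame (s z)\<close> is injective only where \<open>s\<close> is nonzero;
  regular coordinates are nevertheless determined on the diagonal, by density of its
  complement.\<close>

lemma kernel_frame_unique:
  assumes D: "diag_equation O' s" and W: "openin (zariski Y) W" "W \<subseteq> O'"
    and c: "reg_vector Y W c" "reg_vector Y W c'"
    and eq: "\<And>z. z \<in> W \<Longrightarrow> kernel_frame (s z) *v c z = kernel_frame (s z) *v c' z" and z: "z \<in> W"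
  shows "c z = c' z"
proof -
  have "c z $ k - c' z $ k = 0" for k
  proof (rule off_diagonal_dense[OF W(1) _ _ z])
    show "(\<lambda>z. c z $ k - c' z $ k) \<in> reg Y W"
      using c by (intro reg_diff[OF Y W(1)]) (simp_all add: reg_vector_def)
    fix v assume v: "v \<in> W" "\<not> diagonal v"
    then have "s v \<noteq> 0" using diag_equation_zero[OF D] W(2) by blast
    then have "c v = c' v" using kernel_frame_inj eq[OF v(1)] by blast
    then show "c v $ k - c' v $ k = 0" by simp
  qed
  then show ?thesis by (simp add: vec_eq_iff)
qed

text \<open>Applied column by column, this later yields the transition matrices between kernel
  frames.\<close>

lemma kernel_frame_solve_matrix:
  fixes B :: "('x \<times> 'x) \<times> 'm \<Rightarrow> complex^'k::finite^(2 \<times> 2)"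
  assumes D: "diag_equation O' s" and W: "openin (zariski Y) W" "W \<subseteq> O'" and B: "reg_matrix Y W B"
    and diag: "\<And>z b. z \<in> W \<Longrightarrow> diagonal z \<Longrightarrow> wedge (\<chi> a. B z $ a $ b) = 0"
  shows "\<exists>G. reg_matrix Y W G \<and> (\<forall>z\<in>W. kernel_frame (s z) ** G z = B z)"
proof -
  have "\<exists>c. reg_vector Y W c \<and> (\<forall>z\<in>W. kernel_frame (s z) *v c z = (\<chi> a. B z $ a $ b))" for b
    by (rule kernel_frame_solve[OF D W]) (use B diag in \<open>auto simp: reg_vector_def reg_matrix_def\<close>)
  then have "\<forall>b. \<exists>c. reg_vector Y W c \<and> (\<forall>z\<in>W. kernel_frame (s z) *v c z = (\<chi> a. B z $ a $ b))" ..
  from choice[OF this] obtain c where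
    "\<forall>b. reg_vector Y W (c b) \<and> (\<forall>z\<in>W. kernel_frame (s z) *v c b z = (\<chi> a. B z $ a $ b))" ..
  then have c: "\<And>b. reg_vector Y W (c b)" "\<And>b z. z \<in> W \<Longrightarrow> kernel_frame (s z) *v c b z = (\<chi> a. B z $ a $ b)"
    by blast+
  define G where "G z = (\<chi> k b. c b z $ k)" for z
  have "reg_matrix Y W G" using c(1) by (simp add: reg_matrix_def reg_vector_def G_def)
  moreover have "kernel_frame (s z) ** G z = B z" if "z \<in> W" for z
    by (simp add: vec_eq_iff matrix_mult_column G_def c(2)[OF that])
  ultimately show ?thesis by blast
qed

lemma kernel_frame_unique_matrix:
  fixes G :: "('x \<times> 'x) \<times> 'm \<Rightarrow> complex^'k::finite^4"
  assumes D: "diag_equation O' s" and W: "openin (zariski Y) W" "W \<subseteq> O'"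
    and G: "reg_matrix Y W G" "reg_matrix Y W G'"
    and eq: "\<And>z. z \<in> W \<Longrightarrow> kernel_frame (s z) ** G z = kernel_frame (s z) ** G' z" and z: "z \<in> W"
  shows "G z = G' z"
proof -
  have "(\<chi> k. G z $ k $ b) = (\<chi> k. G' z $ k $ b)" for b
  proof (rule kernel_frame_unique[OF D W _ _ _ z])
    show "reg_vector Y W (\<lambda>z. \<chi> k. G z $ k $ b)" "reg_vector Y W (\<lambda>z. \<chi> k. G' z $ k $ b)"
      using G by (simp_all add: reg_vector_def reg_matrix_def)
    fix v assume "v \<in> W"
    show "kernel_frame (s v) *v (\<chi> k. G v $ k $ b) = kernel_frame (s v) *v (\<chi> k. G' v $ k $ b)"
      using eq[OF \<open>v \<in> W\<close>] by (simp add: vec_eq_iff matrix_mult_column)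
  qed
  then show ?thesis by (simp add: vec_eq_iff)
qed

end

text \<open>On each \<open>Oc \<alpha>\<close> one frame of \<open>E\<close> on
  \<open>N \<alpha>\<close> serves both tensor factors; with two different frames the flip would not
  fix the products that make up the kernel frame. The index set is that of the charts of the bundle
  to be built.\<close>

locale descent_family = curve_pair X M for X :: "'x space" and M :: "'m space" +
  fixes E :: "('x \<times> 'm, 'i, 2) vbundle"
    and Oc :: "nat \<Rightarrow> (('x \<times> 'x) \<times> 'm) set" and eqn :: "nat \<Rightarrow> ('x \<times> 'x) \<times> 'm \<Rightarrow> complex"
    and N :: "nat \<Rightarrow> ('x \<times> 'm) set" and A :: "nat \<Rightarrow> 'i \<Rightarrow> 'x \<times> 'm \<Rightarrow> complex^2^2"
  assumes E: "vector_bundle (prod_space X M) E"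
    and eqn: "diag_equation (Oc \<alpha>) (eqn \<alpha>)"
    and frame: "bundle_frame (prod_space X M) E (N \<alpha>) (A \<alpha>)"
    and Oc_N: "z \<in> Oc \<alpha> \<Longrightarrow> p13 z \<in> N \<alpha>" "z \<in> Oc \<alpha> \<Longrightarrow> p23 z \<in> N \<alpha>"
    and cover: "(\<Union>\<alpha>. Oc \<alpha>) = points Y"
begin

section \<open>Changes of frame and their gluing\<close>

lemma p13_swap [simp]: "p13 (swap12 z) = p23 z" and p23_swap [simp]: "p23 (swap12 z) = p13 z"
  by (simp_all add: p13_def p23_def swap12_def split: prod.splits)

lemma diagonal_p: "diagonal z \<Longrightarrow> p23 z = p13 z"
  by (simp add: p13_def p23_def split_def)

lemma oN: "openin (zariski (prod_space X M)) (N \<alpha>)"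
  and A_reg: "reg_matrix (prod_space X M) (N \<alpha> \<inter> chart E i) (A \<alpha> i)"
  and A_inv: "p \<in> N \<alpha> \<Longrightarrow> p \<in> chart E i \<Longrightarrow> invertible (A \<alpha> i p)"
  using frame[of \<alpha>, unfolded bundle_frame_def, THEN conjunct1]
    frame[of \<alpha>, unfolded bundle_frame_def, THEN conjunct2, THEN conjunct1]
    frame[of \<alpha>, unfolded bundle_frame_def, THEN conjunct2, THEN conjunct2, THEN conjunct1]
  by simp_all

lemma A_trans:
  assumes "p \<in> N \<alpha>" "p \<in> chart E i" "p \<in> chart E j"
  shows "A \<alpha> i p = transition E i j p ** A \<alpha> j p"
  using assms
  by (intro frame[of \<alpha>, unfolded bundle_frame_def, THEN conjunct2, THEN conjunct2, THEN conjunct2, rule_format]) simp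

lemma oO: "openin (zariski Y) (Oc \<alpha>)"
  by (rule diag_equation_open[OF eqn])

lemma Oc_swap: "swap12 z \<in> Oc \<alpha> \<longleftrightarrow> z \<in> Oc \<alpha>"
  using diag_equation_swap[OF eqn, of z \<alpha>] diag_equation_swap[OF eqn, of "swap12 z" \<alpha>] by auto

lemma chart_ex: "p \<in> points (prod_space X M) \<Longrightarrow> \<exists>i. p \<in> chart E i"
  using vector_bundle_cover[OF E] by blast

lemma Oc_points: "z \<in> Oc \<alpha> \<Longrightarrow> z \<in> points Y"
  using cover by blast

lemma chart_ex13: "z \<in> points Y \<Longrightarrow> \<exists>i. p13 z \<in> chart E i"
  and chart_ex23: "z \<in> points Y \<Longrightarrow> \<exists>i. p23 z \<in> chart E i"
  using chart_ex morphism_points[OF morphism_p13] morphism_points[OF morphism_p23] by blast+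

text \<open>The change of frame on \<open>E\<close>. The chart is picked by choice, and the
  transition matrices of \<open>E\<close> cancel, so every chart gives the same value
  (\<open>H_eq\<close>).\<close>

definition H :: "nat \<Rightarrow> nat \<Rightarrow> 'x \<times> 'm \<Rightarrow> complex^2^2" where
  "H \<alpha> \<beta> p = (let k = SOME k. p \<in> chart E k in inv2 (A \<alpha> k p) ** A \<beta> k p)"

lemma A_H:
  assumes p: "p \<in> N \<alpha>" "p \<in> N \<beta>" "p \<in> chart E k"
  shows "A \<alpha> k p ** H \<alpha> \<beta> p = A \<beta> k p"
proof -
  define l where "l = (SOME k. p \<in> chart E k)"
  have l: "p \<in> chart E l" unfolding l_def using p(3) by (rule someI)
  have "A \<alpha> k p ** H \<alpha> \<beta> p = transition E k l p ** (A \<alpha> l p ** inv2 (A \<alpha> l p)) ** A \<beta> l p"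
    unfolding H_def l_def[symmetric] Let_def A_trans[OF p(1,3) l] by (simp add: matrix_mul_assoc)
  also have "\<dots> = A \<beta> k p"
    using inv2_right[OF A_inv[OF p(1) l]] A_trans[OF p(2,3) l] by simp
  finally show ?thesis .
qed

lemma H_eq:
  assumes p: "p \<in> N \<alpha>" "p \<in> N \<beta>" "p \<in> chart E k"
  shows "H \<alpha> \<beta> p = inv2 (A \<alpha> k p) ** A \<beta> k p"
  unfolding A_H[OF p, symmetric] matrix_mul_assoc inv2_left[OF A_inv[OF p(1,3)]] by simp

lemma H_reg: "reg_matrix (prod_space X M) (N \<alpha> \<inter> N \<beta>) (H \<alpha> \<beta>)"
proof -
  have o: "openin (zariski (prod_space X M)) (N \<alpha> \<inter> N \<beta>)" by (intro openin_Int oN)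
  show ?thesis
  proof (rule reg_matrix_local[OF XM o])
    fix p assume p: "p \<in> N \<alpha> \<inter> N \<beta>"
    then have "p \<in> points (prod_space X M)" using openin_subset[OF o] by blast
    then obtain k where k: "p \<in> chart E k" using chart_ex by blast
    note ok = vector_bundle_chart[OF E, of k]
    let ?V = "N \<alpha> \<inter> N \<beta> \<inter> chart E k"
    have oV: "openin (zariski (prod_space X M)) ?V" using o ok by (rule openin_Int)
    have r1: "reg_matrix (prod_space X M) ?V (A \<alpha> k)"
      by (rule reg_matrix_mono[OF XM openin_Int[OF oN ok] oV _ A_reg]) blast
    have r2: "reg_matrix (prod_space X M) ?V (A \<beta> k)"
      by (rule reg_matrix_mono[OF XM openin_Int[OF oN ok] oV _ A_reg]) blast
    have "reg_matrix (prod_space X M) ?V (\<lambda>p. inv2 (A \<alpha> k p) ** A \<beta> k p)"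
      by (intro reg_matrix_mult[OF XM oV] reg_matrix_inv2[OF XM oV] r1 r2) (use A_inv in auto)
    then have "reg_matrix (prod_space X M) ?V (H \<alpha> \<beta>)"
      by (rule reg_matrix_cong[OF XM oV]) (use H_eq in auto)
    then show "\<exists>V. openin (zariski (prod_space X M)) V \<and> p \<in> V \<and> V \<subseteq> N \<alpha> \<inter> N \<beta> \<and>
        reg_matrix (prod_space X M) V (H \<alpha> \<beta>)"
      using oV p k by blast
  qed
qed

text \<open>The frame of \<open>boxtimes X M E\<close> formed by the products of frame vectors, the
  first taken at \<open>p13 z\<close> and the second at \<open>p23 z\<close>, written in the chart
  \<open>ij\<close>.\<close>

definition TA :: "nat \<Rightarrow> 'i \<times> 'i \<Rightarrow> ('x \<times> 'x) \<times> 'm \<Rightarrow> complex^(2 \<times> 2)^(2 \<times> 2)" where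
  "TA \<alpha> ij z = tensor_matrix (A \<alpha> (fst ij) (p13 z)) (A \<alpha> (snd ij) (p23 z))"

definition TAinv :: "nat \<Rightarrow> 'i \<times> 'i \<Rightarrow> ('x \<times> 'x) \<times> 'm \<Rightarrow> complex^(2 \<times> 2)^(2 \<times> 2)" where
  "TAinv \<alpha> ij z = tensor_matrix (inv2 (A \<alpha> (fst ij) (p13 z))) (inv2 (A \<alpha> (snd ij) (p23 z)))"

definition TH :: "nat \<Rightarrow> nat \<Rightarrow> ('x \<times> 'x) \<times> 'm \<Rightarrow> complex^(2 \<times> 2)^(2 \<times> 2)" where
  "TH \<alpha> \<beta> z = tensor_matrix (H \<alpha> \<beta> (p13 z)) (H \<alpha> \<beta> (p23 z))"

abbreviation "EE \<equiv> boxtimes X M E"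

lemma box_chart: "z \<in> chart EE ij \<longleftrightarrow> z \<in> points Y \<and> p13 z \<in> chart E (fst ij) \<and> p23 z \<in> chart E (snd ij)"
  by (cases ij) (auto simp: boxtimes_def tensor_bundle_def pullback_bundle_def)

lemma box_transition: "transition EE ij kl z =
  tensor_matrix (transition E (fst ij) (fst kl) (p13 z)) (transition E (snd ij) (snd kl) (p23 z))"
  by (cases ij; cases kl) (simp add: boxtimes_def tensor_bundle_def pullback_bundle_def)

lemma box_chart_ex: "z \<in> points Y \<Longrightarrow> \<exists>ij. z \<in> chart EE ij"
  using chart_ex13[of z] chart_ex23[of z] unfolding box_chart by (metis fst_conv snd_conv)

lemma box_chart_open: "openin (zariski Y) (chart EE ij)"
proof -
  have "chart EE ij = (points Y \<inter> p13 -` chart E (fst ij)) \<inter> (points Y \<inter> p23 -` chart E (snd ij))"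
    using box_chart by blast
  then show ?thesis
    using morphism_openin[OF morphism_p13 vector_bundle_chart[OF E]]
      morphism_openin[OF morphism_p23 vector_bundle_chart[OF E]] by (simp only: openin_Int)
qed

lemma TA_TH:
  assumes "z \<in> Oc \<alpha>" "z \<in> Oc \<beta>" "z \<in> chart EE ij"
  shows "TA \<alpha> ij z ** TH \<alpha> \<beta> z = TA \<beta> ij z"
  using assms by (simp add: TA_def TH_def tensor_matrix_mult A_H Oc_N box_chart)

lemma TA_transition:
  assumes "z \<in> Oc \<alpha>" "z \<in> chart EE ij" "z \<in> chart EE kl"
  shows "TA \<alpha> ij z = transition EE ij kl z ** TA \<alpha> kl z"
proof -
  have "A \<alpha> (fst ij) (p13 z) = transition E (fst ij) (fst kl) (p13 z) ** A \<alpha> (fst kl) (p13 z)"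
    "A \<alpha> (snd ij) (p23 z) = transition E (snd ij) (snd kl) (p23 z) ** A \<alpha> (snd kl) (p23 z)"
    using assms by (auto intro!: A_trans Oc_N simp: box_chart)
  then show ?thesis by (simp add: TA_def box_transition tensor_matrix_mult)
qed

lemma TAinv_left:
  assumes "z \<in> Oc \<alpha>" "z \<in> chart EE ij" shows "TAinv \<alpha> ij z ** TA \<alpha> ij z = mat 1"
  unfolding TA_def TAinv_def using assms
  by (intro tensor_matrix_inverse inv2_left A_inv Oc_N) (auto simp: box_chart)

lemma TAinv_right:
  assumes "z \<in> Oc \<alpha>" "z \<in> chart EE ij" shows "TA \<alpha> ij z ** TAinv \<alpha> ij z = mat 1"
  unfolding TA_def TAinv_def using assms
  by (intro tensor_matrix_inverse inv2_right A_inv Oc_N) (auto simp: box_chart)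

lemma TA_cancel:
  assumes "z \<in> Oc \<alpha>" "z \<in> chart EE ij" "TA \<alpha> ij z *v v = TA \<alpha> ij z *v w"
  shows "v = w"
proof -
  have "TAinv \<alpha> ij z *v (TA \<alpha> ij z *v v) = TAinv \<alpha> ij z *v (TA \<alpha> ij z *v w)" using assms(3) by simp
  then show ?thesis by (simp add: matrix_vector_mul_assoc TAinv_left[OF assms(1,2)])
qed

lemma TA_reg:
  shows "reg_matrix Y (Oc \<alpha> \<inter> chart EE ij) (TA \<alpha> ij)"
    and "reg_matrix Y (Oc \<alpha> \<inter> chart EE ij) (TAinv \<alpha> ij)"
proof -
  have o: "openin (zariski Y) (Oc \<alpha> \<inter> chart EE ij)" by (rule openin_Int[OF oO box_chart_open])
  note oi = openin_Int[OF oN vector_bundle_chart[OF E]]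
  have r1: "reg_matrix Y (Oc \<alpha> \<inter> chart EE ij) (\<lambda>z. A \<alpha> (fst ij) (p13 z))"
    by (rule reg_matrix_comp[OF morphism_p13 Y oi A_reg o]) (auto simp: Oc_N box_chart)
  have r2: "reg_matrix Y (Oc \<alpha> \<inter> chart EE ij) (\<lambda>z. A \<alpha> (snd ij) (p23 z))"
    by (rule reg_matrix_comp[OF morphism_p23 Y oi A_reg o]) (auto simp: Oc_N box_chart)
  show "reg_matrix Y (Oc \<alpha> \<inter> chart EE ij) (TA \<alpha> ij)"
    unfolding TA_def[abs_def] by (rule reg_matrix_tensor[OF Y o r1 r2])
  show "reg_matrix Y (Oc \<alpha> \<inter> chart EE ij) (TAinv \<alpha> ij)"
    unfolding TAinv_def[abs_def]
    by (intro reg_matrix_tensor[OF Y o] reg_matrix_inv2[OF Y o r1] reg_matrix_inv2[OF Y o r2] A_inv Oc_N)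
      (auto simp: box_chart)
qed

lemma TH_reg: "reg_matrix Y (Oc \<alpha> \<inter> Oc \<beta>) (TH \<alpha> \<beta>)"
proof -
  have o: "openin (zariski Y) (Oc \<alpha> \<inter> Oc \<beta>)" by (intro openin_Int oO)
  note oi = openin_Int[OF oN oN]
  show ?thesis
    unfolding TH_def[abs_def]
    by (intro reg_matrix_tensor[OF Y o] reg_matrix_comp[OF morphism_p13 Y oi H_reg o]
        reg_matrix_comp[OF morphism_p23 Y oi H_reg o]) (auto simp: Oc_N)
qed

lemma frame_reg: "W \<subseteq> Oc \<alpha> \<Longrightarrow> openin (zariski Y) W \<Longrightarrow> reg_matrix Y W (\<lambda>z. kernel_frame (eqn \<alpha> z))"
  by (intro reg_matrix_kernel_frame[OF Y] reg_mono[OF Y oO _ _ diag_equation_reg[OF eqn]])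

text \<open>On the diagonal both tensor factors are the same matrix, which acts on the exterior
  square by its determinant and so preserves the kernel of \<open>wedge\<close>.\<close>

lemma wedge_TH:
  assumes z: "diagonal z" and v: "wedge v = 0"
  shows "wedge (TH \<alpha> \<beta> z *v v) = 0"
  unfolding TH_def diagonal_p[OF z] wedge_tensor_matrix v by simp

text \<open>The transition matrix between two kernel frames. Off the diagonal it is an inverse
  kernel frame times \<open>TH\<close> times a kernel frame; since that inverse does not exist on
  the diagonal, the matrix is chosen as a regular solution of the equation.\<close>

definition G :: "nat \<Rightarrow> nat \<Rightarrow> ('x \<times> 'x) \<times> 'm \<Rightarrow> complex^4^4" where
  "G \<alpha> \<beta> = (SOME G. reg_matrix Y (Oc \<alpha> \<inter> Oc \<beta>) G \<and>
     (\<forall>z\<in>Oc \<alpha> \<inter> Oc \<beta>. kernel_frame (eqn \<alpha> z) ** G z = TH \<alpha> \<beta> z ** kernel_frame (eqn \<beta> z)))"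

lemma
  shows G_reg: "reg_matrix Y (Oc \<alpha> \<inter> Oc \<beta>) (G \<alpha> \<beta>)"
    and G_eq: "z \<in> Oc \<alpha> \<Longrightarrow> z \<in> Oc \<beta> \<Longrightarrow>
      kernel_frame (eqn \<alpha> z) ** G \<alpha> \<beta> z = TH \<alpha> \<beta> z ** kernel_frame (eqn \<beta> z)"
proof -
  have o: "openin (zariski Y) (Oc \<alpha> \<inter> Oc \<beta>)" by (intro openin_Int oO)
  have "\<exists>G. reg_matrix Y (Oc \<alpha> \<inter> Oc \<beta>) G \<and>
     (\<forall>z\<in>Oc \<alpha> \<inter> Oc \<beta>. kernel_frame (eqn \<alpha> z) ** G z = TH \<alpha> \<beta> z ** kernel_frame (eqn \<beta> z))"
  proof (rule kernel_frame_solve_matrix[OF eqn o Int_lower1])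
    show "reg_matrix Y (Oc \<alpha> \<inter> Oc \<beta>) (\<lambda>z. TH \<alpha> \<beta> z ** kernel_frame (eqn \<beta> z))"
      by (intro reg_matrix_mult[OF Y o TH_reg] frame_reg Int_lower2 o)
    fix z b assume z: "z \<in> Oc \<alpha> \<inter> Oc \<beta>" "diagonal z"
    have "(\<chi> a. (TH \<alpha> \<beta> z ** kernel_frame (eqn \<beta> z)) $ a $ b)
        = TH \<alpha> \<beta> z *v (\<chi> k. kernel_frame (eqn \<beta> z) $ k $ b)"
      by (simp add: vec_eq_iff matrix_mult_column)
    moreover have "wedge (\<chi> k. kernel_frame (eqn \<beta> z) $ k $ b) = 0"
      using diag_equation_zero[OF eqn, of z \<beta>] z by (simp add: wedge_def kernel_frame_def vec_eq_iff)
    ultimately show "wedge (\<chi> a. (TH \<alpha> \<beta> z ** kernel_frame (eqn \<beta> z)) $ a $ b) = 0"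
      using wedge_TH[OF z(2)] by simp
  qed
  from someI_ex[OF this, folded G_def] show "reg_matrix Y (Oc \<alpha> \<inter> Oc \<beta>) (G \<alpha> \<beta>)"
    "z \<in> Oc \<alpha> \<Longrightarrow> z \<in> Oc \<beta> \<Longrightarrow> kernel_frame (eqn \<alpha> z) ** G \<alpha> \<beta> z = TH \<alpha> \<beta> z ** kernel_frame (eqn \<beta> z)"
    by blast+
qed

lemma TA_G:
  assumes "z \<in> Oc \<alpha>" "z \<in> Oc \<beta>" "z \<in> chart EE ij"
  shows "TA \<alpha> ij z ** (kernel_frame (eqn \<alpha> z) ** G \<alpha> \<beta> z) = TA \<beta> ij z ** kernel_frame (eqn \<beta> z)"
  unfolding G_eq[OF assms(1,2)] matrix_mul_assoc TA_TH[OF assms] ..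

lemma TA_cancel_matrix:
  fixes B C :: "complex^'k::finite^(2 \<times> 2)"
  assumes "z \<in> Oc \<alpha>" "z \<in> chart EE ij" "TA \<alpha> ij z ** B = TA \<alpha> ij z ** C"
  shows "B = C"
proof -
  have "TAinv \<alpha> ij z ** (TA \<alpha> ij z ** B) = TAinv \<alpha> ij z ** (TA \<alpha> ij z ** C)" using assms(3) by simp
  then show ?thesis by (simp add: matrix_mul_assoc TAinv_left[OF assms(1,2)])
qed

text \<open>Applied to the kernel frame of \<alpha> inside the tensor bundle, both sides give the
  kernel frame of \<gamma>. Uniqueness of regular coordinates removes the frame, on the diagonal as
  well.\<close>

lemma G_cocycle:
  assumes z: "z \<in> Oc \<alpha>" "z \<in> Oc \<beta>" "z \<in> Oc \<gamma>"
  shows "G \<alpha> \<beta> z ** G \<beta> \<gamma> z = G \<alpha> \<gamma> z"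
proof (rule kernel_frame_unique_matrix[OF eqn])
  let ?W = "Oc \<alpha> \<inter> Oc \<beta> \<inter> Oc \<gamma>"
  show o: "openin (zariski Y) ?W" by (intro openin_Int oO)
  show "?W \<subseteq> Oc \<alpha>" by blast
  have G: "reg_matrix Y ?W (G a b)" if "?W \<subseteq> Oc a \<inter> Oc b" for a b
    by (rule reg_matrix_mono[OF Y _ o that G_reg]) (intro openin_Int oO)
  show "reg_matrix Y ?W (\<lambda>z. G \<alpha> \<beta> z ** G \<beta> \<gamma> z)"
    by (intro reg_matrix_mult[OF Y o] G) auto
  show "reg_matrix Y ?W (G \<alpha> \<gamma>)" by (intro G) auto
  show "z \<in> ?W" using z by blast
  fix v assume "v \<in> ?W"
  then have v: "v \<in> Oc \<alpha>" "v \<in> Oc \<beta>" "v \<in> Oc \<gamma>" by auto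
  obtain ij where ij: "v \<in> chart EE ij" using box_chart_ex[OF Oc_points[OF v(1)]] by blast
  show "kernel_frame (eqn \<alpha> v) ** (G \<alpha> \<beta> v ** G \<beta> \<gamma> v) = kernel_frame (eqn \<alpha> v) ** G \<alpha> \<gamma> v"
  proof (rule TA_cancel_matrix[OF v(1) ij])
    have "TA \<alpha> ij v ** (kernel_frame (eqn \<alpha> v) ** (G \<alpha> \<beta> v ** G \<beta> \<gamma> v))
        = TA \<alpha> ij v ** (kernel_frame (eqn \<alpha> v) ** G \<alpha> \<beta> v) ** G \<beta> \<gamma> v" by (simp add: matrix_mul_assoc)
    also have "\<dots> = TA \<beta> ij v ** (kernel_frame (eqn \<beta> v) ** G \<beta> \<gamma> v)"
      unfolding TA_G[OF v(1,2) ij] by (simp add: matrix_mul_assoc)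
    also have "\<dots> = TA \<alpha> ij v ** (kernel_frame (eqn \<alpha> v) ** G \<alpha> \<gamma> v)"
      unfolding TA_G[OF v(2,3) ij] TA_G[OF v(1,3) ij] ..
    finally show "TA \<alpha> ij v ** (kernel_frame (eqn \<alpha> v) ** (G \<alpha> \<beta> v ** G \<beta> \<gamma> v))
        = TA \<alpha> ij v ** (kernel_frame (eqn \<alpha> v) ** G \<alpha> \<gamma> v)" .
  qed
qed

lemma G_diag:
  assumes z: "z \<in> Oc \<alpha>"
  shows "G \<alpha> \<alpha> z = mat 1"
proof (rule kernel_frame_unique_matrix[OF eqn oO order_refl _ _ _ z])
  show "reg_matrix Y (Oc \<alpha>) (G \<alpha> \<alpha>)" using G_reg[of \<alpha> \<alpha>] by simp
  show "reg_matrix Y (Oc \<alpha>) (\<lambda>_. mat 1)"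
    unfolding reg_matrix_def by (intro allI reg_const[OF Y oO])
  fix v assume v: "v \<in> Oc \<alpha>"
  obtain ij where ij: "v \<in> chart EE ij" using box_chart_ex[OF Oc_points[OF v]] by blast
  show "kernel_frame (eqn \<alpha> v) ** G \<alpha> \<alpha> v = kernel_frame (eqn \<alpha> v) ** mat 1"
    by (rule TA_cancel_matrix[OF v ij]) (simp add: TA_G[OF v v ij])
qed

text \<open>The flip conjugates \<open>TH\<close> at \<open>swap12 z\<close> to \<open>TH\<close> at
  \<open>z\<close>, since the two projections are exchanged. The odd equations of \<alpha> and
  \<beta> change sign, and the flip undoes this in both kernel frames. Hence \<open>G\<close> at
  both points solves the same equation.\<close>

lemma G_swap:
  assumes z: "z \<in> Oc \<alpha>" "z \<in> Oc \<beta>"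
  shows "G \<alpha> \<beta> (swap12 z) = G \<alpha> \<beta> z"
proof (rule kernel_frame_unique_matrix[OF eqn])
  let ?W = "Oc \<alpha> \<inter> Oc \<beta>"
  show o: "openin (zariski Y) ?W" by (intro openin_Int oO)
  show "?W \<subseteq> Oc \<alpha>" by blast
  show "reg_matrix Y ?W (G \<alpha> \<beta>)" by (rule G_reg)
  show "reg_matrix Y ?W (\<lambda>z. G \<alpha> \<beta> (swap12 z))"
    by (rule reg_matrix_comp[OF morphism_swap12 Y o G_reg o], rule subsetI) (simp only: vimage_eq Int_iff Oc_swap)
  show "z \<in> ?W" using z by blast
  fix v assume "v \<in> ?W"
  then have v: "v \<in> Oc \<alpha>" "v \<in> Oc \<beta>" "swap12 v \<in> Oc \<alpha>" "swap12 v \<in> Oc \<beta>" by (auto simp: Oc_swap)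
  have "kernel_frame (eqn \<alpha> v) ** G \<alpha> \<beta> (swap12 v)
      = flip_matrix ** (kernel_frame (eqn \<alpha> (swap12 v)) ** G \<alpha> \<beta> (swap12 v))"
    unfolding matrix_mul_assoc kernel_frame_flip diag_equation_odd[OF eqn v(1)] by simp
  also have "\<dots> = flip_matrix ** TH \<alpha> \<beta> (swap12 v) ** kernel_frame (eqn \<beta> (swap12 v))"
    unfolding G_eq[OF v(3,4)] by (simp add: matrix_mul_assoc)
  also have "\<dots> = TH \<alpha> \<beta> v ** (flip_matrix ** kernel_frame (eqn \<beta> (swap12 v)))"
    unfolding TH_def flip_matrix_tensor by (simp add: matrix_mul_assoc)
  also have "\<dots> = kernel_frame (eqn \<alpha> v) ** G \<alpha> \<beta> v"
    unfolding kernel_frame_flip diag_equation_odd[OF eqn v(2)] G_eq[OF v(1,2)] by simp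
  finally show "kernel_frame (eqn \<alpha> v) ** G \<alpha> \<beta> (swap12 v) = kernel_frame (eqn \<alpha> v) ** G \<alpha> \<beta> v" .
qed

text \<open>The preimage \<open>z\<close> of \<open>w\<close> is determined up to
  \<open>swap12\<close>, and by \<open>G_swap\<close> the transition matrix takes the same value at
  both choices.\<close>

definition F :: "('x set \<times> 'm, nat, 4) vbundle" where
  "F = \<lparr>chart = (\<lambda>\<alpha>. quot ` Oc \<alpha>), transition = (\<lambda>\<alpha> \<beta> w. G \<alpha> \<beta> (SOME z. z \<in> Oc \<alpha> \<and> quot z = w))\<rparr>"

lemma chart_F: "chart F \<alpha> = quot ` Oc \<alpha>"
  by (simp add: F_def)

lemma quot_Oc: "quot z \<in> quot ` Oc \<alpha> \<longleftrightarrow> z \<in> Oc \<alpha>"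
proof
  assume "quot z \<in> quot ` Oc \<alpha>"
  then obtain w where w: "quot z = quot w" "w \<in> Oc \<alpha>" by (rule imageE)
  then have "z = w \<or> z = swap12 w" by (simp only: quot_eq_iff)
  then show "z \<in> Oc \<alpha>" using w(2) by (auto simp: Oc_swap)
qed (rule imageI)

lemma transition_F:
  assumes z: "z \<in> Oc \<alpha>" "z \<in> Oc \<beta>"
  shows "transition F \<alpha> \<beta> (quot z) = G \<alpha> \<beta> z"
proof -
  define w where "w = (SOME w. w \<in> Oc \<alpha> \<and> quot w = quot z)"
  have "w \<in> Oc \<alpha> \<and> quot w = quot z" unfolding w_def by (rule someI[of _ z]) (use z in simp)
  then have "w = z \<or> w = swap12 z" by (simp only: quot_eq_iff) 
  then show ?thesis using G_swap[OF z] by (auto simp: F_def w_def[symmetric])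
qed

lemma vector_bundle_F: "vector_bundle (prod_space (sym2 X) M) F"
  unfolding vector_bundle_def
proof (intro conjI allI ballI)
  have sub: "quot ` Oc \<alpha> \<subseteq> points (prod_space (sym2 X) M)" for \<alpha>
    unfolding points_S2M using Oc_points by (intro image_mono) blast
  have pre: "points Y \<inter> quot -` (quot ` Oc \<alpha>) = Oc \<alpha>" for \<alpha>
    by (rule set_eqI) (simp only: Int_iff vimage_eq quot_Oc, use Oc_points in blast)
  show "openin (zariski (prod_space (sym2 X) M)) (chart F \<alpha>)" for \<alpha>
    unfolding chart_F by (rule openin_S2M[OF sub]) (simp only: pre oO)
  show "(\<Union>\<alpha>. chart F \<alpha>) = points (prod_space (sym2 X) M)"
    unfolding chart_F points_S2M cover[symmetric] by blast
  fix \<alpha> \<beta>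
  show "(\<lambda>x. transition F \<alpha> \<beta> x $ a $ b) \<in> reg (prod_space (sym2 X) M) (chart F \<alpha> \<inter> chart F \<beta>)" for a b
  proof (rule reg_S2M)
    show "chart F \<alpha> \<inter> chart F \<beta> \<subseteq> points (prod_space (sym2 X) M)"
      unfolding chart_F by (rule order_trans[OF Int_lower1 sub])
    have e: "points Y \<inter> quot -` (chart F \<alpha> \<inter> chart F \<beta>) = Oc \<alpha> \<inter> Oc \<beta>"
      by (rule set_eqI) (simp only: Int_iff vimage_eq chart_F quot_Oc, use Oc_points in blast)
    have o: "openin (zariski Y) (Oc \<alpha> \<inter> Oc \<beta>)" by (intro openin_Int oO)
    then show "openin (zariski Y) (points Y \<inter> quot -` (chart F \<alpha> \<inter> chart F \<beta>))" by (simp only: e)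
    have "(\<lambda>z. G \<alpha> \<beta> z $ a $ b) \<in> reg Y (Oc \<alpha> \<inter> Oc \<beta>)" using G_reg by (simp add: reg_matrix_def)
    then have "(\<lambda>z. transition F \<alpha> \<beta> (quot z) $ a $ b) \<in> reg Y (Oc \<alpha> \<inter> Oc \<beta>)"
      by (rule reg_cong[OF Y o]) (use transition_F in auto)
    then show "(\<lambda>z. transition F \<alpha> \<beta> (quot z) $ a $ b) \<in> reg Y (points Y \<inter> quot -` (chart F \<alpha> \<inter> chart F \<beta>))"
      by (simp only: e)
  qed
  fix x assume "x \<in> chart F \<alpha>"
  then obtain z where z: "x = quot z" "z \<in> Oc \<alpha>" unfolding chart_F by (rule imageE)
  show "transition F \<alpha> \<alpha> x = mat 1" unfolding z(1) transition_F[OF z(2,2)] by (rule G_diag[OF z(2)])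
next
  fix \<alpha> \<beta> \<gamma> x assume x: "x \<in> chart F \<alpha> \<inter> chart F \<beta> \<inter> chart F \<gamma>"
  then have "x \<in> quot ` Oc \<alpha>" by (simp only: chart_F Int_iff)
  then obtain z where z: "x = quot z" "z \<in> Oc \<alpha>" by (rule imageE)
  then have z': "z \<in> Oc \<beta>" "z \<in> Oc \<gamma>" using x by (simp_all only: chart_F Int_iff quot_Oc)
  show "transition F \<alpha> \<beta> x ** transition F \<beta> \<gamma> x = transition F \<alpha> \<gamma> x"
    unfolding z(1) transition_F[OF z(2) z'(1)] transition_F[OF z'] transition_F[OF z(2) z'(2)]
    by (rule G_cocycle[OF z(2) z'])
qed

section \<open>The equivariant isomorphism with the kernel sheaf\<close>

abbreviation "pF \<equiv> pullback_bundle (points Y) quot F"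

lemma chart_pF: "chart pF \<alpha> = Oc \<alpha>"
  by (rule set_eqI)
    (simp only: pullback_bundle_def vbundle.simps Int_iff vimage_eq chart_F quot_Oc, use Oc_points in blast)

lemma transition_pF: "z \<in> Oc \<alpha> \<Longrightarrow> z \<in> Oc \<beta> \<Longrightarrow> transition pF \<alpha> \<beta> z = G \<alpha> \<beta> z"
  by (simp add: pullback_bundle_def transition_F)

lemma sections_pF: "s \<in> sections Y pF W \<longleftrightarrow> (\<forall>\<alpha> z. z \<notin> W \<inter> Oc \<alpha> \<longrightarrow> s \<alpha> z = 0) \<and>
  (\<forall>\<alpha>. reg_vector Y (W \<inter> Oc \<alpha>) (s \<alpha>)) \<and> (\<forall>\<alpha> \<beta>. \<forall>z\<in>W \<inter> Oc \<alpha> \<inter> Oc \<beta>. s \<alpha> z = G \<alpha> \<beta> z *v s \<beta> z)"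
  unfolding sections_def chart_pF reg_vector_def by (simp add: transition_pF)

definition idx :: "('x \<times> 'x) \<times> 'm \<Rightarrow> nat" where
  "idx z = (SOME \<alpha>. z \<in> Oc \<alpha>)"

lemma idx: "z \<in> points Y \<Longrightarrow> z \<in> Oc (idx z)"
  unfolding idx_def using cover by (metis UN_iff someI)

text \<open>The choice depends on \<open>z\<close> only through its membership in the sets
  \<open>Oc \<alpha>\<close>, which are invariant. Equivariance of \<Phi> can thus be checked with
  one index for both points.\<close>

lemma idx_swap: "idx (swap12 z) = idx z"
  by (simp add: idx_def Oc_swap)

text \<open>Reads \<open>s\<close> as coordinates in the kernel frame and writes the resulting
  tensor in the chart \<open>ij\<close>. Sections are extended by 0, so no open set enters, and the
  same map serves all of them.\<close>

definition \<Phi> :: "(nat \<Rightarrow> ('x \<times> 'x) \<times> 'm \<Rightarrow> complex^4) \<Rightarrow> 'i \<times> 'i \<Rightarrow> ('x \<times> 'x) \<times> 'm \<Rightarrow> complex^(2 \<times> 2)" where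
  "\<Phi> s ij z = (if z \<in> chart EE ij
     then TA (idx z) ij z *v (kernel_frame (eqn (idx z) z) *v s (idx z) z) else 0)"

lemma \<Phi>_eq:
  assumes s: "s \<in> sections Y pF W" and z: "z \<in> Oc \<alpha>" "z \<in> chart EE ij"
  shows "\<Phi> s ij z = TA \<alpha> ij z *v (kernel_frame (eqn \<alpha> z) *v s \<alpha> z)"
proof (cases "z \<in> W")
  case True
  have i: "z \<in> Oc (idx z)" by (rule idx[OF Oc_points[OF z(1)]])
  have "s (idx z) z = G (idx z) \<alpha> z *v s \<alpha> z"
    using s[unfolded sections_pF, THEN conjunct2, THEN conjunct2] True i z(1) by blast
  then have "\<Phi> s ij z = TA (idx z) ij z *v (kernel_frame (eqn (idx z) z) *v (G (idx z) \<alpha> z *v s \<alpha> z))"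
    using z(2) by (simp only: \<Phi>_def if_True)
  also have "\<dots> = (TA (idx z) ij z ** (kernel_frame (eqn (idx z) z) ** G (idx z) \<alpha> z)) *v s \<alpha> z"
    by (simp only: matrix_vector_mul_assoc matrix_mul_assoc)
  also have "\<dots> = TA \<alpha> ij z *v (kernel_frame (eqn \<alpha> z) *v s \<alpha> z)"
    unfolding TA_G[OF i z] by (simp only: matrix_vector_mul_assoc)
  finally show ?thesis .
next
  case False
  then have "s (idx z) z = 0" "s \<alpha> z = 0" using s unfolding sections_pF by blast+
  then show ?thesis by (simp add: \<Phi>_def)
qed

lemma \<Phi>_tildeF:
  assumes W: "openin (zariski Y) W" and s: "s \<in> sections Y pF W"
  shows "\<Phi> s \<in> tildeF X M E W"
proof -
  have "\<Phi> s \<in> sections Y EE W"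
    unfolding sections_def
  proof (intro CollectI conjI allI impI ballI)
    fix ij z assume "z \<notin> W \<inter> chart EE ij"
    moreover have "s (idx z) z = 0" if "z \<notin> W" using s that unfolding sections_pF by blast
    ultimately show "\<Phi> s ij z = 0" by (auto simp: \<Phi>_def)
  next
    fix ij a
    have o: "openin (zariski Y) (W \<inter> chart EE ij)" by (rule openin_Int[OF W box_chart_open])
    have "reg_vector Y (W \<inter> chart EE ij) (\<Phi> s ij)"
    proof (rule reg_vector_local[OF Y o])
      fix z assume z: "z \<in> W \<inter> chart EE ij"
      then have zi: "z \<in> Oc (idx z)" by (intro idx) (simp add: box_chart)
      let ?a = "idx z"
      let ?V = "W \<inter> chart EE ij \<inter> Oc ?a"
      have oV: "openin (zariski Y) ?V" using o oO by (rule openin_Int)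
      have r1: "reg_matrix Y ?V (TA ?a ij)"
        by (rule reg_matrix_mono[OF Y openin_Int[OF oO box_chart_open] oV _ TA_reg(1)]) blast
      have r2: "reg_matrix Y ?V (\<lambda>z. kernel_frame (eqn ?a z))" by (rule frame_reg[OF _ oV]) blast
      have "reg_vector Y (W \<inter> Oc ?a) (s ?a)" using s unfolding sections_pF by blast
      then have r3: "reg_vector Y ?V (s ?a)"
        by (rule reg_vector_mono[OF Y openin_Int[OF W oO] oV, rotated]) blast
      have "reg_vector Y ?V (\<lambda>z. TA ?a ij z *v (kernel_frame (eqn ?a z) *v s ?a z))"
        by (intro reg_vector_mult[OF Y oV] r1 r2 r3)
      then have "reg_vector Y ?V (\<Phi> s ij)"
        by (rule reg_vector_cong[OF Y oV]) (use \<Phi>_eq[OF s] in blast)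
      then show "\<exists>V. openin (zariski Y) V \<and> z \<in> V \<and> V \<subseteq> W \<inter> chart EE ij \<and> reg_vector Y V (\<Phi> s ij)"
        using oV z zi by blast
    qed
    then show "(\<lambda>x. \<Phi> s ij x $ a) \<in> reg Y (W \<inter> chart EE ij)" unfolding reg_vector_def by blast
  next
    fix ij kl z assume z: "z \<in> W \<inter> chart EE ij \<inter> chart EE kl"
    then have zi: "z \<in> Oc (idx z)" by (intro idx) (simp add: box_chart)
    show "\<Phi> s ij z = transition EE ij kl z *v \<Phi> s kl z"
      using z TA_transition[OF zi, of ij kl] by (simp add: \<Phi>_def matrix_vector_mul_assoc matrix_mul_assoc)
  qed
  \<comment> \<open>On the diagonal the local equation vanishes, so only symmetric tensors remain;
    the frame of \<open>E\<close> changes their image in the exterior square by a determinant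
    only.\<close>
  moreover have "wedge (\<Phi> s (k, k) (diag p)) = 0" for k p
  proof (cases "diag p \<in> chart EE (k, k)")
    case True
    have d: "diagonal (diag p)" by (simp add: diag_def split: prod.splits)
    have i: "diag p \<in> Oc (idx (diag p))" using True by (intro idx) (simp add: box_chart)
    have "eqn (idx (diag p)) (diag p) = 0" using diag_equation_zero[OF eqn i] d by blast
    then show ?thesis
      using True by (simp add: \<Phi>_def TA_def diagonal_p[OF d] wedge_tensor_matrix kernel_frame_zero_wedge)
  next
    case False
    then show ?thesis by (simp add: \<Phi>_def wedge_def vec_eq_iff)
  qed
  ultimately show ?thesis
    unfolding tildeF_def to_ext_square_def restrict_to_diag_def by (simp add: fun_eq_iff)
qed

lemma \<Phi>_inj:
  assumes W: "openin (zariski Y) W"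
  shows "inj_on \<Phi> (sections Y pF W)"
proof (rule inj_onI, intro ext)
  fix s s' \<alpha> z assume s: "s \<in> sections Y pF W" "s' \<in> sections Y pF W" and eq: "\<Phi> s = \<Phi> s'"
  show "s \<alpha> z = s' \<alpha> z"
  proof (cases "z \<in> W \<inter> Oc \<alpha>")
    case True
    show ?thesis
    proof (rule kernel_frame_unique[OF eqn openin_Int[OF W oO] Int_lower2 _ _ _ True])
      show "reg_vector Y (W \<inter> Oc \<alpha>) (s \<alpha>)" "reg_vector Y (W \<inter> Oc \<alpha>) (s' \<alpha>)"
        using s unfolding sections_pF by blast+
      fix v assume v: "v \<in> W \<inter> Oc \<alpha>"
      then have vO: "v \<in> Oc \<alpha>" by blast
      obtain ij where ij: "v \<in> chart EE ij" using box_chart_ex[OF Oc_points[OF vO]] by blast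
      show "kernel_frame (eqn \<alpha> v) *v s \<alpha> v = kernel_frame (eqn \<alpha> v) *v s' \<alpha> v"
        by (rule TA_cancel[OF vO ij]) (simp add: \<Phi>_eq[OF s(1) vO ij, symmetric] \<Phi>_eq[OF s(2) vO ij, symmetric] eq)
    qed
  next
    case False
    then show ?thesis using s unfolding sections_pF by metis
  qed
qed

text \<open>The tensor coordinates of \<open>s'\<close> in the frame on \<open>Oc \<alpha>\<close>
  are symmetric on the diagonal, because \<open>s'\<close> lies in the kernel; so
  \<open>kernel_frame_solve\<close> gives regular kernel coordinates. Those for different indices
  match by uniqueness.\<close>

lemma \<Phi>_surj:
  assumes W: "openin (zariski Y) W" and s': "s' \<in> tildeF X M E W"
  shows "s' \<in> \<Phi> ` sections Y pF W"
proof -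
  have sec: "s' \<in> sections Y EE W" using s' by (simp add: tildeF_def)
  have out: "s' ij z = 0" if "z \<notin> W \<inter> chart EE ij" for ij z
    using sec that unfolding sections_def by blast
  have regs: "reg_vector Y (W \<inter> chart EE ij) (s' ij)" for ij
    using sec unfolding sections_def reg_vector_def by blast
  have trans: "s' ij z = transition EE ij kl z *v s' kl z" if "z \<in> W" "z \<in> chart EE ij" "z \<in> chart EE kl" for ij kl z
    using sec that unfolding sections_def by blast
  have wed: "wedge (s' (k, k) (diag p)) = 0" for k p
  proof -
    have "to_ext_square (restrict_to_diag s') k p = 0" using s' by (simp add: tildeF_def)
    then show ?thesis by (simp add: to_ext_square_def restrict_to_diag_def)
  qed
  \<comment> \<open>The coordinates of \<open>s'\<close> in the product frame; \<open>w'\<close>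
    shows that the chosen chart does not matter.\<close>
  define w where "w \<alpha> z = (let ij = SOME ij. z \<in> chart EE ij in TAinv \<alpha> ij z *v s' ij z)" for \<alpha> z
  have w: "TA \<alpha> ij z *v w \<alpha> z = s' ij z" if z: "z \<in> W" "z \<in> Oc \<alpha>" "z \<in> chart EE ij" for \<alpha> ij z
  proof -
    define kl where "kl = (SOME ij. z \<in> chart EE ij)"
    have kl: "z \<in> chart EE kl" unfolding kl_def using z(3) by (rule someI)
    have "TA \<alpha> ij z *v w \<alpha> z = transition EE ij kl z *v ((TA \<alpha> kl z ** TAinv \<alpha> kl z) *v s' kl z)"
      unfolding w_def kl_def[symmetric] Let_def TA_transition[OF z(2,3) kl]
      by (simp add: matrix_vector_mul_assoc matrix_mul_assoc)
    also have "\<dots> = s' ij z" using TAinv_right[OF z(2) kl] trans[OF z(1,3) kl] by simp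
    finally show ?thesis .
  qed
  have w': "w \<alpha> z = TAinv \<alpha> ij z *v s' ij z" if z: "z \<in> W" "z \<in> Oc \<alpha>" "z \<in> chart EE ij" for \<alpha> ij z
    unfolding w[OF z, symmetric] by (simp add: matrix_vector_mul_assoc TAinv_left[OF z(2,3)])
  have "\<exists>c. reg_vector Y (W \<inter> Oc \<alpha>) c \<and> (\<forall>z\<in>W \<inter> Oc \<alpha>. kernel_frame (eqn \<alpha> z) *v c z = w \<alpha> z)" for \<alpha>
  proof (rule kernel_frame_solve[OF eqn openin_Int[OF W oO] Int_lower2])
    have o: "openin (zariski Y) (W \<inter> Oc \<alpha>)" by (rule openin_Int[OF W oO])
    show "reg_vector Y (W \<inter> Oc \<alpha>) (w \<alpha>)"
    proof (rule reg_vector_local[OF Y o])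
      fix z assume z: "z \<in> W \<inter> Oc \<alpha>"
      then obtain ij where ij: "z \<in> chart EE ij" using box_chart_ex Oc_points by blast
      let ?V = "W \<inter> Oc \<alpha> \<inter> chart EE ij"
      have oV: "openin (zariski Y) ?V" using o box_chart_open by (rule openin_Int)
      have r1: "reg_matrix Y ?V (TAinv \<alpha> ij)"
        by (rule reg_matrix_mono[OF Y openin_Int[OF oO box_chart_open] oV _ TA_reg(2)]) blast
      have r2: "reg_vector Y ?V (s' ij)"
        by (rule reg_vector_mono[OF Y openin_Int[OF W box_chart_open] oV _ regs]) blast
      have "reg_vector Y ?V (\<lambda>z. TAinv \<alpha> ij z *v s' ij z)" by (rule reg_vector_mult[OF Y oV r1 r2])
      then have "reg_vector Y ?V (w \<alpha>)" by (rule reg_vector_cong[OF Y oV]) (use w' in blast)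
      then show "\<exists>V. openin (zariski Y) V \<and> z \<in> V \<and> V \<subseteq> W \<inter> Oc \<alpha> \<and> reg_vector Y V (w \<alpha>)"
        using oV z ij by blast
    qed
    fix z assume z: "z \<in> W \<inter> Oc \<alpha>" "diagonal z"
    then obtain k where k: "p13 z \<in> chart E k" using chart_ex13 Oc_points by blast
    \<comment> \<open>The kernel condition is tested in the charts (k, k) only. At a diagonal point
      the two projections agree, so such a chart is available.\<close>
    then have ch: "z \<in> chart EE (k, k)"
      using z diagonal_p[OF z(2)] Oc_points[of z \<alpha>] by (simp add: box_chart)
    have "z = diag (p13 z)" using z(2) by (auto simp: diag_def p13_def split: prod.splits)
    then have "wedge (s' (k, k) z) = 0" using wed by metis
    moreover have "s' (k, k) z = TA \<alpha> (k, k) z *v w \<alpha> z" using w z ch by simp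
    \<comment> \<open>The frame acts on the exterior square by its determinant, which is nonzero and
      can be cancelled.\<close>
    ultimately have 0: "mat (det (A \<alpha> k (p13 z))) *v wedge (w \<alpha> z) = 0"
      by (simp add: TA_def diagonal_p[OF z(2)] wedge_tensor_matrix)
    have "invertible (A \<alpha> k (p13 z))" using z k by (intro A_inv Oc_N) auto
    then have d: "det (A \<alpha> k (p13 z)) \<noteq> 0" by (simp add: invertible_det_nz)
    have "mat e *v v = e *s v" for e :: complex and v :: "complex^1"
      by (simp add: vec_eq_iff matrix_vector_mult_def mat_def forall_1 sum_1)
    then show "wedge (w \<alpha> z) = 0" using 0 d by (simp add: vec_eq_iff)
  qed
  then have "\<forall>\<alpha>. \<exists>c. reg_vector Y (W \<inter> Oc \<alpha>) c \<and> (\<forall>z\<in>W \<inter> Oc \<alpha>. kernel_frame (eqn \<alpha> z) *v c z = w \<alpha> z)" ..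
  from choice[OF this] obtain c where
    "\<forall>\<alpha>. reg_vector Y (W \<inter> Oc \<alpha>) (c \<alpha>) \<and> (\<forall>z\<in>W \<inter> Oc \<alpha>. kernel_frame (eqn \<alpha> z) *v c \<alpha> z = w \<alpha> z)" ..
  then have c: "\<And>\<alpha>. reg_vector Y (W \<inter> Oc \<alpha>) (c \<alpha>)"
    "\<And>\<alpha> z. z \<in> W \<Longrightarrow> z \<in> Oc \<alpha> \<Longrightarrow> kernel_frame (eqn \<alpha> z) *v c \<alpha> z = w \<alpha> z" by blast+
  define s where "s \<alpha> z = (if z \<in> W \<inter> Oc \<alpha> then c \<alpha> z else 0)" for \<alpha> z
  have s: "s \<in> sections Y pF W"
    unfolding sections_pF
  proof (intro conjI allI impI ballI)
    show "s \<alpha> z = 0" if "z \<notin> W \<inter> Oc \<alpha>" for \<alpha> z unfolding s_def using that by (rule if_not_P)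
    show "reg_vector Y (W \<inter> Oc \<alpha>) (s \<alpha>)" for \<alpha>
      by (rule reg_vector_cong[OF Y openin_Int[OF W oO] c(1)]) (simp add: s_def)
    fix \<alpha> \<beta> z assume z: "z \<in> W \<inter> Oc \<alpha> \<inter> Oc \<beta>"
    let ?W = "W \<inter> Oc \<alpha> \<inter> Oc \<beta>"
    have o: "openin (zariski Y) ?W" by (intro openin_Int W oO)
    have "c \<alpha> z = G \<alpha> \<beta> z *v c \<beta> z"
    proof (rule kernel_frame_unique[OF eqn o _ _ _ _ z])
      show "?W \<subseteq> Oc \<alpha>" by blast
      show "reg_vector Y ?W (c \<alpha>)"
        by (rule reg_vector_mono[OF Y openin_Int[OF W oO] o _ c(1)]) blast
      have "reg_vector Y ?W (c \<beta>)"
        by (rule reg_vector_mono[OF Y openin_Int[OF W oO] o _ c(1)]) blast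
      moreover have "reg_matrix Y ?W (G \<alpha> \<beta>)"
        by (rule reg_matrix_mono[OF Y openin_Int[OF oO oO] o _ G_reg]) blast
      ultimately show "reg_vector Y ?W (\<lambda>z. G \<alpha> \<beta> z *v c \<beta> z)"
        by (intro reg_vector_mult[OF Y o])
      fix v assume "v \<in> ?W"
      then have v: "v \<in> W" "v \<in> Oc \<alpha>" "v \<in> Oc \<beta>" by auto
      obtain ij where ij: "v \<in> chart EE ij" using box_chart_ex[OF Oc_points[OF v(2)]] by blast
      show "kernel_frame (eqn \<alpha> v) *v c \<alpha> v = kernel_frame (eqn \<alpha> v) *v (G \<alpha> \<beta> v *v c \<beta> v)"
      proof (rule TA_cancel[OF v(2) ij])
        have "TA \<alpha> ij v *v (kernel_frame (eqn \<alpha> v) *v (G \<alpha> \<beta> v *v c \<beta> v))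
            = (TA \<alpha> ij v ** (kernel_frame (eqn \<alpha> v) ** G \<alpha> \<beta> v)) *v c \<beta> v"
          by (simp add: matrix_vector_mul_assoc matrix_mul_assoc)
        also have "\<dots> = TA \<beta> ij v *v (kernel_frame (eqn \<beta> v) *v c \<beta> v)"
          unfolding TA_G[OF v(2,3) ij] by (simp add: matrix_vector_mul_assoc)
        also have "\<dots> = TA \<alpha> ij v *v (kernel_frame (eqn \<alpha> v) *v c \<alpha> v)"
          unfolding c(2)[OF v(1,3)] c(2)[OF v(1,2)] w[OF v(1,2) ij] w[OF v(1,3) ij] ..
        finally show "TA \<alpha> ij v *v (kernel_frame (eqn \<alpha> v) *v c \<alpha> v)
            = TA \<alpha> ij v *v (kernel_frame (eqn \<alpha> v) *v (G \<alpha> \<beta> v *v c \<beta> v))" by (rule sym)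
      qed
    qed
    then show "s \<alpha> z = G \<alpha> \<beta> z *v s \<beta> z" using z by (simp add: s_def)
  qed
  moreover have "\<Phi> s = s'"
  proof (intro ext)
    fix ij z
    show "\<Phi> s ij z = s' ij z"
    proof (cases "z \<in> W \<inter> chart EE ij")
      case True
      then have i: "z \<in> Oc (idx z)" by (intro idx) (simp add: box_chart)
      show ?thesis using True i c(2)[of z "idx z"] w[OF _ i, of ij] by (simp add: \<Phi>_def s_def)
    next
      case False
      then show ?thesis unfolding out[OF False] by (auto simp: \<Phi>_def s_def)
    qed
  qed
  ultimately show ?thesis by blast
qed

lemma \<Phi>_bij: "openin (zariski Y) W \<Longrightarrow> bij_betw \<Phi> (sections Y pF W) (tildeF X M E W)"
  unfolding bij_betw_def using \<Phi>_inj \<Phi>_tildeF \<Phi>_surj by blast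

theorem module_iso_\<Phi>: "module_iso Y (sections Y pF) (tildeF X M E) (\<lambda>_. \<Phi>)"
  unfolding module_iso_def
proof (intro allI impI conjI ballI)
  fix W assume "openin (zariski Y) W"
  then show "bij_betw \<Phi> (sections Y pF W) (tildeF X M E W)" by (rule \<Phi>_bij)
qed (auto simp: \<Phi>_def fun_eq_iff matrix_vector_right_distrib vector_scalar_commute)

text \<open>The flip carries the product frame at \<open>swap12 z\<close> to the one at
  \<open>z\<close> and restores the sign of the odd equation, so the kernel frame is invariant. What
  remains of the action is the composition of the coordinates with \<open>swap12\<close>.\<close>

theorem \<Phi>_equivariant: "\<Phi> (act_pullback s) = act_boxtimes (\<Phi> s)"
proof (intro ext)
  fix ij :: "'i \<times> 'i" and z
  obtain i j where ij: "ij = (i, j)" by (cases ij)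
  have ch: "swap12 z \<in> chart EE (j, i) \<longleftrightarrow> z \<in> chart EE (i, j)"
    using morphism_points[OF morphism_swap12, of z] morphism_points[OF morphism_swap12, of "swap12 z"]
    by (auto simp: box_chart)
  show "\<Phi> (act_pullback s) ij z = act_boxtimes (\<Phi> s) ij z"
  proof (cases "z \<in> chart EE (i, j)")
    case True
    let ?a = "idx z"
    have i: "z \<in> Oc ?a" using True by (intro idx) (simp add: box_chart)
    have "act_boxtimes (\<Phi> s) (i, j) z = flip_matrix *v (\<Phi> s (j, i) (swap12 z))"
      by (simp add: act_boxtimes_def flip_matrix_vec)
    also have "\<dots> = (flip_matrix ** TA ?a (j, i) (swap12 z)) *v (kernel_frame (- eqn ?a z) *v s ?a (swap12 z))"
      using True ch by (simp add: \<Phi>_def idx_swap diag_equation_odd[OF eqn i] matrix_vector_mul_assoc matrix_mul_assoc)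
    also have "flip_matrix ** TA ?a (j, i) (swap12 z) = TA ?a (i, j) z ** flip_matrix"
      by (simp add: TA_def flip_matrix_tensor)
    also have "\<dots> *v (kernel_frame (- eqn ?a z) *v s ?a (swap12 z))
        = TA ?a (i, j) z *v ((flip_matrix ** kernel_frame (- eqn ?a z)) *v s ?a (swap12 z))"
      by (simp add: matrix_vector_mul_assoc matrix_mul_assoc)
    also have "\<dots> = \<Phi> (act_pullback s) (i, j) z"
      using True by (simp add: kernel_frame_flip \<Phi>_def act_pullback_def)
    finally show ?thesis unfolding ij by (rule sym)
  next
    case False
    then show ?thesis using ch by (simp add: ij \<Phi>_def act_boxtimes_def vec_eq_iff)
  qed
qed

end

text \<open>The frame of \<open>E\<close> is taken on a neighbourhood \<open>N\<close> of both (x,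
  m) and (y, m). Requiring both projections to lie in \<open>N\<close> is a condition symmetric
  under the swap, so the neighbourhood stays invariant.\<close>

lemma (in curve_pair) descent_data_exists:
  fixes E :: "('x \<times> 'm, 'i, 2) vbundle"
  assumes E: "vector_bundle (prod_space X M) E" and z: "z \<in> points Y"
  shows "\<exists>O' s N A. diag_equation O' s \<and> bundle_frame (prod_space X M) E N A \<and>
    (\<forall>w\<in>O'. p13 w \<in> N \<and> p23 w \<in> N) \<and> z \<in> O'"
proof -
  obtain x y m where ze: "z = ((x, y), m)" by (metis prod.collapse)
  have pts: "x \<in> points X" "y \<in> points X" "m \<in> points M" using z by (auto simp: points_Y ze)
  obtain U n \<zeta> where c: "affine_chart X U n \<zeta>" "x \<in> U" "y \<in> U" using charts_X[OF pts(1,2)] by blast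
  obtain V k \<eta> where d: "affine_chart M V k \<eta>" "m \<in> V" using charts_M[OF pts(3)] by blast
  have K: "(x, m) \<in> U \<times> V" "(y, m) \<in> U \<times> V" using c d by auto
  obtain N A where NA: "bundle_frame (prod_space X M) E N A" "(x, m) \<in> N" "(y, m) \<in> N"
    using local_frame_two_points[OF XM affine_chart_prod[OF X M c(1) d(1)] E K] by blast
  obtain O1 s where O1: "diag_equation O1 s" "z \<in> O1" using diag_equation_exists[OF z] by blast
  have oN: "openin (zariski (prod_space X M)) N" using NA(1) by (simp add: bundle_frame_def)
  let ?O = "O1 \<inter> ((points Y \<inter> p13 -` N) \<inter> (points Y \<inter> p23 -` N))"
  have o: "openin (zariski Y) ?O"
    by (intro openin_Int diag_equation_open[OF O1(1)] morphism_openin[OF morphism_p13 oN]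
        morphism_openin[OF morphism_p23 oN])
  have p: "p13 (swap12 w) = p23 w" "p23 (swap12 w) = p13 w" for w :: "('x \<times> 'x) \<times> 'm"
    by (simp_all add: p13_def p23_def swap12_def split_def)
  have "diag_equation ?O s"
  proof (rule diag_equation_mono[OF O1(1) o])
    fix w assume "w \<in> ?O"
    then show "swap12 w \<in> ?O"
      using diag_equation_swap[OF O1(1), of w] morphism_points[OF morphism_swap12, of w] by (simp add: p)
  qed blast
  moreover have "z \<in> ?O" using O1(2) z NA(2,3) by (simp add: ze p13_def p23_def)
  ultimately show ?thesis
    using NA(1) by (intro exI[of _ ?O] exI[of _ s] exI[of _ N] exI[of _ A]) simp
qed

text \<open>\<open>Y\<close> is a finite union of products of affine charts, each of which is
  quasi-compact. Finiteness is what allows the descent data to be indexed by the natural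
  numbers.\<close>

lemma (in charted_pair) compact_Y:
  assumes X': "variety X" and M': "variety M"
    and C: "\<And>C. C \<in> \<C> \<Longrightarrow> openin (zariski Y) C" and cov: "points Y \<subseteq> \<Union>\<C>"
  shows "\<exists>\<D>. finite \<D> \<and> \<D> \<subseteq> \<C> \<and> points Y \<subseteq> \<Union>\<D>"
proof -
  obtain \<U> where U: "finite \<U>" "\<Union>\<U> = points X" "\<forall>U\<in>\<U>. \<exists>n \<zeta>. affine_chart X U n \<zeta>"
    using variety_finite_charts[OF X'] by blast
  obtain \<V> where V: "finite \<V>" "\<Union>\<V> = points M" "\<forall>V\<in>\<V>. \<exists>n \<zeta>. affine_chart M V n \<zeta>"
    using variety_finite_charts[OF M'] by blast
  define I where "I = (\<U> \<times> \<U>) \<times> \<V>"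
  define K where "K i = (fst (fst i) \<times> snd (fst i)) \<times> snd i" for i :: "('x set \<times> 'x set) \<times> 'm set"
  have "\<exists>\<D>. finite \<D> \<and> \<D> \<subseteq> \<C> \<and> K i \<subseteq> \<Union>\<D>" if i: "i \<in> I" for i
  proof -
    obtain U1 U2 W where e: "i = ((U1, U2), W)" by (metis prod.collapse)
    then have mem: "U1 \<in> \<U>" "U2 \<in> \<U>" "W \<in> \<V>" using i by (auto simp: I_def)
    obtain n1 \<zeta>1 n2 \<zeta>2 n3 \<zeta>3 where c: "affine_chart X U1 n1 \<zeta>1" "affine_chart X U2 n2 \<zeta>2" "affine_chart M W n3 \<zeta>3"
      using bspec[OF U(3) mem(1)] bspec[OF U(3) mem(2)] bspec[OF V(3) mem(3)] by (elim exE)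
    note ch = affine_chart_prod[OF XX M affine_chart_prod[OF X X c(1,2)] c(3)]
    have "K i \<subseteq> \<Union>\<C>" using openin_subset[OF affine_chart_open[OF ch]] cov by (auto simp: K_def e)
    then show ?thesis using affine_chart_compact[OF Y ch C] by (simp add: K_def e)
  qed
  then have "\<forall>i\<in>I. \<exists>\<D>. finite \<D> \<and> \<D> \<subseteq> \<C> \<and> K i \<subseteq> \<Union>\<D>" by (rule ballI)
  from bchoice[OF this] obtain D where D: "\<forall>i\<in>I. finite (D i) \<and> D i \<subseteq> \<C> \<and> K i \<subseteq> \<Union>(D i)" ..
  have "points Y \<subseteq> (\<Union>i\<in>I. K i)"
  proof
    fix z assume "z \<in> points Y"
    then obtain x y m where z: "z = ((x, y), m)" "x \<in> points X" "y \<in> points X" "m \<in> points M"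
      unfolding points_Y by (elim SigmaE) simp
    obtain U1 where "x \<in> U1" "U1 \<in> \<U>" using U(2) z(2) by blast
    moreover obtain U2 where "y \<in> U2" "U2 \<in> \<U>" using U(2) z(3) by blast
    moreover obtain W where "m \<in> W" "W \<in> \<V>" using V(2) z(4) by blast
    ultimately show "z \<in> (\<Union>i\<in>I. K i)"
      by (intro UN_I[of "((U1, U2), W)"]) (auto simp: I_def K_def z(1))
  qed
  also have "\<dots> \<subseteq> (\<Union>i\<in>I. \<Union>(D i))" using D by (intro UN_mono) simp_all
  also have "\<dots> = \<Union>(\<Union>i\<in>I. D i)" by blast
  finally have "points Y \<subseteq> \<Union>(\<Union>i\<in>I. D i)" .
  moreover have "finite I" using U(1) V(1) by (simp add: I_def)
  then have "finite (\<Union>i\<in>I. D i)" using D by (intro finite_UN_I) simp_all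
  moreover have "(\<Union>i\<in>I. D i) \<subseteq> \<C>" using D by (intro UN_least) simp
  ultimately show ?thesis by (intro exI[of _ "\<Union>i\<in>I. D i"] conjI)
qed

text \<open>Points are closed because coordinates separate them. If {x} were open too,
  irreducibility of \<open>X\<close> would force \<open>X\<close> to be {x}, leaving no room for two
  nested irreducible closed sets.\<close>

lemma curve_not_isolated:
  assumes "regular_space X" "irreducible_closed X (points X)" "has_dimension X 1"
    and two: "\<And>x y. x \<in> points X \<Longrightarrow> y \<in> points X \<Longrightarrow> \<exists>U n \<zeta>. affine_chart X U n \<zeta> \<and> x \<in> U \<and> y \<in> U"
    and x: "x \<in> points X"
  shows "\<not> openin (zariski X) {x}"
proof
  assume o: "openin (zariski X) {x}"
  have "openin (zariski X) (points X - {x})"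
  proof (subst openin_subopen, rule)
    fix y assume y: "y \<in> points X - {x}"
    then obtain U n \<zeta> where c: "affine_chart X U n \<zeta>" "x \<in> U" "y \<in> U" using two[OF x] by blast
    then obtain k where k: "k < n" "\<zeta> x k \<noteq> \<zeta> y k" using affine_chart_separates[OF c] y by auto
    have "(\<lambda>v. v k - \<zeta> x k) \<in> polys n" by (rule polys_diff[OF polys.coord[OF k(1)] polys.const])
    from affine_chart_open_basic[OF c(1) this]
    have "openin (zariski X) {y \<in> U. \<zeta> y k - \<zeta> x k \<noteq> 0}" .
    moreover have "{y \<in> U. \<zeta> y k - \<zeta> x k \<noteq> 0} \<subseteq> points X - {x}"
      using openin_subset[OF affine_chart_open[OF c(1)]] by auto
    ultimately show "\<exists>T. openin (zariski X) T \<and> y \<in> T \<and> T \<subseteq> points X - {x}"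
      using c(3) k(2) by (intro exI[of _ "{y \<in> U. \<zeta> y k - \<zeta> x k \<noteq> 0}"]) auto
  qed
  then have cl: "closedin (zariski X) {x}" using x by (simp add: closedin_def)
  have "closedin (zariski X) (points X - {x})" using o by blast
  moreover have "points X \<subseteq> {x} \<union> (points X - {x})" by blast
  ultimately have "points X \<subseteq> {x} \<or> points X \<subseteq> points X - {x}"
    using assms(2) cl unfolding irreducible_closed_def by blast
  then have p: "points X \<subseteq> {x}" using x by blast
  obtain C :: "nat \<Rightarrow> 'a set" where C: "\<forall>k\<le>1. irreducible_closed X (C k)" "\<forall>k<1. C k \<subset> C (Suc k)"
    using assms(3)[unfolded has_dimension_def, THEN conjunct1, unfolded irreducible_chain_def]
    by (elim exE conjE)
  have "irreducible_closed X (C 0)" "irreducible_closed X (C 1)" using C(1) by simp_all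
  then have "C 0 \<noteq> {}" "C 1 \<subseteq> points X"
    by (auto simp only: irreducible_closed_def dest: closedin_subset)
  moreover have "C 0 \<subset> C 1" using C(2) by simp
  ultimately show False using p by blast
qed

lemma (in curve_pair) descent:
  fixes E :: "('x \<times> 'm, 'i, 2) vbundle"
  assumes X': "variety X" and M': "variety M" and E: "vector_bundle (prod_space X M) E"
  shows "\<exists>(F :: ('x set \<times> 'm, nat, 4) vbundle) \<Phi>. vector_bundle (prod_space (sym2 X) M) F \<and>
    module_iso Y (sections Y (pullback_bundle (points Y) quot F)) (tildeF X M E) (\<lambda>_. \<Phi>) \<and>
    (\<forall>s. \<Phi> (act_pullback s) = act_boxtimes (\<Phi> s))"
proof -
  define good where "good O' \<longleftrightarrow> (\<exists>s N A. diag_equation O' s \<and> bundle_frame (prod_space X M) E N A \<and>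
    (\<forall>w\<in>O'. p13 w \<in> N \<and> p23 w \<in> N))" for O'
  have "good {}"
    unfolding good_def
    by (intro exI[of _ "\<lambda>_. 0"] exI[of _ "{}"] exI[of _ "\<lambda>_ _. mat 1"] conjI)
      (auto simp: diag_equation_def bundle_frame_def reg_matrix_def intro: reg_const[OF Y] reg_const[OF XM])
  have "\<exists>\<D>. finite \<D> \<and> \<D> \<subseteq> Collect good \<and> points Y \<subseteq> \<Union>\<D>"
  proof (rule compact_Y[OF X' M'])
    fix C assume "C \<in> Collect good"
    then show "openin (zariski Y) C" by (auto simp: good_def dest: diag_equation_open)
  next
    show "points Y \<subseteq> \<Union>(Collect good)"
    proof
      fix z assume "z \<in> points Y"
      from descent_data_exists[OF E this] obtain O' where "good O'" "z \<in> O'"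
        unfolding good_def by blast
      then show "z \<in> \<Union>(Collect good)" by blast
    qed
  qed
  then obtain \<D> where D: "finite \<D>" "\<D> \<subseteq> Collect good" "points Y \<subseteq> \<Union>\<D>" by blast
  \<comment> \<open>\<open>from_nat_into\<close> enumerates a countable set with repetitions,
    provided it is nonempty; inserting the empty set secures this and adds only an empty
    chart.\<close>
  let ?D = "insert {} \<D>"
  define Oc where "Oc = from_nat_into ?D"
  have rOc: "range Oc = ?D"
    unfolding Oc_def using D(1) by (intro range_from_nat_into) (auto intro: countable_finite)
  then have "good (Oc \<alpha>)" for \<alpha> using D(2) \<open>good {}\<close> by (metis insertE mem_Collect_eq rangeI subsetD)
  then have "\<forall>\<alpha>. \<exists>sNA. diag_equation (Oc \<alpha>) (fst sNA) \<and> bundle_frame (prod_space X M) E (fst (snd sNA)) (snd (snd sNA)) \<and>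
    (\<forall>w\<in>Oc \<alpha>. p13 w \<in> fst (snd sNA) \<and> p23 w \<in> fst (snd sNA))"
    unfolding good_def by (metis fst_conv snd_conv)
  from choice[OF this] obtain d where d: "\<forall>\<alpha>. diag_equation (Oc \<alpha>) (fst (d \<alpha>)) \<and>
    bundle_frame (prod_space X M) E (fst (snd (d \<alpha>))) (snd (snd (d \<alpha>))) \<and>
    (\<forall>w\<in>Oc \<alpha>. p13 w \<in> fst (snd (d \<alpha>)) \<and> p23 w \<in> fst (snd (d \<alpha>)))" ..
  have "(\<Union>\<alpha>. Oc \<alpha>) = points Y"
  proof
    show "(\<Union>\<alpha>. Oc \<alpha>) \<subseteq> points Y"
      using d diag_equation_open openin_subset by blast
    show "points Y \<subseteq> (\<Union>\<alpha>. Oc \<alpha>)" using D(3) rOc by auto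
  qed
  then interpret descent_family X M E Oc "\<lambda>\<alpha>. fst (d \<alpha>)" "\<lambda>\<alpha>. fst (snd (d \<alpha>))" "\<lambda>\<alpha>. snd (snd (d \<alpha>))"
    using E d by unfold_locales auto
  show ?thesis
    by (intro exI[of _ F] exI[of _ \<Phi>] conjI allI vector_bundle_F module_iso_\<Phi> \<Phi>_equivariant)
qed

theorem lemma2p1:
  fixes X :: "'x space" and L :: "('x, nat, 1) vbundle"
    and M :: "'m space" and E :: "('x \<times> 'm, nat, 2) vbundle" and \<theta> :: "('m, nat, 1) vbundle"
  assumes "smooth_projective_curve X" and "genus X \<ge> 2"
    and "vector_bundle X L" and "odd (line_degree X L)"
    and "moduli_space_with_universal_bundle X L M E"
    and "vector_bundle M \<theta>" and "ample M \<theta>" and "generates_Pic M \<theta>"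
    and "\<forall>x\<in>points X. isomorphic_bundles M
           (det_bundle (pullback_bundle (points M) (\<lambda>m. (x, m)) E)) \<theta>"
  shows "\<exists>(F :: ('x set \<times> 'm, nat, 4) vbundle) \<Phi>.
    vector_bundle (prod_space (sym2 X) M) F \<and>
    module_iso (XXM X M)
      (sections (XXM X M) (pullback_bundle (points (XXM X M)) (map_prod symq id) F))
      (tildeF X M E) \<Phi> \<and>
    (\<forall>W s. openin (zariski (XXM X M)) W \<and>
       s \<in> sections (XXM X M) (pullback_bundle (points (XXM X M)) (map_prod symq id) F) W \<longrightarrow>
       \<Phi> (swap12 ` W) (act_pullback s) = act_boxtimes (\<Phi> W s))"
proof -
  have curve: "variety X" "projective_variety X" "irreducible_closed X (points X)" "has_dimension X 1"
    and tangent: "\<And>x. x \<in> points X \<Longrightarrow> vector_space.dim (\<lambda>c D f. c * D f) (tangent_space X x) = 1"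
    using assms(1) by (simp_all add: smooth_projective_curve_def)
  have moduli: "variety M" "vector_bundle (prod_space X M) E"
    using assms(5) by (simp_all add: moduli_space_with_universal_bundle_def stable_family_def)
  have two: "\<exists>U n \<zeta>. affine_chart X U n \<zeta> \<and> x \<in> U \<and> y \<in> U" if "x \<in> points X" "y \<in> points X" for x y
    using projective_chart_two_points[OF _ curve(2) that] curve(1) by (simp add: variety_def)
  have rX: "regular_space X" and rM: "regular_space M"
    using curve(1) moduli(1) by (auto intro: variety_regular_space)
  interpret curve_pair X M
  proof unfold_locales
    fix m assume "m \<in> points M"
    then show "\<exists>V n \<eta>. affine_chart M V n \<eta> \<and> m \<in> V" using variety_finite_charts[OF moduli(1)] by (metis UnionE)
  next
    fix x assume "x \<in> points X"
    then show "\<not> openin (zariski X) {x}" by (rule curve_not_isolated[OF rX curve(3,4) two, rotated 2])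
  qed (fact rX rM | rule two tangent; assumption)+
  obtain F :: "('x set \<times> 'm, nat, 4) vbundle" and \<Phi> where
    "vector_bundle (prod_space (sym2 X) M) F"
    "module_iso Y (sections Y (pullback_bundle (points Y) quot F)) (tildeF X M E) (\<lambda>_. \<Phi>)"
    "\<forall>s. \<Phi> (act_pullback s) = act_boxtimes (\<Phi> s)"
    using descent[OF curve(1) moduli] by blast
  then show ?thesis by (intro exI[of _ F] exI[of _ "\<lambda>_. \<Phi>"]) simp
qed

end
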